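(* Let $k\ge 2$, $n\ge k+2$, $\alpha\vdash k+2$ and $\beta\vdash k$. The number of times that $S(\beta)$ appears as a Jordan-Hölder factor of $P(\alpha)$, which is the multiplicity of $S^\beta\otimes S^\alpha$ as an irreducible constituent in the $S_k\times S_{k+2}$-module $\mathbb{C}\mathcal{SE}_n(k+2,k)$, equals the multiplicity of $S^\alpha$ as an irreducible constituent in the $S_{k+2}$-module \[ \mathrm{Ind}_{S_{k-1}\times S_3}^{S_{k+2}}\bigl(\mathrm{Res}_{S_{k-1}}^{S_k}(S^\beta)\otimes\mathrm{tr}_3\bigr)\ \oplus\ \mathrm{Ind}_{S_{k-2}\times D_4}^{S_{k+2}}\overline{\mathrm{Res}_{S_{k-2}\times S_2}^{S_k}S^\beta}. \]
   Context: Composition of functions is from right to left. $\mathcal{SE}_n$ is the category with objects $0,1,\ldots,n$ whose hom-set $\mathcal{SE}_n(r,k)$ of morphisms from $r$ to $k$ consists of all onto total functions $\{1,\ldots,r\}\to\{1,\ldots,k\}$ (with $\{1,\ldots,0\}=\varnothing$). Its category algebra $\mathbb{C}\mathcal{SE}_n$ is the $\mathbb{C}$-vector space with basis all morphisms, with product $m'\cdot m=m'm$ if the composition is defined and $0$ otherwise. Modules are finite dimensional left modules. Young diagrams are identified with integer partitions; $0$ has exactly one partition, $\varnothing$. For $\alpha\vdash k$, $S^\alpha$ is the Specht module over $\mathbb{C}S_k$. We have $\mathcal{SE}_n(k,k)=S_k$, so $\mathbb{C}S_k\subseteq\mathbb{C}\mathcal{SE}_n$. For $\alpha\vdash k$ with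 $0\le k\le n$, let $e_\alpha\in\mathbb{C}S_k$ be a primitive idempotent with $\mathbb{C}S_ke_\alpha\simeq S^\alpha$; put $P(\alpha)=\mathbb{C}\mathcal{SE}_n\,e_\alpha$ and $S(\alpha)=P(\alpha)/\mathrm{Rad}\,P(\alpha)$. These give complete lists, up to isomorphism, of the indecomposable projective and the simple $\mathbb{C}\mathcal{SE}_n$-modules. $S_k\times S_{k+2}$ acts on $\mathcal{SE}_n(k+2,k)$ by $(g_1,g_2)\cdot m=g_1mg_2^{-1}$, and $\mathbb{C}\mathcal{SE}_n(k+2,k)$ is the corresponding permutation module. Products $S_p\times S_q$ are embedded in $S_{p+q}$ in the usual way ($S_p$ permuting $\{1,\ldots,p\}$ and $S_q$ permuting $\{p+1,\ldots,p+q\}$). $\mathrm{tr}_3$ is the trivial representation of $S_3$ and $\otimes$ is the outer tensor product. $D_4$ is the subgroup of $S_4$ generated by $a=(12)$ and $b=(13)(24)$, so $S_{k-2}\times D_4\subseteq S_{k-2}\times S_4\subseteq S_{k+2}$. $\nu:D_4\to S_2$ is the group homomorphism with $\nu(a)=\mathrm{id}$, $\nu(b)=(12)$. For an $S_{k-2}\times S_2$-representation $W$, $\overline{W}$ is the $S_{k-2}\times D_4$-representation obtained by inflating $W$ along $\mathrm{id}_{S_{k-2}}\times\nu$. *)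

theory Defs
  imports Complex_Main "HOL-Algebra.Module" "HOL-Algebra.AbelCoset" "HOL-Algebra.Sym_Groups"
begin

section \<open>Complex vector spaces with operators\<close>

text \<open>
  A group representation and a module over a complex algebra are both given as a complex
  vector space on which the elements of an operator set (the carrier of the group, or the
  carrier of the algebra) act; this set is the argument \<open>\<Omega>\<close> below. As usual for the record
  \<open>module\<close>, its multiplicative fields carry no information.
\<close>

definition complex_ring :: "complex ring"
  where "complex_ring = \<lparr>carrier = UNIV, monoid.mult = (*), one = 1, ring.zero = 0, add = (+)\<rparr>"

record ('g, 'v) op_module = "(complex, 'v) module" +
  act :: "'g \<Rightarrow> 'v \<Rightarrow> 'v"

definition op_submodule :: "'g set \<Rightarrow> 'v set \<Rightarrow> ('g, 'v) op_module \<Rightarrow> bool"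
  where "op_submodule \<Omega> N M \<longleftrightarrow>
    submodule N complex_ring M \<and> (\<forall>g\<in>\<Omega>. \<forall>v\<in>N. act M g v \<in> N)"

definition op_iso :: "'g set \<Rightarrow> ('g, 'v) op_module \<Rightarrow> ('g, 'w) op_module \<Rightarrow> bool"
  where "op_iso \<Omega> M N \<longleftrightarrow>
    (\<exists>\<phi> \<in> iso (add_monoid M) (add_monoid N).
      (\<forall>c. \<forall>v\<in>carrier M. \<phi> (c \<odot>\<^bsub>M\<^esub> v) = c \<odot>\<^bsub>N\<^esub> \<phi> v) \<and>
      (\<forall>g\<in>\<Omega>. \<forall>v\<in>carrier M. \<phi> (act M g v) = act N g (\<phi> v)))"

definition op_simple :: "'g set \<Rightarrow> ('g, 'v) op_module \<Rightarrow> bool"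
  where "op_simple \<Omega> M \<longleftrightarrow>
    carrier M \<noteq> {\<zero>\<^bsub>M\<^esub>} \<and>
    (\<forall>N. op_submodule \<Omega> N M \<longrightarrow> N = {\<zero>\<^bsub>M\<^esub>} \<or> N = carrier M)"

definition op_quotient :: "('g, 'v) op_module \<Rightarrow> 'v set \<Rightarrow> ('g, 'v set) op_module"
  where "op_quotient M N =
    \<lparr>carrier = a_rcosets\<^bsub>M\<^esub> N, monoid.mult = undefined, one = undefined, ring.zero = N, add = set_add M,
     smult = (\<lambda>c X. \<Union>v\<in>X. N +>\<^bsub>M\<^esub> (c \<odot>\<^bsub>M\<^esub> v)),
     act = (\<lambda>g X. \<Union>v\<in>X. N +>\<^bsub>M\<^esub> act M g v)\<rparr>"

definition maximal_submodule :: "'g set \<Rightarrow> 'v set \<Rightarrow> ('g, 'v) op_module \<Rightarrow> bool"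
  where "maximal_submodule \<Omega> N M \<longleftrightarrow>
    op_submodule \<Omega> N M \<and> N \<noteq> carrier M \<and>
    (\<forall>L. op_submodule \<Omega> L M \<longrightarrow> N \<subseteq> L \<longrightarrow> L = N \<or> L = carrier M)"

definition Rad :: "'g set \<Rightarrow> ('g, 'v) op_module \<Rightarrow> 'v set"
  where "Rad \<Omega> M = {v \<in> carrier M. \<forall>N. maximal_submodule \<Omega> N M \<longrightarrow> v \<in> N}"

definition composition_series :: "'g set \<Rightarrow> ('g, 'v) op_module \<Rightarrow> 'v set list \<Rightarrow> bool"
  where "composition_series \<Omega> M Ns \<longleftrightarrow>
    Ns \<noteq> [] \<and> hd Ns = {\<zero>\<^bsub>M\<^esub>} \<and> last Ns = carrier M \<and>
    (\<forall>N\<in>set Ns. op_submodule \<Omega> N M) \<and>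
    (\<forall>i. Suc i < length Ns \<longrightarrow>
      Ns ! i \<subseteq> Ns ! Suc i \<and>
      op_simple \<Omega> (op_quotient (M\<lparr>carrier := Ns ! Suc i\<rparr>) (Ns ! i)))"

text \<open>
  For a module of finite length a series exists and the count does not depend on it
  (Jordan-Hoelder); likewise, below, for decompositions of a completely reducible module.
\<close>

definition JH_multiplicity :: "'g set \<Rightarrow> ('g, 'v) op_module \<Rightarrow> ('g, 'w) op_module \<Rightarrow> nat"
  where "JH_multiplicity \<Omega> M S =
    (THE m. \<exists>Ns. composition_series \<Omega> M Ns \<and>
      m = card {i. Suc i < length Ns \<and>
            op_iso \<Omega> (op_quotient (M\<lparr>carrier := Ns ! Suc i\<rparr>) (Ns ! i)) S})"

definition irreducible_decomposition :: "'g set \<Rightarrow> ('g, 'v) op_module \<Rightarrow> 'v set list \<Rightarrow> bool"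
  where "irreducible_decomposition \<Omega> M Us \<longleftrightarrow>
    (\<forall>U\<in>set Us. op_submodule \<Omega> U M \<and> op_simple \<Omega> (M\<lparr>carrier := U\<rparr>)) \<and>
    (\<forall>v\<in>carrier M. \<exists>!u. u \<in> (\<Pi>\<^sub>E i\<in>{..<length Us}. Us ! i) \<and>
      v = (\<Oplus>\<^bsub>M\<^esub>i\<in>{..<length Us}. u i))"

definition constituent_multiplicity ::
    "'g set \<Rightarrow> ('g, 'v) op_module \<Rightarrow> ('g, 'w) op_module \<Rightarrow> nat"
  where "constituent_multiplicity \<Omega> M S =
    (THE m. \<exists>Us. irreducible_decomposition \<Omega> M Us \<and>
      m = card {i. i < length Us \<and> op_iso \<Omega> (M\<lparr>carrier := Us ! i\<rparr>) S})"

definition lin_span :: "('g, 'v) op_module \<Rightarrow> 'v set \<Rightarrow> 'v set"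
  where "lin_span M B = \<Inter>{N. submodule N complex_ring M \<and> B \<subseteq> N}"


section \<open>Constructions of representations\<close>

definition fun_module ::
    "('x \<Rightarrow> complex) set \<Rightarrow> ('g \<Rightarrow> ('x \<Rightarrow> complex) \<Rightarrow> ('x \<Rightarrow> complex)) \<Rightarrow> ('g, 'x \<Rightarrow> complex) op_module"
  where "fun_module V \<rho> =
    \<lparr>carrier = V, monoid.mult = undefined, one = undefined,
     ring.zero = (\<lambda>_. 0), add = (\<lambda>u v x. u x + v x), smult = (\<lambda>c v x. c * v x), act = \<rho>\<rparr>"

text \<open>
  The permutation module with basis the finite set \<open>X\<close>, a formal combination of elements of
  \<open>X\<close> being its coefficient function; \<open>g\<close> sends the basis vector \<open>y\<close> to \<open>\<alpha> g y\<close>.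
\<close>

definition perm_module :: "'x set \<Rightarrow> ('g \<Rightarrow> 'x \<Rightarrow> 'x) \<Rightarrow> ('g, 'x \<Rightarrow> complex) op_module"
  where "perm_module X \<alpha> =
    fun_module {v. \<forall>x. x \<notin> X \<longrightarrow> v x = 0} (\<lambda>g v x. \<Sum>y\<in>{y\<in>X. \<alpha> g y = x}. v y)"

definition trivial_rep :: "('g, unit \<Rightarrow> complex) op_module"
  where "trivial_rep = fun_module UNIV (\<lambda>g v. v)"

text \<open>
  Pullback along a group homomorphism \<open>\<phi>\<close>: restriction if \<open>\<phi>\<close> is an embedding, inflation
  if \<open>\<phi>\<close> is onto.
\<close>

definition pullback :: "('h \<Rightarrow> 'g) \<Rightarrow> ('g, 'v) op_module \<Rightarrow> ('h, 'v) op_module"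
  where "pullback \<phi> M =
    \<lparr>carrier = carrier M, monoid.mult = monoid.mult M, one = one M, ring.zero = ring.zero M, add = add M,
     smult = smult M, act = (\<lambda>h. act M (\<phi> h))\<rparr>"

text \<open>
  The representation of \<open>G\<close> induced from a representation \<open>W\<close> of \<open>H\<close> along an embedding
  \<open>\<phi> : H \<rightarrow> G\<close> of finite groups: the \<open>H\<close>-equivariant functions \<open>G \<rightarrow> W\<close>, with \<open>G\<close> acting by
  right translation of the argument.
\<close>

definition induced ::
    "'h monoid \<Rightarrow> 'g monoid \<Rightarrow> ('h \<Rightarrow> 'g) \<Rightarrow> ('h, 'v) op_module \<Rightarrow> ('g, 'g \<Rightarrow> 'v) op_module"
  where "induced H G \<phi> W =
    \<lparr>carrier = {f \<in> carrier G \<rightarrow>\<^sub>E carrier W.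
       \<forall>h\<in>carrier H. \<forall>g\<in>carrier G. f (\<phi> h \<otimes>\<^bsub>G\<^esub> g) = act W h (f g)},
     monoid.mult = undefined, one = undefined,
     ring.zero = (\<lambda>g\<in>carrier G. \<zero>\<^bsub>W\<^esub>),
     add = (\<lambda>f f'. \<lambda>g\<in>carrier G. f g \<oplus>\<^bsub>W\<^esub> f' g),
     smult = (\<lambda>c f. \<lambda>g\<in>carrier G. c \<odot>\<^bsub>W\<^esub> f g),
     act = (\<lambda>x f. \<lambda>g\<in>carrier G. f (g \<otimes>\<^bsub>G\<^esub> x))\<rparr>"

definition direct_sum ::
    "('g, 'v) op_module \<Rightarrow> ('g, 'w) op_module \<Rightarrow> ('g, 'v \<times> 'w) op_module"
  where "direct_sum V W =
    \<lparr>carrier = carrier V \<times> carrier W, monoid.mult = undefined, one = undefined,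
     ring.zero = (\<zero>\<^bsub>V\<^esub>, \<zero>\<^bsub>W\<^esub>),
     add = (\<lambda>(v, w) (v', w'). (v \<oplus>\<^bsub>V\<^esub> v', w \<oplus>\<^bsub>W\<^esub> w')),
     smult = (\<lambda>c (v, w). (c \<odot>\<^bsub>V\<^esub> v, c \<odot>\<^bsub>W\<^esub> w)),
     act = (\<lambda>g (v, w). (act V g v, act W g w))\<rparr>"

text \<open>
  The outer tensor product of representations on spaces of functions (with the pointwise
  operations) on \<open>X\<close> and on \<open>Y\<close>, realised as a space of functions on \<open>X \<times> Y\<close> by identifying
  \<open>v \<otimes> w\<close> with the function \<open>(x, y) \<mapsto> v x * w y\<close>. The action applies \<open>g\<close> in the first
  variable and then \<open>h\<close> in the second one, so it sends \<open>v \<otimes> w\<close> to \<open>g v \<otimes> h w\<close>.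
\<close>

definition outer_tensor ::
    "('g, 'x \<Rightarrow> complex) op_module \<Rightarrow> ('h, 'y \<Rightarrow> complex) op_module \<Rightarrow>
     ('g \<times> 'h, 'x \<times> 'y \<Rightarrow> complex) op_module"
  where "outer_tensor V W =
    (let T = fun_module UNIV
       (\<lambda>(g, h) t (x, y). act W h (\<lambda>y'. act V g (\<lambda>x'. t (x', y')) x) y)
     in T\<lparr>carrier := lin_span T
       {\<lambda>(x, y). v x * w y | v w. v \<in> carrier V \<and> w \<in> carrier W}\<rparr>)"


section \<open>Algebras spanned by a partial composition\<close>

text \<open>
  The algebra with finite basis \<open>X\<close>, in which the product of two basis elements is given by
  the partial operation \<open>C\<close> (and is \<open>0\<close> where \<open>C\<close> is undefined) and the unit is the sum
  of the basis elements in \<open>E\<close>.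
\<close>

definition span_algebra ::
    "'m set \<Rightarrow> ('m \<Rightarrow> 'm \<Rightarrow> 'm option) \<Rightarrow> 'm set \<Rightarrow> ('m \<Rightarrow> complex) ring"
  where "span_algebra X C E =
    \<lparr>carrier = {a. \<forall>x. x \<notin> X \<longrightarrow> a x = 0},
     monoid.mult = (\<lambda>a b x. \<Sum>(p, q)\<in>{(p, q). p \<in> X \<and> q \<in> X \<and> C p q = Some x}. a p * b q),
     one = (\<lambda>x. if x \<in> E then 1 else 0),
     ring.zero = (\<lambda>_. 0),
     add = (\<lambda>a b x. a x + b x)\<rparr>"

definition group_algebra :: "'g monoid \<Rightarrow> ('g \<Rightarrow> complex) ring"
  where "group_algebra G = span_algebra (carrier G) (\<lambda>g h. Some (g \<otimes>\<^bsub>G\<^esub> h)) {\<one>\<^bsub>G\<^esub>}"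

definition basis_vec :: "'m \<Rightarrow> 'm \<Rightarrow> complex"
  where "basis_vec p = (\<lambda>x. if x = p then 1 else 0)"

definition left_ideal :: "('m \<Rightarrow> complex) ring \<Rightarrow> ('m \<Rightarrow> complex) \<Rightarrow> ('m \<Rightarrow> complex, 'm \<Rightarrow> complex) op_module"
  where "left_ideal A e = fun_module {a \<otimes>\<^bsub>A\<^esub> e | a. a \<in> carrier A} (monoid.mult A)"

definition primitive_idempotent :: "'a ring \<Rightarrow> 'a \<Rightarrow> bool"
  where "primitive_idempotent A e \<longleftrightarrow>
    e \<in> carrier A \<and> e \<otimes>\<^bsub>A\<^esub> e = e \<and> e \<noteq> \<zero>\<^bsub>A\<^esub> \<and>
    \<not> (\<exists>f\<in>carrier A. \<exists>g\<in>carrier A.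
        f \<noteq> \<zero>\<^bsub>A\<^esub> \<and> g \<noteq> \<zero>\<^bsub>A\<^esub> \<and> f \<otimes>\<^bsub>A\<^esub> f = f \<and> g \<otimes>\<^bsub>A\<^esub> g = g \<and>
        f \<otimes>\<^bsub>A\<^esub> g = \<zero>\<^bsub>A\<^esub> \<and> g \<otimes>\<^bsub>A\<^esub> f = \<zero>\<^bsub>A\<^esub> \<and> e = f \<oplus>\<^bsub>A\<^esub> g)"


section \<open>Symmetric groups and Specht modules\<close>

definition partition_of :: "nat list \<Rightarrow> nat \<Rightarrow> bool"
  where "partition_of \<alpha> k \<longleftrightarrow>
    sorted_wrt (\<ge>) \<alpha> \<and> (\<forall>a\<in>set \<alpha>. 0 < a) \<and> sum_list \<alpha> = k"

text \<open>Cells are (row, column) pairs, both counted from \<open>0\<close>.\<close>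

definition cells :: "nat list \<Rightarrow> (nat \<times> nat) set"
  where "cells \<alpha> = {(i, j). i < length \<alpha> \<and> j < \<alpha> ! i}"

definition tableaux :: "nat list \<Rightarrow> (nat \<times> nat \<Rightarrow> nat) set"
  where "tableaux \<alpha> = {t. bij_betw t (cells \<alpha>) {1..sum_list \<alpha>}}"

text \<open>The tabloid of a tableau is the list of the entry sets of its rows.\<close>

definition tabloid :: "nat list \<Rightarrow> (nat \<times> nat \<Rightarrow> nat) \<Rightarrow> nat set list"
  where "tabloid \<alpha> t = map (\<lambda>i. {t (i, j) | j. j < \<alpha> ! i}) [0..<length \<alpha>]"

definition column_stabilizer :: "nat list \<Rightarrow> (nat \<times> nat \<Rightarrow> nat) \<Rightarrow> (nat \<Rightarrow> nat) set"
  where "column_stabilizer \<alpha> t =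
    {\<sigma>. \<sigma> permutes {1..sum_list \<alpha>} \<and>
      (\<forall>j. \<sigma> ` {t (i, j) | i. (i, j) \<in> cells \<alpha>} = {t (i, j) | i. (i, j) \<in> cells \<alpha>})}"

definition polytabloid :: "nat list \<Rightarrow> (nat \<times> nat \<Rightarrow> nat) \<Rightarrow> nat set list \<Rightarrow> complex"
  where "polytabloid \<alpha> t =
    (\<lambda>T. \<Sum>\<sigma>\<in>{\<sigma> \<in> column_stabilizer \<alpha> t. tabloid \<alpha> (\<sigma> \<circ> t) = T}. of_int (sign \<sigma>))"

definition Specht :: "nat list \<Rightarrow> (nat \<Rightarrow> nat, nat set list \<Rightarrow> complex) op_module"
  where "Specht \<alpha> =
    (let M = perm_module (tabloid \<alpha> ` tableaux \<alpha>) (\<lambda>\<sigma>. map (image \<sigma>))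
     in M\<lparr>carrier := lin_span M (polytabloid \<alpha> ` tableaux \<alpha>)\<rparr>)"

definition young_embed :: "nat \<Rightarrow> (nat \<Rightarrow> nat) \<times> (nat \<Rightarrow> nat) \<Rightarrow> nat \<Rightarrow> nat"
  where "young_embed p = (\<lambda>(\<sigma>, \<tau>) x. if x \<le> p then \<sigma> x else \<tau> (x - p) + p)"

definition D4_a :: "nat \<Rightarrow> nat"
  where "D4_a = transpose 1 2"

definition D4_b :: "nat \<Rightarrow> nat"
  where "D4_b = transpose 1 3 \<circ> transpose 2 4"

definition D4 :: "(nat \<Rightarrow> nat) monoid"
  where "D4 = (sym_group 4)\<lparr>carrier := generate (sym_group 4) {D4_a, D4_b}\<rparr>"


section \<open>The category of onto functions and its algebra\<close>

text \<open>
  A morphism is a triple (source, target, function); like a permutation of \<open>{1..r}\<close>, a function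
  on \<open>{1..r}\<close> is extended to all natural numbers by the identity. Onto functions
  \<open>{1..r} \<rightarrow> {1..k}\<close> have \<open>k \<le> r\<close>, so this extension is compatible with composition.
\<close>

type_synonym SE_mor = "nat \<times> nat \<times> (nat \<Rightarrow> nat)"

definition SE_hom :: "nat \<Rightarrow> nat \<Rightarrow> nat \<Rightarrow> SE_mor set"
  where "SE_hom n r k =
    {(r, k, f) | f. r \<le> n \<and> k \<le> n \<and> f ` {1..r} = {1..k} \<and> (\<forall>x. x \<notin> {1..r} \<longrightarrow> f x = x)}"

definition SE_comp :: "SE_mor \<Rightarrow> SE_mor \<Rightarrow> SE_mor option"
  where "SE_comp = (\<lambda>(r', k', f') (r, k, f). if r' = k then Some (r, k', f' \<circ> f) else None)"

definition SE_algebra :: "nat \<Rightarrow> (SE_mor \<Rightarrow> complex) ring"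
  where "SE_algebra n =
    span_algebra (\<Union>r\<le>n. \<Union>k\<le>n. SE_hom n r k) SE_comp {(k, k, id) | k. k \<le> n}"

definition SE_incl :: "nat \<Rightarrow> ((nat \<Rightarrow> nat) \<Rightarrow> complex) \<Rightarrow> SE_mor \<Rightarrow> complex"
  where "SE_incl k a = (\<lambda>(r, l, f). if r = k \<and> l = k then a f else 0)"

definition SE_idempotent_for :: "nat list \<Rightarrow> ((nat \<Rightarrow> nat) \<Rightarrow> complex) \<Rightarrow> bool"
  where "SE_idempotent_for \<alpha> e \<longleftrightarrow>
    (let G = sym_group (sum_list \<alpha>) in
      primitive_idempotent (group_algebra G) e \<and>
      op_iso (carrier G) (pullback basis_vec (left_ideal (group_algebra G) e)) (Specht \<alpha>))"

text \<open>
  The projective module \<open>P(\<alpha>)\<close> and the simple module \<open>S(\<alpha>)\<close> for \<open>\<alpha> \<turnstile> k\<close>, formed with the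
  idempotent \<open>e\<close> chosen for \<open>\<alpha>\<close>.
\<close>

definition SE_proj :: "nat \<Rightarrow> nat \<Rightarrow> ((nat \<Rightarrow> nat) \<Rightarrow> complex) \<Rightarrow> (SE_mor \<Rightarrow> complex, SE_mor \<Rightarrow> complex) op_module"
  where "SE_proj n k e = left_ideal (SE_algebra n) (SE_incl k e)"

definition SE_simple :: "nat \<Rightarrow> nat \<Rightarrow> ((nat \<Rightarrow> nat) \<Rightarrow> complex) \<Rightarrow> (SE_mor \<Rightarrow> complex, (SE_mor \<Rightarrow> complex) set) op_module"
  where "SE_simple n k e =
    op_quotient (SE_proj n k e) (Rad (carrier (SE_algebra n)) (SE_proj n k e))"

definition SE_hom_module ::
    "nat \<Rightarrow> nat \<Rightarrow> nat \<Rightarrow> ((nat \<Rightarrow> nat) \<times> (nat \<Rightarrow> nat), SE_mor \<Rightarrow> complex) op_module"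
  where "SE_hom_module n r k =
    perm_module (SE_hom n r k)
      (\<lambda>(g1, g2) (s, t, f). (s, t, g1 \<circ> f \<circ> inv\<^bsub>sym_group r\<^esub> g2))"

end

theory Submission
  imports Defs "HOL-Library.Function_Algebras" "HOL-Computational_Algebra.Fundamental_Theorem_Algebra"
begin

text \<open>
  All three multiplicities are computed as the trace of an idempotent operator, and the three traces
  are the same sum of fixed point numbers. Write \<open>b = e\<^sub>\<beta>\<close>, \<open>a = e\<^sub>\<alpha>\<close>, \<open>r = k + 2\<close>, and let \<open>F\<close> be the
  set of onto maps from \<open>{1..r}\<close> to \<open>{1..k}\<close>. The common value is
  \<open>\<Sum> b y * a h * card {f \<in> F. y \<circ> f \<circ> h = f}\<close>, summed over \<open>y\<close> in \<open>S\<^sub>k\<close> and \<open>h\<close> in \<open>S\<^sub>r\<close>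
  (the definition \<open>fixed_point_sum\<close>).
  
  Why a multiplicity is a trace: let \<open>e\<close> be an idempotent of an algebra \<open>A\<close> with \<open>e A e = \<complex> e\<close>. On a simple
  module \<open>U\<close> the space \<open>e U\<close> is zero or a line, and it is a line exactly when \<open>U\<close> is isomorphic to the
  simple module \<open>S\<close> that has a nonzero vector fixed by \<open>e\<close>: if \<open>u\<close> and \<open>s\<close> are fixed by \<open>e\<close>, the submodule of
  \<open>U \<times> S\<close> generated by \<open>(u, s)\<close> contains neither \<open>(u, 0)\<close> nor \<open>(0, s)\<close>, hence is the graph of an
  isomorphism (\<open>goursat\<close>). Counting along a composition series or a direct decomposition, the
  number of factors isomorphic to \<open>S\<close> is the dimension of \<open>e M\<close>, that is, the trace of a
  projection onto \<open>e M\<close> (\<open>trace_of_projection\<close>). This also shows that the count does not depend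
  on the series or decomposition. Existence comes
  from bounded dimension and, for group representations, from averaging (\<open>maschke\<close>).
  
  For a primitive idempotent \<open>e\<close> of \<open>\<complex>G\<close>, averaging shows that \<open>\<complex>G e\<close> is simple, and an eigenvector of right
  multiplication by an element of \<open>e \<complex>G e\<close> shows \<open>e \<complex>G e = \<complex> e\<close>. The Specht module enters
  through its isomorphism with \<open>\<complex>G e\<close>.
  
  The three traces. In the category algebra, the endomorphisms \<open>S\<^sub>k\<close> of \<open>k\<close> give \<open>e A e = \<complex> e\<close> for \<open>e = b\<close>, and
  \<open>e P(\<alpha>)\<close> is the image of \<open>z \<mapsto> b z a\<close> (\<open>JH_multiplicity_SE\<close>). In the bimodule of onto
  maps, \<open>b \<otimes> a\<close> acts with \<open>a\<close> inverted, which is harmless because each permutation is conjugate to its inverse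
  (\<open>constituent_multiplicity_SE_hom\<close>). Finally the sum of the two induced modules is the
  space of \<open>S\<^sub>k\<close>-equivariant maps from \<open>F\<close> to \<open>S\<^sup>\<beta>\<close>: under \<open>S\<^sub>k \<times> S\<^sub>r\<close> the set \<open>F\<close> has two orbits, with one
  fibre of size three or two fibres of size two, and the stabilisers of suitable representatives are
  \<open>S\<^bsub>k-1\<^esub> \<times> S\<^sub>3\<close> and \<open>S\<^bsub>k-2\<^esub> \<times> D\<^sub>4\<close> (\<open>two_orbits_iso\<close>, \<open>stabilizer_fold3\<close>, \<open>stabilizer_fold22\<close>).
\<close>

section \<open>Linear algebra in spaces of functions\<close>

definition cscale :: "complex \<Rightarrow> ('x \<Rightarrow> complex) \<Rightarrow> 'x \<Rightarrow> complex"
  where "cscale c v = (\<lambda>x. c * v x)"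

lemma cscale_apply: "cscale c v x = c * v x"
  by (simp add: cscale_def)

text \<open>
  As rewrite rules these pointwise equations would also apply to unapplied functions and turn
  each of them into an explicit abstraction, so they are used only on demand.
\<close>

declare plus_fun_apply [simp del] zero_fun_apply [simp del] times_fun_apply [simp del]
  one_fun_apply [simp del]

lemmas pointwise = cscale_apply plus_fun_apply zero_fun_apply fun_Compl_def fun_diff_def

interpretation fs: vector_space cscale
  by unfold_locales (auto simp: fun_eq_iff pointwise algebra_simps)

abbreviation flinear :: "(('x \<Rightarrow> complex) \<Rightarrow> ('y \<Rightarrow> complex)) \<Rightarrow> bool"
  where "flinear \<equiv> Vector_Spaces.linear cscale cscale"

lemma flinearI:
  assumes "\<And>u v. T (u + v) = T u + T v" "\<And>c v. T (cscale c v) = cscale c (T v)"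
  shows "flinear T"
  using assms by (unfold_locales) auto

lemma flinear_add: "flinear T \<Longrightarrow> T (u + v) = T u + T v"
  by (simp add: Vector_Spaces.linear_iff)

lemma flinear_scale: "flinear T \<Longrightarrow> T (cscale c v) = cscale c (T v)"
  by (simp add: Vector_Spaces.linear_iff)

lemma flinear_zero: "flinear T \<Longrightarrow> T 0 = 0"
  using flinear_scale[of T 0 0] by simp

lemma flinear_diff: "flinear T \<Longrightarrow> T (u - v) = T u - T v"
  using flinear_add[of T "u - v" v] by simp

lemma flinear_sum: "flinear T \<Longrightarrow> T (\<Sum>i\<in>I. f i) = (\<Sum>i\<in>I. T (f i))"
  by (induction I rule: infinite_finite_induct) (auto simp: flinear_zero flinear_add)

lemma sum_fun_apply: "(\<Sum>i\<in>I. f i) x = (\<Sum>i\<in>I. f i x)"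
  for f :: "'i \<Rightarrow> 'x \<Rightarrow> 'b::comm_monoid_add"
  by (induction I rule: infinite_finite_induct) (auto simp: pointwise)

definition funs :: "'x set \<Rightarrow> ('x \<Rightarrow> complex) set"
  where "funs X = {v. \<forall>x. x \<notin> X \<longrightarrow> v x = 0}"

lemma subspace_funs: "fs.subspace (funs X)"
  by (auto simp: fs.subspace_def funs_def pointwise)

lemma basis_vec_in_funs: "x \<in> X \<Longrightarrow> basis_vec x \<in> funs X"
  by (auto simp: basis_vec_def funs_def)

lemma funs_expand:
  assumes "finite X" "v \<in> funs X"
  shows "v = (\<Sum>x\<in>X. cscale (v x) (basis_vec x))"
proof
  fix y
  have "(\<Sum>x\<in>X. v x * basis_vec x y) = (\<Sum>x\<in>X. if y = x then v x else 0)"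
    by (intro sum.cong) (auto simp: basis_vec_def)
  then show "v y = (\<Sum>x\<in>X. cscale (v x) (basis_vec x)) y"
    using assms by (auto simp: sum_fun_apply pointwise funs_def)
qed

lemma funs_subset_span: "finite X \<Longrightarrow> funs X \<subseteq> fs.span (basis_vec ` X)"
proof
  fix v assume "finite X" "v \<in> funs X"
  then have "v = (\<Sum>x\<in>X. cscale (v x) (basis_vec x))" by (rule funs_expand)
  also have "\<dots> \<in> fs.span (basis_vec ` X)"
    by (intro fs.span_sum fs.span_scale fs.span_base imageI)
  finally show "v \<in> fs.span (basis_vec ` X)" .
qed

lemma indep_finite_card:
  assumes "finite X" "V \<subseteq> funs X" "B \<subseteq> V" "fs.independent B"
  shows "finite B" "card B \<le> card X"
proof -
  have "B \<subseteq> fs.span (basis_vec ` X)" using assms funs_subset_span by blast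
  then have "finite B \<and> card B \<le> card (basis_vec ` X)"
    using fs.independent_span_bound[of "basis_vec ` X" B] assms by auto
  then show "finite B" "card B \<le> card X"
    using card_image_le[of X basis_vec] assms(1) by (auto intro: order_trans)
qed

lemma dim_le: assumes "finite X" "V \<subseteq> funs X" shows "fs.dim V \<le> card X"
  using fs.dim_le_card[of V "basis_vec ` X"] funs_subset_span[OF assms(1)] assms
    card_image_le[of X basis_vec] by (meson finite_imageI order_trans)

lemma dim_strict:
  assumes "finite X" "V \<subseteq> funs X" "fs.subspace U" "U \<subset> V"
  shows "fs.dim U < fs.dim V"
proof -
  obtain B where B: "B \<subseteq> U" "fs.independent B" "U \<subseteq> fs.span B" "card B = fs.dim U"
    using fs.basis_exists[of U] by blast
  obtain C where C: "B \<subseteq> C" "C \<subseteq> V" "fs.independent C" "V \<subseteq> fs.span C"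
    using fs.maximal_independent_subset_extend[of B V] B assms by blast
  have "card C = fs.dim V" using fs.basis_card_eq_dim C by blast
  moreover have "finite C" using indep_finite_card[OF assms(1,2) C(2,3)] by simp
  moreover have "B \<noteq> C"
    using fs.span_minimal[OF B(1) assms(3)] C assms(4) by blast
  ultimately show ?thesis
    using psubset_card_mono[of C B] C(1) B(4) by auto
qed

text \<open>
  Expanding \<open>T \<delta>\<^sub>x\<close> in the basis \<open>B\<close> with coefficient functionals, the diagonal sum becomes the sum over \<open>b\<close>
  of the \<open>b\<close>-coefficient of \<open>T b = b\<close>, each equal to one.
\<close>

lemma trace_of_projection:
  assumes X: "finite X" and T: "flinear T"
    and im: "\<And>v. v \<in> funs X \<Longrightarrow> T v \<in> fs.span B"
    and fixed: "\<And>v. v \<in> fs.span B \<Longrightarrow> T v = v"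
    and B: "finite B" "fs.independent B" "B \<subseteq> funs X"
  shows "(\<Sum>x\<in>X. T (basis_vec x) x) = of_nat (card B)"
proof -
  let ?r = "fs.representation B"
  have Tx: "T (basis_vec x) \<in> fs.span B" if "x \<in> X" for x
    by (rule im[OF basis_vec_in_funs[OF that]])
  have "(\<Sum>x\<in>X. T (basis_vec x) x) = (\<Sum>x\<in>X. \<Sum>b\<in>B. ?r (T (basis_vec x)) b * b x)"
  proof (rule sum.cong[OF refl])
    fix x assume "x \<in> X"
    have "(\<Sum>b\<in>B. cscale (?r (T (basis_vec x)) b) b) = T (basis_vec x)"
      by (rule fs.sum_representation_eq[OF B(2) Tx[OF \<open>x \<in> X\<close>] B(1) subset_refl])
    from fun_cong[OF this, of x]
    show "T (basis_vec x) x = (\<Sum>b\<in>B. ?r (T (basis_vec x)) b * b x)"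
      by (simp add: sum_fun_apply pointwise)
  qed
  also have "\<dots> = (\<Sum>b\<in>B. \<Sum>x\<in>X. ?r (T (basis_vec x)) b * b x)"
    by (rule sum.swap)
  also have "\<dots> = (\<Sum>b\<in>B. 1)"
  proof (rule sum.cong[OF refl])
    fix b assume b: "b \<in> B"
    have exp: "b = (\<Sum>x\<in>X. cscale (b x) (basis_vec x))"
      using B(3) b by (intro funs_expand[OF X]) auto
    have "b = T b" using fixed[OF fs.span_base[OF b]] by simp
    also have "T b = T (\<Sum>x\<in>X. cscale (b x) (basis_vec x))"
      using exp by (rule arg_cong)
    also have "\<dots> = (\<Sum>x\<in>X. cscale (b x) (T (basis_vec x)))"
      by (simp only: flinear_sum[OF T] flinear_scale[OF T])
    finally have eq: "b = (\<Sum>x\<in>X. cscale (b x) (T (basis_vec x)))" .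
    have "1 = ?r b b" using fs.representation_basis[OF B(2) b] by simp
    also have "\<dots> = ?r (\<Sum>x\<in>X. cscale (b x) (T (basis_vec x))) b" by (simp only: eq[symmetric])
    also have "\<dots> = (\<Sum>x\<in>X. ?r (cscale (b x) (T (basis_vec x))) b)"
      by (rule fun_cong[OF fs.representation_sum[OF B(2) fs.span_scale[OF Tx]]])
    also have "\<dots> = (\<Sum>x\<in>X. ?r (T (basis_vec x)) b * b x)"
      by (intro sum.cong refl) (simp only: fs.representation_scale[OF B(2) Tx] mult.commute)
    finally show "(\<Sum>x\<in>X. ?r (T (basis_vec x)) b * b x) = 1" ..
  qed
  finally show ?thesis by simp
qed

definition peval :: "complex poly \<Rightarrow> (('x \<Rightarrow> complex) \<Rightarrow> ('x \<Rightarrow> complex)) \<Rightarrow> ('x \<Rightarrow> complex) \<Rightarrow> 'x \<Rightarrow> complex"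
  where "peval p T v = (\<Sum>i\<le>degree p. cscale (coeff p i) ((T ^^ i) v))"

lemma peval_ge: "degree p \<le> n \<Longrightarrow> peval p T v = (\<Sum>i\<le>n. cscale (coeff p i) ((T ^^ i) v))"
  unfolding peval_def by (rule sum.mono_neutral_left) (auto simp: coeff_eq_0)

lemma peval_linear_factor:
  assumes T: "flinear T"
  shows "peval (p * [:- l, 1:]) T v = peval p T (T v - cscale l v)"
proof -
  have lin: "flinear (T ^^ i)" for i
  proof (induction i)
    case 0
    show ?case by (rule flinearI) simp_all
  next
    case (Suc i)
    show ?case by (rule flinearI) (simp_all add: flinear_add[OF T] flinear_scale[OF T] flinear_add[OF Suc] flinear_scale[OF Suc])
  qed
  have "peval (p * [:- l, 1:]) T v = (\<Sum>i\<le>Suc (degree p). cscale (coeff (p * [:- l, 1:]) i) ((T ^^ i) v))"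
    by (rule peval_ge) (use degree_mult_le[of p "[:- l, 1:]"] in auto)
  also have "\<dots> = (\<Sum>i\<le>Suc (degree p). cscale (coeff (pCons 0 p) i) ((T ^^ i) v) - cscale (l * coeff p i) ((T ^^ i) v))"
    by (intro sum.cong refl) (auto simp: fs.scale_left_diff_distrib[symmetric])
  also have "\<dots> = (\<Sum>i\<le>Suc (degree p). cscale (coeff (pCons 0 p) i) ((T ^^ i) v))
       - (\<Sum>i\<le>degree p. cscale (l * coeff p i) ((T ^^ i) v))"
    by (simp add: sum_subtractf coeff_eq_0)
  also have "(\<Sum>i\<le>Suc (degree p). cscale (coeff (pCons 0 p) i) ((T ^^ i) v)) = (\<Sum>i\<le>degree p. cscale (coeff p i) ((T ^^ Suc i) v))"
    by (subst sum.atMost_Suc_shift) (simp add: )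
  also have "\<dots> - (\<Sum>i\<le>degree p. cscale (l * coeff p i) ((T ^^ i) v)) = peval p T (T v - cscale l v)"
    unfolding peval_def sum_subtractf[symmetric]
    by (intro sum.cong refl)
      (simp add: flinear_diff[OF lin] flinear_scale[OF lin] funpow_swap1 fs.scale_right_diff_distrib mult.commute)
  finally show ?thesis .
qed

text \<open>
  Split off a linear factor \<open>X - l\<close> of \<open>p\<close>: either it already kills \<open>v\<close>, which is then an eigenvector, or the
  quotient of smaller degree kills the nonzero vector \<open>T v - l v\<close>.
\<close>

lemma eigenvector_if_annihilated:
  assumes T: "flinear T" and V: "fs.subspace V" "\<And>v. v \<in> V \<Longrightarrow> T v \<in> V"
  shows "p \<noteq> 0 \<Longrightarrow> v \<in> V \<Longrightarrow> v \<noteq> 0 \<Longrightarrow> peval p T v = 0 \<Longrightarrow> \<exists>l w. w \<in> V \<and> w \<noteq> 0 \<and> T w = cscale l w"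
proof (induction "degree p" arbitrary: p v)
  case 0
  then obtain c where "p = [:c:]" by (metis degree_eq_zeroE)
  with 0 show ?case by (auto simp: peval_def)
next
  case (Suc d)
  then have "\<not> constant (poly p)" by (metis constant_degree nat.simps(3))
  then obtain l where "poly p l = 0" using fundamental_theorem_of_algebra by blast
  then obtain q where q: "p = q * [:- l, 1:]" by (metis dvd_def mult.commute poly_eq_0_iff_dvd)
  have "q \<noteq> 0" using q Suc.prems(1) by auto
  then have "degree p = degree q + degree [:- l, 1:]" unfolding q by (intro degree_mult_eq) auto
  then have "degree q = d" using Suc.hyps(2) by simp
  let ?w = "T v - cscale l v"
  show ?case
  proof (cases "?w = 0")
    case True
    then show ?thesis using Suc.prems by (intro exI[of _ l] exI[of _ v]) simp
  next
    case False
    have "?w \<in> V" using V Suc.prems by (auto intro!: fs.subspace_diff fs.subspace_scale)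
    moreover have "peval q T ?w = 0" using Suc.prems(4) unfolding q peval_linear_factor[OF T] .
    ultimately show ?thesis using Suc.hyps(1) \<open>q \<noteq> 0\<close> \<open>degree q = d\<close> False by blast
  qed
qed

text \<open>
  The spans of \<open>v, T v, ..., T\<^bsup>d-1\<^esup> v\<close> cannot grow forever, and where they stop growing some polynomial in \<open>T\<close>
  kills \<open>v\<close>.
\<close>

lemma eigenvector_exists:
  assumes X: "finite X" "V \<subseteq> funs X" and T: "flinear T" and V: "fs.subspace V" "\<And>v. v \<in> V \<Longrightarrow> T v \<in> V"
    and v: "v \<in> V" "v \<noteq> 0"
  shows "\<exists>l w. w \<in> V \<and> w \<noteq> 0 \<and> T w = cscale l w"
proof -
  define P where "P d c = (\<Sum>i<d. cscale (c i) ((T ^^ i) v))" for d and c :: "nat \<Rightarrow> complex"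
  define K where "K d = range (P d)" for d
  have sub: "fs.subspace (K d)" for d
    unfolding fs.subspace_def
  proof (intro conjI ballI allI)
    have "P d (\<lambda>_. 0) = 0" by (simp add: P_def)
    then show "0 \<in> K d" unfolding K_def by (metis rangeI)
  next
    fix a b assume "a \<in> K d" "b \<in> K d"
    then obtain c c' where "a = P d c" "b = P d c'"
      unfolding K_def by blast
    then have "a + b = P d (\<lambda>i. c i + c' i)"
      by (simp add: P_def fs.scale_left_distrib sum.distrib)
    then show "a + b \<in> K d" unfolding K_def by (metis rangeI)
  next
    fix c a assume "a \<in> K d"
    then obtain c' where "a = P d c'"
      unfolding K_def by blast
    then have "cscale c a = P d (\<lambda>i. c * c' i)"
      by (simp add: P_def fs.scale_sum_right)
    then show "cscale c a \<in> K d" unfolding K_def by (metis rangeI)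
  qed
  have pow: "(T ^^ i) v \<in> V" for i by (induction i) (use v V in auto)
  have KV: "K d \<subseteq> V" for d unfolding K_def P_def
    by (auto intro!: fs.subspace_sum[OF V(1)] fs.subspace_scale[OF V(1)] pow)
  have mono: "K d \<subseteq> K (Suc d)" for d
  proof
    fix a assume "a \<in> K d"
    then obtain c where "a = P d c" unfolding K_def by blast
    then have "a = P (Suc d) (c(d := 0))" by (simp add: P_def)
    then show "a \<in> K (Suc d)" unfolding K_def by (metis rangeI)
  qed
  have "\<exists>d. K (Suc d) = K d"
  proof (rule ccontr)
    assume "\<nexists>d. K (Suc d) = K d"
    then have "K d \<subset> K (Suc d)" for d using mono[of d] by (metis psubsetI)
    then have lt: "fs.dim (K d) < fs.dim (K (Suc d))" for d
      by (intro dim_strict[OF X(1) _ sub] order_trans[OF KV X(2)])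
    have "d \<le> fs.dim (K d)" for d
    proof (induction d)
      case (Suc d)
      then show ?case using lt[of d] by linarith
    qed simp
    moreover have "fs.dim (K (Suc (card X))) \<le> card X" 
      by (intro dim_le[OF X(1)] order_trans[OF KV X(2)])
    ultimately show False by (metis not_less_eq_eq)
  qed
  then obtain d where d: "K (Suc d) = K d" by blast
  have "(T ^^ d) v = P (Suc d) (\<lambda>i. if i = d then 1 else 0)"
    by (simp add: P_def sum.neutral)
  then have "(T ^^ d) v \<in> K (Suc d)" unfolding K_def by (metis rangeI)
  then have "(T ^^ d) v \<in> K d" using d by simp
  then obtain c where c: "(T ^^ d) v = (\<Sum>i<d. cscale (c i) ((T ^^ i) v))"
    unfolding K_def P_def by blast
  define p where "p = monom 1 d - (\<Sum>i<d. monom (c i) i)"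
  have cf: "coeff p i = (if i = d then 1 else if i < d then - c i else 0)" for i
    unfolding p_def by (auto simp: coeff_sum)
  have "p \<noteq> 0" using cf[of d] by auto
  have "degree p \<le> d" by (rule degree_le) (auto simp: cf)
  then have "peval p T v = (\<Sum>i\<le>d. cscale (coeff p i) ((T ^^ i) v))" by (rule peval_ge)
  also have "\<dots> = (T ^^ d) v - (\<Sum>i<d. cscale (c i) ((T ^^ i) v))"
    unfolding lessThan_Suc_atMost[symmetric] by (simp add: cf sum_negf)
  finally have "peval p T v = 0" using c by simp
  with \<open>p \<noteq> 0\<close> show ?thesis by (intro eigenvector_if_annihilated[OF T V _ v])
qed



section \<open>Modules with operators\<close>

lemma complex_ring_simps:
  "carrier complex_ring = UNIV" "\<zero>\<^bsub>complex_ring\<^esub> = 0" "\<one>\<^bsub>complex_ring\<^esub> = 1"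
  "x \<oplus>\<^bsub>complex_ring\<^esub> y = x + y" "x \<otimes>\<^bsub>complex_ring\<^esub> y = x * y"
  by (simp_all add: complex_ring_def)

lemma cring_complex_ring: "cring complex_ring"
proof (intro cringI abelian_groupI comm_monoidI)
  fix x :: complex
  show "\<exists>y\<in>carrier complex_ring. y \<oplus>\<^bsub>complex_ring\<^esub> x = \<zero>\<^bsub>complex_ring\<^esub>"
    by (intro bexI[of _ "- x"]) (simp_all add: complex_ring_simps)
qed (simp_all add: complex_ring_simps algebra_simps)

lemma a_inv_complex_ring_one: "\<ominus>\<^bsub>complex_ring\<^esub> 1 = - 1"
proof -
  have "- 1 \<oplus>\<^bsub>complex_ring\<^esub> 1 = \<zero>\<^bsub>complex_ring\<^esub>" by (simp add: complex_ring_simps)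
  then show ?thesis
    using abelian_group.minus_equality[OF ring.is_abelian_group[OF cring.axioms(1)[OF cring_complex_ring]], of "-1" 1]
    by (simp add: complex_ring_simps)
qed

lemma complex_module_sub_iff:
  assumes M: "module complex_ring M"
  shows "op_submodule \<Omega> N M \<longleftrightarrow> N \<subseteq> carrier M \<and> \<zero>\<^bsub>M\<^esub> \<in> N \<and>
    (\<forall>x\<in>N. \<forall>y\<in>N. x \<oplus>\<^bsub>M\<^esub> y \<in> N) \<and> (\<forall>c. \<forall>x\<in>N. c \<odot>\<^bsub>M\<^esub> x \<in> N) \<and>
    (\<forall>g\<in>\<Omega>. \<forall>v\<in>N. act M g v \<in> N)" (is "?L \<longleftrightarrow> ?R")
proof
  assume ?L
  then have s: "submodule N complex_ring M" and a: "\<forall>g\<in>\<Omega>. \<forall>v\<in>N. act M g v \<in> N"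
    by (simp_all add: op_submodule_def)
  have "\<zero>\<^bsub>M\<^esub> \<in> N" using subgroup.one_closed[OF submodule.axioms(1)[OF s]] by simp
  then show ?R using module.submoduleE[OF M s] a by (auto simp: complex_ring_simps)
next
  assume R: ?R
  have inv: "\<ominus>\<^bsub>M\<^esub> a \<in> N" if "a \<in> N" for a
  proof -
    have a: "a \<in> carrier M" using R that by auto
    have "\<ominus>\<^bsub>M\<^esub> a = (- 1) \<odot>\<^bsub>M\<^esub> a"
      using module.smult_l_minus[OF M, of 1 a] module.smult_one[OF M a] a
      by (simp add: complex_ring_simps a_inv_complex_ring_one)
    then show ?thesis using R that by auto
  qed
  show ?L unfolding op_submodule_def
    using R inv by (auto intro!: module.submoduleI[OF M])
qed

text \<open>
  The module axioms are equations, so they pass to quotients and along bijections without being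
  checked again.
\<close>

lemma module_surjective_image:
  assumes M: "module complex_ring M"
    and surj: "\<pi> ` carrier M = carrier Q"
    and zero: "\<pi> \<zero>\<^bsub>M\<^esub> = \<zero>\<^bsub>Q\<^esub>"
    and add: "\<And>x y. x \<in> carrier M \<Longrightarrow> y \<in> carrier M \<Longrightarrow> \<pi> (x \<oplus>\<^bsub>M\<^esub> y) = \<pi> x \<oplus>\<^bsub>Q\<^esub> \<pi> y"
    and smult: "\<And>c x. x \<in> carrier M \<Longrightarrow> \<pi> (c \<odot>\<^bsub>M\<^esub> x) = c \<odot>\<^bsub>Q\<^esub> \<pi> x"
  shows "module complex_ring Q"
proof -
  interpret M: module complex_ring M by fact
  have ex: "\<exists>x\<in>carrier M. q = \<pi> x" if "q \<in> carrier Q" for q using surj that by blast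
  have im: "\<pi> x \<in> carrier Q" if "x \<in> carrier M" for x using surj that by blast
  show ?thesis
  proof (intro moduleI[OF cring_complex_ring] abelian_groupI)
    fix x y assume "x \<in> carrier Q" "y \<in> carrier Q"
    then obtain x' y' where 1: "x' \<in> carrier M" "y' \<in> carrier M" "x = \<pi> x'" "y = \<pi> y'" using ex by blast
    then show "x \<oplus>\<^bsub>Q\<^esub> y \<in> carrier Q" by (simp add: add[symmetric] im)
    show "x \<oplus>\<^bsub>Q\<^esub> y = y \<oplus>\<^bsub>Q\<^esub> x" using 1 by (simp add: add[symmetric] M.a_comm)
    fix a :: complex
    show "a \<odot>\<^bsub>Q\<^esub> (x \<oplus>\<^bsub>Q\<^esub> y) = a \<odot>\<^bsub>Q\<^esub> x \<oplus>\<^bsub>Q\<^esub> a \<odot>\<^bsub>Q\<^esub> y"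
      using 1 M.smult_r_distr[of a x' y'] by (simp add: add[symmetric] smult[symmetric] complex_ring_simps)
    fix z assume "z \<in> carrier Q"
    then obtain z' where "z' \<in> carrier M" "z = \<pi> z'" using ex by blast
    then show "x \<oplus>\<^bsub>Q\<^esub> y \<oplus>\<^bsub>Q\<^esub> z = x \<oplus>\<^bsub>Q\<^esub> (y \<oplus>\<^bsub>Q\<^esub> z)" using 1 by (simp add: add[symmetric] M.a_assoc)
  next
    show "\<zero>\<^bsub>Q\<^esub> \<in> carrier Q" using im[of "\<zero>\<^bsub>M\<^esub>"] zero by simp
  next
    fix x assume "x \<in> carrier Q"
    then obtain x' where 1: "x' \<in> carrier M" "x = \<pi> x'" using ex by blast
    then show "\<zero>\<^bsub>Q\<^esub> \<oplus>\<^bsub>Q\<^esub> x = x" by (simp add: add[symmetric] zero[symmetric])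
    have "\<ominus>\<^bsub>M\<^esub> x' \<oplus>\<^bsub>M\<^esub> x' = \<zero>\<^bsub>M\<^esub>" using 1 M.l_neg by simp
    then have "\<pi> (\<ominus>\<^bsub>M\<^esub> x') \<oplus>\<^bsub>Q\<^esub> x = \<zero>\<^bsub>Q\<^esub>" using 1 by (simp add: add[symmetric] zero)
    then show "\<exists>y\<in>carrier Q. y \<oplus>\<^bsub>Q\<^esub> x = \<zero>\<^bsub>Q\<^esub>" using im[of "\<ominus>\<^bsub>M\<^esub> x'"] 1 by auto
    fix a :: complex
    show "a \<odot>\<^bsub>Q\<^esub> x \<in> carrier Q" using 1 by (auto simp: smult[symmetric] complex_ring_simps intro!: im)
    show "\<one>\<^bsub>complex_ring\<^esub> \<odot>\<^bsub>Q\<^esub> x = x" using 1 M.smult_one[of x'] by (simp add: smult[symmetric])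
    fix b :: complex
    show "(a \<oplus>\<^bsub>complex_ring\<^esub> b) \<odot>\<^bsub>Q\<^esub> x = a \<odot>\<^bsub>Q\<^esub> x \<oplus>\<^bsub>Q\<^esub> b \<odot>\<^bsub>Q\<^esub> x"
      using 1 M.smult_l_distr[of a b x'] by (simp add: add[symmetric] smult[symmetric] complex_ring_simps)
    show "(a \<otimes>\<^bsub>complex_ring\<^esub> b) \<odot>\<^bsub>Q\<^esub> x = a \<odot>\<^bsub>Q\<^esub> (b \<odot>\<^bsub>Q\<^esub> x)"
      using 1 M.smult_assoc1[of a b x'] by (simp add: smult[symmetric] complex_ring_simps)
  qed
qed

text \<open>
  Both projections of \<open>\<Gamma>\<close> are onto, and both kernels \<open>{x. (x, 0) \<in> \<Gamma>}\<close> and \<open>{y. (0, y) \<in> \<Gamma>}\<close> are zero, since each of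
  these is a submodule of a simple module. So \<open>\<Gamma>\<close> is the graph of an isomorphism.
\<close>

lemma goursat:
  assumes U: "module complex_ring U" "op_simple \<Omega> U"
    and S: "module complex_ring S" "op_simple \<Omega> S"
    and act0: "\<And>g. g \<in> \<Omega> \<Longrightarrow> act U g \<zero>\<^bsub>U\<^esub> = \<zero>\<^bsub>U\<^esub>" "\<And>g. g \<in> \<Omega> \<Longrightarrow> act S g \<zero>\<^bsub>S\<^esub> = \<zero>\<^bsub>S\<^esub>"
    and \<Gamma>: "\<Gamma> \<subseteq> carrier U \<times> carrier S"
    and add: "\<And>x y x' y'. (x, y) \<in> \<Gamma> \<Longrightarrow> (x', y') \<in> \<Gamma> \<Longrightarrow> (x \<oplus>\<^bsub>U\<^esub> x', y \<oplus>\<^bsub>S\<^esub> y') \<in> \<Gamma>"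
    and smult: "\<And>c x y. (x, y) \<in> \<Gamma> \<Longrightarrow> (c \<odot>\<^bsub>U\<^esub> x, c \<odot>\<^bsub>S\<^esub> y) \<in> \<Gamma>"
    and act: "\<And>g x y. g \<in> \<Omega> \<Longrightarrow> (x, y) \<in> \<Gamma> \<Longrightarrow> (act U g x, act S g y) \<in> \<Gamma>"
    and us: "(u, s) \<in> \<Gamma>" "u \<noteq> \<zero>\<^bsub>U\<^esub>" "s \<noteq> \<zero>\<^bsub>S\<^esub>" "(u, \<zero>\<^bsub>S\<^esub>) \<notin> \<Gamma>" "(\<zero>\<^bsub>U\<^esub>, s) \<notin> \<Gamma>"
  shows "op_iso \<Omega> U S"
proof -
  interpret U: module complex_ring U by fact
  interpret S: module complex_ring S by fact
  have inU: "x \<in> carrier U" and inS: "y \<in> carrier S" if "(x, y) \<in> \<Gamma>" for x y using that \<Gamma> by auto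
  have z: "(\<zero>\<^bsub>U\<^esub>, \<zero>\<^bsub>S\<^esub>) \<in> \<Gamma>"
    using smult[OF us(1), of 0] U.smult_l_null[OF inU[OF us(1)]] S.smult_l_null[OF inS[OF us(1)]]
    by (simp add: complex_ring_simps)
  have sc: "c \<odot>\<^bsub>U\<^esub> \<zero>\<^bsub>U\<^esub> = \<zero>\<^bsub>U\<^esub>" "c \<odot>\<^bsub>S\<^esub> \<zero>\<^bsub>S\<^esub> = \<zero>\<^bsub>S\<^esub>" for c
    using U.smult_r_null[of c] S.smult_r_null[of c] by (simp_all add: complex_ring_simps)
  have simpU: "N = {\<zero>\<^bsub>U\<^esub>} \<or> N = carrier U" if "op_submodule \<Omega> N U" for N using U(2) that by (auto simp: op_simple_def)
  have simpS: "N = {\<zero>\<^bsub>S\<^esub>} \<or> N = carrier S" if "op_submodule \<Omega> N S" for N using S(2) that by (auto simp: op_simple_def)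
  have "op_submodule \<Omega> (fst ` \<Gamma>) U"
    unfolding complex_module_sub_iff[OF U(1)]
  proof (intro conjI ballI allI)
    have mem: "x \<in> fst ` \<Gamma> \<longleftrightarrow> (\<exists>w. (x, w) \<in> \<Gamma>)" for x by (force simp: image_iff)
    show "fst ` \<Gamma> \<subseteq> carrier U" using \<Gamma> by auto
    show "\<zero>\<^bsub>U\<^esub> \<in> fst ` \<Gamma>" using z mem by blast
    show "x \<oplus>\<^bsub>U\<^esub> y \<in> fst ` \<Gamma>" if "x \<in> fst ` \<Gamma>" "y \<in> fst ` \<Gamma>" for x y
      using that add unfolding mem by blast
    show "c \<odot>\<^bsub>U\<^esub> x \<in> fst ` \<Gamma>" if "x \<in> fst ` \<Gamma>" for c x
      using that smult unfolding mem by blast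
    show "act U g x \<in> fst ` \<Gamma>" if "g \<in> \<Omega>" "x \<in> fst ` \<Gamma>" for g x
      using that act unfolding mem by blast
  qed
  then have pU: "fst ` \<Gamma> = carrier U" using simpU[of "fst ` \<Gamma>"] us(2) image_eqI[OF _ us(1), of u fst] by auto
  have "op_submodule \<Omega> (snd ` \<Gamma>) S"
    unfolding complex_module_sub_iff[OF S(1)]
  proof (intro conjI ballI allI)
    have mem: "x \<in> snd ` \<Gamma> \<longleftrightarrow> (\<exists>w. (w, x) \<in> \<Gamma>)" for x by (force simp: image_iff)
    show "snd ` \<Gamma> \<subseteq> carrier S" using \<Gamma> by auto
    show "\<zero>\<^bsub>S\<^esub> \<in> snd ` \<Gamma>" using z mem by blast
    show "x \<oplus>\<^bsub>S\<^esub> y \<in> snd ` \<Gamma>" if "x \<in> snd ` \<Gamma>" "y \<in> snd ` \<Gamma>" for x y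
      using that add unfolding mem by blast
    show "c \<odot>\<^bsub>S\<^esub> x \<in> snd ` \<Gamma>" if "x \<in> snd ` \<Gamma>" for c x
      using that smult unfolding mem by blast
    show "act S g x \<in> snd ` \<Gamma>" if "g \<in> \<Omega>" "x \<in> snd ` \<Gamma>" for g x
      using that act unfolding mem by blast
  qed
  then have pS: "snd ` \<Gamma> = carrier S" using simpS[of "snd ` \<Gamma>"] us(3) image_eqI[OF _ us(1), of s snd] by auto
  have "op_submodule \<Omega> {x. (x, \<zero>\<^bsub>S\<^esub>) \<in> \<Gamma>} U"
    unfolding complex_module_sub_iff[OF U(1)]
    using \<Gamma> z add[of _ "\<zero>\<^bsub>S\<^esub>" _ "\<zero>\<^bsub>S\<^esub>"] smult[of _ "\<zero>\<^bsub>S\<^esub>"] act[of _ _ "\<zero>\<^bsub>S\<^esub>"]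
    by (auto simp: sc act0)
  then have kU: "x = \<zero>\<^bsub>U\<^esub>" if "(x, \<zero>\<^bsub>S\<^esub>) \<in> \<Gamma>" for x
    using simpU[of "{x. (x, \<zero>\<^bsub>S\<^esub>) \<in> \<Gamma>}"] us(4) inU[OF us(1)] that by auto
  have "op_submodule \<Omega> {x. (\<zero>\<^bsub>U\<^esub>, x) \<in> \<Gamma>} S"
    unfolding complex_module_sub_iff[OF S(1)]
    using \<Gamma> z add[of "\<zero>\<^bsub>U\<^esub>" _ "\<zero>\<^bsub>U\<^esub>"] smult[of "\<zero>\<^bsub>U\<^esub>"] act[of _ "\<zero>\<^bsub>U\<^esub>"]
    by (auto simp: sc act0)
  then have kS: "x = \<zero>\<^bsub>S\<^esub>" if "(\<zero>\<^bsub>U\<^esub>, x) \<in> \<Gamma>" for x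
    using simpS[of "{x. (\<zero>\<^bsub>U\<^esub>, x) \<in> \<Gamma>}"] us(5) inS[OF us(1)] that by auto
  have neg: "(\<ominus>\<^bsub>U\<^esub> x, \<ominus>\<^bsub>S\<^esub> y) \<in> \<Gamma>" if "(x, y) \<in> \<Gamma>" for x y
  proof -
    have "\<ominus>\<^bsub>U\<^esub> x = (- 1) \<odot>\<^bsub>U\<^esub> x" "\<ominus>\<^bsub>S\<^esub> y = (- 1) \<odot>\<^bsub>S\<^esub> y"
      using U.smult_l_minus[of 1 x] S.smult_l_minus[of 1 y] U.smult_one[of x] S.smult_one[of y] inU[OF that] inS[OF that]
      by (simp_all add: complex_ring_simps a_inv_complex_ring_one)
    then show ?thesis using smult[OF that] by simp
  qed
  have un1: "y = y'" if "(x, y) \<in> \<Gamma>" "(x, y') \<in> \<Gamma>" for x y y'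
  proof -
    have "(x \<oplus>\<^bsub>U\<^esub> \<ominus>\<^bsub>U\<^esub> x, y \<oplus>\<^bsub>S\<^esub> \<ominus>\<^bsub>S\<^esub> y') \<in> \<Gamma>" using add[OF that(1) neg[OF that(2)]] .
    then have "y \<oplus>\<^bsub>S\<^esub> \<ominus>\<^bsub>S\<^esub> y' = \<zero>\<^bsub>S\<^esub>" using kS inU[OF that(1)] U.r_neg by simp
    then show ?thesis using inS that by (metis S.minus_minus S.minus_equality S.a_inv_closed)
  qed
  have un2: "x = x'" if "(x, y) \<in> \<Gamma>" "(x', y) \<in> \<Gamma>" for x x' y
  proof -
    have "(x \<oplus>\<^bsub>U\<^esub> \<ominus>\<^bsub>U\<^esub> x', y \<oplus>\<^bsub>S\<^esub> \<ominus>\<^bsub>S\<^esub> y) \<in> \<Gamma>" using add[OF that(1) neg[OF that(2)]] .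
    then have "x \<oplus>\<^bsub>U\<^esub> \<ominus>\<^bsub>U\<^esub> x' = \<zero>\<^bsub>U\<^esub>" using kU inS[OF that(1)] S.r_neg by simp
    then show ?thesis using inU that by (metis U.minus_minus U.minus_equality U.a_inv_closed)
  qed
  define \<phi> where "\<phi> x = (THE y. (x, y) \<in> \<Gamma>)" for x
  have phiI: "\<phi> x = y" if "(x, y) \<in> \<Gamma>" for x y
    unfolding \<phi>_def by (rule the_equality) (use that un1 in auto)
  have phi: "(x, \<phi> x) \<in> \<Gamma>" if "x \<in> carrier U" for x
  proof -
    have "x \<in> fst ` \<Gamma>" using that pU by simp
    then obtain y where "(x, y) \<in> \<Gamma>" by auto
    then show ?thesis using phiI by simp
  qed
  have "bij_betw \<phi> (carrier U) (carrier S)"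
    unfolding bij_betw_def inj_on_def
  proof (intro conjI ballI impI)
    fix x y assume "x \<in> carrier U" "y \<in> carrier U" "\<phi> x = \<phi> y"
    then show "x = y" using un2 phi by metis
  next
    show "\<phi> ` carrier U = carrier S" 
    proof (intro equalityI subsetI)
      fix y assume "y \<in> \<phi> ` carrier U"
      then show "y \<in> carrier S" using phi inS by blast
    next
      fix y assume "y \<in> carrier S"
      then have "y \<in> snd ` \<Gamma>" using pS by simp
      then obtain x where "(x, y) \<in> \<Gamma>" by auto
      then show "y \<in> \<phi> ` carrier U" using phiI inU by blast
    qed
  qed
  moreover have "\<phi> (x \<oplus>\<^bsub>U\<^esub> y) = \<phi> x \<oplus>\<^bsub>S\<^esub> \<phi> y" if "x \<in> carrier U" "y \<in> carrier U" for x y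
    using add[OF phi[OF that(1)] phi[OF that(2)]] phiI by blast
  moreover have "\<phi> (c \<odot>\<^bsub>U\<^esub> x) = c \<odot>\<^bsub>S\<^esub> \<phi> x" if "x \<in> carrier U" for c x
    using smult[OF phi[OF that]] phiI by blast
  moreover have "\<phi> (act U g x) = act S g (\<phi> x)" if "x \<in> carrier U" "g \<in> \<Omega>" for g x
    using act[OF that(2) phi[OF that(1)]] phiI by blast
  ultimately show ?thesis
    unfolding op_iso_def iso_def hom_def
    by (intro bexI[of _ \<phi>]) (auto dest: bij_betwE)
qed

lemma fun_module_simps [simp]:
  "carrier (fun_module V \<rho>) = V" "\<zero>\<^bsub>fun_module V \<rho>\<^esub> = 0" "u \<oplus>\<^bsub>fun_module V \<rho>\<^esub> v = u + v"
  "c \<odot>\<^bsub>fun_module V \<rho>\<^esub> v = cscale c v" "act (fun_module V \<rho>) = \<rho>"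
  "(fun_module V \<rho>)\<lparr>carrier := U\<rparr> = fun_module U \<rho>"
  by (simp_all add: fun_module_def zero_fun_def plus_fun_def cscale_def)

lemma module_fun_module:
  assumes V: "fs.subspace V"
  shows "module complex_ring (fun_module V \<rho>)"
proof (intro moduleI[OF cring_complex_ring] abelian_groupI)
  fix x assume "x \<in> carrier (fun_module V \<rho>)"
  then show "\<exists>y\<in>carrier (fun_module V \<rho>). y \<oplus>\<^bsub>fun_module V \<rho>\<^esub> x = \<zero>\<^bsub>fun_module V \<rho>\<^esub>"
    by (intro bexI[of _ "- x"]) (auto simp: fs.subspace_neg[OF V])
qed (auto simp: fs.subspace_add[OF V] fs.subspace_scale[OF V] fs.subspace_0[OF V]
       add.assoc add.commute complex_ring_simps fs.scale_left_distrib fs.scale_right_distrib)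

definition stable :: "'g set \<Rightarrow> ('g \<Rightarrow> ('x \<Rightarrow> complex) \<Rightarrow> ('x \<Rightarrow> complex)) \<Rightarrow> ('x \<Rightarrow> complex) set \<Rightarrow> bool"
  where "stable \<Omega> \<rho> N \<longleftrightarrow> fs.subspace N \<and> (\<forall>g\<in>\<Omega>. \<forall>v\<in>N. \<rho> g v \<in> N)"

lemma op_submodule_fun_module:
  assumes V: "fs.subspace V"
  shows "op_submodule \<Omega> N (fun_module V \<rho>) \<longleftrightarrow> N \<subseteq> V \<and> stable \<Omega> \<rho> N"
  unfolding complex_module_sub_iff[OF module_fun_module[OF V]]
  by (auto simp: stable_def fs.subspace_def)

lemma op_simple_fun_module:
  assumes V: "fs.subspace V"
  shows "op_simple \<Omega> (fun_module V \<rho>) \<longleftrightarrow> V \<noteq> {0} \<and> (\<forall>N. N \<subseteq> V \<longrightarrow> stable \<Omega> \<rho> N \<longrightarrow> N = {0} \<or> N = V)"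
  unfolding op_simple_def op_submodule_fun_module[OF V] by auto

locale opspace =
  fixes \<Omega> :: "'g set" and \<rho> :: "'g \<Rightarrow> ('x \<Rightarrow> complex) \<Rightarrow> ('x \<Rightarrow> complex)" and V
  assumes stable_V: "stable \<Omega> \<rho> V" and lin: "\<And>g. g \<in> \<Omega> \<Longrightarrow> flinear (\<rho> g)"
begin

lemma subV: "fs.subspace V" and closed: "g \<in> \<Omega> \<Longrightarrow> v \<in> V \<Longrightarrow> \<rho> g v \<in> V"
  using stable_V by (auto simp: stable_def)

end

lemma coset_fun_module: "N +>\<^bsub>fun_module V \<rho>\<^esub> v = {n + v | n. n \<in> N}"
  by (auto simp: a_r_coset_def')

text \<open>
  A quotient of invariant subspaces; \<open>cl\<close> is the quotient map.
\<close>

locale opquot = opspace +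
  fixes N
  assumes N: "N \<subseteq> V" "stable \<Omega> \<rho> N"
begin

abbreviation "Q \<equiv> op_quotient (fun_module V \<rho>) N"

definition cl where "cl v = {n + v | n. n \<in> N}"

lemma subN: "fs.subspace N" using N by (simp add: stable_def)

lemma cl_eq_iff: "cl v = cl w \<longleftrightarrow> v - w \<in> N"
proof
  assume "cl v = cl w"
  moreover have "v \<in> cl v" unfolding cl_def using fs.subspace_0[OF subN] by force
  ultimately obtain n where "n \<in> N" "v = n + w" unfolding cl_def by blast
  then show "v - w \<in> N" by simp
next
  assume d: "v - w \<in> N"
  then have "w - v \<in> N" using fs.subspace_neg[OF subN] by force
  then show "cl v = cl w" unfolding cl_def
    using d fs.subspace_add[OF subN] by (auto) (metis add_diff_eq diff_add_cancel)+
qed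

lemma cl_self: "v \<in> cl v"
  unfolding cl_def using fs.subspace_0[OF subN] by force

lemma cl_mem: "w \<in> cl v \<Longrightarrow> w - v \<in> N" "w \<in> cl v \<Longrightarrow> cl w = cl v"
  by (auto simp: cl_eq_iff) (auto simp: cl_def)

lemma cl_zero: "cl 0 = N" by (auto simp: cl_def)

lemma cl_eq_N_iff: "cl v = N \<longleftrightarrow> v \<in> N"
  using cl_eq_iff[of v 0] by (simp add: cl_zero)

lemma Q_simps:
  "carrier Q = cl ` V" "\<zero>\<^bsub>Q\<^esub> = N"
  "cl v \<oplus>\<^bsub>Q\<^esub> cl w = cl (v + w)"
  "c \<odot>\<^bsub>Q\<^esub> cl v = cl (cscale c v)"
  "g \<in> \<Omega> \<Longrightarrow> act Q g (cl v) = cl (\<rho> g v)"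
proof -
  show "carrier Q = cl ` V"
    by (auto simp: op_quotient_def A_RCOSETS_def' coset_fun_module cl_def)
  show "\<zero>\<^bsub>Q\<^esub> = N" by (simp add: op_quotient_def)
  have "cl v \<oplus>\<^bsub>Q\<^esub> cl w = {a + b | a b. a \<in> cl v \<and> b \<in> cl w}"
    by (auto simp: op_quotient_def set_add_def')
  also have "{a + b | a b. a \<in> cl v \<and> b \<in> cl w} = cl (v + w)"
  proof (intro equalityI subsetI)
    fix x assume "x \<in> {a + b | a b. a \<in> cl v \<and> b \<in> cl w}"
    then obtain n n' where "n \<in> N" "n' \<in> N" "x = (n + v) + (n' + w)" unfolding cl_def by blast
    then have "x = (n + n') + (v + w)" "n + n' \<in> N" by (auto simp: algebra_simps fs.subspace_add[OF subN])
    then show "x \<in> cl (v + w)" unfolding cl_def by blast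
  next
    fix x assume "x \<in> cl (v + w)"
    then obtain n where n: "n \<in> N" "x = (n + v) + w" unfolding cl_def by (auto simp: algebra_simps)
    then have "n + v \<in> cl v" unfolding cl_def by blast
    then show "x \<in> {a + b | a b. a \<in> cl v \<and> b \<in> cl w}" using n cl_self[of w] by blast
  qed
  finally show "cl v \<oplus>\<^bsub>Q\<^esub> cl w = cl (v + w)" .
  have "c \<odot>\<^bsub>Q\<^esub> cl v = (\<Union>w\<in>cl v. cl (cscale c w))"
    by (simp add: op_quotient_def coset_fun_module cl_def)
  also have "\<dots> = (\<Union>w\<in>cl v. cl (cscale c v))"
    by (intro SUP_cong refl) (simp add: cl_eq_iff fs.scale_right_diff_distrib[symmetric] fs.subspace_scale[OF subN] cl_mem)
  finally show "c \<odot>\<^bsub>Q\<^esub> cl v = cl (cscale c v)" using cl_self[of v] by auto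
  assume g: "g \<in> \<Omega>"
  have "act Q g (cl v) = (\<Union>w\<in>cl v. cl (\<rho> g w))"
    by (simp add: op_quotient_def coset_fun_module cl_def)
  also have "\<dots> = (\<Union>w\<in>cl v. cl (\<rho> g v))"
  proof (intro SUP_cong refl)
    fix w assume "w \<in> cl v"
    then have "\<rho> g (w - v) \<in> N" using cl_mem N(2) g by (auto simp: stable_def)
    then show "cl (\<rho> g w) = cl (\<rho> g v)" by (simp add: cl_eq_iff flinear_diff[OF lin[OF g]])
  qed
  finally show "act Q g (cl v) = cl (\<rho> g v)" using cl_self[of v] by auto
qed

lemma module_Q: "module complex_ring Q"
  by (rule module_surjective_image[OF module_fun_module[OF subV], of cl])
    (auto simp: Q_simps cl_zero)

text \<open>
  Submodules of the quotient correspond to invariant subspaces between \<open>N\<close> and \<open>V\<close>.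
\<close>

lemma simple_Q_iff:
  "op_simple \<Omega> Q \<longleftrightarrow> N \<noteq> V \<and> (\<forall>L. stable \<Omega> \<rho> L \<longrightarrow> N \<subseteq> L \<longrightarrow> L \<subseteq> V \<longrightarrow> L = N \<or> L = V)"
proof
  assume s: "op_simple \<Omega> Q"
  have "N \<noteq> V"
  proof
    assume "N = V"
    then have "cl ` V = {N}" using cl_eq_N_iff fs.subspace_0[OF subV] by auto
    then show False using s by (simp add: op_simple_def Q_simps)
  qed
  moreover have "L = N \<or> L = V" if L: "stable \<Omega> \<rho> L" "N \<subseteq> L" "L \<subseteq> V" for L
  proof -
    have sL: "fs.subspace L" using L by (simp add: stable_def)
    have "op_submodule \<Omega> (cl ` L) Q"
      unfolding complex_module_sub_iff[OF module_Q]
      using L sL by (auto simp: Q_simps stable_def fs.subspace_add fs.subspace_scale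
        intro!: image_eqI[of N cl 0] fs.subspace_0 simp: cl_zero)
    then consider "cl ` L = {N}" | "cl ` L = cl ` V" using s by (auto simp: op_simple_def Q_simps)
    then show ?thesis
    proof cases
      case 1
      then have "L \<subseteq> N" using cl_eq_N_iff by (metis image_eqI singletonD subsetI)
      then show ?thesis using L by blast
    next
      case 2
      have "V \<subseteq> L"
      proof
        fix v assume "v \<in> V"
        then obtain l where l: "l \<in> L" "cl v = cl l" using 2 by blast
        then have "v - l \<in> L" using cl_eq_iff L by blast
        then have "v - l + l \<in> L" using l fs.subspace_add[OF sL] by blast
        then show "v \<in> L" by simp
      qed
      then show ?thesis using L by blast
    qed
  qed
  ultimately show "N \<noteq> V \<and> (\<forall>L. stable \<Omega> \<rho> L \<longrightarrow> N \<subseteq> L \<longrightarrow> L \<subseteq> V \<longrightarrow> L = N \<or> L = V)" by blast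
next
  assume h: "N \<noteq> V \<and> (\<forall>L. stable \<Omega> \<rho> L \<longrightarrow> N \<subseteq> L \<longrightarrow> L \<subseteq> V \<longrightarrow> L = N \<or> L = V)"
  have "carrier Q \<noteq> {\<zero>\<^bsub>Q\<^esub>}"
  proof
    assume "carrier Q = {\<zero>\<^bsub>Q\<^esub>}"
    then have "cl ` V = {N}" by (simp add: Q_simps)
    then have "V \<subseteq> N" using cl_eq_N_iff by (metis image_eqI singletonD subsetI)
    then show False using h N by blast
  qed
  moreover have "K = {\<zero>\<^bsub>Q\<^esub>} \<or> K = carrier Q" if K: "op_submodule \<Omega> K Q" for K
  proof -
    let ?L = "{v \<in> V. cl v \<in> K}"
    note k = K[unfolded complex_module_sub_iff[OF module_Q]]
    have KL: "K = cl ` ?L" using k by (auto simp: Q_simps)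
    have "stable \<Omega> \<rho> ?L" unfolding stable_def fs.subspace_def
    proof (intro conjI ballI allI)
      show "0 \<in> ?L" using k fs.subspace_0[OF subV] by (simp add: Q_simps cl_zero)
    next
      fix x y assume "x \<in> ?L" "y \<in> ?L"
      then show "x + y \<in> ?L" using k fs.subspace_add[OF subV] by (auto simp: Q_simps(3)[symmetric])
    next
      fix c x assume "x \<in> ?L"
      then show "cscale c x \<in> ?L" using k fs.subspace_scale[OF subV] by (auto simp: Q_simps(4)[symmetric])
    next
      fix g x assume "g \<in> \<Omega>" "x \<in> ?L"
      then show "\<rho> g x \<in> ?L" using k closed by (auto simp: Q_simps(5)[symmetric])
    qed
    moreover have "N \<subseteq> ?L"
    proof
      fix x assume "x \<in> N"
      moreover have "N \<in> K" using k by (simp add: Q_simps)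
      ultimately show "x \<in> ?L" using N(1) cl_eq_N_iff[of x] by auto
    qed
    ultimately consider "?L = N" | "?L = V" using h by blast
    then show ?thesis
    proof cases
      case 1
      then have "K = cl ` N" using KL by metis
      also have "\<dots> = {N}" using cl_eq_N_iff fs.subspace_0[OF subN] by auto
      finally show ?thesis by (simp add: Q_simps)
    next
      case 2
      then have "K = cl ` V" using KL by metis
      then show ?thesis by (simp add: Q_simps)
    qed
  qed
  ultimately show "op_simple \<Omega> Q" by (auto simp: op_simple_def)
qed

end



section \<open>Composition series and complete reducibility\<close>

text \<open>
  Below \<open>N\<close> take a proper invariant subspace of largest dimension; the top factor is then simple.
\<close>

lemma (in opspace) composition_series_below:
  assumes X: "finite X" "V \<subseteq> funs X"
  shows "stable \<Omega> \<rho> N \<Longrightarrow> N \<subseteq> V \<Longrightarrow>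
    \<exists>Ns. Ns \<noteq> [] \<and> hd Ns = {0} \<and> last Ns = N \<and> (\<forall>L\<in>set Ns. stable \<Omega> \<rho> L \<and> L \<subseteq> V) \<and>
      (\<forall>i. Suc i < length Ns \<longrightarrow>
        Ns ! i \<subseteq> Ns ! Suc i \<and> op_simple \<Omega> (op_quotient (fun_module (Ns ! Suc i) \<rho>) (Ns ! i)))"
proof (induction "fs.dim N" arbitrary: N rule: less_induct)
  case less
  have z: "stable \<Omega> \<rho> {0}" by (auto simp: stable_def flinear_zero lin)
  show ?case
  proof (cases "N = {0}")
    case True
    then show ?thesis using z subV by (intro exI[of _ "[{0}]"]) (auto simp: fs.subspace_0)
  next
    case False
    have sN: "fs.subspace N" using less.prems by (simp add: stable_def)
    have NX: "N \<subseteq> funs X" using less.prems X by blast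
    let ?P = "\<lambda>L. stable \<Omega> \<rho> L \<and> L \<subset> N"
    have lt: "fs.dim L < fs.dim N" if "?P L" for L
      by (rule dim_strict[OF X(1) NX]) (use that in \<open>auto simp: stable_def\<close>)
    have "?P {0}" using z False fs.subspace_0[OF sN] by auto
    moreover have "\<forall>L. ?P L \<longrightarrow> fs.dim L < fs.dim N" by (intro allI impI lt)
    ultimately have "\<exists>L. ?P L \<and> (\<forall>K. ?P K \<longrightarrow> fs.dim K \<le> fs.dim L)"
      by (rule ex_has_greatest_nat)
    then obtain L where L: "?P L" "\<And>K. ?P K \<Longrightarrow> fs.dim K \<le> fs.dim L"
      by blast
    have "L \<subseteq> V" using L(1) less.prems(2) by blast
    from less.hyps[OF lt[OF L(1)] conjunct1[OF L(1)] this]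
    obtain Ns where Ns: "Ns \<noteq> []" "hd Ns = {0}" "last Ns = L" "\<forall>L\<in>set Ns. stable \<Omega> \<rho> L \<and> L \<subseteq> V"
      "\<forall>i. Suc i < length Ns \<longrightarrow>
        Ns ! i \<subseteq> Ns ! Suc i \<and> op_simple \<Omega> (op_quotient (fun_module (Ns ! Suc i) \<rho>) (Ns ! i))"
      by (elim exE conjE) (rule that)
    interpret opquot \<Omega> \<rho> N L
      by (intro opquot.intro opspace.intro opquot_axioms.intro) (use less.prems L lin in auto)
    have simple: "op_simple \<Omega> (op_quotient (fun_module N \<rho>) L)"
      unfolding simple_Q_iff
    proof (intro conjI allI impI)
      show "L \<noteq> N" using L by blast
      fix K assume K: "stable \<Omega> \<rho> K" "L \<subseteq> K" "K \<subseteq> N"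
      show "K = L \<or> K = N"
      proof (rule ccontr)
        assume n: "\<not> (K = L \<or> K = N)"
        then have "fs.dim L < fs.dim K"
          by (intro dim_strict[OF X(1)]) (use K NX L in \<open>auto simp: stable_def\<close>)
        moreover have "fs.dim K \<le> fs.dim L" using L(2)[of K] K n by blast
        ultimately show False by simp
      qed
    qed
    show ?thesis
    proof (intro exI[of _ "Ns @ [N]"] conjI allI impI)
      fix i assume i: "Suc i < length (Ns @ [N])"
      consider "Suc i < length Ns" | "Suc i = length Ns" using i by force
      then have "(Ns @ [N]) ! i \<subseteq> (Ns @ [N]) ! Suc i \<and>
        op_simple \<Omega> (op_quotient (fun_module ((Ns @ [N]) ! Suc i) \<rho>) ((Ns @ [N]) ! i))"
      proof cases
        case 1
        then have "i < length Ns" by simp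
        with 1 show ?thesis using Ns(5)[rule_format, OF 1] by (simp only: nth_append if_True)
      next
        case 2
        then have "i = length Ns - 1" "i < length Ns" by simp_all
        then have "(Ns @ [N]) ! i = L" using last_conv_nth[OF Ns(1)] Ns(3) by (simp add: nth_append)
        moreover have "(Ns @ [N]) ! Suc i = N" using 2 by simp
        ultimately show ?thesis using simple L(1) by auto
      qed
      then show "(Ns @ [N]) ! i \<subseteq> (Ns @ [N]) ! Suc i"
        "op_simple \<Omega> (op_quotient (fun_module ((Ns @ [N]) ! Suc i) \<rho>) ((Ns @ [N]) ! i))" by simp_all
    qed (use Ns(1,2,4) less.prems in auto)
  qed
qed

lemma (in opspace) composition_series_fun_module:
  "composition_series \<Omega> (fun_module V \<rho>) Ns \<longleftrightarrow>
    Ns \<noteq> [] \<and> hd Ns = {0} \<and> last Ns = V \<and> (\<forall>L\<in>set Ns. stable \<Omega> \<rho> L \<and> L \<subseteq> V) \<and>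
      (\<forall>i. Suc i < length Ns \<longrightarrow>
        Ns ! i \<subseteq> Ns ! Suc i \<and> op_simple \<Omega> (op_quotient (fun_module (Ns ! Suc i) \<rho>) (Ns ! i)))"
  unfolding composition_series_def op_submodule_fun_module[OF subV] by auto

lemma (in opspace) composition_series_exists:
  assumes "finite X" "V \<subseteq> funs X"
  shows "\<exists>Ns. composition_series \<Omega> (fun_module V \<rho>) Ns"
  unfolding composition_series_fun_module
  using composition_series_below[OF assms stable_V] by blast

lemma finsum_fun_module:
  assumes V: "fs.subspace V" and "finite I" "\<And>i. i \<in> I \<Longrightarrow> f i \<in> V"
  shows "(\<Oplus>\<^bsub>fun_module V \<rho>\<^esub>i\<in>I. f i) = (\<Sum>i\<in>I. f i)"
proof -
  interpret module complex_ring "fun_module V \<rho>" by (rule module_fun_module[OF V])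
  show ?thesis using assms(2,3)
    by (induction I rule: finite_induct) (auto simp: M.finsum_insert Pi_def)
qed

definition sum_decomposition :: "('x \<Rightarrow> complex) set list \<Rightarrow> ('x \<Rightarrow> complex) set \<Rightarrow> bool"
  where "sum_decomposition Us W \<longleftrightarrow>
    (\<forall>v\<in>W. \<exists>!u. u \<in> (\<Pi>\<^sub>E i\<in>{..<length Us}. Us ! i) \<and> v = (\<Sum>i<length Us. u i))"

lemma (in opspace) irreducible_decomposition_fun_module:
  "irreducible_decomposition \<Omega> (fun_module V \<rho>) Us \<longleftrightarrow>
    (\<forall>U\<in>set Us. stable \<Omega> \<rho> U \<and> U \<subseteq> V \<and> op_simple \<Omega> (fun_module U \<rho>)) \<and> sum_decomposition Us V"
proof (cases "\<forall>U\<in>set Us. U \<subseteq> V")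
  case True
  have "(\<Oplus>\<^bsub>fun_module V \<rho>\<^esub>i\<in>{..<length Us}. u i) = (\<Sum>i<length Us. u i)"
    if "u \<in> (\<Pi>\<^sub>E i\<in>{..<length Us}. Us ! i)" for u
  proof (rule finsum_fun_module[OF subV])
    fix i assume "i \<in> {..<length Us}"
    then show "u i \<in> V" using PiE_mem[OF that] True nth_mem[of i Us] by blast
  qed simp
  then have "(u \<in> (\<Pi>\<^sub>E i\<in>{..<length Us}. Us ! i) \<and> v = (\<Oplus>\<^bsub>fun_module V \<rho>\<^esub>i\<in>{..<length Us}. u i)) \<longleftrightarrow>
     (u \<in> (\<Pi>\<^sub>E i\<in>{..<length Us}. Us ! i) \<and> v = (\<Sum>i<length Us. u i))" for u v
    by auto
  then show ?thesis
    unfolding irreducible_decomposition_def op_submodule_fun_module[OF subV] sum_decomposition_def by auto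
next
  case False
  then show ?thesis
    unfolding irreducible_decomposition_def op_submodule_fun_module[OF subV] by auto
qed

text \<open>
  A nonzero invariant subspace of least dimension is simple; split it off and continue with its
  complement. The assumption is inherited by complements because it is made for all \<open>W\<close>.
\<close>

lemma (in opspace) irreducible_decomposition_exists:
  assumes X: "finite X" "V \<subseteq> funs X"
    and compl: "\<And>W U. W \<subseteq> V \<Longrightarrow> stable \<Omega> \<rho> W \<Longrightarrow> U \<subseteq> W \<Longrightarrow> stable \<Omega> \<rho> U \<Longrightarrow>
      \<exists>U'. stable \<Omega> \<rho> U' \<and> U' \<subseteq> W \<and> U \<inter> U' = {0} \<and> (\<forall>w\<in>W. \<exists>u\<in>U. \<exists>u'\<in>U'. w = u + u')"
  shows "\<exists>Us. irreducible_decomposition \<Omega> (fun_module V \<rho>) Us"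
proof -
  have "\<exists>Us. (\<forall>U\<in>set Us. stable \<Omega> \<rho> U \<and> U \<subseteq> W \<and> op_simple \<Omega> (fun_module U \<rho>)) \<and> sum_decomposition Us W"
    if "stable \<Omega> \<rho> W" "W \<subseteq> V" for W
    using that
  proof (induction "fs.dim W" arbitrary: W rule: less_induct)
    case less
    have sW: "fs.subspace W" using less.prems by (simp add: stable_def)
    show ?case
    proof (cases "W = {0}")
      case True
      then show ?thesis by (intro exI[of _ "[]"]) (auto simp: sum_decomposition_def)
    next
      case False
      let ?P = "\<lambda>L. stable \<Omega> \<rho> L \<and> L \<subseteq> W \<and> L \<noteq> {0}"
      have "?P W" using less.prems False by simp
      then have "\<exists>U. ?P U \<and> (\<forall>K. ?P K \<longrightarrow> fs.dim U \<le> fs.dim K)"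
        by (rule ex_has_least_nat)
      then obtain U where U: "?P U" "\<And>K. ?P K \<Longrightarrow> fs.dim U \<le> fs.dim K"
        by blast
      have sU: "fs.subspace U" using U by (simp add: stable_def)
      have simple: "op_simple \<Omega> (fun_module U \<rho>)"
        unfolding op_simple_fun_module[OF sU]
      proof (intro conjI allI impI)
        show "U \<noteq> {0}" using U by blast
        fix N assume N: "N \<subseteq> U" "stable \<Omega> \<rho> N"
        show "N = {0} \<or> N = U"
        proof (rule ccontr)
          assume n: "\<not> (N = {0} \<or> N = U)"
          then have "fs.dim N < fs.dim U"
            by (intro dim_strict[OF X(1)]) (use N U X less.prems in \<open>auto simp: stable_def\<close>)
          moreover have "fs.dim U \<le> fs.dim N" using U(1) N n by (intro U(2)) auto
          ultimately show False by simp
        qed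
      qed
      obtain U' where U': "stable \<Omega> \<rho> U'" "U' \<subseteq> W" "U \<inter> U' = {0}" "\<forall>w\<in>W. \<exists>u\<in>U. \<exists>u'\<in>U'. w = u + u'"
        using compl[of W U] less.prems U(1) by blast
      have sU': "fs.subspace U'" using U' by (simp add: stable_def)
      have "U' \<noteq> W" using U(1) U'(3) fs.subspace_0[OF sU] by blast
      then have "fs.dim U' < fs.dim W"
        by (intro dim_strict[OF X(1)]) (use U' sU' X less.prems in auto)
      then obtain Us where Us: "\<forall>U\<in>set Us. stable \<Omega> \<rho> U \<and> U \<subseteq> U' \<and> op_simple \<Omega> (fun_module U \<rho>)"
        "sum_decomposition Us U'" using less.hyps[of U'] U' less.prems(2) by blast
      let ?l = "length Us"
      have "sum_decomposition (Us @ [U]) W"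
        unfolding sum_decomposition_def
      proof (intro ballI)
        fix v assume "v \<in> W"
        then obtain u u' where uu: "u \<in> U" "u' \<in> U'" "v = u + u'" using U'(4) by blast
        let ?E = "\<lambda>f. f \<in> (\<Pi>\<^sub>E i\<in>{..<?l}. Us ! i) \<and> u' = (\<Sum>i<?l. f i)"
        have ex1: "\<exists>!f. ?E f" using Us(2) uu(2) unfolding sum_decomposition_def by (rule bspec)
        then obtain f where "?E f" using ex1_implies_ex by blast
        then have f: "f \<in> (\<Pi>\<^sub>E i\<in>{..<?l}. Us ! i)" "u' = (\<Sum>i<?l. f i)"
          "\<And>f'. f' \<in> (\<Pi>\<^sub>E i\<in>{..<?l}. Us ! i) \<Longrightarrow> u' = (\<Sum>i<?l. f' i) \<Longrightarrow> f' = f"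
          using ex1 by auto
        show "\<exists>!u. u \<in> (\<Pi>\<^sub>E i\<in>{..<length (Us @ [U])}. (Us @ [U]) ! i) \<and> v = (\<Sum>i<length (Us @ [U]). u i)"
        proof (rule ex1I[of _ "f(?l := u)"])
          show "f(?l := u) \<in> (\<Pi>\<^sub>E i\<in>{..<length (Us @ [U])}. (Us @ [U]) ! i) \<and> v = (\<Sum>i<length (Us @ [U]). (f(?l := u)) i)"
            using f(1,2) uu by (auto simp: PiE_def Pi_def extensional_def nth_append less_Suc_eq add.commute)
        next
          fix g assume g: "g \<in> (\<Pi>\<^sub>E i\<in>{..<length (Us @ [U])}. (Us @ [U]) ! i) \<and> v = (\<Sum>i<length (Us @ [U]). g i)"
          then have gi: "g i \<in> Us ! i" if "i < ?l" for i
            using that PiE_mem[OF conjunct1[OF g], of i] by (simp add: nth_append)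
          have gl: "g ?l \<in> U" using PiE_mem[OF conjunct1[OF g], of ?l] by simp
          have sg: "(\<Sum>i<?l. g i) \<in> U'"
            using gi Us(1) by (intro fs.subspace_sum[OF sU']) (auto dest: nth_mem)
          have "v = (\<Sum>i<?l. g i) + g ?l" using g by simp
          then have "g ?l - u = u' - (\<Sum>i<?l. g i)" using uu(3) by (simp add: algebra_simps)
          then have "g ?l - u \<in> U \<inter> U'" using fs.subspace_diff[OF sU gl uu(1)] fs.subspace_diff[OF sU' uu(2) sg] by simp
          then have "g ?l = u" using U'(3) by auto
          then have "u' = (\<Sum>i<?l. g i)" using \<open>v = (\<Sum>i<?l. g i) + g ?l\<close> uu(3) by (simp add: add.commute)
          then have "u' = (\<Sum>i<?l. restrict g {..<?l} i)" by simp
          moreover have "restrict g {..<?l} \<in> (\<Pi>\<^sub>E i\<in>{..<?l}. Us ! i)" using gi by auto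
          ultimately have r: "restrict g {..<?l} = f" using f(3) by blast
          show "g = f(?l := u)"
          proof (rule ext)
            fix i
            consider "i < ?l" | "i = ?l" | "i > ?l" by linarith
            then show "g i = (f(?l := u)) i"
            proof cases
              case 1
              then show ?thesis using fun_cong[OF r, of i] by simp
            next
              case 2
              then show ?thesis using \<open>g ?l = u\<close> by simp
            next
              case 3
              then show ?thesis using g f(1) by (auto simp: PiE_def extensional_def)
            qed
          qed
        qed
      qed
      moreover have "\<forall>L\<in>set (Us @ [U]). stable \<Omega> \<rho> L \<and> L \<subseteq> W \<and> op_simple \<Omega> (fun_module L \<rho>)"
        using Us(1) U(1) U'(2) simple by auto
      ultimately show ?thesis by blast
    qed
  qed
  from this[OF stable_V order_refl] show ?thesis
    unfolding irreducible_decomposition_fun_module .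
qed

lemma flinear_projection_exists:
  assumes U: "fs.subspace U"
  shows "\<exists>p. flinear p \<and> (\<forall>v. p v \<in> U) \<and> (\<forall>u\<in>U. p u = u)"
proof -
  interpret vector_space_pair cscale cscale by unfold_locales
  have "flinear id" by (rule flinearI) simp_all
  then obtain g where "range g \<subseteq> U" "flinear g" "\<forall>v\<in>U. g v = v"
    using linear_exists_left_inverse_on[of id U] U by auto
  then show ?thesis by blast
qed

locale fin_group = group G for G :: "'g monoid" (structure) +
  assumes fin: "finite (carrier G)"

locale frep = fin_group G + opspace "carrier G" \<rho> V
  for G :: "'g monoid" (structure) and \<rho> :: "'g \<Rightarrow> ('x \<Rightarrow> complex) \<Rightarrow> ('x \<Rightarrow> complex)" and V +
  assumes rho_mult: "\<And>g h v. g \<in> carrier G \<Longrightarrow> h \<in> carrier G \<Longrightarrow> v \<in> V \<Longrightarrow> \<rho> (g \<otimes> h) v = \<rho> g (\<rho> h v)"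
    and rho_one: "\<And>v. v \<in> V \<Longrightarrow> \<rho> \<one> v = v"
begin

lemma bij_left_mult: "h \<in> carrier G \<Longrightarrow> bij_betw (\<lambda>g. h \<otimes> g) (carrier G) (carrier G)"
  by (rule bij_betwI[where g = "\<lambda>g. inv h \<otimes> g"]) (auto simp: m_assoc[symmetric])

text \<open>
  Average the conjugates \<open>g p g\<^sup>-\<^sup>1\<close> of a linear projection \<open>p\<close> onto \<open>U\<close> over the group.
\<close>

lemma equivariant_projection_exists:
  assumes U: "stable (carrier G) \<rho> U" "U \<subseteq> V"
  shows "\<exists>q. flinear q \<and> (\<forall>v\<in>V. q v \<in> U) \<and> (\<forall>u\<in>U. q u = u) \<and>
    (\<forall>g\<in>carrier G. \<forall>v\<in>V. q (\<rho> g v) = \<rho> g (q v))"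
proof -
  have sU: "fs.subspace U" using U by (simp add: stable_def)
  obtain p where p: "flinear p" "\<And>v. p v \<in> U" "\<And>u. u \<in> U \<Longrightarrow> p u = u"
    using flinear_projection_exists[OF sU] by blast
  define S where "S v = (\<Sum>g\<in>carrier G. \<rho> g (p (\<rho> (inv g) v)))" for v
  define N where "N = (of_nat (card (carrier G)) :: complex)"
  have N: "N \<noteq> 0" using fin one_closed by (auto simp: N_def card_eq_0_iff)
  have SU: "S v \<in> U" for v
    unfolding S_def using U p by (intro fs.subspace_sum[OF sU]) (auto simp: stable_def)
  have Sadd: "S (u + v) = S u + S v" for u v
    unfolding S_def sum.distrib[symmetric]
    by (intro sum.cong refl) (simp add: flinear_add lin p(1))
  have Sscale: "S (cscale c v) = cscale c (S v)" for c v
    unfolding S_def fs.scale_sum_right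
    by (intro sum.cong refl) (simp add: flinear_scale lin p(1))
  have Sid: "S u = cscale N u" if u: "u \<in> U" for u
  proof -
    have "S u = (\<Sum>g\<in>carrier G. u)"
      unfolding S_def
    proof (intro sum.cong refl)
      fix g assume g: "g \<in> carrier G"
      have "p (\<rho> (inv g) u) = \<rho> (inv g) u" using p(3) U(1) g u by (auto simp: stable_def)
      then show "\<rho> g (p (\<rho> (inv g) u)) = u"
        using rho_mult[of g "inv g" u] rho_one[of u] g u U(2) by auto
    qed
    then show ?thesis by (simp only: fs.sum_constant_scale N_def)
  qed
  have Seq: "S (\<rho> h v) = \<rho> h (S v)" if h: "h \<in> carrier G" and v: "v \<in> V" for h v
  proof -
    have "S (\<rho> h v) = (\<Sum>g\<in>carrier G. \<rho> (h \<otimes> g) (p (\<rho> (inv (h \<otimes> g)) (\<rho> h v))))"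
      unfolding S_def by (rule sum.reindex_bij_betw[OF bij_left_mult[OF h], symmetric])
    also have "\<dots> = (\<Sum>g\<in>carrier G. \<rho> h (\<rho> g (p (\<rho> (inv g) v))))"
    proof (intro sum.cong refl)
      fix g assume g: "g \<in> carrier G"
      have "\<rho> (inv (h \<otimes> g)) (\<rho> h v) = \<rho> (inv (h \<otimes> g) \<otimes> h) v"
        using h g v by (simp add: rho_mult)
      also have "inv (h \<otimes> g) \<otimes> h = inv g" using h g by (simp add: inv_mult_group m_assoc)
      finally show "\<rho> (h \<otimes> g) (p (\<rho> (inv (h \<otimes> g)) (\<rho> h v))) = \<rho> h (\<rho> g (p (\<rho> (inv g) v)))"
        using h g p(2)[of "\<rho> (inv g) v"] U(2) by (simp add: rho_mult subset_iff)
    qed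
    also have "\<dots> = \<rho> h (S v)" unfolding S_def by (simp add: flinear_sum[OF lin[OF h]])
    finally show ?thesis .
  qed
  show ?thesis
  proof (intro exI[of _ "\<lambda>v. cscale (inverse N) (S v)"] conjI ballI)
    show "flinear (\<lambda>v. cscale (inverse N) (S v))"
      by (rule flinearI) (simp_all add: Sadd Sscale fs.scale_right_distrib mult.commute)
  qed (auto simp: SU fs.subspace_scale[OF sU] Sid N Seq flinear_scale[OF lin])
qed

lemma maschke:
  assumes W: "W \<subseteq> V" "stable (carrier G) \<rho> W" and U: "U \<subseteq> W" "stable (carrier G) \<rho> U"
  shows "\<exists>U'. stable (carrier G) \<rho> U' \<and> U' \<subseteq> W \<and> U \<inter> U' = {0} \<and> (\<forall>w\<in>W. \<exists>u\<in>U. \<exists>u'\<in>U'. w = u + u')"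
proof -
  have sU: "fs.subspace U" and sW: "fs.subspace W" using U W by (auto simp: stable_def)
  obtain q where q: "flinear q" "\<And>v. v \<in> V \<Longrightarrow> q v \<in> U" "\<And>u. u \<in> U \<Longrightarrow> q u = u"
    "\<And>g v. g \<in> carrier G \<Longrightarrow> v \<in> V \<Longrightarrow> q (\<rho> g v) = \<rho> g (q v)"
    using equivariant_projection_exists[OF U(2) order_trans[OF U(1) W(1)]] by blast
  let ?K = "{w \<in> W. q w = 0}"
  have "stable (carrier G) \<rho> ?K"
    unfolding stable_def fs.subspace_def
    using W q(4) by (auto simp: fs.subspace_0[OF sW] fs.subspace_add[OF sW] fs.subspace_scale[OF sW]
      flinear_add[OF q(1)] flinear_scale[OF q(1)] flinear_zero[OF q(1)] stable_def flinear_zero[OF lin] subset_iff)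
  moreover have "U \<inter> ?K = {0}"
    using q(3) fs.subspace_0[OF sU] U(1) flinear_zero[OF q(1)] by fastforce
  moreover have "\<exists>u\<in>U. \<exists>u'\<in>?K. w = u + u'" if w: "w \<in> W" for w
  proof -
    have "q w \<in> U" using q(2) w W(1) by blast
    moreover from this have "w - q w \<in> ?K"
      using U(1) fs.subspace_diff[OF sW w] q(3) by (auto simp: flinear_diff[OF q(1)])
    moreover have "w = q w + (w - q w)" by simp
    ultimately show ?thesis by blast
  qed
  ultimately show ?thesis by (intro exI[of _ ?K]) auto
qed

lemma irreducible_decomposition_exists_rep:
  assumes "finite X" "V \<subseteq> funs X"
  shows "\<exists>Us. irreducible_decomposition (carrier G) (fun_module V \<rho>) Us"
  by (rule irreducible_decomposition_exists[OF assms maschke])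

lemma frep_stable: "stable (carrier G) \<rho> U \<Longrightarrow> U \<subseteq> V \<Longrightarrow> frep G \<rho> U"
  by (intro frep.intro opspace.intro frep_axioms.intro fin_group_axioms)
    (auto simp: rho_mult rho_one lin subset_iff)

end



section \<open>The group algebra and its primitive idempotents\<close>

abbreviation gmult :: "'g monoid \<Rightarrow> ('g \<Rightarrow> complex) \<Rightarrow> ('g \<Rightarrow> complex) \<Rightarrow> 'g \<Rightarrow> complex"
  where "gmult G \<equiv> monoid.mult (group_algebra G)"

abbreviation reg :: "'g monoid \<Rightarrow> 'g \<Rightarrow> ('g \<Rightarrow> complex) \<Rightarrow> 'g \<Rightarrow> complex"
  where "reg G \<equiv> \<lambda>g. gmult G (basis_vec g)"

text \<open>
  The action of the group algebra that extends a representation \<open>\<rho>\<close> linearly.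
\<close>

definition galg :: "'g monoid \<Rightarrow> ('g \<Rightarrow> ('x \<Rightarrow> complex) \<Rightarrow> ('x \<Rightarrow> complex)) \<Rightarrow>
    ('g \<Rightarrow> complex) \<Rightarrow> ('x \<Rightarrow> complex) \<Rightarrow> ('x \<Rightarrow> complex)"
  where "galg G \<rho> a v = (\<Sum>g\<in>carrier G. cscale (a g) (\<rho> g v))"

lemma span_algebra_mult_linear:
  "flinear (monoid.mult (span_algebra X C E) a)"
  "flinear (\<lambda>a. monoid.mult (span_algebra X C E) a b)"
  by (auto intro!: flinearI simp: span_algebra_def fun_eq_iff pointwise algebra_simps sum.distrib sum_distrib_left case_prod_unfold)

lemma span_algebra_mult_closed:
  assumes "\<And>p q x. p \<in> X \<Longrightarrow> q \<in> X \<Longrightarrow> C p q = Some x \<Longrightarrow> x \<in> X"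
  shows "monoid.mult (span_algebra X C E) a b \<in> funs X"
  using assms by (auto simp: span_algebra_def funs_def intro!: sum.neutral)

lemma carrier_span_algebra: "carrier (span_algebra X C E) = funs X"
  by (auto simp: span_algebra_def funs_def)

lemma carrier_group_algebra: "carrier (group_algebra G) = funs (carrier G)"
  by (simp add: group_algebra_def carrier_span_algebra)

lemma gmult_linear: "flinear (gmult G a)" "flinear (\<lambda>a. gmult G a b)"
  unfolding group_algebra_def by (rule span_algebra_mult_linear)+

context fin_group
begin

lemma gmult_closed: "gmult G a b \<in> funs (carrier G)"
  unfolding group_algebra_def by (rule span_algebra_mult_closed) auto

lemma gmult_apply:
  assumes x: "x \<in> carrier G"
  shows "gmult G a b x = (\<Sum>g\<in>carrier G. a g * b (inv g \<otimes> x))"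
proof -
  have "gmult G a b x = (\<Sum>(p, q)\<in>{(p, q). p \<in> carrier G \<and> q \<in> carrier G \<and> p \<otimes> q = x}. a p * b q)"
    by (simp add: group_algebra_def span_algebra_def)
  also have "\<dots> = (\<Sum>g\<in>carrier G. a g * b (inv g \<otimes> x))"
    by (rule sum.reindex_bij_witness[of _ "\<lambda>g. (g, inv g \<otimes> x)" fst])
      (use x in \<open>auto simp: m_assoc[symmetric]\<close>)
  finally show ?thesis .
qed

lemma reg_apply:
  assumes g: "g \<in> carrier G" and x: "x \<in> carrier G"
  shows "reg G g b x = b (inv g \<otimes> x)"
proof -
  have "reg G g b x = (\<Sum>h\<in>carrier G. if h = g then b (inv g \<otimes> x) else 0)"
    unfolding gmult_apply[OF x] by (intro sum.cong) (auto simp: basis_vec_def)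
  then show ?thesis using fin g by simp
qed

lemma funs_eqI:
  "a \<in> funs (carrier G) \<Longrightarrow> b \<in> funs (carrier G) \<Longrightarrow> (\<And>x. x \<in> carrier G \<Longrightarrow> a x = b x) \<Longrightarrow> a = b"
  by (rule ext, case_tac "x \<in> carrier G") (auto simp: funs_def)

lemma frep_regular: "frep G (reg G) (funs (carrier G))"
proof (intro frep.intro opspace.intro frep_axioms.intro fin_group_axioms)
  show "stable (carrier G) (reg G) (funs (carrier G))"
    by (auto simp: stable_def subspace_funs gmult_closed)
  fix g h v assume 1: "g \<in> carrier G" "h \<in> carrier G" "v \<in> funs (carrier G)"
  show "reg G (g \<otimes> h) v = reg G g (reg G h v)"
    by (rule funs_eqI[OF gmult_closed gmult_closed])
      (use 1 in \<open>simp add: reg_apply inv_mult_group m_assoc\<close>)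
next
  fix v assume 1: "v \<in> funs (carrier G)"
  show "reg G \<one> v = v"
    by (rule funs_eqI[OF gmult_closed 1]) (simp add: reg_apply)
qed (rule gmult_linear)

lemma galg_regular:
  assumes "b \<in> funs (carrier G)"
  shows "galg G (reg G) a b = gmult G a b"
proof (rule funs_eqI[OF _ gmult_closed])
  show "galg G (reg G) a b \<in> funs (carrier G)"
    unfolding galg_def
    by (intro fs.subspace_sum fs.subspace_scale subspace_funs gmult_closed)
next
  fix x assume x: "x \<in> carrier G"
  have "galg G (reg G) a b x = (\<Sum>g\<in>carrier G. a g * reg G g b x)"
    by (simp add: galg_def sum_fun_apply cscale_apply)
  also have "\<dots> = gmult G a b x"
    unfolding gmult_apply[OF x, of a] by (intro sum.cong refl) (simp only: reg_apply[OF _ x])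
  finally show "galg G (reg G) a b x = gmult G a b x" .
qed

end

context frep
begin

lemma galg_closed: "stable (carrier G) \<rho> U \<Longrightarrow> v \<in> U \<Longrightarrow> galg G \<rho> a v \<in> U"
  unfolding galg_def by (auto intro!: fs.subspace_sum fs.subspace_scale simp: stable_def)

lemma galg_linear: "flinear (galg G \<rho> a)"
  unfolding galg_def
proof (rule flinearI)
  fix u v
  show "(\<Sum>g\<in>carrier G. cscale (a g) (\<rho> g (u + v))) =
    (\<Sum>g\<in>carrier G. cscale (a g) (\<rho> g u)) + (\<Sum>g\<in>carrier G. cscale (a g) (\<rho> g v))"
    unfolding sum.distrib[symmetric]
    by (intro sum.cong refl) (simp add: flinear_add[OF lin] fs.scale_right_distrib)
next
  fix c v
  show "(\<Sum>g\<in>carrier G. cscale (a g) (\<rho> g (cscale c v))) = cscale c (\<Sum>g\<in>carrier G. cscale (a g) (\<rho> g v))"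
    unfolding fs.scale_sum_right
    by (intro sum.cong refl) (simp add: flinear_scale[OF lin] mult.commute)
qed

lemma galg_linear_left:
  "galg G \<rho> (a + b) v = galg G \<rho> a v + galg G \<rho> b v"
  "galg G \<rho> (cscale c a) v = cscale c (galg G \<rho> a v)"
proof -
  have "(a + b) g = a g + b g" "cscale c a g = c * a g" for g
    by (rule plus_fun_apply cscale_apply)+
  then show "galg G \<rho> (a + b) v = galg G \<rho> a v + galg G \<rho> b v"
    "galg G \<rho> (cscale c a) v = cscale c (galg G \<rho> a v)"
    unfolding galg_def by (simp_all only: fs.scale_left_distrib sum.distrib fs.scale_sum_right fs.scale_scale)
qed

lemma galg_basis_vec:
  assumes g: "g \<in> carrier G"
  shows "galg G \<rho> (basis_vec g) v = \<rho> g v"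
proof -
  have "(\<Sum>h\<in>carrier G. cscale (basis_vec g h) (\<rho> h v)) = (\<Sum>h\<in>carrier G. if h = g then \<rho> g v else 0)"
    by (intro sum.cong) (auto simp: basis_vec_def)
  then show ?thesis unfolding galg_def using fin g by simp
qed

lemma galg_gmult:
  assumes v: "v \<in> V"
  shows "galg G \<rho> (gmult G a b) v = galg G \<rho> a (galg G \<rho> b v)"
proof -
  have "galg G \<rho> a (galg G \<rho> b v) = (\<Sum>g\<in>carrier G. \<Sum>h\<in>carrier G. cscale (a g * b h) (\<rho> (g \<otimes> h) v))"
    unfolding galg_def
    by (intro sum.cong refl) (simp add: flinear_sum[OF lin] flinear_scale[OF lin] fs.scale_sum_right rho_mult v)
  also have "\<dots> = (\<Sum>g\<in>carrier G. \<Sum>k\<in>carrier G. cscale (a g * b (inv g \<otimes> k)) (\<rho> k v))"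
  proof (rule sum.cong[OF refl])
    fix g assume g: "g \<in> carrier G"
    have "(\<Sum>k\<in>carrier G. cscale (a g * b (inv g \<otimes> k)) (\<rho> k v)) =
      (\<Sum>h\<in>carrier G. cscale (a g * b (inv g \<otimes> (g \<otimes> h))) (\<rho> (g \<otimes> h) v))"
      by (rule sum.reindex_bij_betw[OF bij_left_mult[OF g], symmetric])
    also have "\<dots> = (\<Sum>h\<in>carrier G. cscale (a g * b h) (\<rho> (g \<otimes> h) v))"
      by (intro sum.cong refl) (simp add: g m_assoc[symmetric])
    finally show "(\<Sum>h\<in>carrier G. cscale (a g * b h) (\<rho> (g \<otimes> h) v)) =
       (\<Sum>k\<in>carrier G. cscale (a g * b (inv g \<otimes> k)) (\<rho> k v))" by simp
  qed
  also have "\<dots> = (\<Sum>k\<in>carrier G. \<Sum>g\<in>carrier G. cscale (a g * b (inv g \<otimes> k)) (\<rho> k v))"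
    by (rule sum.swap)
  also have "\<dots> = galg G \<rho> (gmult G a b) v"
    unfolding galg_def by (intro sum.cong refl) (simp add: gmult_apply fs.scale_sum_left)
  finally show ?thesis ..
qed

end

lemma (in fin_group) gmult_assoc:
  assumes "c \<in> funs (carrier G)"
  shows "gmult G (gmult G a b) c = gmult G a (gmult G b c)"
proof -
  interpret R: frep G "reg G" "funs (carrier G)" by (rule frep_regular)
  show ?thesis using R.galg_gmult[OF assms, of a b]
    by (simp add: galg_regular assms gmult_closed)
qed

text \<open>
  These idempotents satisfy \<open>e \<complex>G e = \<complex> e\<close>; it suffices to ask this for the group elements.
\<close>

definition schur_idem :: "'g monoid \<Rightarrow> ('g \<Rightarrow> complex) \<Rightarrow> bool"
  where "schur_idem G e \<longleftrightarrow> e \<in> funs (carrier G) \<and> gmult G e e = e \<and>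
    (\<forall>g\<in>carrier G. \<exists>c. gmult G e (gmult G (basis_vec g) e) = cscale c e)"

definition lideal :: "'g monoid \<Rightarrow> ('g \<Rightarrow> complex) \<Rightarrow> ('g \<Rightarrow> complex) set"
  where "lideal G e = {a \<in> funs (carrier G). gmult G a e = a}"

lemma (in fin_group) left_ideal_group_algebra:
  assumes "e \<in> funs (carrier G)" "gmult G e e = e"
  shows "pullback basis_vec (left_ideal (group_algebra G) e) = fun_module (lideal G e) (reg G)"
proof -
  have "{gmult G a e | a. a \<in> carrier (group_algebra G)} = lideal G e"
    unfolding carrier_group_algebra lideal_def
    using assms gmult_assoc[OF assms(1)] gmult_closed by (auto) metis+
  then show ?thesis by (simp add: pullback_def left_ideal_def fun_module_def)
qed

locale primitive_idem = fin_group +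
  fixes e
  assumes prim: "primitive_idempotent (group_algebra G) e"
begin

lemma e_funs: "e \<in> funs (carrier G)" and e_idem: "gmult G e e = e"
  and e_nonzero: "e \<noteq> 0"
proof -
  have "\<zero>\<^bsub>group_algebra G\<^esub> = 0"
    by (simp add: group_algebra_def span_algebra_def zero_fun_def)
  then show "e \<in> funs (carrier G)" "gmult G e e = e" "e \<noteq> 0"
    using prim by (auto simp: primitive_idempotent_def carrier_group_algebra)
qed

lemma e_prim:
  assumes "f \<in> funs (carrier G)" "g \<in> funs (carrier G)" "gmult G f f = f" "gmult G g g = g"
    "gmult G f g = 0" "gmult G g f = 0" "e = f + g"
  shows "f = 0 \<or> g = 0"
proof -
  have "\<zero>\<^bsub>group_algebra G\<^esub> = 0" "f \<oplus>\<^bsub>group_algebra G\<^esub> g = f + g"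
    by (simp_all add: group_algebra_def span_algebra_def zero_fun_def plus_fun_def)
  then show ?thesis
    using prim assms unfolding primitive_idempotent_def carrier_group_algebra by metis
qed

interpretation R: frep G "reg G" "funs (carrier G)" by (rule frep_regular)

lemma assoc: "c \<in> funs (carrier G) \<Longrightarrow> gmult G (gmult G a b) c = gmult G a (gmult G b c)"
  by (rule gmult_assoc)

lemma lideal_subspace: "fs.subspace (lideal G e)"
  unfolding lideal_def fs.subspace_def
  using subspace_funs[of "carrier G"] gmult_linear(2)[of G e]
  by (auto simp: fs.subspace_def flinear_add[OF gmult_linear(2)] flinear_scale[OF gmult_linear(2)] flinear_zero[OF gmult_linear(2)])

lemma stable_lideal: "stable (carrier G) (reg G) (lideal G e)"
  unfolding stable_def using lideal_subspace by (auto simp: lideal_def gmult_closed assoc e_funs)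

lemma lideal_sub: "lideal G e \<subseteq> funs (carrier G)" by (auto simp: lideal_def)

lemma frep_lideal: "frep G (reg G) (lideal G e)"
  by (rule R.frep_stable[OF stable_lideal lideal_sub])

lemma e_in_lideal: "e \<in> lideal G e" by (simp add: lideal_def e_funs e_idem)

lemma stable_mult: "stable (carrier G) (reg G) K \<Longrightarrow> K \<subseteq> funs (carrier G) \<Longrightarrow> z \<in> K \<Longrightarrow> gmult G a z \<in> K"
  using R.galg_closed[of K z a] galg_regular by auto

text \<open>
  For an invariant \<open>K\<close> inside \<open>\<complex>G e\<close> and an equivariant projection \<open>q\<close> onto \<open>K\<close>, the element \<open>f = q e\<close> is an idempotent
  with \<open>q z = z f\<close>, and \<open>e = f + (e - f)\<close> is an orthogonal decomposition. So \<open>f\<close> or \<open>e - f\<close> vanishes.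
\<close>

lemma lideal_simple: "op_simple (carrier G) (fun_module (lideal G e) (reg G))"
  unfolding op_simple_fun_module[OF lideal_subspace]
proof (intro conjI allI impI)
  show "lideal G e \<noteq> {0}" using e_in_lideal e_nonzero by blast
  fix K assume K: "K \<subseteq> lideal G e" "stable (carrier G) (reg G) K"
  have KF: "K \<subseteq> funs (carrier G)" using K lideal_sub by blast
  obtain q where q: "flinear q" "\<And>v. v \<in> funs (carrier G) \<Longrightarrow> q v \<in> K" "\<And>u. u \<in> K \<Longrightarrow> q u = u"
    "\<And>g v. g \<in> carrier G \<Longrightarrow> v \<in> funs (carrier G) \<Longrightarrow> q (reg G g v) = reg G g (q v)"
    using R.equivariant_projection_exists[OF K(2) KF] by blast
  have qm: "q (gmult G a v) = gmult G a (q v)" if v: "v \<in> funs (carrier G)" for a v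
  proof -
    have "q (galg G (reg G) a v) = galg G (reg G) a (q v)"
      unfolding galg_def by (simp add: flinear_sum[OF q(1)] flinear_scale[OF q(1)] q(4) v)
    moreover have "q v \<in> funs (carrier G)" using q(2)[OF v] KF by blast
    ultimately show ?thesis using v by (simp add: galg_regular)
  qed
  define f where "f = q e"
  have fK: "f \<in> K" unfolding f_def by (rule q(2)[OF e_funs])
  then have fe: "gmult G f e = f" and ff: "f \<in> funs (carrier G)" using K(1) by (auto simp: lideal_def)
  have zf: "gmult G z f = q z" if "z \<in> lideal G e" for z
    using qm[OF e_funs, of z] that by (simp add: f_def lideal_def)
  have ef: "gmult G e f = f" using zf[OF e_in_lideal] by (simp add: f_def)
  have fidem: "gmult G f f = f" using zf[of f] fK K(1) q(3)[OF fK] by auto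
  have sub1: "gmult G (e - f) h = gmult G e h - gmult G f h" for h
    by (rule flinear_diff[OF gmult_linear(2)])
  have sub2: "gmult G h (e - f) = gmult G h e - gmult G h f" for h
    by (rule flinear_diff[OF gmult_linear(1)])
  have "f = 0 \<or> e - f = 0"
    by (rule e_prim) (simp_all add: ff fs.subspace_diff[OF subspace_funs] e_funs sub1 sub2 e_idem ef fe fidem)
  then show "K = {0} \<or> K = lideal G e"
  proof
    assume "f = 0"
    then have "z = 0" if "z \<in> K" for z
      using zf[of z] K(1) q(3) that flinear_zero[OF gmult_linear(1)] by (metis subsetD)
    then show ?thesis using K(2) fs.subspace_0 by (auto simp: stable_def)
  next
    assume "e - f = 0"
    then have "e \<in> K" using fK by simp
    have "z \<in> K" if "z \<in> lideal G e" for z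
      using stable_mult[OF K(2) KF \<open>e \<in> K\<close>, of z] that by (simp add: lideal_def)
    then have "lideal G e \<subseteq> K" by blast
    then show ?thesis using K(1) by blast
  qed
qed

text \<open>
  For \<open>x\<close> in \<open>e \<complex>G e\<close>, right multiplication by \<open>x\<close> has an eigenvector in \<open>\<complex>G e\<close>; its eigenspace is a
  left submodule, hence contains \<open>e\<close>, which says that \<open>x\<close> is a multiple of \<open>e\<close>.
\<close>

lemma schur: "\<exists>c. gmult G e (gmult G a e) = cscale c e"
proof -
  define x where "x = gmult G e (gmult G a e)"
  have xF: "x \<in> funs (carrier G)" unfolding x_def by (rule gmult_closed)
  have xe: "gmult G x e = x" unfolding x_def by (simp add: assoc e_funs e_idem)
  have ex: "gmult G e x = x" unfolding x_def by (simp add: assoc[symmetric] gmult_closed e_idem)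
  have cl: "gmult G z x \<in> lideal G e" for z by (simp add: lideal_def gmult_closed assoc e_funs xe)
  obtain l w where lw: "w \<in> lideal G e" "w \<noteq> 0" "gmult G w x = cscale l w"
    using eigenvector_exists[OF fin lideal_sub gmult_linear(2) lideal_subspace cl e_in_lideal e_nonzero]
    by (elim exE conjE) (rule that)
  define K where "K = {z \<in> lideal G e. gmult G z x = cscale l z}"
  have "stable (carrier G) (reg G) K"
    unfolding stable_def fs.subspace_def
  proof (intro conjI ballI allI)
    show "0 \<in> K"
      by (simp add: K_def fs.subspace_0[OF lideal_subspace] flinear_zero[OF gmult_linear(2)])
  next
    fix z z' assume "z \<in> K" "z' \<in> K"
    then show "z + z' \<in> K"
      by (simp add: K_def fs.subspace_add[OF lideal_subspace] flinear_add[OF gmult_linear(2)] fs.scale_right_distrib)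
  next
    fix k z assume "z \<in> K"
    then show "cscale k z \<in> K"
      by (simp add: K_def fs.subspace_scale[OF lideal_subspace] flinear_scale[OF gmult_linear(2)] mult.commute[of k])
  next
    fix g z assume "g \<in> carrier G" "z \<in> K"
    then show "reg G g z \<in> K"
      using stable_lideal by (simp add: K_def stable_def assoc[OF xF] flinear_scale[OF gmult_linear(1)])
  qed
  moreover have "K \<subseteq> lideal G e" "K \<noteq> {0}" using lw by (auto simp: K_def)
  ultimately have "K = lideal G e"
    using lideal_simple unfolding op_simple_fun_module[OF lideal_subspace] by metis
  then have "e \<in> K" using e_in_lideal by simp
  then show ?thesis using ex unfolding K_def x_def by auto
qed

lemma schur_idem: "schur_idem G e"
  unfolding schur_idem_def using e_funs e_idem schur by blast

end

lemma schur_scalars: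
  assumes "schur_idem G e"
  obtains c where "\<And>g. g \<in> carrier G \<Longrightarrow> gmult G e (gmult G (basis_vec g) e) = cscale (c g) e"
  using assms unfolding schur_idem_def by metis

lemma (in frep) schur_sandwich:
  assumes c: "\<And>g. g \<in> carrier G \<Longrightarrow> gmult G e (gmult G (basis_vec g) e) = cscale (c g) e"
    and v: "v \<in> V" "galg G \<rho> e v = v"
  shows "galg G \<rho> e (galg G \<rho> a v) = cscale (\<Sum>g\<in>carrier G. a g * c g) v"
proof -
  have "galg G \<rho> e (\<rho> g v) = cscale (c g) v" if g: "g \<in> carrier G" for g
  proof -
    have ev: "galg G \<rho> (gmult G (basis_vec g) e) v = \<rho> g v"
      by (simp add: galg_gmult[OF v(1)] v(2) galg_basis_vec[OF g])
    have "galg G \<rho> e (\<rho> g v) = galg G \<rho> (gmult G e (gmult G (basis_vec g) e)) v"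
      by (simp add: galg_gmult[OF v(1), of e] ev)
    also have "\<dots> = cscale (c g) v" by (simp add: c[OF g] galg_linear_left v(2))
    finally show ?thesis .
  qed
  then have "galg G \<rho> e (galg G \<rho> a v) = (\<Sum>g\<in>carrier G. cscale (a g) (cscale (c g) v))"
    unfolding galg_def[of _ _ a] by (simp add: flinear_sum[OF galg_linear] flinear_scale[OF galg_linear])
  then show ?thesis by (simp add: fs.scale_sum_left)
qed

lemma (in frep) cyclic_stable:
  assumes u: "u \<in> V"
  shows "stable (carrier G) \<rho> (range (\<lambda>a. galg G \<rho> a u))"
  unfolding stable_def fs.subspace_def
proof (intro conjI ballI allI)
  have "galg G \<rho> 0 u = 0" using galg_linear_left(2)[of 0 0 u] by simp
  then show "0 \<in> range (\<lambda>a. galg G \<rho> a u)" by (metis rangeI)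
next
  fix x y assume "x \<in> range (\<lambda>a. galg G \<rho> a u)" "y \<in> range (\<lambda>a. galg G \<rho> a u)"
  then show "x + y \<in> range (\<lambda>a. galg G \<rho> a u)" by (auto simp: galg_linear_left(1)[symmetric])
next
  fix c x assume "x \<in> range (\<lambda>a. galg G \<rho> a u)"
  then show "cscale c x \<in> range (\<lambda>a. galg G \<rho> a u)" by (auto simp: galg_linear_left(2)[symmetric])
next
  fix g x assume g: "g \<in> carrier G" and "x \<in> range (\<lambda>a. galg G \<rho> a u)"
  then obtain a where "x = galg G \<rho> a u" by blast
  then have "\<rho> g x = galg G \<rho> (reg G g a) u"
    by (simp add: galg_gmult[OF u] galg_basis_vec[OF g])
  then show "\<rho> g x \<in> range (\<lambda>a. galg G \<rho> a u)" by (metis rangeI)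
qed

lemma (in frep) simple_cyclic:
  assumes "op_simple (carrier G) (fun_module V \<rho>)" "u \<in> V" "u \<noteq> 0" "v \<in> V"
  shows "\<exists>a. v = galg G \<rho> a u"
proof -
  let ?N = "range (\<lambda>a. galg G \<rho> a u)"
  have "u = galg G \<rho> (basis_vec \<one>) u" using galg_basis_vec[OF one_closed, of u] rho_one assms by simp
  then have "u \<in> ?N" by (metis rangeI)
  moreover have "?N \<subseteq> V" using galg_closed[OF stable_V assms(2)] by auto
  ultimately have "?N = V"
    using assms cyclic_stable[OF assms(2)] unfolding op_simple_fun_module[OF subV] by blast
  then show ?thesis using assms(4) by auto
qed

text \<open>
  Apply Goursat to the submodule generated by \<open>(u, s)\<close>. If \<open>a\<close> maps \<open>(u, s)\<close> to \<open>(u, 0)\<close> or \<open>(0, s)\<close>, then \<open>e a e\<close> would be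
  the scalar one on one side and the scalar zero on the other, although both are the same scalar.
\<close>

lemma iso_of_fixed_vectors:
  fixes \<rho> :: "'g \<Rightarrow> ('d \<Rightarrow> complex) \<Rightarrow> 'd \<Rightarrow> complex" and \<rho>' :: "'g \<Rightarrow> ('e \<Rightarrow> complex) \<Rightarrow> 'e \<Rightarrow> complex"
  assumes e: "schur_idem G e" and V: "frep G \<rho> V" and V': "frep G \<rho>' V'"
    and simple: "op_simple (carrier G) (fun_module V \<rho>)" "op_simple (carrier G) (fun_module V' \<rho>')"
    and u: "u \<in> V" "u \<noteq> 0" "galg G \<rho> e u = u" and s: "s \<in> V'" "s \<noteq> 0" "galg G \<rho>' e s = s"
  shows "op_iso (carrier G) (fun_module V \<rho>) (fun_module V' \<rho>')"
proof -
  interpret V: frep G \<rho> V by fact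
  interpret V': frep G \<rho>' V' by fact
  obtain c where c: "\<And>g. g \<in> carrier G \<Longrightarrow> gmult G e (gmult G (basis_vec g) e) = cscale (c g) e"
    using schur_scalars[OF e] by blast
  have sand: "galg G \<rho> e (galg G \<rho> a u) = cscale (\<Sum>g\<in>carrier G. a g * c g) u"
    "galg G \<rho>' e (galg G \<rho>' a s) = cscale (\<Sum>g\<in>carrier G. a g * c g) s" for a
    using V.schur_sandwich[OF c u(1,3)] V'.schur_sandwich[OF c s(1,3)] by blast+
  let ?\<Gamma> = "range (\<lambda>a. (galg G \<rho> a u, galg G \<rho>' a s))"
  have split: False if "galg G \<rho> a u = u \<and> galg G \<rho>' a s = 0 \<or> galg G \<rho> a u = 0 \<and> galg G \<rho>' a s = s" for a
  proof -
    let ?c = "\<Sum>g\<in>carrier G. a g * c g"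
    from that show False
    proof
      assume h: "galg G \<rho> a u = u \<and> galg G \<rho>' a s = 0"
      have "u = cscale ?c u"
        using sand(1)[of a] unfolding conjunct1[OF h] u(3) .
      moreover have "0 = cscale ?c s"
        using sand(2)[of a] unfolding conjunct2[OF h] flinear_zero[OF V'.galg_linear] .
      ultimately show False using u(2) s(2) by (metis fs.scale_eq_0_iff)
    next
      assume h: "galg G \<rho> a u = 0 \<and> galg G \<rho>' a s = s"
      have "0 = cscale ?c u"
        using sand(1)[of a] unfolding conjunct1[OF h] flinear_zero[OF V.galg_linear] .
      moreover have "s = cscale ?c s"
        using sand(2)[of a] unfolding conjunct2[OF h] s(3) .
      ultimately show False using u(2) s(2) by (metis fs.scale_eq_0_iff)
    qed
  qed
  show ?thesis
  proof (rule goursat[where \<Gamma> = ?\<Gamma> and u = u and s = s])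
    show "(u, s) \<in> ?\<Gamma>" by (rule range_eqI[of _ _ e]) (simp only: u(3) s(3))
    have "(u, 0) \<noteq> (galg G \<rho> a u, galg G \<rho>' a s)" "(0, s) \<noteq> (galg G \<rho> a u, galg G \<rho>' a s)" for a
      using split[of a] by (metis Pair_inject)+
    then have "(u, 0) \<notin> ?\<Gamma>" "(0, s) \<notin> ?\<Gamma>" unfolding image_iff by blast+
    then show "(u, \<zero>\<^bsub>fun_module V' \<rho>'\<^esub>) \<notin> ?\<Gamma>" "(\<zero>\<^bsub>fun_module V \<rho>\<^esub>, s) \<notin> ?\<Gamma>" by simp_all
    fix x y x' y' assume "(x, y) \<in> ?\<Gamma>" "(x', y') \<in> ?\<Gamma>"
    then obtain a b where "x = galg G \<rho> a u" "y = galg G \<rho>' a s" "x' = galg G \<rho> b u" "y' = galg G \<rho>' b s" by blast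
    then have "(x + x', y + y') = (galg G \<rho> (a + b) u, galg G \<rho>' (a + b) s)"
      by (simp add: V.galg_linear_left V'.galg_linear_left)
    then show "(x \<oplus>\<^bsub>fun_module V \<rho>\<^esub> x', y \<oplus>\<^bsub>fun_module V' \<rho>'\<^esub> y') \<in> ?\<Gamma>" by auto
  next
    fix k x y assume "(x, y) \<in> ?\<Gamma>"
    then obtain a where "x = galg G \<rho> a u" "y = galg G \<rho>' a s" by blast
    then have "(cscale k x, cscale k y) = (galg G \<rho> (cscale k a) u, galg G \<rho>' (cscale k a) s)"
      by (simp add: V.galg_linear_left V'.galg_linear_left)
    then show "(k \<odot>\<^bsub>fun_module V \<rho>\<^esub> x, k \<odot>\<^bsub>fun_module V' \<rho>'\<^esub> y) \<in> ?\<Gamma>" by auto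
  next
    fix g x y assume g: "g \<in> carrier G" and "(x, y) \<in> ?\<Gamma>"
    then obtain a where "x = galg G \<rho> a u" "y = galg G \<rho>' a s" by blast
    then have "(\<rho> g x, \<rho>' g y) = (galg G \<rho> (gmult G (basis_vec g) a) u, galg G \<rho>' (gmult G (basis_vec g) a) s)"
      using g by (simp add: V.galg_gmult V'.galg_gmult u s V.galg_basis_vec V'.galg_basis_vec)
    then show "(act (fun_module V \<rho>) g x, act (fun_module V' \<rho>') g y) \<in> ?\<Gamma>" by auto
  qed (use u s simple module_fun_module V.subV V'.subV V.galg_closed[OF V.stable_V] V'.galg_closed[OF V'.stable_V]
       flinear_zero[OF V.lin] flinear_zero[OF V'.lin] in auto)
qed



section \<open>Counting constituents by traces\<close>

lemma op_iso_fun_moduleE: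
  assumes "op_iso \<Omega> (fun_module V \<rho>) (fun_module V' \<rho>')"
  obtains \<phi> where "bij_betw \<phi> V V'" "\<And>u v. u \<in> V \<Longrightarrow> v \<in> V \<Longrightarrow> \<phi> (u + v) = \<phi> u + \<phi> v"
    "\<And>c v. v \<in> V \<Longrightarrow> \<phi> (cscale c v) = cscale c (\<phi> v)"
    "\<And>g v. g \<in> \<Omega> \<Longrightarrow> v \<in> V \<Longrightarrow> \<phi> (\<rho> g v) = \<rho>' g (\<phi> v)"
proof -
  obtain \<phi> where p: "\<phi> \<in> iso (add_monoid (fun_module V \<rho>)) (add_monoid (fun_module V' \<rho>'))"
    "\<forall>c. \<forall>v\<in>carrier (fun_module V \<rho>). \<phi> (c \<odot>\<^bsub>fun_module V \<rho>\<^esub> v) = c \<odot>\<^bsub>fun_module V' \<rho>'\<^esub> \<phi> v"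
    "\<forall>g\<in>\<Omega>. \<forall>v\<in>carrier (fun_module V \<rho>). \<phi> (act (fun_module V \<rho>) g v) = act (fun_module V' \<rho>') g (\<phi> v)"
    using assms unfolding op_iso_def by blast
  show ?thesis
  proof (rule that[of \<phi>])
    show "bij_betw \<phi> V V'" using p(1) by (simp add: iso_def)
    show "\<phi> (u + v) = \<phi> u + \<phi> v" if "u \<in> V" "v \<in> V" for u v
      using p(1) that by (simp add: iso_def hom_def)
    show "\<phi> (cscale c v) = cscale c (\<phi> v)" if "v \<in> V" for c v
      using p(2) that by simp
    show "\<phi> (\<rho> g v) = \<rho>' g (\<phi> v)" if "g \<in> \<Omega>" "v \<in> V" for g v
      using p(3) that by simp
  qed
qed

lemma additive_on_sum:
  assumes V: "fs.subspace V"
    and add: "\<And>u v. u \<in> V \<Longrightarrow> v \<in> V \<Longrightarrow> \<phi> (u + v) = \<phi> u + \<phi> v"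
    and scale: "\<And>c v. v \<in> V \<Longrightarrow> \<phi> (cscale c v) = cscale c (\<phi> v)"
  shows "(\<And>i. i \<in> I \<Longrightarrow> f i \<in> V) \<Longrightarrow> \<phi> (\<Sum>i\<in>I. f i) = (\<Sum>i\<in>I. \<phi> (f i))"
proof (induction I rule: infinite_finite_induct)
  have "\<phi> 0 = 0" using scale[OF fs.subspace_0[OF V], of 0] by simp
  {
    case (infinite A)
    then show ?case using \<open>\<phi> 0 = 0\<close> by simp
  next
    case empty
    then show ?case using \<open>\<phi> 0 = 0\<close> by simp
  }
next
  case (insert x F)
  then show ?case using add[of "f x" "sum f F"] fs.subspace_sum[OF V, of F f] by simp
qed

lemma galg_equivariant:
  assumes V: "frep G \<rho> V"
    and add: "\<And>u v. u \<in> V \<Longrightarrow> v \<in> V \<Longrightarrow> \<phi> (u + v) = \<phi> u + \<phi> v"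
    and scale: "\<And>c v. v \<in> V \<Longrightarrow> \<phi> (cscale c v) = cscale c (\<phi> v)"
    and act: "\<And>g v. g \<in> carrier G \<Longrightarrow> v \<in> V \<Longrightarrow> \<phi> (\<rho> g v) = \<rho>' g (\<phi> v)"
    and v: "v \<in> V"
  shows "\<phi> (galg G \<rho> a v) = galg G \<rho>' a (\<phi> v)"
proof -
  interpret V: frep G \<rho> V by fact
  have "\<phi> (galg G \<rho> a v) = (\<Sum>g\<in>carrier G. \<phi> (cscale (a g) (\<rho> g v)))"
    unfolding galg_def
    by (rule additive_on_sum[OF V.subV add scale]) (auto intro!: fs.subspace_scale[OF V.subV] V.closed v)
  also have "\<dots> = galg G \<rho>' a (\<phi> v)"
    unfolding galg_def by (intro sum.cong refl) (simp add: scale V.closed v act)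
  finally show ?thesis .
qed

lemma fixed_vector_of_iso:
  assumes iso: "op_iso (carrier G) (fun_module V \<rho>) (fun_module V' \<rho>')" and V: "frep G \<rho> V"
    and s: "s \<in> V'" "s \<noteq> 0" "galg G \<rho>' e s = s"
  shows "\<exists>u\<in>V. u \<noteq> 0 \<and> galg G \<rho> e u = u"
proof -
  interpret V: frep G \<rho> V by fact
  obtain \<phi> where p: "bij_betw \<phi> V V'" "\<And>u v. u \<in> V \<Longrightarrow> v \<in> V \<Longrightarrow> \<phi> (u + v) = \<phi> u + \<phi> v"
    "\<And>c v. v \<in> V \<Longrightarrow> \<phi> (cscale c v) = cscale c (\<phi> v)"
    "\<And>g v. g \<in> carrier G \<Longrightarrow> v \<in> V \<Longrightarrow> \<phi> (\<rho> g v) = \<rho>' g (\<phi> v)"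
    using op_iso_fun_moduleE[OF iso] by metis
  obtain u where u: "u \<in> V" "\<phi> u = s" using p(1) s(1) by (auto simp: bij_betw_def)
  have "\<phi> (galg G \<rho> e u) = \<phi> u"
    using galg_equivariant[OF V p(2,3,4) u(1)] u(2) s(3) by simp
  then have "galg G \<rho> e u = u"
    by (rule inj_onD[OF bij_betw_imp_inj_on[OF p(1)] _ V.galg_closed[OF V.stable_V u(1)] u(1)])
  moreover have "u \<noteq> 0"
    using p(3)[OF u(1), of 0] s(2) u(2) by auto
  ultimately show ?thesis using u(1) by blast
qed

lemma sum_decomposition_zero:
  assumes dec: "sum_decomposition Us W" and W: "0 \<in> W"
    and U0: "\<And>i. i < length Us \<Longrightarrow> 0 \<in> Us ! i"
    and f: "\<And>i. i < length Us \<Longrightarrow> f i \<in> Us ! i" "(\<Sum>i<length Us. f i) = 0" and i: "i < length Us"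
  shows "f i = 0"
proof -
  let ?E = "\<lambda>u. u \<in> (\<Pi>\<^sub>E i\<in>{..<length Us}. Us ! i) \<and> 0 = (\<Sum>i<length Us. u i)"
  have ex1: "\<exists>!u. ?E u" using dec W unfolding sum_decomposition_def by (rule bspec)
  have 1: "?E (restrict f {..<length Us})" using f by auto
  have 2: "?E (restrict (\<lambda>_. 0) {..<length Us})" using U0 by auto
  have "restrict f {..<length Us} = restrict (\<lambda>_. 0) {..<length Us}"
    using the1_equality[where P = ?E, OF ex1 1] the1_equality[where P = ?E, OF ex1 2] by (rule trans[OF sym])
  from fun_cong[OF this, of i] show ?thesis using i by simp
qed

text \<open>
  In each summand isomorphic to \<open>V'\<close> choose a nonzero vector fixed by \<open>e\<close>; on the other summands \<open>e\<close> vanishes. By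
  the uniqueness of the decomposition these vectors form a basis of the image of \<open>e\<close>.
\<close>

lemma (in frep) decomposition_basis:
  assumes e: "schur_idem G e" and V': "frep G \<rho>' V'" "op_simple (carrier G) (fun_module V' \<rho>')"
    and s': "s' \<in> V'" "s' \<noteq> 0" "galg G \<rho>' e s' = s'"
    and dec: "irreducible_decomposition (carrier G) (fun_module V \<rho>) Us"
  shows "\<exists>B. finite B \<and> fs.independent B \<and> fs.span B = {v \<in> V. galg G \<rho> e v = v} \<and>
    card B = card {i. i < length Us \<and> op_iso (carrier G) ((fun_module V \<rho>)\<lparr>carrier := Us ! i\<rparr>) (fun_module V' \<rho>')}"
proof -
  define l where "l = length Us"
  define J where "J = {i. i < l \<and> op_iso (carrier G) (fun_module (Us ! i) \<rho>) (fun_module V' \<rho>')}"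
  have Jl: "J \<subseteq> {..<l}" and finJ: "finite J" by (auto simp: J_def)
  have Us: "stable (carrier G) \<rho> (Us ! i)" "Us ! i \<subseteq> V" "op_simple (carrier G) (fun_module (Us ! i) \<rho>)"
    if "i < l" for i
    using dec nth_mem[of i Us] that unfolding irreducible_decomposition_fun_module l_def by blast+
  have sd: "sum_decomposition Us V" using dec unfolding irreducible_decomposition_fun_module by blast
  have fr: "frep G \<rho> (Us ! i)" if "i < l" for i by (rule frep_stable[OF Us(1,2)[OF that]])
  have sub: "fs.subspace (Us ! i)" if "i < l" for i using Us(1)[OF that] by (simp add: stable_def)
  have ee: "galg G \<rho> e (galg G \<rho> e v) = galg G \<rho> e v" if "v \<in> V" for v
    using galg_gmult[OF that, of e e] e by (simp add: schur_idem_def)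
  have "\<forall>i\<in>J. \<exists>u. u \<in> Us ! i \<and> u \<noteq> 0 \<and> galg G \<rho> e u = u"
  proof
    fix i assume "i \<in> J"
    then have i: "i < l" "op_iso (carrier G) (fun_module (Us ! i) \<rho>) (fun_module V' \<rho>')" by (auto simp: J_def)
    show "\<exists>u. u \<in> Us ! i \<and> u \<noteq> 0 \<and> galg G \<rho> e u = u"
      using fixed_vector_of_iso[OF i(2) fr[OF i(1)] s'] by blast
  qed
  from bchoice[OF this] obtain s where s: "\<And>i. i \<in> J \<Longrightarrow> s i \<in> Us ! i" "\<And>i. i \<in> J \<Longrightarrow> s i \<noteq> 0"
    "\<And>i. i \<in> J \<Longrightarrow> galg G \<rho> e (s i) = s i" by blast
  have notJ: "galg G \<rho> e w = 0" if i: "i < l" "i \<notin> J" and w: "w \<in> Us ! i" for i w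
  proof (rule ccontr)
    assume n: "galg G \<rho> e w \<noteq> 0"
    have "galg G \<rho> e w \<in> Us ! i" by (rule galg_closed[OF Us(1)[OF i(1)] w])
    moreover have "galg G \<rho> e (galg G \<rho> e w) = galg G \<rho> e w" using ee Us(2)[OF i(1)] w by blast
    ultimately have "op_iso (carrier G) (fun_module (Us ! i) \<rho>) (fun_module V' \<rho>')"
      using iso_of_fixed_vectors[OF e fr[OF i(1)] V'(1) Us(3)[OF i(1)] V'(2) _ n _ s'] by blast
    then show False using i by (simp add: J_def)
  qed
  obtain cs where cs: "\<And>g. g \<in> carrier G \<Longrightarrow> gmult G e (gmult G (basis_vec g) e) = cscale (cs g) e"
    using schur_scalars[OF e] by blast
  have inJ: "galg G \<rho> e w \<in> fs.span (s ` J)" if i: "i \<in> J" and w: "w \<in> Us ! i" for i w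
  proof -
    have il: "i < l" using i Jl by blast
    interpret U: frep G \<rho> "Us ! i" by (rule fr[OF il])
    obtain a where a: "w = galg G \<rho> a (s i)" using U.simple_cyclic[OF Us(3)[OF il] s(1,2)[OF i] w] by blast
    have "galg G \<rho> e w = cscale (\<Sum>g\<in>carrier G. a g * cs g) (s i)"
      unfolding a by (rule U.schur_sandwich[OF cs s(1)[OF i] s(3)[OF i]])
    then show ?thesis by (simp add: fs.span_scale fs.span_base imageI i)
  qed
  have scal: "c i = 0" if z: "(\<Sum>i\<in>J. cscale (c i) (s i)) = 0" and i: "i \<in> J" for c i
  proof -
    have "(\<Sum>i<length Us. if i \<in> J then cscale (c i) (s i) else 0) = (\<Sum>i\<in>J. cscale (c i) (s i))"
      using Jl by (simp add: sum.If_cases l_def Int_absorb1)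
    then have "(if i \<in> J then cscale (c i) (s i) else 0) = 0"
      using z i Jl sub s(1)
      by (intro sum_decomposition_zero[OF sd fs.subspace_0[OF subV], of "\<lambda>i. if i \<in> J then cscale (c i) (s i) else 0"])
        (auto simp: l_def fs.subspace_0 fs.subspace_scale)
    then show ?thesis using i s(2) by simp
  qed
  have inj: "inj_on s J"
  proof (rule inj_onI, rule ccontr)
    fix i j assume ij: "i \<in> J" "j \<in> J" "s i = s j" "i \<noteq> j"
    let ?c = "\<lambda>k. (if k = i then 1 else 0) - (if k = j then 1 else 0 :: complex)"
    have "(\<Sum>k\<in>J. cscale (?c k) (s k)) = (\<Sum>k\<in>J. (if k = i then s i else 0) - (if k = j then s j else 0))"
      by (intro sum.cong refl) (auto simp: fs.scale_left_diff_distrib)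
    also have "\<dots> = 0" using ij finJ by (simp add: sum_subtractf)
    finally have "?c i = 0" by (rule scal) (rule ij(1))
    then show False using ij(4) by simp
  qed
  have indep: "fs.independent (s ` J)"
  proof (rule fs.independent_if_scalars_zero)
    show "finite (s ` J)" using finJ by simp
    fix f x assume h: "(\<Sum>x\<in>s ` J. cscale (f x) x) = 0" "x \<in> s ` J"
    then obtain i where i: "i \<in> J" "x = s i" by blast
    have "(\<Sum>i\<in>J. cscale (f (s i)) (s i)) = 0" using h(1) by (simp add: sum.reindex[OF inj])
    from scal[OF this i(1)] show "f x = 0" using i(2) by simp
  qed
  have span: "fs.span (s ` J) = {v \<in> V. galg G \<rho> e v = v}"
  proof (intro equalityI fs.span_minimal subsetI)
    fix x assume "x \<in> s ` J"
    then obtain i where i: "i \<in> J" "x = s i" by blast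
    then have "s i \<in> V" using s(1) Us(2) Jl by blast
    then show "x \<in> {v \<in> V. galg G \<rho> e v = v}" using s(3) i by simp
  next
    show "fs.subspace {v \<in> V. galg G \<rho> e v = v}"
      unfolding fs.subspace_def
      by (auto simp: fs.subspace_0[OF subV] fs.subspace_add[OF subV] fs.subspace_scale[OF subV]
        flinear_zero[OF galg_linear] flinear_add[OF galg_linear] flinear_scale[OF galg_linear])
  next
    fix v assume v: "v \<in> {v \<in> V. galg G \<rho> e v = v}"
    then have "\<exists>!u. u \<in> (\<Pi>\<^sub>E i\<in>{..<length Us}. Us ! i) \<and> v = (\<Sum>i<length Us. u i)"
      using sd unfolding sum_decomposition_def by blast
    then obtain u where u: "u \<in> (\<Pi>\<^sub>E i\<in>{..<length Us}. Us ! i)" "v = (\<Sum>i<length Us. u i)" by blast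
    have "v = galg G \<rho> e (\<Sum>i<length Us. u i)" using v u(2) by simp
    also have "\<dots> = (\<Sum>i<length Us. galg G \<rho> e (u i))" by (rule flinear_sum[OF galg_linear])
    also have "\<dots> \<in> fs.span (s ` J)"
    proof (rule fs.span_sum)
      fix i assume i: "i \<in> {..<length Us}"
      have ui: "u i \<in> Us ! i" by (rule PiE_mem[OF u(1) i])
      show "galg G \<rho> e (u i) \<in> fs.span (s ` J)"
      proof (cases "i \<in> J")
        case False
        then have "galg G \<rho> e (u i) = 0" using notJ ui i by (simp add: l_def)
        then show ?thesis by (simp add: fs.span_zero)
      qed (rule inJ[OF _ ui])
    qed
    finally show "v \<in> fs.span (s ` J)" .
  qed
  show ?thesis
  proof (intro exI[of _ "s ` J"] conjI indep span)
    show "finite (s ` J)" using finJ by simp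
    show "card (s ` J) = card {i. i < length Us \<and> op_iso (carrier G) ((fun_module V \<rho>)\<lparr>carrier := Us ! i\<rparr>) (fun_module V' \<rho>')}"
      unfolding card_image[OF inj] by (simp add: J_def l_def)
  qed
qed

theorem (in frep) constituent_multiplicity_trace:
  assumes X: "finite X" "V \<subseteq> funs X"
    and e: "schur_idem G e" and V': "frep G \<rho>' V'" "op_simple (carrier G) (fun_module V' \<rho>')"
    and s': "s' \<in> V'" "s' \<noteq> 0" "galg G \<rho>' e s' = s'"
    and T: "flinear T" "\<And>v. v \<in> funs X \<Longrightarrow> T v \<in> V" "\<And>v. v \<in> funs X \<Longrightarrow> galg G \<rho> e (T v) = T v"
      "\<And>v. v \<in> V \<Longrightarrow> galg G \<rho> e v = v \<Longrightarrow> T v = v"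
  shows "of_nat (constituent_multiplicity (carrier G) (fun_module V \<rho>) (fun_module V' \<rho>')) =
    (\<Sum>x\<in>X. T (basis_vec x) x)"
proof -
  let ?cnt = "\<lambda>Us. card {i. i < length Us \<and> op_iso (carrier G) ((fun_module V \<rho>)\<lparr>carrier := Us ! i\<rparr>) (fun_module V' \<rho>')}"
  have cnt: "of_nat (?cnt Us) = (\<Sum>x\<in>X. T (basis_vec x) x)"
    if dec: "irreducible_decomposition (carrier G) (fun_module V \<rho>) Us" for Us
  proof -
    obtain B where B: "finite B" "fs.independent B" "fs.span B = {v \<in> V. galg G \<rho> e v = v}" "card B = ?cnt Us"
      using decomposition_basis[OF e V' s' dec] by (elim exE conjE) (rule that)
    have "B \<subseteq> fs.span B" by (rule fs.span_superset)
    then have "B \<subseteq> funs X" using B(3) X(2) by blast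
    have "(\<Sum>x\<in>X. T (basis_vec x) x) = of_nat (card B)"
    proof (rule trace_of_projection[OF X(1) T(1) _ _ B(1,2) \<open>B \<subseteq> funs X\<close>])
      show "T v \<in> fs.span B" if "v \<in> funs X" for v unfolding B(3) using T(2,3)[OF that] by simp
      show "T v = v" if "v \<in> fs.span B" for v using that unfolding B(3) by (simp add: T(4))
    qed
    then show ?thesis using B(4) by simp
  qed
  obtain Us where Us: "irreducible_decomposition (carrier G) (fun_module V \<rho>) Us"
    using irreducible_decomposition_exists_rep[OF X] by blast
  have "constituent_multiplicity (carrier G) (fun_module V \<rho>) (fun_module V' \<rho>') = ?cnt Us"
    unfolding constituent_multiplicity_def
  proof (rule the_equality)
    show "\<exists>Us'. irreducible_decomposition (carrier G) (fun_module V \<rho>) Us' \<and> ?cnt Us = ?cnt Us'"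
      using Us by (intro exI[of _ Us] conjI refl)
    fix m assume "\<exists>Us'. irreducible_decomposition (carrier G) (fun_module V \<rho>) Us' \<and> m = ?cnt Us'"
    then obtain Us' where "irreducible_decomposition (carrier G) (fun_module V \<rho>) Us'" "m = ?cnt Us'" by blast
    then have "(of_nat m :: complex) = of_nat (?cnt Us)" using cnt Us by simp
    then show "m = ?cnt Us" by (simp only: of_nat_eq_iff)
  qed
  then show ?thesis using cnt[OF Us] by simp
qed

section \<open>Counting composition factors by traces\<close>

text \<open>
  An algebra of functions on \<open>X\<close>. The product is defined for all functions, not only
  for those supported in \<open>X\<close>, so that it is linear on the whole type.
\<close>

locale fin_algebra =
  fixes X :: "'m set" and mul :: "('m \<Rightarrow> complex) \<Rightarrow> ('m \<Rightarrow> complex) \<Rightarrow> 'm \<Rightarrow> complex" and unit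
  assumes finX: "finite X"
    and mul_linear: "\<And>a. flinear (mul a)" "\<And>b. flinear (\<lambda>a. mul a b)"
    and mul_closed: "\<And>a b. mul a b \<in> funs X"
    and mul_assoc: "\<And>a b c. a \<in> funs X \<Longrightarrow> b \<in> funs X \<Longrightarrow> c \<in> funs X \<Longrightarrow> mul (mul a b) c = mul a (mul b c)"
    and unit: "unit \<in> funs X" "\<And>a. a \<in> funs X \<Longrightarrow> mul unit a = a"
begin

definition ideal_of :: "('m \<Rightarrow> complex) \<Rightarrow> ('m \<Rightarrow> complex) set"
  where "ideal_of f = {a \<in> funs X. mul a f = a}"

lemma subspace_ideal_of: "fs.subspace (ideal_of f)"
  unfolding ideal_of_def fs.subspace_def
  by (auto simp: fs.subspace_0[OF subspace_funs] fs.subspace_add[OF subspace_funs] fs.subspace_scale[OF subspace_funs]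
    flinear_zero[OF mul_linear(2)] flinear_add[OF mul_linear(2)] flinear_scale[OF mul_linear(2)])

lemma stable_ideal_of: "f \<in> funs X \<Longrightarrow> stable (funs X) mul (ideal_of f)"
  unfolding stable_def using subspace_ideal_of by (auto simp: ideal_of_def mul_closed mul_assoc)

lemma opspace_stable: "stable (funs X) mul N \<Longrightarrow> opspace (funs X) mul N"
  by (intro opspace.intro mul_linear)

lemma cyclic_stable:
  assumes N: "stable (funs X) mul N" and v: "v \<in> funs X"
  shows "stable (funs X) mul {n + mul a v | n a. n \<in> N \<and> a \<in> funs X}" (is "stable _ _ ?L")
proof -
  have sN: "fs.subspace N" using N by (simp add: stable_def)
  have I: "n + mul a v \<in> ?L" if "n \<in> N" "a \<in> funs X" for n a using that by blast
  show ?thesis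
    unfolding stable_def fs.subspace_def
  proof (intro conjI ballI allI)
    show "0 \<in> ?L" using I[OF fs.subspace_0[OF sN] fs.subspace_0[OF subspace_funs]] flinear_zero[OF mul_linear(2)] by simp
  next
    fix x y assume "x \<in> ?L" "y \<in> ?L"
    then obtain n a m b where h: "n \<in> N" "a \<in> funs X" "m \<in> N" "b \<in> funs X" "x = n + mul a v" "y = m + mul b v" by blast
    then have "x + y = (n + m) + mul (a + b) v" by (simp add: flinear_add[OF mul_linear(2)] algebra_simps)
    then show "x + y \<in> ?L" using I[OF fs.subspace_add[OF sN h(1,3)] fs.subspace_add[OF subspace_funs h(2,4)]] by simp
  next
    fix c x assume "x \<in> ?L"
    then obtain n a where h: "n \<in> N" "a \<in> funs X" "x = n + mul a v" by blast
    then have "cscale c x = cscale c n + mul (cscale c a) v"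
      by (simp add: flinear_scale[OF mul_linear(2)] fs.scale_right_distrib)
    then show "cscale c x \<in> ?L" using I[OF fs.subspace_scale[OF sN h(1)] fs.subspace_scale[OF subspace_funs h(2)]] by simp
  next
    fix b x assume b: "b \<in> funs X" and "x \<in> ?L"
    then obtain n a where h: "n \<in> N" "a \<in> funs X" "x = n + mul a v" by blast
    then have "mul b x = mul b n + mul (mul b a) v"
      using b v by (simp add: flinear_add[OF mul_linear(1)] mul_assoc)
    moreover have "mul b n \<in> N" using N b h(1) by (simp add: stable_def)
    ultimately show "mul b x \<in> ?L" using I[OF _ mul_closed] by simp
  qed
qed

end

locale schur_algebra = fin_algebra +
  fixes e
  assumes e: "e \<in> funs X" "mul e e = e" "e \<noteq> 0"
    and schur: "\<And>a. a \<in> funs X \<Longrightarrow> \<exists>c. mul e (mul a e) = cscale c e"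
begin

definition radical :: "('a \<Rightarrow> complex) set"
  where "radical = {v \<in> ideal_of e. \<forall>a\<in>funs X. mul e (mul a v) = 0}"

abbreviation "proj f \<equiv> fun_module (ideal_of f) mul"

lemma ideal_sub: "ideal_of f \<subseteq> funs X" by (auto simp: ideal_of_def)

lemma e_ideal: "e \<in> ideal_of e" by (simp add: ideal_of_def e)

lemma stable_radical: "stable (funs X) mul radical"
  unfolding stable_def fs.subspace_def
proof (intro conjI ballI allI)
  show "0 \<in> radical"
    by (simp add: radical_def fs.subspace_0[OF subspace_ideal_of] flinear_zero[OF mul_linear(1)])
  show "x + y \<in> radical" if "x \<in> radical" "y \<in> radical" for x y
    using that by (simp add: radical_def fs.subspace_add[OF subspace_ideal_of] flinear_add[OF mul_linear(1)])
  show "cscale c x \<in> radical" if "x \<in> radical" for c x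
    using that by (simp add: radical_def fs.subspace_scale[OF subspace_ideal_of] flinear_scale[OF mul_linear(1)])
  fix b x assume b: "b \<in> funs X" and x: "x \<in> radical"
  have xF: "x \<in> funs X" and xI: "x \<in> ideal_of e" using x ideal_sub by (auto simp: radical_def)
  have "mul b x \<in> ideal_of e" using stable_ideal_of[OF e(1)] b xI by (simp add: stable_def)
  moreover have "mul e (mul a (mul b x)) = 0" if "a \<in> funs X" for a
  proof -
    have "mul e (mul (mul a b) x) = 0" using x by (simp add: radical_def mul_closed)
    then show ?thesis using that b xF by (simp add: mul_assoc)
  qed
  ultimately show "mul b x \<in> radical" by (simp add: radical_def)
qed

lemma radical_sub: "radical \<subseteq> ideal_of e" by (auto simp: radical_def)

lemma radical_proper: "e \<notin> radical"
proof
  assume "e \<in> radical"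
  then have "mul e (mul unit e) = 0" using unit(1) by (simp add: radical_def)
  then show False using e unit(2) by simp
qed

text \<open>
  If \<open>e a v\<close> is nonzero for some \<open>v\<close> in \<open>N\<close>, it is a nonzero multiple of \<open>e\<close>, because \<open>v = v e\<close>; so \<open>e\<close> lies in \<open>N\<close> and
  \<open>N\<close> is everything. Hence \<open>radical\<close> is the only maximal submodule.
\<close>

lemma proper_sub_radical:
  assumes N: "stable (funs X) mul N" "N \<subseteq> ideal_of e" "N \<noteq> ideal_of e"
  shows "N \<subseteq> radical"
proof
  fix v assume v: "v \<in> N"
  have "mul e (mul a v) = 0" if a: "a \<in> funs X" for a
  proof (rule ccontr)
    assume nz: "mul e (mul a v) \<noteq> 0"
    have av: "mul a v \<in> N" using N(1) a v by (simp add: stable_def)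
    then have avI: "mul (mul a v) e = mul a v" using N(2) by (auto simp: ideal_of_def)
    obtain c where "mul e (mul (mul a v) e) = cscale c e" using schur[OF mul_closed] by blast
    then have c: "mul e (mul a v) = cscale c e" using avI by simp
    then have "c \<noteq> 0" using nz by auto
    have sN: "fs.subspace N" using N(1) by (simp add: stable_def)
    have "mul e (mul a v) \<in> N" using N(1) e(1) av by (simp add: stable_def)
    then have "cscale (inverse c) (cscale c e) \<in> N" unfolding c by (rule fs.subspace_scale[OF sN])
    then have eN: "e \<in> N" using \<open>c \<noteq> 0\<close> by simp
    have "z \<in> N" if "z \<in> ideal_of e" for z
    proof -
      have z: "z \<in> funs X" "mul z e = z" using that by (auto simp: ideal_of_def)
      have "mul z e \<in> N" using N(1) eN z(1) unfolding stable_def by blast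
      then show ?thesis unfolding z(2) .
    qed
    then show False using N(2,3) by blast
  qed
  then show "v \<in> radical" using v N(2) by (auto simp: radical_def)
qed

lemma Rad_proj: "Rad (funs X) (proj e) = radical"
proof -
  have "maximal_submodule (funs X) N (proj e) \<longleftrightarrow> N = radical" for N
  proof
    assume "maximal_submodule (funs X) N (proj e)"
    then have N: "N \<subseteq> ideal_of e" "stable (funs X) mul N" "N \<noteq> ideal_of e"
      "\<And>L. L \<subseteq> ideal_of e \<Longrightarrow> stable (funs X) mul L \<Longrightarrow> N \<subseteq> L \<Longrightarrow> L = N \<or> L = ideal_of e"
      unfolding maximal_submodule_def op_submodule_fun_module[OF subspace_ideal_of] by auto
    have "radical = N \<or> radical = ideal_of e"
      using N(4)[OF radical_sub stable_radical proper_sub_radical[OF N(2,1,3)]] .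
    then show "N = radical" using radical_proper e_ideal by auto
  next
    assume N: "N = radical"
    have "radical \<noteq> ideal_of e" using radical_proper e_ideal by auto
    moreover have "L = radical \<or> L = ideal_of e"
      if "L \<subseteq> ideal_of e" "stable (funs X) mul L" "radical \<subseteq> L" for L
      using proper_sub_radical[OF that(2,1)] that(3) by auto
    ultimately show "maximal_submodule (funs X) N (proj e)"
      unfolding maximal_submodule_def op_submodule_fun_module[OF subspace_ideal_of] N
      using radical_sub stable_radical by auto
  qed
  then show ?thesis using radical_sub by (auto simp: Rad_def)
qed

abbreviation "head \<equiv> op_quotient (proj e) radical"

interpretation R: opquot "funs X" mul "ideal_of e" radical
  by (intro opquot.intro opspace_stable stable_ideal_of e(1) opquot_axioms.intro radical_sub stable_radical)

lemma head_simple: "op_simple (funs X) head"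
  unfolding R.simple_Q_iff
  using proper_sub_radical radical_proper e_ideal by blast

text \<open>
  From left to right, pull the class of \<open>e\<close> back. From right to left, apply Goursat to the submodule
  generated by the classes of \<open>e w\<close> and of \<open>e\<close>.
\<close>

lemma iso_head_iff:
  assumes N: "stable (funs X) mul N" "N \<subseteq> funs X" and N': "stable (funs X) mul N'" "N' \<subseteq> N"
    and simple: "op_simple (funs X) (op_quotient (fun_module N mul) N')"
  shows "op_iso (funs X) (op_quotient (fun_module N mul) N') head \<longleftrightarrow> (\<exists>w\<in>N. mul e w \<notin> N')"
proof -
  interpret Q: opquot "funs X" mul N N'
    by (intro opquot.intro opspace_stable N opquot_axioms.intro N')
  show ?thesis
  proof
    assume "op_iso (funs X) (op_quotient (fun_module N mul) N') head"
    then obtain \<phi> where p: "\<phi> \<in> iso (add_monoid Q.Q) (add_monoid R.Q)"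
      "\<forall>c. \<forall>v\<in>carrier Q.Q. \<phi> (c \<odot>\<^bsub>Q.Q\<^esub> v) = c \<odot>\<^bsub>R.Q\<^esub> \<phi> v"
      "\<forall>g\<in>funs X. \<forall>v\<in>carrier Q.Q. \<phi> (act Q.Q g v) = act R.Q g (\<phi> v)"
      unfolding op_iso_def by blast
    have bij: "bij_betw \<phi> (carrier Q.Q) (carrier R.Q)" using p(1) by (simp add: iso_def)
    have "R.cl e \<in> carrier R.Q" using e_ideal by (simp add: R.Q_simps)
    then have "R.cl e \<in> \<phi> ` (Q.cl ` N)" using bij by (simp add: bij_betw_def Q.Q_simps)
    then obtain w where w: "w \<in> N" "\<phi> (Q.cl w) = R.cl e" by auto
    have wC: "Q.cl w \<in> carrier Q.Q" using w(1) by (simp add: Q.Q_simps)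
    have "\<phi> (Q.cl (mul e w)) = R.cl e"
      using p(3)[rule_format, OF e(1) wC] w(2) e by (simp add: Q.Q_simps R.Q_simps)
    moreover have "\<phi> (Q.cl 0) = R.cl 0"
      using p(2)[rule_format, OF wC, of 0] w(2) by (simp add: Q.Q_simps R.Q_simps)
    moreover have "R.cl e \<noteq> R.cl 0" using radical_proper by (simp add: R.cl_eq_iff)
    ultimately have "Q.cl (mul e w) \<noteq> Q.cl 0" by metis
    then have "mul e w \<notin> N'" by (simp add: Q.cl_eq_iff)
    then show "\<exists>w\<in>N. mul e w \<notin> N'" using w(1) by blast
  next
    assume "\<exists>w\<in>N. mul e w \<notin> N'"
    then obtain w where w: "w \<in> N" "mul e w \<notin> N'" by blast
    define u where "u = mul e w"
    have wF: "w \<in> funs X" using w(1) N(2) by blast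
    have uN: "u \<in> N" unfolding u_def using N(1) e(1) w(1) by (simp add: stable_def)
    have uF: "u \<in> funs X" unfolding u_def by (rule mul_closed)
    have eu: "mul e u = u" unfolding u_def using mul_assoc[OF e(1) e(1) wF] e(2) by simp
    have auN: "mul a u \<in> N" if "a \<in> funs X" for a using N(1) uN that by (simp add: stable_def)
    have aeI: "mul a e \<in> ideal_of e" if "a \<in> funs X" for a
      using stable_ideal_of[OF e(1)] e_ideal that by (simp add: stable_def)
    have sN': "fs.subspace N'" using N'(1) by (simp add: stable_def)
    have key: "\<exists>c. mul e (mul a u) = cscale c u \<and> mul e (mul a e) = cscale c e" if a: "a \<in> funs X" for a
    proof -
      obtain c where c: "mul e (mul a e) = cscale c e" using schur[OF a] by blast
      have "mul e (mul a u) = mul e (mul a (mul e u))" using eu by simp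
      also have "\<dots> = mul (mul e (mul a e)) u"
        using a e(1) uF by (simp add: mul_assoc mul_closed)
      also have "\<dots> = cscale c (mul e u)" unfolding c by (rule flinear_scale[OF mul_linear(2)])
      also have "\<dots> = cscale c u" using eu by simp
      finally show ?thesis using c by blast
    qed
    let ?\<Gamma> = "(\<lambda>a. (Q.cl (mul a u), R.cl (mul a e))) ` funs X"
    have no1: "\<not> (Q.cl (mul a u) = Q.cl u \<and> R.cl (mul a e) = radical)" if a: "a \<in> funs X" for a
    proof
      assume h: "Q.cl (mul a u) = Q.cl u \<and> R.cl (mul a e) = radical"
      obtain c where c: "mul e (mul a u) = cscale c u" "mul e (mul a e) = cscale c e" using key[OF a] by blast
      have "mul a e \<in> radical" using h R.cl_eq_N_iff by blast
      then have "mul e (mul unit (mul a e)) = 0" using unit(1) by (simp add: radical_def)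
      then have "c = 0" using c(2) unit(2)[OF mul_closed] e(3) by simp
      then have z: "mul e (mul a u) = 0" using c(1) by simp
      have "mul a u - u \<in> N'" using h Q.cl_eq_iff by blast
      then have "mul e (mul a u - u) \<in> N'" using N'(1) e(1) by (simp add: stable_def)
      then have "- u \<in> N'" using z eu by (simp add: flinear_diff[OF mul_linear(1)])
      then show False using fs.subspace_neg[OF sN', of "- u"] w(2) by (simp add: u_def)
    qed
    have no2: "\<not> (Q.cl (mul a u) = N' \<and> R.cl (mul a e) = R.cl e)" if a: "a \<in> funs X" for a
    proof
      assume h: "Q.cl (mul a u) = N' \<and> R.cl (mul a e) = R.cl e"
      obtain c where c: "mul e (mul a u) = cscale c u" "mul e (mul a e) = cscale c e" using key[OF a] by blast
      have "mul a u \<in> N'" using h Q.cl_eq_N_iff by blast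
      then have "cscale c u \<in> N'" using N'(1) e(1) c(1) unfolding stable_def by metis
      have "c = 0"
      proof (rule ccontr)
        assume "c \<noteq> 0"
        have "cscale (inverse c) (cscale c u) \<in> N'" by (rule fs.subspace_scale[OF sN' \<open>cscale c u \<in> N'\<close>])
        then show False using \<open>c \<noteq> 0\<close> w(2) by (simp add: u_def)
      qed
      have "mul a e - e \<in> radical" using h R.cl_eq_iff by blast
      then have z: "mul e (mul unit (mul a e - e)) = 0" using unit(1) by (simp add: radical_def)
      have q: "mul unit (mul a e - e) = mul a e - e"
        by (rule unit(2)[OF fs.subspace_diff[OF subspace_funs mul_closed e(1)]])
      have "mul e (mul a e) - mul e e = 0" using z[unfolded q] unfolding flinear_diff[OF mul_linear(1)] .
      then show False using c(2) \<open>c = 0\<close> e by simp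
    qed
    have "(Q.cl u, radical) \<noteq> (Q.cl (mul a u), R.cl (mul a e))"
      "(N', R.cl e) \<noteq> (Q.cl (mul a u), R.cl (mul a e))" if "a \<in> funs X" for a
      using no1[OF that] no2[OF that] by (metis Pair_inject)+
    then have notin: "(Q.cl u, radical) \<notin> ?\<Gamma>" "(N', R.cl e) \<notin> ?\<Gamma>"
      unfolding image_iff by blast+
    show "op_iso (funs X) (op_quotient (fun_module N mul) N') head"
    proof (rule goursat[where \<Gamma> = ?\<Gamma> and u = "Q.cl u" and s = "R.cl e"])
      show "?\<Gamma> \<subseteq> carrier Q.Q \<times> carrier R.Q" using auN aeI by (auto simp: Q.Q_simps R.Q_simps)
      show "(Q.cl u, R.cl e) \<in> ?\<Gamma>"
        by (rule image_eqI[of _ _ e]) (simp_all only: eu e)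
      show "Q.cl u \<noteq> \<zero>\<^bsub>Q.Q\<^esub>" using w(2) by (simp add: Q.Q_simps Q.cl_eq_N_iff u_def)
      show "R.cl e \<noteq> \<zero>\<^bsub>R.Q\<^esub>" using radical_proper by (simp add: R.Q_simps R.cl_eq_N_iff)
      show "(Q.cl u, \<zero>\<^bsub>R.Q\<^esub>) \<notin> ?\<Gamma>" using notin(1) by (simp only: R.Q_simps not_False_eq_True)
      show "(\<zero>\<^bsub>Q.Q\<^esub>, R.cl e) \<notin> ?\<Gamma>" using notin(2) by (simp only: Q.Q_simps not_False_eq_True)
      fix x y x' y' assume "(x, y) \<in> ?\<Gamma>" "(x', y') \<in> ?\<Gamma>"
      then obtain a b where ab: "a \<in> funs X" "b \<in> funs X" "x = Q.cl (mul a u)" "y = R.cl (mul a e)"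
        "x' = Q.cl (mul b u)" "y' = R.cl (mul b e)" by blast
      show "(x \<oplus>\<^bsub>Q.Q\<^esub> x', y \<oplus>\<^bsub>R.Q\<^esub> y') \<in> ?\<Gamma>"
        by (rule image_eqI[of _ _ "a + b"])
          (simp_all add: ab Q.Q_simps R.Q_simps flinear_add[OF mul_linear(2)] fs.subspace_add[OF subspace_funs])
    next
      fix c x y assume "(x, y) \<in> ?\<Gamma>"
      then obtain a where a: "a \<in> funs X" "x = Q.cl (mul a u)" "y = R.cl (mul a e)" by blast
      show "(c \<odot>\<^bsub>Q.Q\<^esub> x, c \<odot>\<^bsub>R.Q\<^esub> y) \<in> ?\<Gamma>"
        by (rule image_eqI[of _ _ "cscale c a"])
          (simp_all add: a Q.Q_simps R.Q_simps flinear_scale[OF mul_linear(2)] fs.subspace_scale[OF subspace_funs])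
    next
      fix g x y assume g: "g \<in> funs X" and "(x, y) \<in> ?\<Gamma>"
      then obtain a where a: "a \<in> funs X" "x = Q.cl (mul a u)" "y = R.cl (mul a e)" by blast
      show "(act Q.Q g x, act R.Q g y) \<in> ?\<Gamma>"
        by (rule image_eqI[of _ _ "mul g a"])
          (simp_all add: a g Q.Q_simps R.Q_simps mul_assoc uF e mul_closed)
    next
      fix g assume g: "g \<in> funs X"
      have "act Q.Q g (Q.cl 0) = Q.cl 0" "act R.Q g (R.cl 0) = R.cl 0"
        using g by (simp_all add: Q.Q_simps R.Q_simps flinear_zero[OF mul_linear(1)])
      then show "act Q.Q g \<zero>\<^bsub>Q.Q\<^esub> = \<zero>\<^bsub>Q.Q\<^esub>" "act R.Q g \<zero>\<^bsub>R.Q\<^esub> = \<zero>\<^bsub>R.Q\<^esub>"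
        by (simp_all add: Q.Q_simps R.Q_simps Q.cl_zero R.cl_zero)
    qed (rule Q.module_Q R.module_Q simple head_simple)+
  qed
qed

text \<open>
  Climbing the series, the space fixed by \<open>e\<close> grows by one dimension exactly at the factors isomorphic to
  \<open>head\<close>: there the next term is \<open>N' + A u\<close> with \<open>u = e w\<close>, and \<open>e a u\<close> is a multiple of \<open>u\<close>.
\<close>

lemma series_basis:
  assumes f: "f \<in> funs X"
    and Ns: "composition_series (funs X) (proj f) Ns"
  shows "\<exists>B. finite B \<and> fs.independent B \<and> fs.span B = {v \<in> ideal_of f. mul e v = v} \<and>
    card B = card {i. Suc i < length Ns \<and>
      op_iso (funs X) (op_quotient ((proj f)\<lparr>carrier := Ns ! Suc i\<rparr>) (Ns ! i)) head}"
proof -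
  interpret P: opspace "funs X" mul "ideal_of f" by (rule opspace_stable[OF stable_ideal_of[OF f]])
  let ?iso = "\<lambda>i. op_iso (funs X) (op_quotient (fun_module (Ns ! Suc i) mul) (Ns ! i)) head"
  have N: "Ns \<noteq> []" "hd Ns = {0}" "last Ns = ideal_of f"
    "\<And>i. i < length Ns \<Longrightarrow> stable (funs X) mul (Ns ! i)" "\<And>i. i < length Ns \<Longrightarrow> Ns ! i \<subseteq> ideal_of f"
    "\<And>i. Suc i < length Ns \<Longrightarrow> Ns ! i \<subseteq> Ns ! Suc i"
    "\<And>i. Suc i < length Ns \<Longrightarrow> op_simple (funs X) (op_quotient (fun_module (Ns ! Suc i) mul) (Ns ! i))"
    using Ns nth_mem unfolding P.composition_series_fun_module by blast+
  have "i < length Ns \<Longrightarrow> \<exists>B. finite B \<and> fs.independent B \<and> fs.span B = {v \<in> Ns ! i. mul e v = v} \<and>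
    card B = card {j. j < i \<and> ?iso j}" for i
  proof (induction i)
    case 0
    have N0: "Ns ! 0 = {0}" using N(1,2) by (simp add: hd_conv_nth)
    have "{v \<in> Ns ! 0. mul e v = v} = {0}"
      unfolding N0 using flinear_zero[OF mul_linear(1)] by blast
    then have "fs.span {} = {v \<in> Ns ! 0. mul e v = v}" by (simp only: fs.span_empty)
    then show ?case by (intro exI[of _ "{}"]) (simp add: fs.independent_empty del: fs.span_empty)
  next
    case (Suc i)
    then have i: "i < length Ns" by simp
    let ?N = "Ns ! Suc i" and ?N' = "Ns ! i"
    from Suc.IH[OF i] obtain B where B: "finite B" "fs.independent B" "fs.span B = {v \<in> ?N'. mul e v = v}"
      "card B = card {j. j < i \<and> ?iso j}" by (elim exE conjE) (rule that)
    have sN: "stable (funs X) mul ?N" "?N \<subseteq> funs X" using N(4,5)[OF Suc.prems] ideal_sub by auto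
    have sN': "stable (funs X) mul ?N'" "?N' \<subseteq> ?N" using N(4)[OF i] N(6)[OF Suc.prems] by auto
    note simple = N(7)[OF Suc.prems]
    note iso = iso_head_iff[OF sN sN' simple]
    show ?case
    proof (cases "\<exists>w\<in>?N. mul e w \<notin> ?N'")
      case False
      then have "\<not> ?iso i" using iso by simp
      then have "{j. j < Suc i \<and> ?iso j} = {j. j < i \<and> ?iso j}" using less_Suc_eq by auto
      moreover have "{v \<in> ?N. mul e v = v} = {v \<in> ?N'. mul e v = v}"
      proof (intro equalityI subsetI)
        fix v assume v: "v \<in> {v \<in> ?N. mul e v = v}"
        then have "mul e v \<in> ?N'" using False by blast
        then show "v \<in> {v \<in> ?N'. mul e v = v}" using v by simp
      qed (use sN' in auto)
      ultimately show ?thesis using B by (intro exI[of _ B]) simp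
    next
      case True
      then have "?iso i" using iso by simp
      then have "{j. j < Suc i \<and> ?iso j} = insert i {j. j < i \<and> ?iso j}" using less_Suc_eq by auto
      then have card: "card {j. j < Suc i \<and> ?iso j} = Suc (card {j. j < i \<and> ?iso j})" by simp
      obtain w where w: "w \<in> ?N" "mul e w \<notin> ?N'" using True by blast
      define u where "u = mul e w"
      have wF: "w \<in> funs X" using w(1) sN(2) by blast
      have uN: "u \<in> ?N" unfolding u_def using sN(1) e(1) w(1) by (simp add: stable_def)
      have uF: "u \<in> funs X" unfolding u_def by (rule mul_closed)
      have eu: "mul e u = u" unfolding u_def using mul_assoc[OF e(1) e(1) wF] e(2) by simp
      have subN: "fs.subspace ?N" and subN': "fs.subspace ?N'" using sN(1) sN'(1) by (auto simp: stable_def)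
      have unotin: "u \<notin> fs.span B" using w(2) B(3) by (simp add: u_def)
      interpret Q: opquot "funs X" mul ?N ?N'
        by (intro opquot.intro opspace_stable sN opquot_axioms.intro sN')
      let ?L = "{n + mul a u | n a. n \<in> ?N' \<and> a \<in> funs X}"
      have "?L = ?N"
      proof -
        have I: "n + mul a u \<in> ?L" if "n \<in> ?N'" "a \<in> funs X" for n a using that by blast
        have "?N' \<subseteq> ?L"
        proof
          fix n assume "n \<in> ?N'"
          from I[OF this fs.subspace_0[OF subspace_funs]] show "n \<in> ?L"
            by (simp add: flinear_zero[OF mul_linear(2)])
        qed
        moreover have "?L \<subseteq> ?N"
        proof
          fix x assume "x \<in> ?L"
          then obtain n a where "n \<in> ?N'" "a \<in> funs X" "x = n + mul a u" by blast
          moreover from this have "mul a u \<in> ?N" using sN(1) uN by (simp add: stable_def)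
          ultimately show "x \<in> ?N" using sN'(2) by (auto intro!: fs.subspace_add[OF subN])
        qed
        moreover have "u \<in> ?L" using I[OF fs.subspace_0[OF subN'] e(1)] eu by simp
        moreover have "u \<notin> ?N'" using w(2) by (simp add: u_def)
        ultimately show ?thesis
          using simple cyclic_stable[OF sN'(1) uF] unfolding Q.simple_Q_iff by blast
      qed
      have "fs.span (insert u B) = {v \<in> ?N. mul e v = v}"
      proof (intro equalityI subsetI)
        fix v assume "v \<in> fs.span (insert u B)"
        then obtain k where k: "v - cscale k u \<in> {v \<in> ?N'. mul e v = v}"
          unfolding fs.span_breakdown_eq B(3) by blast
        define n where "n = v - cscale k u"
        have n: "n \<in> ?N" "mul e n = n" using k sN'(2) by (auto simp: n_def)
        have v: "v = n + cscale k u" by (simp add: n_def)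
        show "v \<in> {v \<in> ?N. mul e v = v}"
          unfolding v using n uN eu
          by (simp add: fs.subspace_add[OF subN] fs.subspace_scale[OF subN] flinear_add[OF mul_linear(1)] flinear_scale[OF mul_linear(1)])
      next
        fix v assume v: "v \<in> {v \<in> ?N. mul e v = v}"
        then have "v \<in> ?L" using \<open>?L = ?N\<close> by simp
        then obtain n a where na: "n \<in> ?N'" "a \<in> funs X" "v = n + mul a u" by blast
        obtain c where c: "mul e (mul a e) = cscale c e" using schur[OF na(2)] by blast
        have "mul e (mul a u) = mul (mul e (mul a e)) u"
          using na(2) e(1) uF eu by (simp add: mul_assoc mul_closed)
        also have "\<dots> = cscale c u" unfolding c using eu by (simp add: flinear_scale[OF mul_linear(2)])
        finally have eau: "mul e (mul a u) = cscale c u" .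
        have nF: "n \<in> funs X" using na(1) sN sN' by blast
        have "v = mul e v" using v by simp
        also have "mul e v = mul e n + cscale c u" unfolding na(3) by (simp add: flinear_add[OF mul_linear(1)] eau)
        finally have "v - cscale c u = mul e n" by simp
        moreover have "mul e n \<in> ?N'" using sN'(1) e(1) na(1) by (simp add: stable_def)
        moreover have "mul e (mul e n) = mul e n" using mul_assoc[OF e(1) e(1) nF] e(2) by simp
        ultimately have "v - cscale c u \<in> fs.span B" unfolding B(3) by simp
        then show "v \<in> fs.span (insert u B)" unfolding fs.span_breakdown_eq by blast
      qed
      moreover have "u \<notin> B" using unotin fs.span_base by blast
      ultimately show ?thesis
        using B(1,2,4) card fs.independent_insertI[OF unotin B(2)] by (intro exI[of _ "insert u B"]) simp
    qed
  qed
  from this[OF diff_less[OF zero_less_one, of "length Ns"]] N(1) obtain B where B: "finite B" "fs.independent B"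
    "fs.span B = {v \<in> Ns ! (length Ns - 1). mul e v = v}" "card B = card {j. j < length Ns - 1 \<and> ?iso j}"
    by (elim exE conjE meta_impE) (simp, rule that)
  have "Ns ! (length Ns - 1) = ideal_of f" using N(1,3) by (simp add: last_conv_nth)
  moreover have "{j. j < length Ns - 1 \<and> ?iso j} = {j. Suc j < length Ns \<and> ?iso j}" by auto
  ultimately show ?thesis using B by (intro exI[of _ B]) simp
qed

theorem JH_multiplicity_trace:
  assumes f: "f \<in> funs X" "mul f f = f"
  shows "of_nat (JH_multiplicity (funs X) (proj f) (op_quotient (proj e) (Rad (funs X) (proj e)))) =
    (\<Sum>x\<in>X. mul e (mul (basis_vec x) f) x)"
proof -
  interpret P: opspace "funs X" mul "ideal_of f" by (rule opspace_stable[OF stable_ideal_of[OF f(1)]])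
  let ?cnt = "\<lambda>Ns. card {i. Suc i < length Ns \<and>
      op_iso (funs X) (op_quotient ((proj f)\<lparr>carrier := Ns ! Suc i\<rparr>) (Ns ! i)) head}"
  let ?T = "\<lambda>z. mul e (mul z f)"
  have linT: "flinear ?T"
    by (rule flinearI) (simp_all add: flinear_add[OF mul_linear(1)] flinear_add[OF mul_linear(2)]
      flinear_scale[OF mul_linear(1)] flinear_scale[OF mul_linear(2)])
  have cnt: "of_nat (?cnt Ns) = (\<Sum>x\<in>X. ?T (basis_vec x) x)"
    if Ns: "composition_series (funs X) (proj f) Ns" for Ns
  proof -
    obtain B where B: "finite B" "fs.independent B" "fs.span B = {v \<in> ideal_of f. mul e v = v}" "card B = ?cnt Ns"
      using series_basis[OF f(1) Ns] by (elim exE conjE) (rule that)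
    have "B \<subseteq> fs.span B" by (rule fs.span_superset)
    then have "B \<subseteq> funs X" using B(3) ideal_sub by blast
    have "(\<Sum>x\<in>X. ?T (basis_vec x) x) = of_nat (card B)"
    proof (rule trace_of_projection[OF finX linT _ _ B(1,2) \<open>B \<subseteq> funs X\<close>])
      show "?T v \<in> fs.span B" if v: "v \<in> funs X" for v
        unfolding B(3) ideal_of_def
        using mul_assoc[OF e(1) e(1) mul_closed] mul_assoc[OF e(1) mul_closed f(1)] mul_assoc[OF v f(1) f(1)] e(2) f(2)
        by (simp add: mul_closed)
      show "?T v = v" if "v \<in> fs.span B" for v using that unfolding B(3) ideal_of_def by simp
    qed
    then show ?thesis using B(4) by simp
  qed
  obtain Ns where Ns: "composition_series (funs X) (proj f) Ns"
    using P.composition_series_exists[OF finX ideal_sub] by blast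
  have "JH_multiplicity (funs X) (proj f) head = ?cnt Ns"
    unfolding JH_multiplicity_def
  proof (rule the_equality)
    show "\<exists>Ns'. composition_series (funs X) (proj f) Ns' \<and> ?cnt Ns = ?cnt Ns'"
      using Ns by (intro exI[of _ Ns] conjI refl)
    fix m assume "\<exists>Ns'. composition_series (funs X) (proj f) Ns' \<and> m = ?cnt Ns'"
    then obtain Ns' where "composition_series (funs X) (proj f) Ns'" "m = ?cnt Ns'" by blast
    then have "(of_nat m :: complex) = of_nat (?cnt Ns)" using cnt Ns by simp
    then show "m = ?cnt Ns" by (simp only: of_nat_eq_iff)
  qed
  then show ?thesis using cnt[OF Ns] unfolding Rad_proj by simp
qed

end



section \<open>The algebra of onto functions\<close>

text \<open>
  The intervals \<open>{1..k}\<close> are to keep this form under simplification.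
\<close>

declare One_nat_def [simp del]

lemma span_algebra_mult_double_sum:
  assumes "finite X"
  shows "monoid.mult (span_algebra X C E) a b x = (\<Sum>p\<in>X. \<Sum>q\<in>X. if C p q = Some x then a p * b q else 0)"
proof -
  have "monoid.mult (span_algebra X C E) a b x = (\<Sum>z\<in>{z \<in> X \<times> X. C (fst z) (snd z) = Some x}. a (fst z) * b (snd z))"
    by (simp add: span_algebra_def case_prod_unfold) (intro sum.cong; auto)
  also have "\<dots> = (\<Sum>z\<in>X \<times> X. if C (fst z) (snd z) = Some x then a (fst z) * b (snd z) else 0)"
    using assms by (intro sum.inter_filter) simp
  also have "\<dots> = (\<Sum>p\<in>X. \<Sum>q\<in>X. if C p q = Some x then a p * b q else 0)"
    by (simp add: sum.cartesian_product case_prod_unfold)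
  finally show ?thesis .
qed

lemma span_algebra_assoc:
  assumes X: "finite X"
    and closed: "\<And>p q x. p \<in> X \<Longrightarrow> q \<in> X \<Longrightarrow> C p q = Some x \<Longrightarrow> x \<in> X"
    and assoc: "\<And>p q r. p \<in> X \<Longrightarrow> q \<in> X \<Longrightarrow> r \<in> X \<Longrightarrow>
      Option.bind (C p q) (\<lambda>y. C y r) = Option.bind (C q r) (\<lambda>z. C p z)"
  shows "monoid.mult (span_algebra X C E) (monoid.mult (span_algebra X C E) a b) c =
    monoid.mult (span_algebra X C E) a (monoid.mult (span_algebra X C E) b c)"
proof
  fix x
  let ?A = "span_algebra X C E"
  have delta: "(\<Sum>y\<in>X. if m = Some y \<and> P y then t else 0) = (if \<exists>y. m = Some y \<and> P y then t else (0::complex))"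
    if "\<And>y. m = Some y \<Longrightarrow> y \<in> X" for m P t
  proof (cases m)
    case (Some y)
    then have "(\<Sum>y\<in>X. if m = Some y \<and> P y then t else 0) = (\<Sum>y'\<in>X. if y' = y then if P y then t else 0 else 0)"
      by (intro sum.cong) auto
    then show ?thesis using Some X that by simp
  qed simp
  have sw: "(\<Sum>y\<in>X. \<Sum>r\<in>X. \<Sum>p\<in>X. \<Sum>q\<in>X. F y r p q) = (\<Sum>r\<in>X. \<Sum>p\<in>X. \<Sum>q\<in>X. \<Sum>y\<in>X. F y r p q)"
    for F :: "'a \<Rightarrow> 'a \<Rightarrow> 'a \<Rightarrow> 'a \<Rightarrow> complex"
  proof -
    have "(\<Sum>y\<in>X. \<Sum>r\<in>X. \<Sum>p\<in>X. \<Sum>q\<in>X. F y r p q) = (\<Sum>r\<in>X. \<Sum>y\<in>X. \<Sum>p\<in>X. \<Sum>q\<in>X. F y r p q)"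
      by (rule sum.swap)
    also have "\<dots> = (\<Sum>r\<in>X. \<Sum>p\<in>X. \<Sum>y\<in>X. \<Sum>q\<in>X. F y r p q)"
      by (rule sum.cong[OF refl], rule sum.swap)
    also have "\<dots> = (\<Sum>r\<in>X. \<Sum>p\<in>X. \<Sum>q\<in>X. \<Sum>y\<in>X. F y r p q)"
      by (rule sum.cong[OF refl], rule sum.cong[OF refl], rule sum.swap)
    finally show ?thesis .
  qed
  have "monoid.mult ?A (monoid.mult ?A a b) c x =
    (\<Sum>y\<in>X. \<Sum>r\<in>X. \<Sum>p\<in>X. \<Sum>q\<in>X. if C p q = Some y \<and> C y r = Some x then a p * b q * c r else 0)"
    unfolding span_algebra_mult_double_sum[OF X]
  proof (rule sum.cong[OF refl], rule sum.cong[OF refl])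
    fix y r
    show "(if C y r = Some x then (\<Sum>p\<in>X. \<Sum>q\<in>X. if C p q = Some y then a p * b q else 0) * c r else 0) =
      (\<Sum>p\<in>X. \<Sum>q\<in>X. if C p q = Some y \<and> C y r = Some x then a p * b q * c r else 0)"
      by (cases "C y r = Some x") (simp_all add: sum_distrib_right if_distrib[of "\<lambda>t. t * c r"] cong: if_cong)
  qed
  also have "\<dots> = (\<Sum>r\<in>X. \<Sum>p\<in>X. \<Sum>q\<in>X. \<Sum>y\<in>X. if C p q = Some y \<and> C y r = Some x then a p * b q * c r else 0)"
    by (rule sw)
  also have "\<dots> = (\<Sum>r\<in>X. \<Sum>p\<in>X. \<Sum>q\<in>X. if \<exists>y. C p q = Some y \<and> C y r = Some x then a p * b q * c r else 0)"
  proof (rule sum.cong[OF refl], rule sum.cong[OF refl], rule sum.cong[OF refl])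
    fix r p q assume m: "r \<in> X" "p \<in> X" "q \<in> X"
    show "(\<Sum>y\<in>X. if C p q = Some y \<and> C y r = Some x then a p * b q * c r else 0) =
      (if \<exists>y. C p q = Some y \<and> C y r = Some x then a p * b q * c r else 0)"
      by (rule delta[of "C p q" "\<lambda>y. C y r = Some x" "a p * b q * c r", OF closed[OF m(2,3)]])
  qed
  also have "\<dots> = (\<Sum>r\<in>X. \<Sum>p\<in>X. \<Sum>q\<in>X. if \<exists>z. C q r = Some z \<and> C p z = Some x then a p * b q * c r else 0)"
  proof (rule sum.cong[OF refl], rule sum.cong[OF refl], rule sum.cong[OF refl])
    fix r p q assume "r \<in> X" "p \<in> X" "q \<in> X"
    from assoc[OF this(2,3,1)]
    have "Option.bind (C p q) (\<lambda>y. C y r) = Some x \<longleftrightarrow> Option.bind (C q r) (\<lambda>z. C p z) = Some x" by simp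
    then have "(\<exists>y. C p q = Some y \<and> C y r = Some x) \<longleftrightarrow> (\<exists>z. C q r = Some z \<and> C p z = Some x)"
      unfolding bind_eq_Some_conv .
    then show "(if \<exists>y. C p q = Some y \<and> C y r = Some x then a p * b q * c r else 0) =
      (if \<exists>z. C q r = Some z \<and> C p z = Some x then a p * b q * c r else 0)" by simp
  qed
  also have "\<dots> = (\<Sum>r\<in>X. \<Sum>p\<in>X. \<Sum>q\<in>X. \<Sum>z\<in>X. if C q r = Some z \<and> C p z = Some x then a p * b q * c r else 0)"
  proof (rule sum.cong[OF refl], rule sum.cong[OF refl], rule sum.cong[OF refl])
    fix r p q assume m: "r \<in> X" "p \<in> X" "q \<in> X"
    show "(if \<exists>z. C q r = Some z \<and> C p z = Some x then a p * b q * c r else 0) =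
      (\<Sum>z\<in>X. if C q r = Some z \<and> C p z = Some x then a p * b q * c r else 0)"
      by (rule delta[of "C q r" "\<lambda>z. C p z = Some x" "a p * b q * c r", OF closed[OF m(3,1)], symmetric])
  qed
  also have "\<dots> = (\<Sum>z\<in>X. \<Sum>r\<in>X. \<Sum>p\<in>X. \<Sum>q\<in>X. if C q r = Some z \<and> C p z = Some x then a p * b q * c r else 0)"
    by (rule sw[symmetric])
  also have "\<dots> = (\<Sum>z\<in>X. \<Sum>p\<in>X. \<Sum>q\<in>X. \<Sum>r\<in>X. if C q r = Some z \<and> C p z = Some x then a p * b q * c r else 0)"
  proof (rule sum.cong[OF refl])
    fix z
    let ?F = "\<lambda>r p q. if C q r = Some z \<and> C p z = Some x then a p * b q * c r else 0"
    have "(\<Sum>r\<in>X. \<Sum>p\<in>X. \<Sum>q\<in>X. ?F r p q) = (\<Sum>p\<in>X. \<Sum>r\<in>X. \<Sum>q\<in>X. ?F r p q)" by (rule sum.swap)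
    also have "\<dots> = (\<Sum>p\<in>X. \<Sum>q\<in>X. \<Sum>r\<in>X. ?F r p q)" by (rule sum.cong[OF refl], rule sum.swap)
    finally show "(\<Sum>r\<in>X. \<Sum>p\<in>X. \<Sum>q\<in>X. ?F r p q) = (\<Sum>p\<in>X. \<Sum>q\<in>X. \<Sum>r\<in>X. ?F r p q)" .
  qed
  also have "\<dots> = (\<Sum>p\<in>X. \<Sum>z\<in>X. \<Sum>q\<in>X. \<Sum>r\<in>X. if C q r = Some z \<and> C p z = Some x then a p * b q * c r else 0)"
    by (rule sum.swap)
  also have "\<dots> = monoid.mult ?A a (monoid.mult ?A b c) x"
    unfolding span_algebra_mult_double_sum[OF X]
  proof (rule sum.cong[OF refl], rule sum.cong[OF refl])
    fix p z
    show "(\<Sum>q\<in>X. \<Sum>r\<in>X. if C q r = Some z \<and> C p z = Some x then a p * b q * c r else 0) =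
      (if C p z = Some x then a p * (\<Sum>q\<in>X. \<Sum>r\<in>X. if C q r = Some z then b q * c r else 0) else 0)"
      by (cases "C p z = Some x") (simp_all add: sum_distrib_left if_distrib[of "\<lambda>t. a p * t"] mult.assoc cong: if_cong)
  qed
  finally show "monoid.mult ?A (monoid.mult ?A a b) c x = monoid.mult ?A a (monoid.mult ?A b c) x" .
qed

definition onto :: "nat \<Rightarrow> nat \<Rightarrow> (nat \<Rightarrow> nat) set"
  where "onto r k = {f. f ` {1..r} = {1..k} \<and> (\<forall>x. x \<notin> {1..r} \<longrightarrow> f x = x)}"

definition SE_mors :: "nat \<Rightarrow> SE_mor set"
  where "SE_mors n = (\<Union>r\<le>n. \<Union>k\<le>n. SE_hom n r k)"

lemma SE_mors_iff: "(r, k, f) \<in> SE_mors n \<longleftrightarrow> r \<le> n \<and> k \<le> n \<and> f \<in> onto r k"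
  by (auto simp: SE_mors_def SE_hom_def onto_def)

lemma SE_hom_eq: "r \<le> n \<Longrightarrow> k \<le> n \<Longrightarrow> SE_hom n r k = (\<lambda>f. (r, k, f)) ` onto r k"
  by (auto simp: SE_hom_def onto_def)

lemma finite_onto: "finite (onto r k)"
proof (rule finite_subset)
  show "onto r k \<subseteq> (\<lambda>h x. if x \<in> {1..r} then h x else x) ` (\<Pi>\<^sub>E x\<in>{1..r}. {1..k})"
  proof
    fix f assume f: "f \<in> onto r k"
    show "f \<in> (\<lambda>h x. if x \<in> {1..r} then h x else x) ` (\<Pi>\<^sub>E x\<in>{1..r}. {1..k})"
      by (rule image_eqI[of _ _ "restrict f {1..r}"]) (use f in \<open>auto simp: onto_def fun_eq_iff\<close>)
  qed
qed (intro finite_imageI finite_PiE; simp)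

lemma finite_SE_mors: "finite (SE_mors n)"
  unfolding SE_mors_def by (auto simp: SE_hom_eq finite_onto)

lemma onto_le: "f \<in> onto r k \<Longrightarrow> k \<le> r"
  using card_image_le[of "{1..r}" f] by (simp add: onto_def)

lemma onto_comp:
  assumes "f \<in> onto r k" "g \<in> onto k l"
  shows "g \<circ> f \<in> onto r l"
proof -
  have "f ` {1..r} = {1..k}" "g ` {1..k} = {1..l}" using assms unfolding onto_def by blast+
  then have "(g \<circ> f) ` {1..r} = {1..l}" by (simp only: image_comp[symmetric])
  moreover have "(g \<circ> f) x = x" if "x \<notin> {1..r}" for x
    using that assms onto_le[OF assms(1)] by (auto simp: onto_def)
  ultimately show ?thesis by (simp add: onto_def)
qed

lemma onto_self_iff: "f \<in> onto k k \<longleftrightarrow> f permutes {1..k}"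
proof
  assume f: "f \<in> onto k k"
  then have im: "f ` {1..k} = {1..k}" and out: "\<And>x. x \<notin> {1..k} \<Longrightarrow> f x = x" by (auto simp: onto_def)
  have "inj_on f {1..k}" by (rule eq_card_imp_inj_on) (simp_all only: finite_atLeastAtMost im)
  then show "f permutes {1..k}"
    using im out by (intro bij_imp_permutes) (auto simp: bij_betw_def)
next
  assume "f permutes {1..k}"
  then show "f \<in> onto k k" by (simp add: onto_def permutes_image permutes_not_in)
qed

lemma SE_comp_closed:
  assumes "p \<in> SE_mors n" "q \<in> SE_mors n" "SE_comp p q = Some x"
  shows "x \<in> SE_mors n"
  using assms onto_comp
  by (cases p; cases q; cases x) (auto simp: SE_comp_def SE_mors_iff split: if_splits)

lemma SE_comp_assoc: "Option.bind (SE_comp p q) (\<lambda>y. SE_comp y r) = Option.bind (SE_comp q r) (\<lambda>z. SE_comp p z)"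
  by (cases p; cases q; cases r) (auto simp: SE_comp_def o_assoc)

abbreviation semul :: "nat \<Rightarrow> (SE_mor \<Rightarrow> complex) \<Rightarrow> (SE_mor \<Rightarrow> complex) \<Rightarrow> SE_mor \<Rightarrow> complex"
  where "semul n \<equiv> monoid.mult (SE_algebra n)"

lemma SE_algebra_eq: "SE_algebra n = span_algebra (SE_mors n) SE_comp {(k, k, id) | k. k \<le> n}"
  by (simp add: SE_algebra_def SE_mors_def)

lemma carrier_SE_algebra: "carrier (SE_algebra n) = funs (SE_mors n)"
  by (simp add: SE_algebra_eq carrier_span_algebra)

lemma semul_double_sum:
  "semul n a b x = (\<Sum>p\<in>SE_mors n. \<Sum>q\<in>SE_mors n. if SE_comp p q = Some x then a p * b q else 0)"
  unfolding SE_algebra_eq by (rule span_algebra_mult_double_sum[OF finite_SE_mors])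

abbreviation Sym :: "nat \<Rightarrow> (nat \<Rightarrow> nat) set"
  where "Sym k \<equiv> {p. p permutes {1..k}}"

lemma carrier_sym: "carrier (sym_group k) = Sym k"
  by (simp add: sym_group_def)

lemma finite_Sym: "finite (Sym k)"
  by (rule finite_permutations[OF finite_atLeastAtMost])

lemma fin_group_sym: "fin_group (sym_group k)"
  by (intro fin_group.intro fin_group_axioms.intro sym_group_is_group) (simp add: carrier_sym finite_Sym)

lemma inv_sym: "p permutes {1..k} \<Longrightarrow> m_inv (sym_group k) p = inv' p"
  by (simp add: sym_group_carrier)

lemma permutes_comp_eq_iff:
  "y permutes A \<Longrightarrow> y \<circ> f = g \<longleftrightarrow> f = inv' y \<circ> g" "y permutes A \<Longrightarrow> f \<circ> y = g \<longleftrightarrow> f = g \<circ> inv' y"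
  by (auto simp: o_assoc permutes_inv_o) (auto simp: o_assoc[symmetric] permutes_inv_o)

lemma SE_incl_mult_left:
  assumes e: "e \<in> funs (Sym k)" and k: "k \<le> n" and z: "z \<in> funs (SE_mors n)"
  shows "semul n (SE_incl k e) z (r, l, f) =
    (if l = k then \<Sum>y\<in>Sym k. e y * z (r, k, inv' y \<circ> f) else 0)"
proof -
  have sub: "(\<lambda>y. (k, k, y)) ` Sym k \<subseteq> SE_mors n" using k by (auto simp: SE_mors_iff onto_self_iff)
  let ?in = "\<lambda>p. \<Sum>q\<in>SE_mors n. if SE_comp p q = Some (r, l, f) then SE_incl k e p * z q else 0"
  have "semul n (SE_incl k e) z (r, l, f) = (\<Sum>p\<in>SE_mors n. ?in p)" by (rule semul_double_sum)
  also have "\<dots> = (\<Sum>p\<in>(\<lambda>y. (k, k, y)) ` Sym k. ?in p)"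
  proof (rule sum.mono_neutral_right[OF finite_SE_mors sub], rule ballI)
    fix p assume p: "p \<in> SE_mors n - (\<lambda>y. (k, k, y)) ` Sym k"
    have "SE_incl k e p = 0"
      using p e by (cases p) (auto simp: SE_incl_def funs_def)
    then show "?in p = 0" by (intro sum.neutral) simp
  qed
  also have "\<dots> = (\<Sum>y\<in>Sym k. ?in (k, k, y))"
    by (subst sum.reindex) (auto simp: inj_on_def)
  also have "\<dots> = (\<Sum>y\<in>Sym k. if l = k then e y * z (r, k, inv' y \<circ> f) else 0)"
  proof (rule sum.cong[OF refl])
    fix y assume y: "y \<in> Sym k"
    then have yp: "y permutes {1..k}" by simp
    have "SE_comp (k, k, y) q = Some (r, l, f) \<longleftrightarrow> l = k \<and> q = (r, k, inv' y \<circ> f)" for q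
      using permutes_comp_eq_iff(1)[OF yp] by (cases q) (auto simp: SE_comp_def)
    then have "?in (k, k, y) = (\<Sum>q\<in>SE_mors n. if q = (r, k, inv' y \<circ> f) then if l = k then e y * z (r, k, inv' y \<circ> f) else 0 else 0)"
      by (intro sum.cong refl) (auto simp: SE_incl_def)
    also have "\<dots> = (if l = k then e y * z (r, k, inv' y \<circ> f) else 0)"
      using z finite_SE_mors by (auto simp: funs_def)
    finally show "?in (k, k, y) = (if l = k then e y * z (r, k, inv' y \<circ> f) else 0)" .
  qed
  finally show ?thesis by simp
qed

lemma SE_incl_mult_right:
  assumes e: "e \<in> funs (Sym k)" and k: "k \<le> n" and z: "z \<in> funs (SE_mors n)"
  shows "semul n z (SE_incl k e) (r, l, f) =
    (if r = k then \<Sum>h\<in>Sym k. e h * z (k, l, f \<circ> inv' h) else 0)"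
proof -
  have sub: "(\<lambda>y. (k, k, y)) ` Sym k \<subseteq> SE_mors n" using k by (auto simp: SE_mors_iff onto_self_iff)
  let ?in = "\<lambda>q. \<Sum>p\<in>SE_mors n. if SE_comp p q = Some (r, l, f) then z p * SE_incl k e q else 0"
  have "semul n z (SE_incl k e) (r, l, f) = (\<Sum>q\<in>SE_mors n. ?in q)"
    unfolding semul_double_sum by (rule sum.swap)
  also have "\<dots> = (\<Sum>p\<in>(\<lambda>y. (k, k, y)) ` Sym k. ?in p)"
  proof (rule sum.mono_neutral_right[OF finite_SE_mors sub], rule ballI)
    fix p assume p: "p \<in> SE_mors n - (\<lambda>y. (k, k, y)) ` Sym k"
    have "SE_incl k e p = 0"
      using p e by (cases p) (auto simp: SE_incl_def funs_def)
    then show "?in p = 0" by (intro sum.neutral) simp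
  qed
  also have "\<dots> = (\<Sum>y\<in>Sym k. ?in (k, k, y))"
    by (subst sum.reindex) (auto simp: inj_on_def)
  also have "\<dots> = (\<Sum>h\<in>Sym k. if r = k then e h * z (k, l, f \<circ> inv' h) else 0)"
  proof (rule sum.cong[OF refl])
    fix y assume y: "y \<in> Sym k"
    then have yp: "y permutes {1..k}" by simp
    have "SE_comp p (k, k, y) = Some (r, l, f) \<longleftrightarrow> r = k \<and> p = (k, l, f \<circ> inv' y)" for p
      using permutes_comp_eq_iff(2)[OF yp] by (cases p) (auto simp: SE_comp_def)
    then have "?in (k, k, y) = (\<Sum>p\<in>SE_mors n. if p = (k, l, f \<circ> inv' y) then if r = k then e y * z (k, l, f \<circ> inv' y) else 0 else 0)"
      by (intro sum.cong refl) (auto simp: SE_incl_def)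
    also have "\<dots> = (if r = k then e y * z (k, l, f \<circ> inv' y) else 0)"
      using z finite_SE_mors by (auto simp: funs_def)
    finally show "?in (k, k, y) = (if r = k then e y * z (k, l, f \<circ> inv' y) else 0)" .
  qed
  finally show ?thesis by simp
qed

lemma semul_closed: "semul n a b \<in> funs (SE_mors n)"
  unfolding SE_algebra_eq by (rule span_algebra_mult_closed) (rule SE_comp_closed)

lemma SE_incl_funs: "e \<in> funs (Sym k) \<Longrightarrow> k \<le> n \<Longrightarrow> SE_incl k e \<in> funs (SE_mors n)"
  by (auto simp: funs_def SE_incl_def SE_mors_iff onto_self_iff)

lemma gmult_sym_left:
  assumes "x \<in> Sym k"
  shows "gmult (sym_group k) a b x = (\<Sum>g\<in>Sym k. a g * b (inv' g \<circ> x))"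
proof -
  interpret fin_group "sym_group k" by (rule fin_group_sym)
  show ?thesis using gmult_apply[of x a b] assms
    by (simp add: carrier_sym sym_group_mult inv_sym)
qed

lemma gmult_sym_funs: "gmult (sym_group k) a b \<in> funs (Sym k)"
proof -
  interpret fin_group "sym_group k" by (rule fin_group_sym)
  show ?thesis using gmult_closed[of a b] by (simp add: carrier_sym)
qed

lemma comp_inv_not_perm: "y permutes A \<Longrightarrow> \<not> f permutes A \<Longrightarrow> \<not> (inv' y \<circ> f) permutes A"
  using permutes_compose[of "inv' y \<circ> f" A y] by (auto simp: o_assoc permutes_inv_o)

lemma SE_incl_gmult:
  assumes a: "a \<in> funs (Sym k)" and b: "b \<in> funs (Sym k)" and k: "k \<le> n"
  shows "semul n (SE_incl k a) (SE_incl k b) = SE_incl k (gmult (sym_group k) a b)"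
proof
  fix x :: SE_mor
  obtain r l f where x: "x = (r, l, f)" by (cases x)
  have "semul n (SE_incl k a) (SE_incl k b) (r, l, f) =
    (if l = k then \<Sum>y\<in>Sym k. a y * SE_incl k b (r, k, inv' y \<circ> f) else 0)"
    by (rule SE_incl_mult_left[OF a k SE_incl_funs[OF b k]])
  also have "\<dots> = SE_incl k (gmult (sym_group k) a b) (r, l, f)"
  proof (cases "f \<in> Sym k")
    case True
    then show ?thesis by (simp add: SE_incl_def gmult_sym_left)
  next
    case False
    then have "b (inv' y \<circ> f) = 0" if "y \<in> Sym k" for y
      using b comp_inv_not_perm[of y "{1..k}" f] that by (simp add: funs_def)
    moreover have "gmult (sym_group k) a b f = 0"
      using gmult_sym_funs[of k a b] False by (simp add: funs_def)
    ultimately show ?thesis by (simp add: SE_incl_def)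
  qed
  finally show "semul n (SE_incl k a) (SE_incl k b) x = SE_incl k (gmult (sym_group k) a b) x"
    unfolding x .
qed

lemma fin_algebra_SE:
  "fin_algebra (SE_mors n) (semul n) (\<lambda>x. if x \<in> {(k, k, id) | k. k \<le> n} then 1 else 0)"
proof (rule fin_algebra.intro)
  show "finite (SE_mors n)" by (rule finite_SE_mors)
  show "Vector_Spaces.linear cscale cscale (semul n a)" for a
    unfolding SE_algebra_eq by (rule span_algebra_mult_linear)
  show "Vector_Spaces.linear cscale cscale (\<lambda>a. semul n a b)" for b
    unfolding SE_algebra_eq by (rule span_algebra_mult_linear)
  show "semul n a b \<in> funs (SE_mors n)" for a b by (rule semul_closed)
  show "semul n (semul n a b) c = semul n a (semul n b c)" for a b c
    unfolding SE_algebra_eq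
    by (rule span_algebra_assoc[OF finite_SE_mors SE_comp_closed SE_comp_assoc])
  let ?u = "\<lambda>x::SE_mor. if x \<in> {(k, k, id) | k. k \<le> n} then 1 else 0 :: complex"
  have idm: "(k, k, id) \<in> SE_mors n" if "k \<le> n" for k
    using that by (simp add: SE_mors_iff onto_self_iff permutes_id)
  show "?u \<in> funs (SE_mors n)" using idm by (auto simp: funs_def)
  fix a :: "SE_mor \<Rightarrow> complex" assume a: "a \<in> funs (SE_mors n)"
  show "semul n ?u a = a"
  proof
    fix x :: SE_mor
    obtain r l f where x: "x = (r, l, f)" by (cases x)
    have ax: "a x = 0" if "x \<notin> SE_mors n" using a that unfolding funs_def by blast
    have "semul n ?u a x = (\<Sum>p\<in>SE_mors n. \<Sum>q\<in>SE_mors n. if p = (l, l, id) \<and> q = x then ?u p * a q else 0)"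
      unfolding semul_double_sum
      by (intro sum.cong refl) (auto simp: SE_comp_def x split: if_splits)
    also have "\<dots> = (\<Sum>p\<in>SE_mors n. if p = (l, l, id) then ?u p * a x else 0)"
    proof (rule sum.cong[OF refl])
      fix p
      have "(\<Sum>q\<in>SE_mors n. if p = (l, l, id) \<and> q = x then ?u p * a q else 0) =
        (\<Sum>q\<in>SE_mors n. if q = x then if p = (l, l, id) then ?u p * a x else 0 else 0)"
        by (intro sum.cong refl) auto
      also have "\<dots> = (if p = (l, l, id) then ?u p * a x else 0)"
        by (cases "x \<in> SE_mors n") (simp_all add: finite_SE_mors ax)
      finally show "(\<Sum>q\<in>SE_mors n. if p = (l, l, id) \<and> q = x then ?u p * a q else 0) =
        (if p = (l, l, id) then ?u p * a x else 0)" .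
    qed
    also have "\<dots> = (if (l, l, id) \<in> SE_mors n then ?u (l, l, id) * a x else 0)"
      using finite_SE_mors by (simp add: sum.delta)
    also have "\<dots> = a x"
    proof (cases "x \<in> SE_mors n")
      case True
      then have "l \<le> n" by (simp add: x SE_mors_iff)
      then show ?thesis using idm by simp
    next
      case False
      then show ?thesis by (simp add: ax)
    qed
    finally show "semul n ?u a x = a x" .
  qed
qed

lemma gmult_sym_right:
  assumes x: "x \<in> Sym k"
  shows "gmult (sym_group k) a b x = (\<Sum>h\<in>Sym k. b h * a (x \<circ> inv' h))"
  unfolding gmult_sym_left[OF x]
proof (rule sum.reindex_bij_witness[of _ "\<lambda>h. x \<circ> inv' h" "\<lambda>g. inv' g \<circ> x"])
  fix g assume g: "g \<in> Sym k"
  have bx: "bij x" "bij g" using x g by (auto simp: permutes_bij)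
  have i: "inv' (inv' g \<circ> x) = inv' x \<circ> g"
    using bx by (simp add: o_inv_distrib bij_imp_bij_inv inv_inv_eq)
  show "x \<circ> inv' (inv' g \<circ> x) = g"
    unfolding i using x by (simp add: o_assoc permutes_inv_o)
  then show "b (inv' g \<circ> x) * a (x \<circ> inv' (inv' g \<circ> x)) = a g * b (inv' g \<circ> x)" by simp
  show "inv' g \<circ> x \<in> Sym k" using x g by (simp add: permutes_compose permutes_inv)
next
  fix h assume h: "h \<in> Sym k"
  have bx: "bij x" "bij h" using x h by (auto simp: permutes_bij)
  have i: "inv' (x \<circ> inv' h) = h \<circ> inv' x"
    using bx by (simp add: o_inv_distrib bij_imp_bij_inv inv_inv_eq)
  show "inv' (x \<circ> inv' h) \<circ> x = h"
    unfolding i using x by (simp add: o_assoc[symmetric] permutes_inv_o)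
  show "x \<circ> inv' h \<in> Sym k" using x h by (simp add: permutes_compose permutes_inv)
qed

text \<open>
  Between two copies of the idempotent only the endomorphisms of \<open>k\<close> survive, and these form \<open>S\<^sub>k\<close>. So \<open>e A e\<close> for
  the category algebra is \<open>e \<complex>S\<^sub>k e\<close>.
\<close>

lemma SE_incl_sandwich:
  assumes e: "e \<in> funs (Sym k)" and k: "k \<le> n" and a: "a \<in> funs (SE_mors n)"
  shows "semul n (SE_incl k e) (semul n a (SE_incl k e)) =
    SE_incl k (gmult (sym_group k) e (gmult (sym_group k) (\<lambda>f. a (k, k, f)) e))"
proof
  fix x :: SE_mor
  obtain r l f where x: "x = (r, l, f)" by (cases x)
  have a0: "a (k, k, f) = 0" if "f \<notin> Sym k" for f
    using that a k by (auto simp: funs_def SE_mors_iff onto_self_iff)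
  have r: "semul n a (SE_incl k e) (r, k, f) = (if r = k then gmult (sym_group k) (\<lambda>f. a (k, k, f)) e f else 0)" for f
  proof (cases "f \<in> Sym k")
    case True
    then show ?thesis by (simp add: SE_incl_mult_right[OF e k a] gmult_sym_right)
  next
    case False
    have "a (k, k, f \<circ> inv' h) = 0" if h: "h \<in> Sym k" for h
    proof (rule a0, rule notI)
      assume "f \<circ> inv' h \<in> Sym k"
      then have "f \<circ> inv' h \<circ> h \<in> Sym k" using permutes_compose[of h "{1..k}" "f \<circ> inv' h"] h by simp
      then show False using h False by (simp add: o_assoc[symmetric] permutes_inv_o)
    qed
    moreover have "gmult (sym_group k) (\<lambda>f. a (k, k, f)) e f = 0"
      using gmult_sym_funs[of k "\<lambda>f. a (k, k, f)" e] False by (simp add: funs_def)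
    ultimately show ?thesis by (simp add: SE_incl_mult_right[OF e k a])
  qed
  let ?g = "gmult (sym_group k) (\<lambda>f. a (k, k, f)) e"
  have "semul n (SE_incl k e) (semul n a (SE_incl k e)) (r, l, f) =
    (if l = k then \<Sum>y\<in>Sym k. e y * (if r = k then ?g (inv' y \<circ> f) else 0) else 0)"
    unfolding SE_incl_mult_left[OF e k semul_closed] r ..
  also have "\<dots> = SE_incl k (gmult (sym_group k) e ?g) (r, l, f)"
  proof (cases "f \<in> Sym k")
    case True
    then show ?thesis by (simp add: SE_incl_def gmult_sym_left[of f k e ?g])
  next
    case False
    then have "?g (inv' y \<circ> f) = 0" if "y \<in> Sym k" for y
      using gmult_sym_funs[of k "\<lambda>f. a (k, k, f)" e] comp_inv_not_perm[of y "{1..k}" f] that by (simp add: funs_def)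
    moreover have "gmult (sym_group k) e ?g f = 0"
      using gmult_sym_funs[of k e ?g] False by (simp add: funs_def)
    ultimately show ?thesis by (simp add: SE_incl_def)
  qed
  finally show "semul n (SE_incl k e) (semul n a (SE_incl k e)) x = SE_incl k (gmult (sym_group k) e ?g) x"
    unfolding x .
qed

lemma primitive_idem_sym:
  assumes "primitive_idempotent (group_algebra (sym_group k)) e"
  shows "primitive_idem (sym_group k) e"
  by (intro primitive_idem.intro fin_group_sym primitive_idem_axioms.intro assms)

lemma schur_algebra_SE:
  assumes e: "primitive_idem (sym_group k) e" and k: "k \<le> n"
  shows "schur_algebra (SE_mors n) (semul n) (\<lambda>x. if x \<in> {(k, k, id) | k. k \<le> n} then 1 else 0) (SE_incl k e)"
proof (intro schur_algebra.intro fin_algebra_SE schur_algebra_axioms.intro)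
  interpret primitive_idem "sym_group k" e by fact
  have eF: "e \<in> funs (Sym k)" using e_funs by (simp add: carrier_sym)
  show "SE_incl k e \<in> funs (SE_mors n)" by (rule SE_incl_funs[OF eF k])
  show "semul n (SE_incl k e) (SE_incl k e) = SE_incl k e"
    by (simp add: SE_incl_gmult[OF eF eF k] e_idem)
  show "SE_incl k e \<noteq> 0"
  proof
    assume z: "SE_incl k e = 0"
    have "e f = 0" for f using fun_cong[OF z, of "(k, k, f)"] by (simp add: SE_incl_def zero_fun_def)
    then show False using e_nonzero by (simp add: zero_fun_def fun_eq_iff)
  qed
  fix a assume a: "a \<in> funs (SE_mors n)"
  obtain c where c: "gmult (sym_group k) e (gmult (sym_group k) (\<lambda>f. a (k, k, f)) e) = cscale c e"
    using schur by blast
  have "SE_incl k (cscale c e) = cscale c (SE_incl k e)"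
    by (auto simp: SE_incl_def cscale_def fun_eq_iff)
  then show "\<exists>c. semul n (SE_incl k e) (semul n a (SE_incl k e)) = cscale c (SE_incl k e)"
    unfolding SE_incl_sandwich[OF eF k a] c by blast
qed

definition fixed_point_sum :: "nat \<Rightarrow> nat \<Rightarrow> ((nat \<Rightarrow> nat) \<Rightarrow> complex) \<Rightarrow> ((nat \<Rightarrow> nat) \<Rightarrow> complex) \<Rightarrow> complex"
  where "fixed_point_sum r k a b =
    (\<Sum>f\<in>onto r k. \<Sum>y\<in>Sym k. \<Sum>h\<in>Sym r. if y \<circ> f \<circ> h = f then a y * b h else 0)"

lemma JH_multiplicity_SE:
  assumes e: "primitive_idem (sym_group k) e" and k: "k \<le> n"
    and f: "f \<in> funs (Sym r)" "gmult (sym_group r) f f = f" and r: "r \<le> n"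
  shows "of_nat (JH_multiplicity (carrier (SE_algebra n)) (SE_proj n r f) (SE_simple n k e)) =
    fixed_point_sum r k e f"
proof -
  interpret schur_algebra "SE_mors n" "semul n" "\<lambda>x. if x \<in> {(k, k, id) | k. k \<le> n} then 1 else 0" "SE_incl k e"
    by (rule schur_algebra_SE[OF e k])
  interpret pe: primitive_idem "sym_group k" e by fact
  have eF: "e \<in> funs (Sym k)" using pe.e_funs by (simp add: carrier_sym)
  have proj_eq: "SE_proj n m g = proj (SE_incl m g)"
    if g: "SE_incl m g \<in> funs (SE_mors n)" "semul n (SE_incl m g) (SE_incl m g) = SE_incl m g" for m g
  proof -
    have "{semul n a (SE_incl m g) | a. a \<in> carrier (SE_algebra n)} = ideal_of (SE_incl m g)"
    proof (intro equalityI subsetI)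
      fix x assume "x \<in> {semul n a (SE_incl m g) | a. a \<in> carrier (SE_algebra n)}"
      then obtain a where a: "a \<in> funs (SE_mors n)" "x = semul n a (SE_incl m g)"
        by (auto simp: carrier_SE_algebra)
      then show "x \<in> ideal_of (SE_incl m g)"
        using mul_assoc[OF a(1) g(1) g(1)] g(2) by (simp add: ideal_of_def semul_closed)
    next
      fix x assume "x \<in> ideal_of (SE_incl m g)"
      then have "x = semul n x (SE_incl m g)" "x \<in> carrier (SE_algebra n)"
        by (simp_all add: ideal_of_def carrier_SE_algebra)
      then show "x \<in> {semul n a (SE_incl m g) | a. a \<in> carrier (SE_algebra n)}" by blast
    qed
    then show ?thesis by (simp add: SE_proj_def left_ideal_def)
  qed
  have iF: "SE_incl r f \<in> funs (SE_mors n)" "semul n (SE_incl r f) (SE_incl r f) = SE_incl r f"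
    using SE_incl_funs[OF f(1) r] SE_incl_gmult[OF f(1) f(1) r] f(2) by simp_all
  have "of_nat (JH_multiplicity (carrier (SE_algebra n)) (SE_proj n r f) (SE_simple n k e)) =
    (\<Sum>x\<in>SE_mors n. semul n (SE_incl k e) (semul n (basis_vec x) (SE_incl r f)) x)"
    unfolding SE_simple_def carrier_SE_algebra proj_eq[OF iF] proj_eq[OF e(1,2)]
    by (rule JH_multiplicity_trace[OF iF])
  also have "\<dots> = (\<Sum>x\<in>SE_hom n r k. semul n (SE_incl k e) (semul n (basis_vec x) (SE_incl r f)) x)"
  proof (rule sum.mono_neutral_right[OF finite_SE_mors])
    show "SE_hom n r k \<subseteq> SE_mors n" using r k by (auto simp: SE_mors_def)
    show "\<forall>x\<in>SE_mors n - SE_hom n r k. semul n (SE_incl k e) (semul n (basis_vec x) (SE_incl r f)) x = 0"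
    proof
      fix x assume x: "x \<in> SE_mors n - SE_hom n r k"
      obtain r' l g where xe: "x = (r', l, g)" by (cases x)
      have ne: "\<not> (r' = r \<and> l = k)" using x k r unfolding xe by (auto simp: SE_mors_iff SE_hom_eq)
      have xF: "basis_vec x \<in> funs (SE_mors n)" using x by (intro basis_vec_in_funs) blast
      show "semul n (SE_incl k e) (semul n (basis_vec x) (SE_incl r f)) x = 0"
        using ne unfolding xe SE_incl_mult_left[OF eF k semul_closed] SE_incl_mult_right[OF f(1) r xF[unfolded xe]] by auto
    qed
  qed
  also have "\<dots> = (\<Sum>g\<in>onto r k. semul n (SE_incl k e) (semul n (basis_vec (r, k, g)) (SE_incl r f)) (r, k, g))"
    unfolding SE_hom_eq[OF r k] by (subst sum.reindex) (auto simp: inj_on_def)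
  also have "\<dots> = fixed_point_sum r k e f"
    unfolding fixed_point_sum_def
  proof (rule sum.cong[OF refl])
    fix g assume g: "g \<in> onto r k"
    have xF: "basis_vec (r, k, g) \<in> funs (SE_mors n)"
      using g r k by (intro basis_vec_in_funs) (simp add: SE_mors_iff)
    have "semul n (SE_incl k e) (semul n (basis_vec (r, k, g)) (SE_incl r f)) (r, k, g) =
      (\<Sum>y\<in>Sym k. e y * (\<Sum>h\<in>Sym r. f h * basis_vec (r, k, g) (r, k, inv' y \<circ> g \<circ> inv' h)))"
      unfolding SE_incl_mult_left[OF eF k semul_closed] SE_incl_mult_right[OF f(1) r xF] by simp
    also have "\<dots> = (\<Sum>y\<in>Sym k. \<Sum>h\<in>Sym r. if y \<circ> g \<circ> h = g then e y * f h else 0)"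
      unfolding sum_distrib_left
    proof (intro sum.cong refl)
      fix y h assume "y \<in> Sym k" "h \<in> Sym r"
      then have yh: "y permutes {1..k}" "h permutes {1..r}" by simp_all
      have "y \<circ> g \<circ> h = g \<longleftrightarrow> inv' y \<circ> g \<circ> inv' h = g"
        using permutes_comp_eq_iff(2)[OF yh(2), of "y \<circ> g" g] permutes_comp_eq_iff(1)[OF yh(1), of g "g \<circ> inv' h"]
        by (auto simp: o_assoc)
      then show "e y * (f h * basis_vec (r, k, g) (r, k, inv' y \<circ> g \<circ> inv' h)) =
        (if y \<circ> g \<circ> h = g then e y * f h else 0)"
        by (simp add: basis_vec_def)
    qed
    finally show "semul n (SE_incl k e) (semul n (basis_vec (r, k, g)) (SE_incl r f)) (r, k, g) =
      (\<Sum>y\<in>Sym k. \<Sum>h\<in>Sym r. if y \<circ> g \<circ> h = g then e y * f h else 0)" .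
  qed
  finally show ?thesis .
qed



section \<open>Specht modules and outer tensor products\<close>

lemma frep_of_iso:
  assumes V: "frep G \<rho> V" and lin': "\<And>g. g \<in> carrier G \<Longrightarrow> flinear (\<rho>' g)"
    and p: "bij_betw \<phi> V V'" "\<And>u v. u \<in> V \<Longrightarrow> v \<in> V \<Longrightarrow> \<phi> (u + v) = \<phi> u + \<phi> v"
      "\<And>c v. v \<in> V \<Longrightarrow> \<phi> (cscale c v) = cscale c (\<phi> v)"
      "\<And>g v. g \<in> carrier G \<Longrightarrow> v \<in> V \<Longrightarrow> \<phi> (\<rho> g v) = \<rho>' g (\<phi> v)"
  shows "frep G \<rho>' V'"
proof -
  interpret V: frep G \<rho> V by fact
  have ex: "\<exists>v\<in>V. w = \<phi> v" if "w \<in> V'" for w using p(1) that by (auto simp: bij_betw_def)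
  have im: "\<phi> v \<in> V'" if "v \<in> V" for v using p(1) that by (auto simp: bij_betw_def)
  have z: "\<phi> 0 = 0" using p(3)[OF fs.subspace_0[OF V.subV], of 0] by simp
  show ?thesis
  proof (intro frep.intro opspace.intro frep_axioms.intro V.fin_group_axioms lin')
    show "stable (carrier G) \<rho>' V'"
      unfolding stable_def fs.subspace_def
    proof (intro conjI ballI allI)
      show "0 \<in> V'" using im[OF fs.subspace_0[OF V.subV]] z by simp
    next
      fix x y assume "x \<in> V'" "y \<in> V'"
      then obtain v w where h: "v \<in> V" "x = \<phi> v" "w \<in> V" "y = \<phi> w" using ex by blast
      show "x + y \<in> V'" unfolding h using im[OF fs.subspace_add[OF V.subV h(1,3)]] p(2)[OF h(1,3)] by simp
    next
      fix c x assume "x \<in> V'"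
      then obtain v where h: "v \<in> V" "x = \<phi> v" using ex by blast
      show "cscale c x \<in> V'" unfolding h using im[OF fs.subspace_scale[OF V.subV h(1)]] p(3)[OF h(1)] by simp
    next
      fix g x assume g: "g \<in> carrier G" and "x \<in> V'"
      then obtain v where h: "v \<in> V" "x = \<phi> v" using ex by blast
      show "\<rho>' g x \<in> V'" unfolding h using im[OF V.closed[OF g h(1)]] p(4)[OF g h(1)] by simp
    qed
    fix g h x assume gh: "g \<in> carrier G" "h \<in> carrier G" and "x \<in> V'"
    then obtain v where v: "v \<in> V" "x = \<phi> v" using ex by blast
    have "\<rho>' (g \<otimes>\<^bsub>G\<^esub> h) (\<phi> v) = \<phi> (\<rho> (g \<otimes>\<^bsub>G\<^esub> h) v)"
      using gh v by (intro p(4)[symmetric]) auto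
    also have "\<dots> = \<rho>' g (\<rho>' h (\<phi> v))"
      using gh v by (simp add: V.rho_mult p(4) V.closed)
    finally show "\<rho>' (g \<otimes>\<^bsub>G\<^esub> h) x = \<rho>' g (\<rho>' h x)" unfolding v .
  next
    fix x assume "x \<in> V'"
    then obtain v where v: "v \<in> V" "x = \<phi> v" using ex by blast
    show "\<rho>' \<one>\<^bsub>G\<^esub> x = x" unfolding v using p(4)[OF V.one_closed v(1)] V.rho_one[OF v(1)] by simp
  qed
qed

lemma simple_of_iso:
  assumes V: "fs.subspace V" "op_simple \<Omega> (fun_module V \<rho>)"
    and V': "fs.subspace V'" and cl: "\<And>g v. g \<in> \<Omega> \<Longrightarrow> v \<in> V \<Longrightarrow> \<rho> g v \<in> V"
    and p: "bij_betw \<phi> V V'" "\<And>u v. u \<in> V \<Longrightarrow> v \<in> V \<Longrightarrow> \<phi> (u + v) = \<phi> u + \<phi> v"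
      "\<And>c v. v \<in> V \<Longrightarrow> \<phi> (cscale c v) = cscale c (\<phi> v)"
      "\<And>g v. g \<in> \<Omega> \<Longrightarrow> v \<in> V \<Longrightarrow> \<phi> (\<rho> g v) = \<rho>' g (\<phi> v)"
  shows "op_simple \<Omega> (fun_module V' \<rho>')"
  unfolding op_simple_fun_module[OF V']
proof (intro conjI allI impI)
  have z: "\<phi> 0 = 0" using p(3)[OF fs.subspace_0[OF V(1)], of 0] by simp
  have simple: "V \<noteq> {0}" "\<And>N. N \<subseteq> V \<Longrightarrow> stable \<Omega> \<rho> N \<Longrightarrow> N = {0} \<or> N = V"
    using V(2) unfolding op_simple_fun_module[OF V(1)] by blast+
  have imV: "\<phi> ` V = V'" using p(1) by (simp add: bij_betw_def)
  show "V' \<noteq> {0}"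
  proof
    assume 0: "V' = {0}"
    have "v = 0" if "v \<in> V" for v
    proof -
      have "\<phi> v = \<phi> 0" using imV 0 that z by auto
      then show ?thesis using inj_onD[OF bij_betw_imp_inj_on[OF p(1)] _ that fs.subspace_0[OF V(1)]] by blast
    qed
    then show False using simple(1) fs.subspace_0[OF V(1)] by blast
  qed
  fix N assume N: "N \<subseteq> V'" "stable \<Omega> \<rho>' N"
  define K where "K = {v \<in> V. \<phi> v \<in> N}"
  have sN: "fs.subspace N" using N by (simp add: stable_def)
  have NK: "N = \<phi> ` K" using N(1) imV by (auto simp: K_def)
  have "stable \<Omega> \<rho> K"
    unfolding stable_def fs.subspace_def K_def
    using N(2) cl
    by (auto simp: fs.subspace_0[OF V(1)] fs.subspace_add[OF V(1)] fs.subspace_scale[OF V(1)] z p(2-4)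
      fs.subspace_0[OF sN] fs.subspace_add[OF sN] fs.subspace_scale[OF sN] stable_def)
  moreover have "K \<subseteq> V" by (auto simp: K_def)
  ultimately consider "K = {0}" | "K = V" using simple(2) by blast
  then show "N = {0} \<or> N = V'"
  proof cases
    case 1
    then show ?thesis using NK z by simp
  next
    case 2
    then show ?thesis using NK imV by simp
  qed
qed

lemma perm_act_linear: "flinear (\<lambda>v x. \<Sum>y\<in>{y \<in> X. \<alpha> y = x}. v y)"
  by (rule flinearI) (auto simp: fun_eq_iff pointwise sum.distrib sum_distrib_left)

lemma perm_module_eq:
  "perm_module X \<alpha> = fun_module (funs X) (\<lambda>g v x. \<Sum>y\<in>{y \<in> X. \<alpha> g y = x}. v y)"
  by (simp add: perm_module_def funs_def)

definition Specht_space :: "nat list \<Rightarrow> (nat set list \<Rightarrow> complex) set"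
  where "Specht_space \<alpha> = carrier (Specht \<alpha>)"

definition Specht_act :: "nat list \<Rightarrow> (nat \<Rightarrow> nat) \<Rightarrow> (nat set list \<Rightarrow> complex) \<Rightarrow> nat set list \<Rightarrow> complex"
  where "Specht_act \<alpha> = (\<lambda>g v x. \<Sum>y\<in>{y \<in> tabloid \<alpha> ` tableaux \<alpha>. map (image g) y = x}. v y)"

lemma Specht_eq: "Specht \<alpha> = fun_module (Specht_space \<alpha>) (Specht_act \<alpha>)"
  by (simp add: Specht_space_def Specht_def Let_def perm_module_eq Specht_act_def)

lemma Specht_act_linear: "flinear (Specht_act \<alpha> g)"
  unfolding Specht_act_def by (rule perm_act_linear)

text \<open>
  Everything needed about the Specht module is carried over from the left ideal \<open>\<complex>S\<^sub>k e\<close>: it is a simple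
  representation, and \<open>\<phi> e\<close> is a vector fixed by \<open>e\<close>.
\<close>

lemma Specht_of_idempotent:
  assumes k: "sum_list \<alpha> = k" and e: "SE_idempotent_for \<alpha> e"
  obtains \<phi> where "primitive_idem (sym_group k) e"
    "frep (sym_group k) (Specht_act \<alpha>) (Specht_space \<alpha>)"
    "op_simple (carrier (sym_group k)) (fun_module (Specht_space \<alpha>) (Specht_act \<alpha>))"
    "bij_betw \<phi> (lideal (sym_group k) e) (Specht_space \<alpha>)"
    "\<And>u v. u \<in> lideal (sym_group k) e \<Longrightarrow> v \<in> lideal (sym_group k) e \<Longrightarrow> \<phi> (u + v) = \<phi> u + \<phi> v"
    "\<And>c v. v \<in> lideal (sym_group k) e \<Longrightarrow> \<phi> (cscale c v) = cscale c (\<phi> v)"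
    "\<And>g v. g \<in> carrier (sym_group k) \<Longrightarrow> v \<in> lideal (sym_group k) e \<Longrightarrow>
      \<phi> (reg (sym_group k) g v) = Specht_act \<alpha> g (\<phi> v)"
    "\<phi> e \<in> Specht_space \<alpha>" "\<phi> e \<noteq> 0" "galg (sym_group k) (Specht_act \<alpha>) e (\<phi> e) = \<phi> e"
proof -
  have prim: "primitive_idempotent (group_algebra (sym_group k)) e"
    and iso: "op_iso (carrier (sym_group k)) (pullback basis_vec (left_ideal (group_algebra (sym_group k)) e)) (Specht \<alpha>)"
    using e k unfolding SE_idempotent_for_def Let_def by auto
  interpret P: primitive_idem "sym_group k" e by (rule primitive_idem_sym[OF prim])
  have iso': "op_iso (carrier (sym_group k)) (fun_module (lideal (sym_group k) e) (reg (sym_group k)))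
    (fun_module (Specht_space \<alpha>) (Specht_act \<alpha>))"
    using iso unfolding P.left_ideal_group_algebra[OF P.e_funs P.e_idem] Specht_eq .
  interpret L: frep "sym_group k" "reg (sym_group k)" "lideal (sym_group k) e" by (rule P.frep_lideal)
  from iso' show ?thesis
  proof (rule op_iso_fun_moduleE)
    fix \<phi> assume p: "bij_betw \<phi> (lideal (sym_group k) e) (Specht_space \<alpha>)"
      "\<And>u v. u \<in> lideal (sym_group k) e \<Longrightarrow> v \<in> lideal (sym_group k) e \<Longrightarrow> \<phi> (u + v) = \<phi> u + \<phi> v"
      "\<And>c v. v \<in> lideal (sym_group k) e \<Longrightarrow> \<phi> (cscale c v) = cscale c (\<phi> v)"
      "\<And>g v. g \<in> carrier (sym_group k) \<Longrightarrow> v \<in> lideal (sym_group k) e \<Longrightarrow>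
        \<phi> (reg (sym_group k) g v) = Specht_act \<alpha> g (\<phi> v)"
    have fr: "frep (sym_group k) (Specht_act \<alpha>) (Specht_space \<alpha>)"
      by (rule frep_of_iso[where \<phi> = \<phi> and V = "lideal (sym_group k) e" and \<rho> = "reg (sym_group k)"])
        (rule Specht_act_linear | fact P.frep_lideal p)+
    interpret S: frep "sym_group k" "Specht_act \<alpha>" "Specht_space \<alpha>" by (rule fr)
    have z: "\<phi> 0 = 0" using p(3)[OF fs.subspace_0[OF L.subV], of 0] by simp
    have phi_nz: "\<phi> e \<noteq> 0"
    proof
      assume "\<phi> e = 0"
      then have eq: "\<phi> e = \<phi> 0" using z by simp
      have "e = 0"
        by (rule inj_onD[OF bij_betw_imp_inj_on[OF p(1)] eq P.e_in_lideal fs.subspace_0[OF L.subV]])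
      then show False using P.e_nonzero by simp
    qed
    have "\<phi> (galg (sym_group k) (reg (sym_group k)) e e) = galg (sym_group k) (Specht_act \<alpha>) e (\<phi> e)"
      by (rule galg_equivariant[where \<phi> = \<phi> and V = "lideal (sym_group k) e"])
        (fact P.frep_lideal p P.e_in_lideal)+
    then have phi_fix: "galg (sym_group k) (Specht_act \<alpha>) e (\<phi> e) = \<phi> e"
      by (simp add: P.galg_regular[OF P.e_funs] P.e_idem)
    have phi_in: "\<phi> e \<in> Specht_space \<alpha>" using bij_betwE[OF p(1)] P.e_in_lideal by blast
    have simple: "op_simple (carrier (sym_group k)) (fun_module (Specht_space \<alpha>) (Specht_act \<alpha>))"
      by (rule simple_of_iso[where \<phi> = \<phi> and V = "lideal (sym_group k) e" and \<rho> = "reg (sym_group k)"])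
        (fact L.subV P.lideal_simple S.subV L.closed p)+
    show ?thesis
      by (rule that[of \<phi>]) (fact P.primitive_idem_axioms fr simple p phi_in phi_nz phi_fix)+
  qed
qed

definition tensor :: "('x \<Rightarrow> complex) \<Rightarrow> ('y \<Rightarrow> complex) \<Rightarrow> 'x \<times> 'y \<Rightarrow> complex"
  where "tensor v w = (\<lambda>(x, y). v x * w y)"

lemma tensor_apply: "tensor v w (x, y) = v x * w y"
  by (simp add: tensor_def)

definition tensor_act :: "('g \<Rightarrow> ('x \<Rightarrow> complex) \<Rightarrow> ('x \<Rightarrow> complex)) \<Rightarrow> ('h \<Rightarrow> ('y \<Rightarrow> complex) \<Rightarrow> ('y \<Rightarrow> complex)) \<Rightarrow>
    'g \<times> 'h \<Rightarrow> ('x \<times> 'y \<Rightarrow> complex) \<Rightarrow> 'x \<times> 'y \<Rightarrow> complex"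
  where "tensor_act \<rho> \<sigma> = (\<lambda>(g, h) t (x, y). \<sigma> h (\<lambda>y'. \<rho> g (\<lambda>x'. t (x', y')) x) y)"

definition tensor_space :: "('x \<Rightarrow> complex) set \<Rightarrow> ('y \<Rightarrow> complex) set \<Rightarrow> ('x \<times> 'y \<Rightarrow> complex) set"
  where "tensor_space V W = fs.span {tensor v w | v w. v \<in> V \<and> w \<in> W}"

lemma lin_span_fun_module: "lin_span (fun_module UNIV \<rho>) B = fs.span B"
proof -
  have "submodule N complex_ring (fun_module UNIV \<rho>) \<longleftrightarrow> fs.subspace N" for N
    using op_submodule_fun_module[OF fs.subspace_UNIV, of "{}" N \<rho>]
    by (simp add: op_submodule_def stable_def)
  then show ?thesis by (auto simp: lin_span_def fs.span_def hull_def)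
qed

lemma outer_tensor_eq:
  "outer_tensor (fun_module V \<rho>) (fun_module W \<sigma>) = fun_module (tensor_space V W) (tensor_act \<rho> \<sigma>)"
  by (simp add: outer_tensor_def Let_def lin_span_fun_module tensor_space_def tensor_act_def tensor_def)

lemma tensor_act_tensor:
  fixes \<rho> :: "'g \<Rightarrow> ('x \<Rightarrow> complex) \<Rightarrow> 'x \<Rightarrow> complex" and \<sigma> :: "'h \<Rightarrow> ('y \<Rightarrow> complex) \<Rightarrow> 'y \<Rightarrow> complex"
  assumes "flinear (\<rho> g)" "flinear (\<sigma> h)"
  shows "tensor_act \<rho> \<sigma> (g, h) (tensor v w) = tensor (\<rho> g v) (\<sigma> h w)"
proof
  fix z :: "'x \<times> 'y"
  obtain x y where z: "z = (x, y)" by (cases z)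
  have 1: "\<rho> g (\<lambda>x'. v x' * w y') x = \<rho> g v x * w y'" for y'
    using fun_cong[OF flinear_scale[OF assms(1), of "w y'" v], of x] by (simp add: cscale_def mult.commute)
  have 2: "\<sigma> h (\<lambda>y'. \<rho> g v x * w y') y = \<rho> g v x * \<sigma> h w y"
    using fun_cong[OF flinear_scale[OF assms(2), of "\<rho> g v x" w], of y] by (simp add: cscale_def)
  show "tensor_act \<rho> \<sigma> (g, h) (tensor v w) z = tensor (\<rho> g v) (\<sigma> h w) z"
    by (simp add: tensor_act_def tensor_apply z 1 2)
qed

lemma tensor_act_linear:
  fixes \<rho> :: "'g \<Rightarrow> ('x \<Rightarrow> complex) \<Rightarrow> 'x \<Rightarrow> complex" and \<sigma> :: "'h \<Rightarrow> ('y \<Rightarrow> complex) \<Rightarrow> 'y \<Rightarrow> complex"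
  assumes "flinear (\<rho> g)" "flinear (\<sigma> h)"
  shows "flinear (tensor_act \<rho> \<sigma> (g, h))"
proof (rule flinearI)
  fix t t' :: "'x \<times> 'y \<Rightarrow> complex"
  have 1: "(\<lambda>x'. (t + t') (x', y')) = (\<lambda>x'. t (x', y')) + (\<lambda>x'. t' (x', y'))" for y'
    by (simp add: plus_fun_def)
  have 2: "\<rho> g (\<lambda>x'. (t + t') (x', y')) x = \<rho> g (\<lambda>x'. t (x', y')) x + \<rho> g (\<lambda>x'. t' (x', y')) x" for x y'
    unfolding 1 flinear_add[OF assms(1)] by (simp add: plus_fun_def)
  show "tensor_act \<rho> \<sigma> (g, h) (t + t') = tensor_act \<rho> \<sigma> (g, h) t + tensor_act \<rho> \<sigma> (g, h) t'"
  proof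
    fix z :: "'x \<times> 'y"
    obtain x y where z: "z = (x, y)" by (cases z)
    have "(\<lambda>y'. \<rho> g (\<lambda>x'. (t + t') (x', y')) x) = (\<lambda>y'. \<rho> g (\<lambda>x'. t (x', y')) x) + (\<lambda>y'. \<rho> g (\<lambda>x'. t' (x', y')) x)"
      unfolding 2 by (simp add: plus_fun_def)
    then have "\<sigma> h (\<lambda>y'. \<rho> g (\<lambda>x'. (t + t') (x', y')) x) y =
      \<sigma> h (\<lambda>y'. \<rho> g (\<lambda>x'. t (x', y')) x) y + \<sigma> h (\<lambda>y'. \<rho> g (\<lambda>x'. t' (x', y')) x) y"
      by (simp only: flinear_add[OF assms(2)]) (simp add: plus_fun_def)
    then show "tensor_act \<rho> \<sigma> (g, h) (t + t') z = (tensor_act \<rho> \<sigma> (g, h) t + tensor_act \<rho> \<sigma> (g, h) t') z"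
      by (simp add: tensor_act_def z plus_fun_apply)
  qed
next
  fix c and t :: "'x \<times> 'y \<Rightarrow> complex"
  have 1: "(\<lambda>x'. cscale c t (x', y')) = cscale c (\<lambda>x'. t (x', y'))" for y'
    by (simp add: cscale_def)
  have 2: "\<rho> g (\<lambda>x'. cscale c t (x', y')) x = c * \<rho> g (\<lambda>x'. t (x', y')) x" for x y'
    unfolding 1 flinear_scale[OF assms(1)] by (simp add: cscale_def)
  show "tensor_act \<rho> \<sigma> (g, h) (cscale c t) = cscale c (tensor_act \<rho> \<sigma> (g, h) t)"
  proof
    fix z :: "'x \<times> 'y"
    obtain x y where z: "z = (x, y)" by (cases z)
    have "(\<lambda>y'. \<rho> g (\<lambda>x'. cscale c t (x', y')) x) = cscale c (\<lambda>y'. \<rho> g (\<lambda>x'. t (x', y')) x)"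
      unfolding 2 by (simp add: cscale_def)
    then have "\<sigma> h (\<lambda>y'. \<rho> g (\<lambda>x'. cscale c t (x', y')) x) y = c * \<sigma> h (\<lambda>y'. \<rho> g (\<lambda>x'. t (x', y')) x) y"
      by (simp only: flinear_scale[OF assms(2)]) (simp add: cscale_def)
    then show "tensor_act \<rho> \<sigma> (g, h) (cscale c t) z = cscale c (tensor_act \<rho> \<sigma> (g, h) t) z"
      by (simp add: tensor_act_def z cscale_apply)
  qed
qed

lemma tensor_in_space: "v \<in> V \<Longrightarrow> w \<in> W \<Longrightarrow> tensor v w \<in> tensor_space V W"
  unfolding tensor_space_def by (rule fs.span_base) blast

lemma tensor_space_induct:
  assumes "t \<in> tensor_space V W" "fs.subspace {t. P t}" "\<And>v w. v \<in> V \<Longrightarrow> w \<in> W \<Longrightarrow> P (tensor v w)"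
  shows "P t"
  using assms(1) unfolding tensor_space_def
proof (rule fs.span_induct[OF _ assms(2)])
  fix x assume "x \<in> {tensor v w | v w. v \<in> V \<and> w \<in> W}"
  then show "P x" using assms(3) by blast
qed

lemma subspace_eq_linear:
  assumes "flinear f" "flinear g"
  shows "fs.subspace {t. f t = g t}"
  unfolding fs.subspace_def
  by (simp add: flinear_zero[OF assms(1)] flinear_zero[OF assms(2)] flinear_add[OF assms(1)] flinear_add[OF assms(2)]
    flinear_scale[OF assms(1)] flinear_scale[OF assms(2)])

lemma subspace_linear_vimage:
  assumes "flinear f" "fs.subspace N"
  shows "fs.subspace {t. f t \<in> N}"
  unfolding fs.subspace_def
  by (simp add: flinear_zero[OF assms(1)] flinear_add[OF assms(1)] flinear_scale[OF assms(1)]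
    fs.subspace_0[OF assms(2)] fs.subspace_add[OF assms(2)] fs.subspace_scale[OF assms(2)])

lemma flinear_comp: "flinear f \<Longrightarrow> flinear g \<Longrightarrow> flinear (\<lambda>t. f (g t))"
  by (rule flinearI) (simp_all add: flinear_add flinear_scale)

lemma flinear_ident: "flinear (\<lambda>t. t)"
  by (rule flinearI) simp_all

lemma fin_group_DirProd: "fin_group G \<Longrightarrow> fin_group H \<Longrightarrow> fin_group (G \<times>\<times> H)"
  by (intro fin_group.intro fin_group_axioms.intro DirProd_group)
    (auto simp: fin_group_def fin_group_axioms_def)

lemma frep_tensor:
  assumes V: "frep G \<rho> V" and W: "frep H \<sigma> W"
  shows "frep (G \<times>\<times> H) (tensor_act \<rho> \<sigma>) (tensor_space V W)"
proof -
  interpret V: frep G \<rho> V by fact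
  interpret W: frep H \<sigma> W by fact
  have lin: "flinear (tensor_act \<rho> \<sigma> (g, h))" if "g \<in> carrier G" "h \<in> carrier H" for g h
    by (rule tensor_act_linear) (use that V.lin W.lin in auto)
  have tt: "tensor_act \<rho> \<sigma> (g, h) (tensor v w) = tensor (\<rho> g v) (\<sigma> h w)"
    if "g \<in> carrier G" "h \<in> carrier H" for g h v w
    by (rule tensor_act_tensor) (use that V.lin W.lin in auto)
  show ?thesis
  proof (intro frep.intro opspace.intro frep_axioms.intro fin_group_DirProd V.fin_group_axioms W.fin_group_axioms)
    show "stable (carrier (G \<times>\<times> H)) (tensor_act \<rho> \<sigma>) (tensor_space V W)"
      unfolding stable_def
    proof (intro conjI ballI)
      show sub: "fs.subspace (tensor_space V W)" by (simp add: tensor_space_def)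
      fix p t assume "p \<in> carrier (G \<times>\<times> H)" and t: "t \<in> tensor_space V W"
      then obtain g h where p: "p = (g, h)" "g \<in> carrier G" "h \<in> carrier H" by auto
      show "tensor_act \<rho> \<sigma> p t \<in> tensor_space V W"
        using t unfolding p(1)
        by (rule tensor_space_induct[OF _ subspace_linear_vimage[OF lin[OF p(2,3)] sub]])
          (simp add: tt[OF p(2,3)] tensor_in_space V.closed[OF p(2)] W.closed[OF p(3)])
    qed
    show "Vector_Spaces.linear cscale cscale (tensor_act \<rho> \<sigma> p)" if "p \<in> carrier (G \<times>\<times> H)" for p
      using that lin by auto
    fix p q t assume "p \<in> carrier (G \<times>\<times> H)" "q \<in> carrier (G \<times>\<times> H)" and t: "t \<in> tensor_space V W"
    then obtain g h g' h' where p: "p = (g, h)" "g \<in> carrier G" "h \<in> carrier H"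
      and q: "q = (g', h')" "g' \<in> carrier G" "h' \<in> carrier H" by auto
    have gg: "g \<otimes>\<^bsub>G\<^esub> g' \<in> carrier G" "h \<otimes>\<^bsub>H\<^esub> h' \<in> carrier H" using p q by auto
    show "tensor_act \<rho> \<sigma> (p \<otimes>\<^bsub>G \<times>\<times> H\<^esub> q) t = tensor_act \<rho> \<sigma> p (tensor_act \<rho> \<sigma> q t)"
      using t unfolding p(1) q(1) mult_DirProd
      by (rule tensor_space_induct[OF _ subspace_eq_linear[OF lin[OF gg] flinear_comp[OF lin[OF p(2,3)] lin[OF q(2,3)]]]])
        (simp add: tt gg p q V.rho_mult W.rho_mult)
  next
    fix t assume t: "t \<in> tensor_space V W"
    show "tensor_act \<rho> \<sigma> \<one>\<^bsub>G \<times>\<times> H\<^esub> t = t"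
      using t unfolding one_DirProd
      by (rule tensor_space_induct[OF _ subspace_eq_linear[OF lin[OF V.one_closed W.one_closed] flinear_ident]])
        (simp add: tt V.rho_one W.rho_one)
  qed
qed

lemma galg_tensor:
  fixes \<rho> :: "'g \<Rightarrow> ('x \<Rightarrow> complex) \<Rightarrow> 'x \<Rightarrow> complex" and \<sigma> :: "'h \<Rightarrow> ('y \<Rightarrow> complex) \<Rightarrow> 'y \<Rightarrow> complex"
  assumes V: "frep G \<rho> V" and W: "frep H \<sigma> W"
  shows "galg (G \<times>\<times> H) (tensor_act \<rho> \<sigma>) (tensor a b) (tensor v w) = tensor (galg G \<rho> a v) (galg H \<sigma> b w)"
proof
  interpret V: frep G \<rho> V by fact
  interpret W: frep H \<sigma> W by fact
  fix z :: "'x \<times> 'y"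
  obtain x y where z: "z = (x, y)" by (cases z)
  have "galg (G \<times>\<times> H) (tensor_act \<rho> \<sigma>) (tensor a b) (tensor v w) (x, y) =
    (\<Sum>p\<in>carrier G \<times> carrier H. tensor a b p * tensor_act \<rho> \<sigma> p (tensor v w) (x, y))"
    by (simp add: galg_def sum_fun_apply cscale_apply)
  also have "\<dots> = (\<Sum>g\<in>carrier G. \<Sum>h\<in>carrier H. (a g * b h) * (\<rho> g v x * \<sigma> h w y))"
    unfolding sum.cartesian_product
    by (intro sum.cong refl) (auto simp: tensor_act_tensor[OF V.lin W.lin] tensor_apply)
  also have "\<dots> = (\<Sum>g\<in>carrier G. a g * \<rho> g v x) * (\<Sum>h\<in>carrier H. b h * \<sigma> h w y)"
    by (simp add: sum_product mult_ac)
  also have "\<dots> = tensor (galg G \<rho> a v) (galg H \<sigma> b w) (x, y)"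
    by (simp add: tensor_apply galg_def sum_fun_apply cscale_apply)
  finally show "galg (G \<times>\<times> H) (tensor_act \<rho> \<sigma>) (tensor a b) (tensor v w) z = tensor (galg G \<rho> a v) (galg H \<sigma> b w) z"
    unfolding z .
qed

lemma gmult_tensor:
  fixes G :: "'g monoid" and H :: "'h monoid"
  assumes G: "fin_group G" and H: "fin_group H"
  shows "gmult (G \<times>\<times> H) (tensor a b) (tensor a' b') = tensor (gmult G a a') (gmult H b b')"
proof
  interpret G: fin_group G by fact
  interpret H: fin_group H by fact
  interpret GH: fin_group "G \<times>\<times> H" by (rule fin_group_DirProd[OF G H])
  fix z :: "'g \<times> 'h"
  obtain x y where z: "z = (x, y)" by (cases z)
  show "gmult (G \<times>\<times> H) (tensor a b) (tensor a' b') z = tensor (gmult G a a') (gmult H b b') z"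
  proof (cases "x \<in> carrier G \<and> y \<in> carrier H")
    case True
    then have "gmult (G \<times>\<times> H) (tensor a b) (tensor a' b') z =
      (\<Sum>p\<in>carrier G \<times> carrier H. tensor a b p * tensor a' b' (m_inv (G \<times>\<times> H) p \<otimes>\<^bsub>G \<times>\<times> H\<^esub> z))"
      using GH.gmult_apply[of z] by (simp add: z)
    also have "\<dots> = (\<Sum>g\<in>carrier G. \<Sum>h\<in>carrier H. (a g * b h) * (a' (m_inv G g \<otimes>\<^bsub>G\<^esub> x) * b' (m_inv H h \<otimes>\<^bsub>H\<^esub> y)))"
      unfolding sum.cartesian_product
      by (intro sum.cong refl)
        (auto simp: z tensor_apply inv_DirProd[OF G.is_group H.is_group])
    also have "\<dots> = (\<Sum>g\<in>carrier G. a g * a' (m_inv G g \<otimes>\<^bsub>G\<^esub> x)) * (\<Sum>h\<in>carrier H. b h * b' (m_inv H h \<otimes>\<^bsub>H\<^esub> y))"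
      by (simp add: sum_product mult_ac)
    also have "\<dots> = tensor (gmult G a a') (gmult H b b') z"
      using True by (simp add: z tensor_apply G.gmult_apply H.gmult_apply)
    finally show ?thesis .
  next
    case False
    then have "gmult (G \<times>\<times> H) (tensor a b) (tensor a' b') z = 0"
      using GH.gmult_closed[of "tensor a b" "tensor a' b'"] by (auto simp: funs_def z)
    moreover have "gmult G a a' x = 0 \<or> gmult H b b' y = 0"
      using False G.gmult_closed[of a a'] H.gmult_closed[of b b'] by (auto simp: funs_def)
    ultimately show ?thesis by (auto simp: z tensor_apply)
  qed
qed

lemma schur_idem_tensor:
  assumes G: "fin_group G" and H: "fin_group H" and e: "schur_idem G e" and f: "schur_idem H f"
  shows "schur_idem (G \<times>\<times> H) (tensor e f)"
  unfolding schur_idem_def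
proof (intro conjI ballI)
  show "tensor e f \<in> funs (carrier (G \<times>\<times> H))"
    using e f by (auto simp: schur_idem_def funs_def tensor_def)
  show "gmult (G \<times>\<times> H) (tensor e f) (tensor e f) = tensor e f"
    unfolding gmult_tensor[OF G H] using e f by (simp add: schur_idem_def)
  fix p assume "p \<in> carrier (G \<times>\<times> H)"
  then obtain g h where p: "p = (g, h)" "g \<in> carrier G" "h \<in> carrier H" by auto
  have b: "basis_vec p = tensor (basis_vec g) (basis_vec h)"
    by (auto simp: basis_vec_def tensor_def p fun_eq_iff)
  obtain c d where "gmult G e (gmult G (basis_vec g) e) = cscale c e" "gmult H f (gmult H (basis_vec h) f) = cscale d f"
    using e f p(2,3) unfolding schur_idem_def by blast
  then have "gmult (G \<times>\<times> H) (tensor e f) (gmult (G \<times>\<times> H) (basis_vec p) (tensor e f)) = tensor (cscale c e) (cscale d f)"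
    unfolding b gmult_tensor[OF G H] by simp
  also have "\<dots> = cscale (c * d) (tensor e f)"
    by (auto simp: tensor_def cscale_def fun_eq_iff)
  finally show "\<exists>k. gmult (G \<times>\<times> H) (tensor e f) (gmult (G \<times>\<times> H) (basis_vec p) (tensor e f)) = cscale k (tensor e f)" by blast
qed

text \<open>
  The idempotent \<open>e \<otimes> f\<close> maps the tensor product onto the line through \<open>u \<otimes> w\<close>, and \<open>u \<otimes> w\<close> generates
  everything. By complete reducibility, that vector lies in an invariant subspace or in its complement.
\<close>

lemma tensor_simple:
  assumes V: "frep G \<rho> V" "op_simple (carrier G) (fun_module V \<rho>)" and W: "frep H \<sigma> W" "op_simple (carrier H) (fun_module W \<sigma>)"
    and e: "schur_idem G e" and f: "schur_idem H f"
    and u: "u \<in> V" "u \<noteq> 0" "galg G \<rho> e u = u" and w: "w \<in> W" "w \<noteq> 0" "galg H \<sigma> f w = w"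
  shows "tensor u w \<in> tensor_space V W" "tensor u w \<noteq> 0"
    "galg (G \<times>\<times> H) (tensor_act \<rho> \<sigma>) (tensor e f) (tensor u w) = tensor u w"
    "op_simple (carrier (G \<times>\<times> H)) (fun_module (tensor_space V W) (tensor_act \<rho> \<sigma>))"
proof -
  interpret V: frep G \<rho> V by fact
  interpret W: frep H \<sigma> W by fact
  interpret T: frep "G \<times>\<times> H" "tensor_act \<rho> \<sigma>" "tensor_space V W" by (rule frep_tensor[OF V(1) W(1)])
  let ?s = "tensor u w" and ?E = "galg (G \<times>\<times> H) (tensor_act \<rho> \<sigma>) (tensor e f)"
  show s1: "?s \<in> tensor_space V W" by (rule tensor_in_space[OF u(1) w(1)])
  show s2: "?s \<noteq> 0"
  proof
    assume 0: "?s = 0"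
    obtain x y where xy: "u x \<noteq> 0" "w y \<noteq> 0" using u(2) w(2) by (auto simp: fun_eq_iff zero_fun_def)
    have "u x * w y = 0" using fun_cong[OF 0, of "(x, y)"] by (simp add: tensor_apply zero_fun_def)
    then show False using xy by simp
  qed
  show s3: "?E ?s = ?s" unfolding galg_tensor[OF V(1) W(1)] u(3) w(3) ..
  obtain cV where cV: "\<And>g. g \<in> carrier G \<Longrightarrow> gmult G e (gmult G (basis_vec g) e) = cscale (cV g) e"
    using schur_scalars[OF e] by blast
  obtain cW where cW: "\<And>g. g \<in> carrier H \<Longrightarrow> gmult H f (gmult H (basis_vec g) f) = cscale (cW g) f"
    using schur_scalars[OF f] by blast
  have E: "?E t \<in> fs.span {?s}" if "t \<in> tensor_space V W" for t
    using that
  proof (rule tensor_space_induct[OF _ subspace_linear_vimage[OF T.galg_linear fs.subspace_span]])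
    fix v' w' assume vw: "v' \<in> V" "w' \<in> W"
    obtain a where a: "v' = galg G \<rho> a u" using V.simple_cyclic[OF V(2) u(1,2) vw(1)] by blast
    obtain b where b: "w' = galg H \<sigma> b w" using W.simple_cyclic[OF W(2) w(1,2) vw(2)] by blast
    have "?E (tensor v' w') = tensor (cscale (\<Sum>g\<in>carrier G. a g * cV g) u) (cscale (\<Sum>g\<in>carrier H. b g * cW g) w)"
      unfolding galg_tensor[OF V(1) W(1)] a b
      using V.schur_sandwich[OF cV u(1,3)] W.schur_sandwich[OF cW w(1,3)] by simp
    also have "\<dots> = cscale ((\<Sum>g\<in>carrier G. a g * cV g) * (\<Sum>g\<in>carrier H. b g * cW g)) ?s"
      by (auto simp: tensor_def cscale_def fun_eq_iff)
    also have "\<dots> \<in> fs.span {?s}" by (intro fs.span_scale fs.span_base singletonI)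
    finally show "?E (tensor v' w') \<in> fs.span {?s}" .
  qed
  have all: "K = tensor_space V W" if K: "stable (carrier (G \<times>\<times> H)) (tensor_act \<rho> \<sigma>) K" "K \<subseteq> tensor_space V W" "?s \<in> K" for K
  proof (rule equalityI[OF K(2)], rule subsetI)
    have sK: "fs.subspace {t. t \<in> K}" using K(1) by (simp add: stable_def)
    fix t assume "t \<in> tensor_space V W"
    then show "t \<in> K"
    proof (rule tensor_space_induct[OF _ sK])
      fix v' w' assume vw: "v' \<in> V" "w' \<in> W"
      obtain a where a: "v' = galg G \<rho> a u" using V.simple_cyclic[OF V(2) u(1,2) vw(1)] by blast
      obtain b where b: "w' = galg H \<sigma> b w" using W.simple_cyclic[OF W(2) w(1,2) vw(2)] by blast
      have "tensor v' w' = galg (G \<times>\<times> H) (tensor_act \<rho> \<sigma>) (tensor a b) ?s"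
        unfolding a b by (rule galg_tensor[OF V(1) W(1), symmetric])
      also have "\<dots> \<in> K" by (rule T.galg_closed[OF K(1,3)])
      finally show "tensor v' w' \<in> K" .
    qed
  qed
  have inK: "?s \<in> K" if K: "stable (carrier (G \<times>\<times> H)) (tensor_act \<rho> \<sigma>) K" "K \<subseteq> tensor_space V W"
    and t: "t \<in> K" "?E t \<noteq> 0" for K t
  proof -
    obtain c where c: "?E t = cscale c ?s" using E[of t] t(1) K(2) unfolding fs.span_singleton by blast
    have "c \<noteq> 0" using t(2) unfolding c by auto
    have "?E t \<in> K" by (rule T.galg_closed[OF K(1) t(1)])
    moreover have "fs.subspace K" using K(1) by (simp add: stable_def)
    ultimately have "cscale (inverse c) (cscale c ?s) \<in> K" unfolding c by (rule fs.subspace_scale[rotated])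
    then show ?thesis using \<open>c \<noteq> 0\<close> by simp
  qed
  show "op_simple (carrier (G \<times>\<times> H)) (fun_module (tensor_space V W) (tensor_act \<rho> \<sigma>))"
    unfolding op_simple_fun_module[OF T.subV]
  proof (intro conjI allI impI)
    show "tensor_space V W \<noteq> {0}" using s1 s2 by blast
    fix K assume K: "K \<subseteq> tensor_space V W" "stable (carrier (G \<times>\<times> H)) (tensor_act \<rho> \<sigma>) K"
    obtain K' where K': "stable (carrier (G \<times>\<times> H)) (tensor_act \<rho> \<sigma>) K'" "K' \<subseteq> tensor_space V W" "K \<inter> K' = {0}"
      "\<forall>w\<in>tensor_space V W. \<exists>u\<in>K. \<exists>u'\<in>K'. w = u + u'"
      using T.maschke[OF order_refl T.stable_V K] by (elim exE conjE) (rule that)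
    obtain a b where ab: "a \<in> K" "b \<in> K'" "?s = a + b" using K'(4) s1 by blast
    have "?E a + ?E b \<noteq> 0" using s2 s3 unfolding ab(3) flinear_add[OF T.galg_linear] by simp
    then consider "?E a \<noteq> 0" | "?E b \<noteq> 0" by fastforce
    then show "K = {0} \<or> K = tensor_space V W"
    proof cases
      case 1
      show ?thesis using all[OF K(2,1) inK[OF K(2,1) ab(1) 1]] ..
    next
      case 2
      have "K' = tensor_space V W" by (rule all[OF K'(1,2) inK[OF K'(1,2) ab(2) 2]])
      then show ?thesis using K'(3) K(1) by blast
    qed
  qed
qed

section \<open>The bimodule of onto functions\<close>

lemma frep_perm:
  assumes G: "fin_group G"
    and act: "\<And>g x. g \<in> carrier G \<Longrightarrow> x \<in> X \<Longrightarrow> \<alpha> g x \<in> X"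
    and mult: "\<And>g h x. g \<in> carrier G \<Longrightarrow> h \<in> carrier G \<Longrightarrow> x \<in> X \<Longrightarrow> \<alpha> (g \<otimes>\<^bsub>G\<^esub> h) x = \<alpha> g (\<alpha> h x)"
    and one: "\<And>x. x \<in> X \<Longrightarrow> \<alpha> \<one>\<^bsub>G\<^esub> x = x"
  shows "frep G (\<lambda>g v x. \<Sum>y\<in>{y \<in> X. \<alpha> g y = x}. v y) (funs X)"
proof -
  interpret G: fin_group G by fact
  let ?\<rho> = "\<lambda>g v x. \<Sum>y\<in>{y \<in> X. \<alpha> g y = x}. v y :: complex"
  have inv: "\<alpha> g y = x \<longleftrightarrow> y = \<alpha> (m_inv G g) x" if "g \<in> carrier G" "x \<in> X" "y \<in> X" for g x y
    using mult[of "m_inv G g" g y] mult[of g "m_inv G g" x] one that by auto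
  have val: "?\<rho> g v x = (if x \<in> X then v (\<alpha> (m_inv G g) x) else 0)" if g: "g \<in> carrier G" for g v x
  proof (cases "x \<in> X")
    case True
    then have "{y \<in> X. \<alpha> g y = x} = {\<alpha> (m_inv G g) x}" using inv[OF g True] act[OF G.inv_closed[OF g] True] by auto
    then show ?thesis using True by simp
  next
    case False
    then have "{y \<in> X. \<alpha> g y = x} = {}" using act[OF g] by auto
    then show ?thesis unfolding \<open>{y \<in> X. \<alpha> g y = x} = {}\<close> using False by simp
  qed
  show ?thesis
  proof (intro frep.intro opspace.intro frep_axioms.intro G perm_act_linear)
    show "stable (carrier G) ?\<rho> (funs X)"
      by (auto simp: stable_def subspace_funs) (auto simp: funs_def val)
    fix g h v assume gh: "g \<in> carrier G" "h \<in> carrier G"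
    show "?\<rho> (g \<otimes>\<^bsub>G\<^esub> h) v = ?\<rho> g (?\<rho> h v)"
    proof
      fix x
      show "?\<rho> (g \<otimes>\<^bsub>G\<^esub> h) v x = ?\<rho> g (?\<rho> h v) x"
        unfolding val[OF gh(1)] val[OF gh(2)] val[OF G.m_closed[OF gh]]
        using gh act[of "m_inv G g" x] by (simp add: G.inv_mult_group mult)
    qed
  next
    fix v assume v: "v \<in> funs X"
    show "?\<rho> \<one>\<^bsub>G\<^esub> v = v"
      unfolding val[OF G.one_closed] using v by (auto simp: fun_eq_iff funs_def one)
  qed
qed

lemma perm_trace:
  assumes X: "finite X" and "finite (carrier G)"
  shows "(\<Sum>x\<in>X. galg G (\<lambda>g v x. \<Sum>y\<in>{y \<in> X. \<alpha> g y = x}. v y) a (basis_vec x) x) =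
    (\<Sum>x\<in>X. \<Sum>g\<in>carrier G. if \<alpha> g x = x then a g else 0)"
proof (rule sum.cong[OF refl])
  fix x assume x: "x \<in> X"
  have "(\<Sum>y\<in>{y \<in> X. \<alpha> g y = x}. basis_vec x y) = (if \<alpha> g x = x then 1 else 0)" for g
  proof -
    have "(\<Sum>y\<in>{y \<in> X. \<alpha> g y = x}. basis_vec x y) = (\<Sum>y\<in>{y \<in> X. \<alpha> g y = x}. if y = x then 1 else 0)"
      by (intro sum.cong refl) (simp add: basis_vec_def)
    also have "\<dots> = (if \<alpha> g x = x then 1 else 0)" using X x by (simp add: sum.delta)
    finally show ?thesis .
  qed
  then show "galg G (\<lambda>g v x. \<Sum>y\<in>{y \<in> X. \<alpha> g y = x}. v y) a (basis_vec x) x =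
    (\<Sum>g\<in>carrier G. if \<alpha> g x = x then a g else 0)"
    unfolding galg_def sum_fun_apply cscale_apply by (intro sum.cong refl) simp
qed

text \<open>
  On each cycle of \<open>h\<close> with base point \<open>c\<close>, reflect: \<open>s\<close> sends \<open>h\<^sup>i c\<close> to \<open>h\<^sup>-\<^sup>i c\<close>. Base points are the least
  elements of the cycles.
\<close>

lemma inverse_conjugate_by_involution:
  fixes h :: "nat \<Rightarrow> nat"
  assumes h: "h permutes A" and A: "finite A"
  obtains s where "s permutes A" "s \<circ> s = id" "s \<circ> h = inv' h \<circ> s"
proof -
  have inj: "inj h" by (rule permutes_inj[OF h])
  have hi: "h (inv' h x) = x" "inv' h (h x) = x" for x using permutes_inverses[OF h] by auto
  have "permutation h" using h A permutation_permutes by blast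
  then obtain m where m: "(h ^^ m) = id" "m > 0" using permutation_is_nilpotent by blast
  define orb where "orb x = {z. \<exists>i. (h ^^ i) z = x}" for x
  define c where "c x = (LEAST z. z \<in> orb x)" for x
  have self: "x \<in> orb x" for x unfolding orb_def by (auto intro: exI[of _ 0])
  have cin: "c x \<in> orb x" for x unfolding c_def by (rule LeastI[of "\<lambda>z. z \<in> orb x", OF self])
  have orbh: "orb (h x) = orb x" for x
  proof (intro equalityI subsetI)
    fix z assume "z \<in> orb x"
    then obtain i where "(h ^^ i) z = x" by (auto simp: orb_def)
    then have "(h ^^ Suc i) z = h x" by simp
    then show "z \<in> orb (h x)" unfolding orb_def by blast
  next
    fix z assume "z \<in> orb (h x)"
    then obtain i where "(h ^^ i) z = h x" by (auto simp: orb_def)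
    then have "(h ^^ (m - 1 + i)) z = (h ^^ (m - 1)) (h x)" by (simp add: funpow_add)
    also have "\<dots> = (h ^^ m) x" using m(2) by (cases m) (simp_all add: funpow_swap1)
    finally show "z \<in> orb x" unfolding orb_def m(1) by auto
  qed
  have orbi: "orb ((h ^^ i) x) = orb x" for i x by (induction i) (simp_all add: orbh)
  have ch: "c (h x) = c x" for x by (simp add: c_def orbh)
  have ci: "c ((h ^^ i) x) = c x" for i x by (simp add: c_def orbi)
  have comm: "(h ^^ i) ((h ^^ j) x) = (h ^^ j) ((h ^^ i) x)" for i j x
    by (metis add.commute comp_apply funpow_add)
  have ih: "(inv' h ^^ i) ((h ^^ i) x) = x" "(h ^^ i) ((inv' h ^^ i) x) = x" for i x
    by (induction i arbitrary: x) (simp_all add: hi funpow_swap1)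
  have wd: "(inv' h ^^ i) z = (inv' h ^^ j) z" if "(h ^^ i) z = (h ^^ j) z" for i j z
  proof -
    have "(h ^^ i) ((h ^^ j) ((inv' h ^^ i) z)) = (h ^^ j) z" using comm ih(2) by metis
    also have "\<dots> = (h ^^ i) z" using that by simp
    finally have "(h ^^ j) ((inv' h ^^ i) z) = z" by (metis ih(1))
    then show ?thesis by (metis ih(1))
  qed
  define s where "s x = (inv' h ^^ (SOME i. (h ^^ i) (c x) = x)) (c x)" for x
  have s: "s x = (inv' h ^^ i) (c x)" if "(h ^^ i) (c x) = x" for i x
  proof -
    have "(h ^^ (SOME i. (h ^^ i) (c x) = x)) (c x) = x" by (rule someI[of "\<lambda>i. (h ^^ i) (c x) = x", OF that])
    then show ?thesis unfolding s_def using wd that by metis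
  qed
  have ex: "\<exists>i. (h ^^ i) (c x) = x" for x using cin[of x] by (simp add: orb_def)
  have sh: "s (h x) = inv' h (s x)" for x
  proof -
    obtain i where i: "(h ^^ i) (c x) = x" using ex by blast
    then have "(h ^^ Suc i) (c (h x)) = h x" by (simp add: ch)
    then have "s (h x) = (inv' h ^^ Suc i) (c (h x))" by (rule s)
    then show ?thesis using s[OF i] by (simp add: ch)
  qed
  have ss: "s (s x) = x" for x
  proof -
    obtain i where i: "(h ^^ i) (c x) = x" using ex by blast
    have sx: "s x = (inv' h ^^ i) (c x)" by (rule s[OF i])
    have "(h ^^ i) (s x) = c x" unfolding sx by (rule ih(2))
    then have cs: "c (s x) = c x" using ci[of i "s x"] ci[of i "c x"] i by metis
    obtain j where j: "(h ^^ j) (c (s x)) = s x" using ex by blast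
    have "(h ^^ i) ((h ^^ j) (c x)) = c x" using \<open>(h ^^ i) (s x) = c x\<close> j cs by simp
    then have "(h ^^ j) x = c x" using comm i by metis
    then have "x = (inv' h ^^ j) (c x)" using ih(1) by metis
    then show ?thesis using s[OF j] cs by simp
  qed
  have out: "s x = x" if x: "x \<notin> A" for x
  proof -
    have "h x = x" using h x by (simp add: permutes_not_in)
    then have hx: "(h ^^ i) x = x" for i by (induction i) simp_all
    obtain i where i: "(h ^^ i) (c x) = x" using ex by blast
    then have "(h ^^ i) (c x) = (h ^^ i) x" using hx by simp
    then have cx: "c x = x" by (metis ih(1))
    show ?thesis using s[of 0 x] cx by simp
  qed
  show ?thesis
  proof (rule that[of s])
    show "s permutes A" unfolding permutes_def
    proof (intro conjI allI impI)
      show "s x = x" if "x \<notin> A" for x using out[OF that] .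
      fix y show "\<exists>!x. s x = y" by (rule ex1I[of _ "s y"]) (use ss in auto)
    qed
    show "s \<circ> s = id" using ss by auto
    show "s \<circ> h = inv' h \<circ> s" using sh by auto
  qed
qed

lemma onto_comp_perm: "f \<in> onto r k \<Longrightarrow> h permutes {1..r} \<Longrightarrow> f \<circ> h \<in> onto r k"
  using onto_comp[of h r r f k] by (simp add: onto_self_iff)

lemma onto_perm_comp: "f \<in> onto r k \<Longrightarrow> g permutes {1..k} \<Longrightarrow> g \<circ> f \<in> onto r k"
  using onto_comp[of f r k g k] by (simp add: onto_self_iff)

text \<open>
  Composing with an involution that conjugates \<open>h\<close> to its inverse exchanges the two fixed point sets.
\<close>

lemma card_fixed_inverse:
  assumes h: "h permutes {1..r}"
  shows "card {f \<in> onto r k. y \<circ> f \<circ> inv' h = f} = card {f \<in> onto r k. y \<circ> f \<circ> h = f}"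
proof -
  obtain s where s: "s permutes {1..r}" "s \<circ> s = id" "s \<circ> h = inv' h \<circ> s"
    using inverse_conjugate_by_involution[OF h finite_atLeastAtMost] by blast
  have hs: "h \<circ> s = s \<circ> inv' h"
  proof -
    have "s \<circ> (s \<circ> h) \<circ> s = s \<circ> (inv' h \<circ> s) \<circ> s" using s(3) by simp
    then show ?thesis using s(2) by (simp add: o_assoc[symmetric]) (simp add: o_assoc)
  qed
  have "bij_betw (\<lambda>f. f \<circ> s) {f \<in> onto r k. y \<circ> f \<circ> inv' h = f} {f \<in> onto r k. y \<circ> f \<circ> h = f}"
  proof (rule bij_betwI[where g = "\<lambda>f. f \<circ> s"])
    show "(\<lambda>f. f \<circ> s) \<in> {f \<in> onto r k. y \<circ> f \<circ> inv' h = f} \<rightarrow> {f \<in> onto r k. y \<circ> f \<circ> h = f}"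
    proof
      fix f assume f: "f \<in> {f \<in> onto r k. y \<circ> f \<circ> inv' h = f}"
      have "y \<circ> (f \<circ> s) \<circ> h = y \<circ> f \<circ> (s \<circ> h)" by (simp add: o_assoc)
      also have "\<dots> = (y \<circ> f \<circ> inv' h) \<circ> s" unfolding s(3) by (simp add: o_assoc)
      finally show "f \<circ> s \<in> {f \<in> onto r k. y \<circ> f \<circ> h = f}" using f onto_comp_perm[OF _ s(1)] by simp
    qed
    show "(\<lambda>f. f \<circ> s) \<in> {f \<in> onto r k. y \<circ> f \<circ> h = f} \<rightarrow> {f \<in> onto r k. y \<circ> f \<circ> inv' h = f}"
    proof
      fix f assume f: "f \<in> {f \<in> onto r k. y \<circ> f \<circ> h = f}"
      have "y \<circ> (f \<circ> s) \<circ> inv' h = y \<circ> f \<circ> (s \<circ> inv' h)" by (simp add: o_assoc)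
      also have "\<dots> = (y \<circ> f \<circ> h) \<circ> s" unfolding hs[symmetric] by (simp add: o_assoc)
      finally show "f \<circ> s \<in> {f \<in> onto r k. y \<circ> f \<circ> inv' h = f}" using f onto_comp_perm[OF _ s(1)] by simp
    qed
  qed (simp_all add: o_assoc[symmetric] s(2))
  then show ?thesis by (rule bij_betw_same_card)
qed

lemma fixed_point_sum_card:
  "(\<Sum>f\<in>onto r k. \<Sum>y\<in>Sym k. \<Sum>h\<in>Sym r. if P y f h then a y * b h else 0) =
    (\<Sum>y\<in>Sym k. \<Sum>h\<in>Sym r. of_nat (card {f \<in> onto r k. P y f h}) * (a y * b h :: complex))"
proof -
  have "(\<Sum>f\<in>onto r k. \<Sum>y\<in>Sym k. \<Sum>h\<in>Sym r. if P y f h then a y * b h else 0) =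
    (\<Sum>y\<in>Sym k. \<Sum>f\<in>onto r k. \<Sum>h\<in>Sym r. if P y f h then a y * b h else 0)" by (rule sum.swap)
  also have "\<dots> = (\<Sum>y\<in>Sym k. \<Sum>h\<in>Sym r. \<Sum>f\<in>onto r k. if P y f h then a y * b h else 0)"
    by (rule sum.cong[OF refl], rule sum.swap)
  also have "\<dots> = (\<Sum>y\<in>Sym k. \<Sum>h\<in>Sym r. of_nat (card {f \<in> onto r k. P y f h}) * (a y * b h))"
    by (intro sum.cong refl) (simp add: sum.inter_filter[OF finite_onto, symmetric])
  finally show ?thesis .
qed

lemma fixed_point_sum_inverse:
  "(\<Sum>f\<in>onto r k. \<Sum>y\<in>Sym k. \<Sum>h\<in>Sym r. if y \<circ> f \<circ> inv' h = f then a y * b h else 0) = fixed_point_sum r k a b"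
  unfolding fixed_point_sum_def fixed_point_sum_card
  by (intro sum.cong refl) (simp add: card_fixed_inverse)

lemma constituent_multiplicity_SE_hom:
  assumes r: "sum_list \<alpha> = r" "r \<le> n" and k: "sum_list \<beta> = k" "k \<le> n"
    and ea: "SE_idempotent_for \<alpha> a" and eb: "SE_idempotent_for \<beta> b"
  shows "of_nat (constituent_multiplicity (carrier (sym_group k \<times>\<times> sym_group r)) (SE_hom_module n r k)
    (outer_tensor (Specht \<beta>) (Specht \<alpha>))) = fixed_point_sum r k b a"
proof -
  from Specht_of_idempotent[OF r(1) ea] obtain u where A: "primitive_idem (sym_group r) a"
    "frep (sym_group r) (Specht_act \<alpha>) (Specht_space \<alpha>)"
    "op_simple (carrier (sym_group r)) (fun_module (Specht_space \<alpha>) (Specht_act \<alpha>))"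
    "u \<in> Specht_space \<alpha>" "u \<noteq> 0" "galg (sym_group r) (Specht_act \<alpha>) a u = u" by metis
  from Specht_of_idempotent[OF k(1) eb] obtain w where B: "primitive_idem (sym_group k) b"
    "frep (sym_group k) (Specht_act \<beta>) (Specht_space \<beta>)"
    "op_simple (carrier (sym_group k)) (fun_module (Specht_space \<beta>) (Specht_act \<beta>))"
    "w \<in> Specht_space \<beta>" "w \<noteq> 0" "galg (sym_group k) (Specht_act \<beta>) b w = w" by metis
  let ?G = "sym_group k \<times>\<times> sym_group r"
  let ?X = "SE_hom n r k"
  let ?\<alpha> = "\<lambda>(g1, g2) (s, t, f). (s, t, g1 \<circ> f \<circ> m_inv (sym_group r) g2)"
  let ?\<rho> = "\<lambda>g v x. \<Sum>y\<in>{y \<in> ?X. ?\<alpha> g y = x}. v y :: complex"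
  have GH: "fin_group ?G" by (rule fin_group_DirProd[OF fin_group_sym fin_group_sym])
  have finX: "finite ?X" unfolding SE_hom_eq[OF r(2) k(2)] using finite_onto by simp
  have frX: "frep ?G ?\<rho> (funs ?X)"
  proof (rule frep_perm[OF GH])
    fix g x assume "g \<in> carrier ?G" "x \<in> ?X"
    then obtain g1 g2 f where e: "g = (g1, g2)" "x = (r, k, f)" "g1 permutes {1..k}" "g2 permutes {1..r}" "f \<in> onto r k"
      by (auto simp: SE_hom_eq[OF r(2) k(2)] sym_group_carrier)
    have "g1 \<circ> f \<circ> inv' g2 \<in> onto r k"
      by (rule onto_comp_perm[OF onto_perm_comp[OF e(5,3)] permutes_inv[OF e(4)]])
    then show "?\<alpha> g x \<in> ?X" unfolding e(1,2) SE_hom_eq[OF r(2) k(2)] case_prod_conv inv_sym[OF e(4)]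
      by (rule imageI)
  next
    fix g h x assume gh: "g \<in> carrier ?G" "h \<in> carrier ?G" and x: "x \<in> ?X"
    obtain g1 g2 h1 h2 s t f where e: "g = (g1, g2)" "h = (h1, h2)" "x = (s, t, f)"
      by (cases g; cases h; cases x)
    have "inv' (g2 \<circ> h2) = inv' h2 \<circ> inv' g2"
      using gh by (intro o_inv_distrib permutes_bij) (auto simp: e sym_group_carrier)
    moreover have "g2 \<circ> h2 \<in> carrier (sym_group r)" using gh by (auto simp: e sym_group_carrier intro: permutes_compose)
    ultimately show "?\<alpha> (g \<otimes>\<^bsub>?G\<^esub> h) x = ?\<alpha> g (?\<alpha> h x)"
      using gh by (auto simp: e sym_group_mult o_assoc)
  next
    fix x assume "x \<in> ?X"
    have "id \<in> carrier (sym_group r)" by (simp add: sym_group_carrier permutes_id)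
    then show "?\<alpha> \<one>\<^bsub>?G\<^esub> x = x" by (cases x) (simp add: sym_group_one)
  qed
  interpret X: frep ?G ?\<rho> "funs ?X" by (rule frX)
  let ?E = "tensor b a"
  have sE: "schur_idem ?G ?E"
    by (rule schur_idem_tensor[OF fin_group_sym fin_group_sym primitive_idem.schur_idem[OF B(1)] primitive_idem.schur_idem[OF A(1)]])
  note ts = tensor_simple[OF B(2,3) A(2,3) primitive_idem.schur_idem[OF B(1)] primitive_idem.schur_idem[OF A(1)] B(4-6) A(4-6)]
  have idem: "galg ?G ?\<rho> ?E (galg ?G ?\<rho> ?E v) = galg ?G ?\<rho> ?E v" if "v \<in> funs ?X" for v
    using X.galg_gmult[OF that, of ?E ?E] sE by (simp add: schur_idem_def)
  have "of_nat (constituent_multiplicity (carrier ?G) (fun_module (funs ?X) ?\<rho>)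
      (fun_module (tensor_space (Specht_space \<beta>) (Specht_space \<alpha>)) (tensor_act (Specht_act \<beta>) (Specht_act \<alpha>)))) =
    (\<Sum>x\<in>?X. galg ?G ?\<rho> ?E (basis_vec x) x)"
    by (rule X.constituent_multiplicity_trace[OF finX order_refl sE frep_tensor[OF B(2) A(2)] ts(4,1,2,3) X.galg_linear
      X.galg_closed[OF X.stable_V] idem])
  also have "\<dots> = (\<Sum>x\<in>?X. \<Sum>g\<in>carrier ?G. if ?\<alpha> g x = x then ?E g else 0)"
    by (rule perm_trace[OF finX X.fin])
  also have "\<dots> = (\<Sum>f\<in>onto r k. \<Sum>g\<in>carrier ?G. if ?\<alpha> g (r, k, f) = (r, k, f) then ?E g else 0)"
    unfolding SE_hom_eq[OF r(2) k(2)] by (subst sum.reindex) (auto simp: inj_on_def)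
  also have "\<dots> = (\<Sum>f\<in>onto r k. \<Sum>y\<in>Sym k. \<Sum>h\<in>Sym r. if y \<circ> f \<circ> inv' h = f then b y * a h else 0)"
  proof (rule sum.cong[OF refl])
    fix f
    have "(\<Sum>g\<in>carrier ?G. if ?\<alpha> g (r, k, f) = (r, k, f) then ?E g else 0) =
      (\<Sum>(y, h)\<in>Sym k \<times> Sym r. if y \<circ> f \<circ> inv' h = f then b y * a h else 0)"
      unfolding carrier_DirProd carrier_sym
    proof (rule sum.cong[OF refl])
      fix p assume "p \<in> Sym k \<times> Sym r"
      then obtain y h where p: "p = (y, h)" "h permutes {1..r}" by auto
      show "(if ?\<alpha> p (r, k, f) = (r, k, f) then ?E p else 0) =
        (case p of (y, h) \<Rightarrow> if y \<circ> f \<circ> inv' h = f then b y * a h else 0)"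
        unfolding p(1) case_prod_conv inv_sym[OF p(2)] tensor_apply prod.inject by (simp only: simp_thms)
    qed
    then show "(\<Sum>g\<in>carrier ?G. if ?\<alpha> g (r, k, f) = (r, k, f) then ?E g else 0) =
      (\<Sum>y\<in>Sym k. \<Sum>h\<in>Sym r. if y \<circ> f \<circ> inv' h = f then b y * a h else 0)"
      by (simp only: sum.cartesian_product)
  qed
  also have "\<dots> = fixed_point_sum r k b a" by (rule fixed_point_sum_inverse)
  finally show ?thesis
    unfolding SE_hom_module_def perm_module_eq Specht_eq outer_tensor_eq .
qed



section \<open>Transport of multiplicities along isomorphisms\<close>

definition iso_via :: "'g set \<Rightarrow> ('v \<Rightarrow> 'w) \<Rightarrow> ('g, 'v) op_module \<Rightarrow> ('g, 'w) op_module \<Rightarrow> bool"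
  where "iso_via \<Omega> \<phi> M N \<longleftrightarrow> bij_betw \<phi> (carrier M) (carrier N) \<and>
    (\<forall>x\<in>carrier M. \<forall>y\<in>carrier M. \<phi> (x \<oplus>\<^bsub>M\<^esub> y) = \<phi> x \<oplus>\<^bsub>N\<^esub> \<phi> y) \<and>
    (\<forall>c. \<forall>v\<in>carrier M. \<phi> (c \<odot>\<^bsub>M\<^esub> v) = c \<odot>\<^bsub>N\<^esub> \<phi> v) \<and>
    (\<forall>g\<in>\<Omega>. \<forall>v\<in>carrier M. \<phi> (act M g v) = act N g (\<phi> v))"

lemma op_iso_iff: "op_iso \<Omega> M N \<longleftrightarrow> (\<exists>\<phi>. iso_via \<Omega> \<phi> M N)"
proof
  assume "op_iso \<Omega> M N"
  then obtain \<phi> where "\<phi> \<in> iso (add_monoid M) (add_monoid N)"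
      "\<forall>c. \<forall>v\<in>carrier M. \<phi> (c \<odot>\<^bsub>M\<^esub> v) = c \<odot>\<^bsub>N\<^esub> \<phi> v"
      "\<forall>g\<in>\<Omega>. \<forall>v\<in>carrier M. \<phi> (act M g v) = act N g (\<phi> v)"
    unfolding op_iso_def by blast
  then have "iso_via \<Omega> \<phi> M N" by (simp add: iso_via_def iso_def hom_def)
  then show "\<exists>\<phi>. iso_via \<Omega> \<phi> M N" by blast
next
  assume "\<exists>\<phi>. iso_via \<Omega> \<phi> M N"
  then obtain \<phi> where p: "iso_via \<Omega> \<phi> M N" by blast
  then have "\<phi> \<in> iso (add_monoid M) (add_monoid N)"
    using bij_betwE by (force simp: iso_via_def iso_def hom_def)
  then show "op_iso \<Omega> M N" using p unfolding op_iso_def iso_via_def by blast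
qed

lemma iso_viaD:
  assumes "iso_via \<Omega> \<phi> M N"
  shows "bij_betw \<phi> (carrier M) (carrier N)"
    "\<And>x y. x \<in> carrier M \<Longrightarrow> y \<in> carrier M \<Longrightarrow> \<phi> (x \<oplus>\<^bsub>M\<^esub> y) = \<phi> x \<oplus>\<^bsub>N\<^esub> \<phi> y"
    "\<And>c v. v \<in> carrier M \<Longrightarrow> \<phi> (c \<odot>\<^bsub>M\<^esub> v) = c \<odot>\<^bsub>N\<^esub> \<phi> v"
    "\<And>g v. g \<in> \<Omega> \<Longrightarrow> v \<in> carrier M \<Longrightarrow> \<phi> (act M g v) = act N g (\<phi> v)"
  using assms by (auto simp: iso_via_def)

definition act_closed :: "'g set \<Rightarrow> ('g, 'v) op_module \<Rightarrow> bool"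
  where "act_closed \<Omega> M \<longleftrightarrow> module complex_ring M \<and> (\<forall>g\<in>\<Omega>. \<forall>v\<in>carrier M. act M g v \<in> carrier M)"

lemma module_ops:
  assumes "module complex_ring M"
  shows "x \<in> carrier M \<Longrightarrow> y \<in> carrier M \<Longrightarrow> x \<oplus>\<^bsub>M\<^esub> y \<in> carrier M"
    "v \<in> carrier M \<Longrightarrow> c \<odot>\<^bsub>M\<^esub> v \<in> carrier M" "\<zero>\<^bsub>M\<^esub> \<in> carrier M"
    "v \<in> carrier M \<Longrightarrow> 0 \<odot>\<^bsub>M\<^esub> v = \<zero>\<^bsub>M\<^esub>"
proof -
  interpret module complex_ring M by fact
  show "x \<in> carrier M \<Longrightarrow> y \<in> carrier M \<Longrightarrow> x \<oplus>\<^bsub>M\<^esub> y \<in> carrier M" by simp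
  show "\<zero>\<^bsub>M\<^esub> \<in> carrier M" by simp
  show "v \<in> carrier M \<Longrightarrow> c \<odot>\<^bsub>M\<^esub> v \<in> carrier M" using smult_closed[of c v] by (simp add: complex_ring_simps)
  show "v \<in> carrier M \<Longrightarrow> 0 \<odot>\<^bsub>M\<^esub> v = \<zero>\<^bsub>M\<^esub>" using smult_l_null[of v] by (simp add: complex_ring_simps)
qed

lemma iso_via_inverse:
  assumes M: "act_closed \<Omega> M" and p: "iso_via \<Omega> \<phi> M N"
  shows "iso_via \<Omega> (inv_into (carrier M) \<phi>) N M"
proof -
  let ?i = "inv_into (carrier M) \<phi>"
  note p' = iso_viaD[OF p]
  have mod: "module complex_ring M" using M by (simp add: act_closed_def)
  have inv: "?i (\<phi> v) = v" if "v \<in> carrier M" for v by (rule bij_betw_inv_into_left[OF p'(1) that])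
  have ex: "\<exists>v\<in>carrier M. w = \<phi> v" if "w \<in> carrier N" for w using that p'(1) by (auto simp: bij_betw_def)
  show ?thesis
    unfolding iso_via_def
  proof (intro conjI ballI allI)
    show "bij_betw ?i (carrier N) (carrier M)" by (rule bij_betw_inv_into[OF p'(1)])
    fix x assume "x \<in> carrier N"
    then obtain v where v: "v \<in> carrier M" "x = \<phi> v" using ex by blast
    show "?i (c \<odot>\<^bsub>N\<^esub> x) = c \<odot>\<^bsub>M\<^esub> ?i x" for c
      unfolding v(2) p'(3)[OF v(1), symmetric] inv[OF v(1)] by (rule inv[OF module_ops(2)[OF mod v(1)]])
    show "?i (act N g x) = act M g (?i x)" if "g \<in> \<Omega>" for g
      unfolding v(2) p'(4)[OF that v(1), symmetric] inv[OF v(1)]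
      by (rule inv) (use M that v(1) in \<open>simp add: act_closed_def\<close>)
    fix y assume "y \<in> carrier N"
    then obtain w where w: "w \<in> carrier M" "y = \<phi> w" using ex by blast
    show "?i (x \<oplus>\<^bsub>N\<^esub> y) = ?i x \<oplus>\<^bsub>M\<^esub> ?i y"
      unfolding v(2) w(2) p'(2)[OF v(1) w(1), symmetric] inv[OF v(1)] inv[OF w(1)]
      by (rule inv[OF module_ops(1)[OF mod v(1) w(1)]])
  qed
qed

lemma iso_via_comp:
  assumes p: "iso_via \<Omega> \<phi> L M" and q: "iso_via \<Omega> \<psi> M N"
  shows "iso_via \<Omega> (\<lambda>x. \<psi> (\<phi> x)) L N"
proof -
  have im: "\<phi> x \<in> carrier M" if "x \<in> carrier L" for x
    using bij_betwE[OF iso_viaD(1)[OF p]] that by blast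
  have "bij_betw (\<psi> \<circ> \<phi>) (carrier L) (carrier N)"
    by (rule bij_betw_trans[OF iso_viaD(1)[OF p] iso_viaD(1)[OF q]])
  then show ?thesis
    unfolding iso_via_def
    by (auto simp: comp_def iso_viaD(2-4)[OF p] iso_viaD(2-4)[OF q] im)
qed

lemma iso_via_zero:
  assumes "module complex_ring M" "module complex_ring N" "iso_via \<Omega> \<phi> M N"
  shows "\<phi> \<zero>\<^bsub>M\<^esub> = \<zero>\<^bsub>N\<^esub>"
proof -
  have 0: "\<zero>\<^bsub>M\<^esub> \<in> carrier M" by (rule module_ops(3)[OF assms(1)])
  have "\<phi> \<zero>\<^bsub>M\<^esub> = \<phi> (0 \<odot>\<^bsub>M\<^esub> \<zero>\<^bsub>M\<^esub>)" using module_ops(4)[OF assms(1) 0] by simp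
  also have "\<dots> = 0 \<odot>\<^bsub>N\<^esub> \<phi> \<zero>\<^bsub>M\<^esub>" by (rule iso_viaD(3)[OF assms(3) 0])
  also have "\<dots> = \<zero>\<^bsub>N\<^esub>"
    using module_ops(4)[OF assms(2)] bij_betwE[OF iso_viaD(1)[OF assms(3)]] 0 by blast
  finally show ?thesis .
qed

lemma submodule_image:
  assumes M: "module complex_ring M" and N: "module complex_ring N" and p: "iso_via \<Omega> \<phi> M N"
    and U: "op_submodule \<Omega> U M"
  shows "op_submodule \<Omega> (\<phi> ` U) N"
proof -
  note u = U[unfolded complex_module_sub_iff[OF M]]
  have UM: "x \<in> carrier M" if "x \<in> U" for x using u that by blast
  show ?thesis
    unfolding complex_module_sub_iff[OF N]
  proof (intro conjI ballI allI)
    show "\<phi> ` U \<subseteq> carrier N" using UM bij_betwE[OF iso_viaD(1)[OF p]] by blast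
    show "\<zero>\<^bsub>N\<^esub> \<in> \<phi> ` U" using iso_via_zero[OF M N p] u by (metis image_eqI)
    show "x \<oplus>\<^bsub>N\<^esub> y \<in> \<phi> ` U" if xy: "x \<in> \<phi> ` U" "y \<in> \<phi> ` U" for x y
    proof -
      obtain a b where ab: "a \<in> U" "b \<in> U" "x = \<phi> a" "y = \<phi> b" using xy by blast
      have "x \<oplus>\<^bsub>N\<^esub> y = \<phi> (a \<oplus>\<^bsub>M\<^esub> b)" unfolding ab(3,4) using iso_viaD(2)[OF p UM[OF ab(1)] UM[OF ab(2)]] by simp
      then show ?thesis using u ab by blast
    qed
    show "c \<odot>\<^bsub>N\<^esub> x \<in> \<phi> ` U" if x: "x \<in> \<phi> ` U" for c x
    proof -
      obtain a where a: "a \<in> U" "x = \<phi> a" using x by blast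
      have "c \<odot>\<^bsub>N\<^esub> x = \<phi> (c \<odot>\<^bsub>M\<^esub> a)" unfolding a(2) using iso_viaD(3)[OF p UM[OF a(1)]] by simp
      then show ?thesis using u a by blast
    qed
    show "act N g x \<in> \<phi> ` U" if g: "g \<in> \<Omega>" and x: "x \<in> \<phi> ` U" for g x
    proof -
      obtain a where a: "a \<in> U" "x = \<phi> a" using x by blast
      have "act N g x = \<phi> (act M g a)" unfolding a(2) using iso_viaD(4)[OF p g UM[OF a(1)]] by simp
      then show ?thesis using u a g by blast
    qed
  qed
qed

lemma simple_image:
  assumes M: "act_closed \<Omega> M" and N: "module complex_ring N" and p: "iso_via \<Omega> \<phi> M N" and s: "op_simple \<Omega> M"
  shows "op_simple \<Omega> N"
proof -
  have mod: "module complex_ring M" using M by (simp add: act_closed_def)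
  let ?i = "inv_into (carrier M) \<phi>"
  note q = iso_via_inverse[OF M p]
  have im: "\<phi> ` carrier M = carrier N" using iso_viaD(1)[OF p] by (simp add: bij_betw_def)
  have z: "\<phi> \<zero>\<^bsub>M\<^esub> = \<zero>\<^bsub>N\<^esub>" by (rule iso_via_zero[OF mod N p])
  have img_back: "\<phi> ` (?i ` K) = K" if "K \<subseteq> carrier N" for K
    using image_inv_into_cancel[OF im that] .
  have "carrier N \<noteq> {\<zero>\<^bsub>N\<^esub>}"
  proof
    assume "carrier N = {\<zero>\<^bsub>N\<^esub>}"
    then have "?i ` carrier N = {?i \<zero>\<^bsub>N\<^esub>}" by simp
    moreover have "?i \<zero>\<^bsub>N\<^esub> = \<zero>\<^bsub>M\<^esub>" by (rule iso_via_zero[OF N mod q])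
    moreover have "?i ` carrier N = carrier M" using iso_viaD(1)[OF q] by (simp add: bij_betw_def)
    ultimately show False using s by (simp add: op_simple_def)
  qed
  moreover have "K = {\<zero>\<^bsub>N\<^esub>} \<or> K = carrier N" if K: "op_submodule \<Omega> K N" for K
  proof -
    have KN: "K \<subseteq> carrier N" using K unfolding complex_module_sub_iff[OF N] by blast
    have "op_submodule \<Omega> (?i ` K) M" by (rule submodule_image[OF N mod q K])
    then consider "?i ` K = {\<zero>\<^bsub>M\<^esub>}" | "?i ` K = carrier M" using s by (auto simp: op_simple_def)
    then show ?thesis
    proof cases
      case 1
      then show ?thesis using img_back[OF KN] z by simp
    next
      case 2
      then show ?thesis using img_back[OF KN] im by simp
    qed
  qed
  ultimately show ?thesis by (simp add: op_simple_def)
qed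

lemma module_submodule:
  assumes M: "module complex_ring M" and U: "op_submodule \<Omega> U M"
  shows "module complex_ring (M\<lparr>carrier := U\<rparr>)" "act_closed \<Omega> (M\<lparr>carrier := U\<rparr>)"
proof -
  note u = U[unfolded complex_module_sub_iff[OF M]]
  show "module complex_ring (M\<lparr>carrier := U\<rparr>)"
    using U by (intro submodule.submodule_is_module[OF _ M]) (simp add: op_submodule_def)
  then show "act_closed \<Omega> (M\<lparr>carrier := U\<rparr>)" using u by (simp add: act_closed_def)
qed

lemma finsum_image:
  assumes M: "module complex_ring M" and N: "module complex_ring N" and p: "iso_via \<Omega> \<phi> M N"
  shows "finite I \<Longrightarrow> (\<And>i. i \<in> I \<Longrightarrow> f i \<in> carrier M) \<Longrightarrow>
    (\<And>i. i \<in> I \<Longrightarrow> g i = \<phi> (f i)) \<Longrightarrow> \<phi> (\<Oplus>\<^bsub>M\<^esub>i\<in>I. f i) = (\<Oplus>\<^bsub>N\<^esub>i\<in>I. g i)"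
proof (induction I rule: finite_induct)
  interpret M: module complex_ring M by fact
  interpret N: module complex_ring N by fact
  case empty
  then show ?case using iso_via_zero[OF M N p] by simp
next
  interpret M: module complex_ring M by fact
  interpret N: module complex_ring N by fact
  case (insert x F)
  have im: "\<phi> v \<in> carrier N" if "v \<in> carrier M" for v using bij_betwE[OF iso_viaD(1)[OF p]] that by blast
  have fF: "f \<in> F \<rightarrow> carrier M" and gF: "g \<in> F \<rightarrow> carrier N" using insert.prems im by auto
  have "\<phi> (\<Oplus>\<^bsub>M\<^esub>i\<in>insert x F. f i) = \<phi> (f x \<oplus>\<^bsub>M\<^esub> (\<Oplus>\<^bsub>M\<^esub>i\<in>F. f i))"
    using insert.hyps fF insert.prems(1)[of x] by (simp add: M.finsum_insert)
  also have "\<dots> = g x \<oplus>\<^bsub>N\<^esub> (\<Oplus>\<^bsub>N\<^esub>i\<in>F. g i)"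
    using iso_viaD(2)[OF p, of "f x" "\<Oplus>\<^bsub>M\<^esub>i\<in>F. f i"] insert.IH insert.prems M.finsum_closed[OF fF] by simp
  also have "\<dots> = (\<Oplus>\<^bsub>N\<^esub>i\<in>insert x F. g i)"
    using insert.hyps gF insert.prems im[of "f x"] by (simp add: N.finsum_insert)
  finally show ?case .
qed

lemma decomposition_image:
  assumes M: "act_closed \<Omega> M" and N: "act_closed \<Omega> N" and p: "iso_via \<Omega> \<phi> M N"
    and dec: "irreducible_decomposition \<Omega> M Us"
  shows "\<exists>Us'. irreducible_decomposition \<Omega> N Us' \<and>
    card {i. i < length Us \<and> op_iso \<Omega> (M\<lparr>carrier := Us ! i\<rparr>) S} =
    card {i. i < length Us' \<and> op_iso \<Omega> (N\<lparr>carrier := Us' ! i\<rparr>) S}"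
proof -
  have mM: "module complex_ring M" and mN: "module complex_ring N" using M N by (simp_all add: act_closed_def)
  let ?i = "inv_into (carrier M) \<phi>"
  note q = iso_via_inverse[OF M p]
  have bij: "bij_betw \<phi> (carrier M) (carrier N)" by (rule iso_viaD(1)[OF p])
  let ?Us' = "map ((`) \<phi>) Us"
  have sub: "op_submodule \<Omega> U M" "op_simple \<Omega> (M\<lparr>carrier := U\<rparr>)" if "U \<in> set Us" for U
    using dec that unfolding irreducible_decomposition_def by blast+
  have subU: "U \<subseteq> carrier M" if "U \<in> set Us" for U
    using sub(1)[OF that] unfolding complex_module_sub_iff[OF mM] by blast
  have res: "iso_via \<Omega> \<phi> (M\<lparr>carrier := U\<rparr>) (N\<lparr>carrier := \<phi> ` U\<rparr>)" if "U \<in> set Us" for U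
    using bij_betw_subset[OF bij subU[OF that] refl] unfolding iso_via_def
    by (simp add: iso_viaD(2-4)[OF p] subsetD[OF subU[OF that]])
  have "op_submodule \<Omega> (\<phi> ` U) N \<and> op_simple \<Omega> (N\<lparr>carrier := \<phi> ` U\<rparr>)" if U: "U \<in> set Us" for U
    using submodule_image[OF mM mN p sub(1)[OF U]]
      simple_image[OF module_submodule(2)[OF mM sub(1)[OF U]] module_submodule(1)[OF mN submodule_image[OF mM mN p sub(1)[OF U]]] res[OF U] sub(2)[OF U]]
    by blast
  then have 1: "\<forall>U\<in>set ?Us'. op_submodule \<Omega> U N \<and> op_simple \<Omega> (N\<lparr>carrier := U\<rparr>)" by auto
  have 2: "\<exists>!u. u \<in> (\<Pi>\<^sub>E i\<in>{..<length ?Us'}. ?Us' ! i) \<and> w = (\<Oplus>\<^bsub>N\<^esub>i\<in>{..<length ?Us'}. u i)" if w: "w \<in> carrier N" for w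
  proof -
    obtain v where v: "v \<in> carrier M" "w = \<phi> v" using w bij by (auto simp: bij_betw_def)
    let ?E = "\<lambda>u. u \<in> (\<Pi>\<^sub>E i\<in>{..<length Us}. Us ! i) \<and> v = (\<Oplus>\<^bsub>M\<^esub>i\<in>{..<length Us}. u i)"
    have ex1: "\<exists>!u. ?E u" using dec v(1) unfolding irreducible_decomposition_def by blast
    then obtain u where u: "?E u" by (rule ex1_implies_ex[THEN exE])
    have ui: "u i \<in> Us ! i" "u i \<in> carrier M" if "i < length Us" for i
      using PiE_mem[OF conjunct1[OF u], of i] subU[OF nth_mem[OF that]] that by auto
    show ?thesis
    proof (rule ex1I[of _ "\<lambda>i\<in>{..<length Us}. \<phi> (u i)"], rule conjI)
      show "(\<lambda>i\<in>{..<length Us}. \<phi> (u i)) \<in> (\<Pi>\<^sub>E i\<in>{..<length ?Us'}. ?Us' ! i)"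
        using ui(1) by auto
      have "\<phi> (\<Oplus>\<^bsub>M\<^esub>i\<in>{..<length Us}. u i) = (\<Oplus>\<^bsub>N\<^esub>i\<in>{..<length Us}. (\<lambda>i\<in>{..<length Us}. \<phi> (u i)) i)"
        by (rule finsum_image[OF mM mN p]) (use ui(2) in auto)
      then show "w = (\<Oplus>\<^bsub>N\<^esub>i\<in>{..<length ?Us'}. (\<lambda>i\<in>{..<length Us}. \<phi> (u i)) i)"
        using v(2) u by simp
    next
      fix t assume t: "t \<in> (\<Pi>\<^sub>E i\<in>{..<length ?Us'}. ?Us' ! i) \<and> w = (\<Oplus>\<^bsub>N\<^esub>i\<in>{..<length ?Us'}. t i)"
      have ti: "t i \<in> \<phi> ` (Us ! i)" if "i < length Us" for i
        using PiE_mem[OF conjunct1[OF t], of i] that by simp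
      let ?t = "\<lambda>i\<in>{..<length Us}. ?i (t i)"
      have tt: "?i (t i) \<in> Us ! i" "\<phi> (?i (t i)) = t i" "t i \<in> carrier N" if i: "i < length Us" for i
      proof -
        obtain a where a: "a \<in> Us ! i" "t i = \<phi> a" using ti[OF i] by blast
        have aM: "a \<in> carrier M" using a(1) subU[OF nth_mem[OF i]] by blast
        have "?i (t i) = a" unfolding a(2) by (rule bij_betw_inv_into_left[OF bij aM])
        then show "?i (t i) \<in> Us ! i" "\<phi> (?i (t i)) = t i" using a by simp_all
        show "t i \<in> carrier N" unfolding a(2) using bij_betwE[OF bij] aM by blast
      qed
      have "?i (\<Oplus>\<^bsub>N\<^esub>i\<in>{..<length Us}. t i) = (\<Oplus>\<^bsub>M\<^esub>i\<in>{..<length Us}. ?t i)"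
        by (rule finsum_image[OF mN mM q]) (use tt(3) in auto)
      moreover have "?i w = v" unfolding v(2) by (rule bij_betw_inv_into_left[OF bij v(1)])
      moreover have "?t \<in> (\<Pi>\<^sub>E i\<in>{..<length Us}. Us ! i)" using tt(1) by auto
      ultimately have "?E ?t" using t by simp
      then have "?t = u" using ex1 u by blast
      show "t = (\<lambda>i\<in>{..<length Us}. \<phi> (u i))"
      proof (rule ext)
        fix i
        show "t i = (\<lambda>i\<in>{..<length Us}. \<phi> (u i)) i"
        proof (cases "i < length Us")
          case True
          then have "u i = ?i (t i)" using fun_cong[OF \<open>?t = u\<close>, of i] by simp
          then show ?thesis using True tt(2) by simp
        next
          case False
          then show ?thesis using conjunct1[OF t] by (auto simp: PiE_def extensional_def)
        qed
      qed
    qed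
  qed
  have iff: "op_iso \<Omega> (M\<lparr>carrier := Us ! i\<rparr>) S \<longleftrightarrow> op_iso \<Omega> (N\<lparr>carrier := \<phi> ` (Us ! i)\<rparr>) S" if i: "i < length Us" for i
  proof -
    note r = res[OF nth_mem[OF i]]
    note r' = iso_via_inverse[OF module_submodule(2)[OF mM sub(1)[OF nth_mem[OF i]]] r]
    show ?thesis unfolding op_iso_iff using iso_via_comp[OF r] iso_via_comp[OF r'] by blast
  qed
  have "{i. i < length Us \<and> op_iso \<Omega> (M\<lparr>carrier := Us ! i\<rparr>) S} =
    {i. i < length ?Us' \<and> op_iso \<Omega> (N\<lparr>carrier := ?Us' ! i\<rparr>) S}"
  proof (rule Collect_cong)
    fix i
    show "(i < length Us \<and> op_iso \<Omega> (M\<lparr>carrier := Us ! i\<rparr>) S) \<longleftrightarrow>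
      (i < length ?Us' \<and> op_iso \<Omega> (N\<lparr>carrier := ?Us' ! i\<rparr>) S)"
      using iff[of i] by (cases "i < length Us") simp_all
  qed
  then have card: "card {i. i < length Us \<and> op_iso \<Omega> (M\<lparr>carrier := Us ! i\<rparr>) S} =
    card {i. i < length ?Us' \<and> op_iso \<Omega> (N\<lparr>carrier := ?Us' ! i\<rparr>) S}" by (rule arg_cong)
  have "irreducible_decomposition \<Omega> N ?Us'"
    unfolding irreducible_decomposition_def by (rule conjI[OF 1 ballI[OF 2]])
  then show ?thesis using card by (intro exI[of _ ?Us'] conjI)
qed

lemma constituent_multiplicity_iso:
  assumes M: "act_closed \<Omega> M" and N: "act_closed \<Omega> N" and p: "iso_via \<Omega> \<phi> M N"
  shows "constituent_multiplicity \<Omega> M S = constituent_multiplicity \<Omega> N S"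
proof -
  let ?P = "\<lambda>A m. \<exists>Us. irreducible_decomposition \<Omega> A Us \<and> m = card {i. i < length Us \<and> op_iso \<Omega> (A\<lparr>carrier := Us ! i\<rparr>) S}"
  have "?P M m = ?P N m" for m
  proof
    assume "?P M m"
    then obtain Us where Us: "irreducible_decomposition \<Omega> M Us"
      "m = card {i. i < length Us \<and> op_iso \<Omega> (M\<lparr>carrier := Us ! i\<rparr>) S}" by (elim exE conjE) (rule that)
    show "?P N m" unfolding Us(2) by (rule decomposition_image[OF M N p Us(1)])
  next
    assume "?P N m"
    then obtain Us where Us: "irreducible_decomposition \<Omega> N Us"
      "m = card {i. i < length Us \<and> op_iso \<Omega> (N\<lparr>carrier := Us ! i\<rparr>) S}" by (elim exE conjE) (rule that)
    show "?P M m" unfolding Us(2) by (rule decomposition_image[OF N M iso_via_inverse[OF M p] Us(1)])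
  qed
  then show ?thesis unfolding constituent_multiplicity_def by (intro arg_cong[where f = The] ext)
qed

section \<open>Induced representations as equivariant functions\<close>

text \<open>
  The action of \<open>e\<close> on functions of onto maps, through composition on the left. Its image \<open>avg_space\<close>
  encodes the equivariant maps \<open>\<Phi>\<close> into \<open>\<complex>S\<^sub>k e\<close> by \<open>\<phi> f = \<Phi> f id\<close>.
\<close>

definition avg :: "nat \<Rightarrow> nat \<Rightarrow> ((nat \<Rightarrow> nat) \<Rightarrow> complex) \<Rightarrow> ((nat \<Rightarrow> nat) \<Rightarrow> complex) \<Rightarrow> (nat \<Rightarrow> nat) \<Rightarrow> complex"
  where "avg r k e \<phi> = (\<lambda>f. if f \<in> onto r k then \<Sum>y\<in>Sym k. e y * \<phi> (y \<circ> f) else 0)"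

definition avg_space :: "nat \<Rightarrow> nat \<Rightarrow> ((nat \<Rightarrow> nat) \<Rightarrow> complex) \<Rightarrow> ((nat \<Rightarrow> nat) \<Rightarrow> complex) set"
  where "avg_space r k e = {\<phi> \<in> funs (onto r k). avg r k e \<phi> = \<phi>}"

definition precomp :: "(nat \<Rightarrow> nat) \<Rightarrow> ((nat \<Rightarrow> nat) \<Rightarrow> complex) \<Rightarrow> (nat \<Rightarrow> nat) \<Rightarrow> complex"
  where "precomp h \<phi> = (\<lambda>f. \<phi> (f \<circ> h))"

lemma onto_comp_perm_iff: "h permutes {1..r} \<Longrightarrow> f \<circ> h \<in> onto r k \<longleftrightarrow> f \<in> onto r k"
proof
  assume h: "h permutes {1..r}" and fh: "f \<circ> h \<in> onto r k"
  have "(f \<circ> h) \<circ> inv' h \<in> onto r k" by (rule onto_comp_perm[OF fh permutes_inv[OF h]])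
  then show "f \<in> onto r k" by (simp only: o_assoc[symmetric] permutes_inv_o(1)[OF h] comp_id)
qed (rule onto_comp_perm)

lemma avg_linear: "flinear (avg r k e)"
  by (rule flinearI) (auto simp: avg_def plus_fun_def cscale_def fun_eq_iff algebra_simps sum.distrib sum_distrib_left)

lemma precomp_linear: "flinear (precomp h)"
  by (rule flinearI) (auto simp: precomp_def plus_fun_def cscale_def)

lemma avg_precomp:
  assumes h: "h permutes {1..r}"
  shows "avg r k e (precomp h \<phi>) = precomp h (avg r k e \<phi>)"
  by (rule ext) (simp only: avg_def precomp_def onto_comp_perm_iff[OF h] o_assoc)

lemma avg_idem:
  assumes e: "gmult (sym_group k) e e = e"
  shows "avg r k e (avg r k e \<phi>) = avg r k e \<phi>"
proof (rule ext)
  fix f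
  show "avg r k e (avg r k e \<phi>) f = avg r k e \<phi> f"
  proof (cases "f \<in> onto r k")
    case True
    have "avg r k e (avg r k e \<phi>) f = (\<Sum>y\<in>Sym k. e y * (\<Sum>z\<in>Sym k. e z * \<phi> (z \<circ> (y \<circ> f))))"
      using True onto_perm_comp[OF True] by (simp add: avg_def)
    also have "\<dots> = (\<Sum>z\<in>Sym k. \<Sum>y\<in>Sym k. e z * e y * \<phi> (z \<circ> y \<circ> f))"
      unfolding sum_distrib_left by (subst sum.swap) (simp add: mult_ac o_assoc)
    also have "\<dots> = (\<Sum>z\<in>Sym k. \<Sum>x\<in>Sym k. e z * e (inv' z \<circ> x) * \<phi> (x \<circ> f))"
    proof (rule sum.cong[OF refl])
      fix z assume z: "z \<in> Sym k"
      then have zp: "z permutes {1..k}" by simp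
      show "(\<Sum>y\<in>Sym k. e z * e y * \<phi> (z \<circ> y \<circ> f)) = (\<Sum>x\<in>Sym k. e z * e (inv' z \<circ> x) * \<phi> (x \<circ> f))"
        by (rule sum.reindex_bij_witness[of _ "\<lambda>x. inv' z \<circ> x" "\<lambda>y. z \<circ> y"])
          (use z in \<open>simp_all add: o_assoc permutes_inv_o[OF zp] permutes_compose permutes_inv\<close>)
    qed
    also have "\<dots> = (\<Sum>x\<in>Sym k. \<Sum>z\<in>Sym k. e z * e (inv' z \<circ> x) * \<phi> (x \<circ> f))" by (rule sum.swap)
    also have "\<dots> = (\<Sum>x\<in>Sym k. gmult (sym_group k) e e x * \<phi> (x \<circ> f))"
      by (intro sum.cong refl) (simp add: gmult_sym_left[of _ k e e] sum_distrib_right)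
    also have "\<dots> = avg r k e \<phi> f" unfolding e using True by (simp add: avg_def)
    finally show ?thesis .
  qed (simp add: avg_def)
qed

lemma avg_funs: "avg r k e \<phi> \<in> funs (onto r k)"
  by (simp add: avg_def funs_def)

lemma frep_precomp: "frep (sym_group r) precomp (funs (onto r k))"
proof (intro frep.intro opspace.intro frep_axioms.intro fin_group_sym precomp_linear)
  show "stable (carrier (sym_group r)) precomp (funs (onto r k))"
    unfolding stable_def
  proof (intro conjI ballI subspace_funs)
    fix g v assume g: "g \<in> carrier (sym_group r)" and v: "v \<in> funs (onto r k)"
    have "f \<circ> g \<notin> onto r k" if "f \<notin> onto r k" for f
      using g that onto_comp_perm_iff[of g r f k] by (simp add: sym_group_carrier)
    then show "precomp g v \<in> funs (onto r k)" using v by (simp add: funs_def precomp_def del: comp_apply)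
  qed
qed (simp_all add: precomp_def sym_group_mult sym_group_one o_assoc)

lemma avg_space_sub: "avg_space r k e \<subseteq> funs (onto r k)"
  by (auto simp: avg_space_def)

lemma stable_avg_space: "stable (carrier (sym_group r)) precomp (avg_space r k e)"
proof -
  interpret F: frep "sym_group r" precomp "funs (onto r k)" by (rule frep_precomp)
  show ?thesis
    unfolding stable_def fs.subspace_def avg_space_def
    using F.closed
    by (auto simp: fs.subspace_0[OF subspace_funs] fs.subspace_add[OF subspace_funs] fs.subspace_scale[OF subspace_funs]
      flinear_zero[OF avg_linear] flinear_add[OF avg_linear] flinear_scale[OF avg_linear] sym_group_carrier avg_precomp)
qed

text \<open>
  The projection used for the trace first averages with \<open>e\<close> and then applies the idempotent \<open>a\<close> of
  the right factor; its diagonal entry at \<open>f\<close> counts the pairs that fix \<open>f\<close>.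
\<close>

lemma constituent_multiplicity_avg_space:
  assumes r: "sum_list \<alpha> = r" and ea: "SE_idempotent_for \<alpha> a" and e: "primitive_idem (sym_group k) e"
  shows "of_nat (constituent_multiplicity (carrier (sym_group r)) (fun_module (avg_space r k e) precomp) (Specht \<alpha>)) =
    fixed_point_sum r k e a"
proof -
  from Specht_of_idempotent[OF r ea] obtain u where A: "primitive_idem (sym_group r) a"
    "frep (sym_group r) (Specht_act \<alpha>) (Specht_space \<alpha>)"
    "op_simple (carrier (sym_group r)) (fun_module (Specht_space \<alpha>) (Specht_act \<alpha>))"
    "u \<in> Specht_space \<alpha>" "u \<noteq> 0" "galg (sym_group r) (Specht_act \<alpha>) a u = u" by metis
  interpret F: frep "sym_group r" precomp "funs (onto r k)" by (rule frep_precomp)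
  interpret W: frep "sym_group r" precomp "avg_space r k e"
    by (rule F.frep_stable[OF stable_avg_space avg_space_sub])
  note sa = primitive_idem.schur_idem[OF A(1)]
  have ee: "gmult (sym_group k) e e = e" by (rule primitive_idem.e_idem[OF e])
  let ?T = "\<lambda>\<phi>. galg (sym_group r) precomp a (avg r k e \<phi>)"
  have avgW: "avg r k e \<phi> \<in> avg_space r k e" for \<phi>
    by (simp add: avg_space_def avg_funs avg_idem[OF ee])
  have idem: "galg (sym_group r) precomp a (galg (sym_group r) precomp a v) = galg (sym_group r) precomp a v"
    if "v \<in> avg_space r k e" for v
    using W.galg_gmult[OF that, of a a] sa by (simp add: schur_idem_def)
  have "of_nat (constituent_multiplicity (carrier (sym_group r)) (fun_module (avg_space r k e) precomp)
      (fun_module (Specht_space \<alpha>) (Specht_act \<alpha>))) = (\<Sum>f\<in>onto r k. ?T (basis_vec f) f)"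
    by (rule W.constituent_multiplicity_trace[OF finite_onto avg_space_sub sa A(2-6)
        flinear_comp[OF W.galg_linear avg_linear] W.galg_closed[OF W.stable_V avgW] idem[OF avgW]])
      (simp add: avg_space_def)
  also have "\<dots> = fixed_point_sum r k e a"
    unfolding fixed_point_sum_def
  proof (rule sum.cong[OF refl])
    fix f assume f: "f \<in> onto r k"
    have "?T (basis_vec f) f = (\<Sum>h\<in>Sym r. a h * (\<Sum>y\<in>Sym k. e y * basis_vec f (y \<circ> (f \<circ> h))))"
      using f by (simp add: galg_def sum_fun_apply cscale_apply precomp_def avg_def carrier_sym onto_comp_perm del: comp_apply)
    also have "\<dots> = (\<Sum>y\<in>Sym k. \<Sum>h\<in>Sym r. a h * (e y * basis_vec f (y \<circ> (f \<circ> h))))"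
      unfolding sum_distrib_left by (rule sum.swap)
    also have "\<dots> = (\<Sum>y\<in>Sym k. \<Sum>h\<in>Sym r. if y \<circ> f \<circ> h = f then e y * a h else 0)"
      by (rule sum.cong[OF refl], rule sum.cong[OF refl]) (simp add: basis_vec_def o_assoc del: comp_apply)
    finally show "?T (basis_vec f) f = (\<Sum>y\<in>Sym k. \<Sum>h\<in>Sym r. if y \<circ> f \<circ> h = f then e y * a h else 0)" .
  qed
  finally show ?thesis unfolding Specht_eq .
qed

text \<open>
  One orbit of onto maps, with representative \<open>f0\<close>. The group \<open>H\<close> is the stabiliser of \<open>f0\<close> in
  \<open>S\<^sub>k \<times> S\<^sub>r\<close>, with projections \<open>\<pi>\<close> and \<open>\<iota>\<close>, and \<open>Wm\<close> is the left ideal \<open>\<complex>S\<^sub>k e\<close> restricted along \<open>\<pi>\<close>.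
\<close>

locale orbit_piece = primitive_idem "sym_group k" e for k e +
  fixes r :: nat and f0 :: "nat \<Rightarrow> nat" and H :: "'h monoid" and \<iota> \<pi> :: "'h \<Rightarrow> nat \<Rightarrow> nat"
    and Wm :: "('h, 'v) op_module" and \<theta> :: "((nat \<Rightarrow> nat) \<Rightarrow> complex) \<Rightarrow> 'v"
  assumes f0: "f0 \<in> onto r k"
    and \<theta>_bij: "bij_betw \<theta> (lideal (sym_group k) e) (carrier Wm)"
    and \<theta>_add: "\<And>u v. u \<in> lideal (sym_group k) e \<Longrightarrow> v \<in> lideal (sym_group k) e \<Longrightarrow> \<theta> (u + v) = \<theta> u \<oplus>\<^bsub>Wm\<^esub> \<theta> v"
    and \<theta>_scale: "\<And>c v. v \<in> lideal (sym_group k) e \<Longrightarrow> \<theta> (cscale c v) = c \<odot>\<^bsub>Wm\<^esub> \<theta> v"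
    and \<theta>_zero: "\<theta> 0 = \<zero>\<^bsub>Wm\<^esub>"
    and \<theta>_act: "\<And>\<kappa> v. \<kappa> \<in> carrier H \<Longrightarrow> v \<in> lideal (sym_group k) e \<Longrightarrow> \<theta> (reg (sym_group k) (\<pi> \<kappa>) v) = act Wm \<kappa> (\<theta> v)"
    and stab: "\<And>x p. x \<in> Sym r \<Longrightarrow> p \<in> Sym k \<Longrightarrow> f0 \<circ> x = p \<circ> f0 \<longleftrightarrow> (\<exists>\<kappa>\<in>carrier H. x = \<iota> \<kappa> \<and> p = \<pi> \<kappa>)"
    and \<iota>_in: "\<And>\<kappa>. \<kappa> \<in> carrier H \<Longrightarrow> \<iota> \<kappa> \<in> Sym r" and \<pi>_in: "\<And>\<kappa>. \<kappa> \<in> carrier H \<Longrightarrow> \<pi> \<kappa> \<in> Sym k"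
begin

text \<open>
  The value at \<open>f\<close> of the equivariant map encoded by \<open>\<phi>\<close>.
\<close>

definition slice :: "((nat \<Rightarrow> nat) \<Rightarrow> complex) \<Rightarrow> (nat \<Rightarrow> nat) \<Rightarrow> (nat \<Rightarrow> nat) \<Rightarrow> complex"
  where "slice \<phi> f = (\<lambda>y. if y \<in> Sym k then \<phi> (inv' y \<circ> f) else 0)"

definition \<Psi> :: "((nat \<Rightarrow> nat) \<Rightarrow> complex) \<Rightarrow> (nat \<Rightarrow> nat) \<Rightarrow> 'v"
  where "\<Psi> \<phi> = (\<lambda>h\<in>carrier (sym_group r). \<theta> (slice \<phi> (f0 \<circ> h)))"

abbreviation "Ind \<equiv> induced H (sym_group r) \<iota> Wm"

lemma inv_comp: "y \<in> Sym m \<Longrightarrow> z \<in> Sym m \<Longrightarrow> inv' (y \<circ> z) = inv' z \<circ> inv' y"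
  by (intro o_inv_distrib) (auto intro: permutes_bij)

lemma inv_inv: "y \<in> Sym m \<Longrightarrow> inv' (inv' y) = y"
  by (intro inv_inv_eq) (auto intro: permutes_bij)

lemma inv_in: "y \<in> Sym m \<Longrightarrow> inv' y \<in> Sym m"
  by (auto intro: permutes_inv)

lemma comp_in: "y \<in> Sym m \<Longrightarrow> z \<in> Sym m \<Longrightarrow> y \<circ> z \<in> Sym m"
  by (auto intro: permutes_compose)

lemma slice_in: 
  assumes p: "\<phi> \<in> avg_space r k e" and f: "f \<in> onto r k"
  shows "slice \<phi> f \<in> lideal (sym_group k) e"
proof -
  have s: "slice \<phi> f \<in> funs (Sym k)" by (simp add: slice_def funs_def)
  have "gmult (sym_group k) (slice \<phi> f) e = slice \<phi> f"
  proof (rule funs_eqI[unfolded carrier_sym, OF gmult_sym_funs s])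
    fix x assume x: "x \<in> Sym k"
    have "gmult (sym_group k) (slice \<phi> f) e x = (\<Sum>h\<in>Sym k. e h * slice \<phi> f (x \<circ> inv' h))"
      by (rule gmult_sym_right[OF x])
    also have "\<dots> = (\<Sum>h\<in>Sym k. e h * \<phi> (h \<circ> (inv' x \<circ> f)))"
    proof (rule sum.cong[OF refl])
      fix h assume h: "h \<in> Sym k"
      have "x \<circ> inv' h \<in> Sym k" by (rule comp_in[OF x inv_in[OF h]])
      then show "e h * slice \<phi> f (x \<circ> inv' h) = e h * \<phi> (h \<circ> (inv' x \<circ> f))"
        unfolding slice_def inv_comp[OF x inv_in[OF h]] inv_inv[OF h] o_assoc by simp
    qed
    also have "\<dots> = avg r k e \<phi> (inv' x \<circ> f)"
      using onto_perm_comp[OF f, of "inv' x"] inv_in[OF x] by (simp add: avg_def)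
    also have "\<dots> = slice \<phi> f x" using p x by (simp add: avg_space_def slice_def)
    finally show "gmult (sym_group k) (slice \<phi> f) e x = slice \<phi> f x" .
  qed
  then show ?thesis using s by (simp add: lideal_def carrier_sym)
qed

lemma reg_sym: "p \<in> Sym k \<Longrightarrow> y \<in> Sym k \<Longrightarrow> reg (sym_group k) p v y = v (inv' p \<circ> y)"
  using reg_apply[of p y v] by (simp add: carrier_sym sym_group_mult inv_sym)

lemma slice_equivariant:
  assumes p: "p \<in> Sym k"
  shows "slice \<phi> (p \<circ> f) = reg (sym_group k) p (slice \<phi> f)"
proof (rule funs_eqI[unfolded carrier_sym, OF _ gmult_sym_funs])
  show "slice \<phi> (p \<circ> f) \<in> funs (Sym k)" by (simp add: slice_def funs_def)
  fix y assume y: "y \<in> Sym k"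
  have "inv' p \<circ> y \<in> Sym k" by (rule comp_in[OF inv_in[OF p] y])
  then show "slice \<phi> (p \<circ> f) y = reg (sym_group k) p (slice \<phi> f) y"
    unfolding reg_sym[OF p y] slice_def inv_comp[OF inv_in[OF p] y] inv_inv[OF p] using y by (simp add: o_assoc)
qed

lemma \<theta>_in: "v \<in> lideal (sym_group k) e \<Longrightarrow> \<theta> v \<in> carrier Wm"
  using bij_betwE[OF \<theta>_bij] by blast

lemma f0h: "h \<in> carrier (sym_group r) \<Longrightarrow> f0 \<circ> h \<in> onto r k"
  using onto_comp_perm[OF f0] by (simp add: sym_group_carrier)

lemma \<Psi>_in:
  assumes p: "\<phi> \<in> avg_space r k e"
  shows "\<Psi> \<phi> \<in> carrier Ind"
proof -
  have "\<Psi> \<phi> \<in> carrier (sym_group r) \<rightarrow>\<^sub>E carrier Wm"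
    unfolding \<Psi>_def by (auto intro!: \<theta>_in slice_in[OF p] f0h)
  moreover have "\<Psi> \<phi> (\<iota> \<kappa> \<otimes>\<^bsub>sym_group r\<^esub> g) = act Wm \<kappa> (\<Psi> \<phi> g)"
    if \<kappa>: "\<kappa> \<in> carrier H" and g: "g \<in> carrier (sym_group r)" for \<kappa> g
  proof -
    have ig: "\<iota> \<kappa> \<circ> g \<in> carrier (sym_group r)"
      using comp_in[OF \<iota>_in[OF \<kappa>], of g] g by (simp add: carrier_sym)
    have "f0 \<circ> \<iota> \<kappa> = \<pi> \<kappa> \<circ> f0" using stab[OF \<iota>_in[OF \<kappa>] \<pi>_in[OF \<kappa>]] \<kappa> by blast
    then have "f0 \<circ> (\<iota> \<kappa> \<circ> g) = \<pi> \<kappa> \<circ> (f0 \<circ> g)" by (simp only: o_assoc)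
    then show ?thesis
      using ig g by (simp add: \<Psi>_def sym_group_mult slice_equivariant[OF \<pi>_in[OF \<kappa>]] \<theta>_act[OF \<kappa> slice_in[OF p f0h[OF g]]])
  qed
  ultimately show ?thesis by (simp add: induced_def)
qed

lemma \<Psi>_hom:
  assumes p: "\<phi> \<in> avg_space r k e"
  shows "\<phi>' \<in> avg_space r k e \<Longrightarrow> \<Psi> (\<phi> + \<phi>') = \<Psi> \<phi> \<oplus>\<^bsub>Ind\<^esub> \<Psi> \<phi>'" "\<Psi> (cscale c \<phi>) = c \<odot>\<^bsub>Ind\<^esub> \<Psi> \<phi>"
    "x \<in> carrier (sym_group r) \<Longrightarrow> \<Psi> (precomp x \<phi>) = act Ind x (\<Psi> \<phi>)"
proof -
  have a: "slice (\<phi> + \<phi>') f = slice \<phi> f + slice \<phi>' f" for f \<phi>' by (auto simp: slice_def plus_fun_def)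
  show "\<Psi> (\<phi> + \<phi>') = \<Psi> \<phi> \<oplus>\<^bsub>Ind\<^esub> \<Psi> \<phi>'" if q: "\<phi>' \<in> avg_space r k e"
    by (auto simp: \<Psi>_def induced_def a \<theta>_add slice_in[OF p f0h] slice_in[OF q f0h] intro!: restrict_ext)
  have s: "slice (cscale c \<phi>) f = cscale c (slice \<phi> f)" for f by (auto simp: slice_def cscale_def)
  show "\<Psi> (cscale c \<phi>) = c \<odot>\<^bsub>Ind\<^esub> \<Psi> \<phi>"
    by (auto simp: \<Psi>_def induced_def s \<theta>_scale slice_in[OF p f0h] intro!: restrict_ext)
  have t: "slice (precomp x \<phi>) f = slice \<phi> (f \<circ> x)" for f x by (auto simp: slice_def precomp_def o_assoc)
  show "\<Psi> (precomp x \<phi>) = act Ind x (\<Psi> \<phi>)" if x: "x \<in> carrier (sym_group r)"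
  proof -
    have "g \<circ> x \<in> carrier (sym_group r)" if "g \<in> carrier (sym_group r)" for g
      using comp_in[of g r x] x that by (simp add: carrier_sym)
    then show ?thesis
      by (auto simp: \<Psi>_def induced_def t sym_group_mult o_assoc intro!: restrict_ext)
  qed
qed

lemma \<Psi>_inj:
  assumes p: "\<phi> \<in> avg_space r k e" and q: "\<phi>' \<in> avg_space r k e" and eq: "\<Psi> \<phi> = \<Psi> \<phi>'"
    and y: "y \<in> Sym k" and h: "h \<in> Sym r"
  shows "\<phi> (y \<circ> f0 \<circ> h) = \<phi>' (y \<circ> f0 \<circ> h)"
proof -
  have hc: "h \<in> carrier (sym_group r)" using h by (simp add: carrier_sym)
  have "\<theta> (slice \<phi> (f0 \<circ> h)) = \<theta> (slice \<phi>' (f0 \<circ> h))" using fun_cong[OF eq, of h] hc by (simp add: \<Psi>_def)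
  then have s: "slice \<phi> (f0 \<circ> h) = slice \<phi>' (f0 \<circ> h)"
    by (rule inj_onD[OF bij_betw_imp_inj_on[OF \<theta>_bij] _ slice_in[OF p f0h[OF hc]] slice_in[OF q f0h[OF hc]]])
  show ?thesis using fun_cong[OF s, of "inv' y"] inv_in[OF y] unfolding slice_def inv_inv[OF y] by (simp add: o_assoc)
qed

abbreviation "\<theta>i \<equiv> inv_into (lideal (sym_group k) e) \<theta>"

text \<open>
  The value prescribed at \<open>p \<circ> f0 \<circ> h\<close> depends only on that map: two such presentations differ by
  an element of the stabiliser, and \<open>F\<close> is equivariant under it.
\<close>

lemma \<Psi>_lift:
  assumes F: "F \<in> carrier Ind"
  obtains \<psi> where "\<And>p h. p \<in> Sym k \<Longrightarrow> h \<in> Sym r \<Longrightarrow> \<psi> (p \<circ> f0 \<circ> h) = \<theta>i (F h) (inv' p)"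
proof -
  have F1: "F h \<in> carrier Wm" if "h \<in> Sym r" for h
    using F that by (auto simp: induced_def carrier_sym)
  have F2: "F (\<iota> \<kappa> \<circ> h) = act Wm \<kappa> (F h)" if "\<kappa> \<in> carrier H" "h \<in> Sym r" for \<kappa> h
    using F that by (simp add: induced_def carrier_sym sym_group_mult)
  have ti: "\<theta>i w \<in> lideal (sym_group k) e" "\<theta> (\<theta>i w) = w" if "w \<in> carrier Wm" for w
    using bij_betw_inv_into[OF \<theta>_bij] bij_betw_inv_into_right[OF \<theta>_bij that] that by (auto dest: bij_betwE)
  have wd: "\<theta>i (F h) (inv' p) = \<theta>i (F h') (inv' p')"
    if ph: "p \<in> Sym k" "h \<in> Sym r" "p' \<in> Sym k" "h' \<in> Sym r" and eq: "p \<circ> f0 \<circ> h = p' \<circ> f0 \<circ> h'" for p h p' h'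
  proof -
    have inj: "inv' p' \<circ> p' = id" "h \<circ> inv' h = id" "inv' h \<circ> h = id" "p' \<circ> inv' p' = id"
      using ph permutes_inv_o by blast+
    have "inv' p' \<circ> (p \<circ> f0 \<circ> h) \<circ> inv' h = inv' p' \<circ> (p' \<circ> f0 \<circ> h') \<circ> inv' h" unfolding eq ..
    moreover have "inv' p' \<circ> (p \<circ> f0 \<circ> h) \<circ> inv' h = (inv' p' \<circ> p) \<circ> f0 \<circ> (h \<circ> inv' h)" by (simp only: o_assoc)
    moreover have "inv' p' \<circ> (p' \<circ> f0 \<circ> h') \<circ> inv' h = (inv' p' \<circ> p') \<circ> f0 \<circ> (h' \<circ> inv' h)" by (simp only: o_assoc)
    ultimately have "f0 \<circ> (h' \<circ> inv' h) = (inv' p' \<circ> p) \<circ> f0" unfolding inj by simp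
    then obtain \<kappa> where \<kappa>: "\<kappa> \<in> carrier H" "h' \<circ> inv' h = \<iota> \<kappa>" "inv' p' \<circ> p = \<pi> \<kappa>"
      using stab[OF comp_in[OF ph(4) inv_in[OF ph(2)]] comp_in[OF inv_in[OF ph(3)] ph(1)]] by blast
    have h': "h' = \<iota> \<kappa> \<circ> h" unfolding \<kappa>(2)[symmetric] by (simp only: o_assoc[symmetric] inj comp_id)
    have p: "p = p' \<circ> \<pi> \<kappa>" unfolding \<kappa>(3)[symmetric] by (simp only: o_assoc inj id_comp)
    note v = ti[OF F1[OF ph(2)]]
    have rI: "reg (sym_group k) (\<pi> \<kappa>) (\<theta>i (F h)) \<in> lideal (sym_group k) e"
      using stable_lideal v(1) \<pi>_in[OF \<kappa>(1)] unfolding stable_def carrier_sym by blast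
    have "F h' = \<theta> (reg (sym_group k) (\<pi> \<kappa>) (\<theta>i (F h)))"
      unfolding h' F2[OF \<kappa>(1) ph(2)] \<theta>_act[OF \<kappa>(1) v(1)] v(2) ..
    then have "\<theta>i (F h') = reg (sym_group k) (\<pi> \<kappa>) (\<theta>i (F h))"
      using bij_betw_inv_into_left[OF \<theta>_bij rI] by simp
    then have "\<theta>i (F h') (inv' p') = \<theta>i (F h) (inv' (\<pi> \<kappa>) \<circ> inv' p')"
      using reg_sym[OF \<pi>_in[OF \<kappa>(1)] inv_in[OF ph(3)]] by simp
    then show ?thesis unfolding p inv_comp[OF ph(3) \<pi>_in[OF \<kappa>(1)]] by simp
  qed
  let ?P = "\<lambda>f ph. fst ph \<in> Sym k \<and> snd ph \<in> Sym r \<and> f = fst ph \<circ> f0 \<circ> snd ph"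
  define \<psi> where "\<psi> f = \<theta>i (F (snd (SOME ph. ?P f ph))) (inv' (fst (SOME ph. ?P f ph)))" for f
  show ?thesis
  proof (rule that[of \<psi>])
    fix p h assume ph: "p \<in> Sym k" "h \<in> Sym r"
    have "?P (p \<circ> f0 \<circ> h) (p, h)" using ph by simp
    then have S: "?P (p \<circ> f0 \<circ> h) (SOME ph. ?P (p \<circ> f0 \<circ> h) ph)" by (rule someI[where P = "?P (p \<circ> f0 \<circ> h)"])
    show "\<psi> (p \<circ> f0 \<circ> h) = \<theta>i (F h) (inv' p)"
      unfolding \<psi>_def
      by (rule wd[OF conjunct1[OF S] conjunct1[OF conjunct2[OF S]] ph conjunct2[OF conjunct2[OF S], symmetric]])
  qed
qed

lemma slice_lift:
  assumes F: "F \<in> carrier Ind" and h: "h \<in> Sym r"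
    and \<phi>: "\<And>p. p \<in> Sym k \<Longrightarrow> \<phi> (p \<circ> f0 \<circ> h) = \<theta>i (F h) (inv' p)"
  shows "\<theta> (slice \<phi> (f0 \<circ> h)) = F h"
    "p \<in> Sym k \<Longrightarrow> (\<Sum>y\<in>Sym k. e y * \<phi> (y \<circ> (p \<circ> f0 \<circ> h))) = \<phi> (p \<circ> f0 \<circ> h)"
proof -
  have F1: "F h \<in> carrier Wm" using F h by (auto simp: induced_def carrier_sym)
  have v: "\<theta>i (F h) \<in> lideal (sym_group k) e" "\<theta> (\<theta>i (F h)) = F h"
    using bij_betwE[OF bij_betw_inv_into[OF \<theta>_bij]] bij_betw_inv_into_right[OF \<theta>_bij F1] F1 by blast+
  have vF: "\<theta>i (F h) \<in> funs (Sym k)" "gmult (sym_group k) (\<theta>i (F h)) e = \<theta>i (F h)"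
    using v(1) by (simp_all add: lideal_def carrier_sym)
  have "slice \<phi> (f0 \<circ> h) = \<theta>i (F h)"
  proof (rule funs_eqI[unfolded carrier_sym, OF _ vF(1)])
    show "slice \<phi> (f0 \<circ> h) \<in> funs (Sym k)" by (simp add: slice_def funs_def)
    fix y assume y: "y \<in> Sym k"
    show "slice \<phi> (f0 \<circ> h) y = \<theta>i (F h) y"
      using \<phi>[OF inv_in[OF y]] y unfolding slice_def inv_inv[OF y] by (simp add: o_assoc)
  qed
  then show "\<theta> (slice \<phi> (f0 \<circ> h)) = F h" using v(2) by simp
  assume p: "p \<in> Sym k"
  have "(\<Sum>y\<in>Sym k. e y * \<phi> (y \<circ> (p \<circ> f0 \<circ> h))) = (\<Sum>y\<in>Sym k. e y * \<theta>i (F h) (inv' p \<circ> inv' y))"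
  proof (rule sum.cong[OF refl])
    fix y assume y: "y \<in> Sym k"
    show "e y * \<phi> (y \<circ> (p \<circ> f0 \<circ> h)) = e y * \<theta>i (F h) (inv' p \<circ> inv' y)"
      using \<phi>[OF comp_in[OF y p]] unfolding inv_comp[OF y p] by (simp add: o_assoc)
  qed
  also have "\<dots> = gmult (sym_group k) (\<theta>i (F h)) e (inv' p)"
    by (rule gmult_sym_right[OF inv_in[OF p], symmetric])
  also have "\<dots> = \<phi> (p \<circ> f0 \<circ> h)" unfolding vF(2) \<phi>[OF p] ..
  finally show "(\<Sum>y\<in>Sym k. e y * \<phi> (y \<circ> (p \<circ> f0 \<circ> h))) = \<phi> (p \<circ> f0 \<circ> h)" .
qed

end

lemma two_orbits_iso:
  assumes P1: "orbit_piece k e r f1 H1 \<iota>1 \<pi>1 W1 \<theta>1" and P2: "orbit_piece k e r f2 H2 \<iota>2 \<pi>2 W2 \<theta>2"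
    and cover: "\<And>f. f \<in> onto r k \<Longrightarrow> \<exists>p\<in>Sym k. \<exists>h\<in>Sym r. f = p \<circ> f1 \<circ> h \<or> f = p \<circ> f2 \<circ> h"
    and disjoint: "\<And>p h p' h'. p \<in> Sym k \<Longrightarrow> h \<in> Sym r \<Longrightarrow> p' \<in> Sym k \<Longrightarrow> h' \<in> Sym r \<Longrightarrow>
      p \<circ> f1 \<circ> h \<noteq> p' \<circ> f2 \<circ> h'"
  shows "constituent_multiplicity (carrier (sym_group r))
      (direct_sum (induced H1 (sym_group r) \<iota>1 W1) (induced H2 (sym_group r) \<iota>2 W2)) S =
    constituent_multiplicity (carrier (sym_group r)) (fun_module (avg_space r k e) precomp) S"
proof -
  interpret P1: orbit_piece k e r f1 H1 \<iota>1 \<pi>1 W1 \<theta>1 by fact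
  interpret P2: orbit_piece k e r f2 H2 \<iota>2 \<pi>2 W2 \<theta>2 by fact
  let ?W = "avg_space r k e" and ?D = "direct_sum P1.Ind P2.Ind"
  let ?\<Psi> = "\<lambda>\<phi>. (P1.\<Psi> \<phi>, P2.\<Psi> \<phi>)"
  have stW: "stable (carrier (sym_group r)) precomp ?W" by (rule stable_avg_space)
  then have subW: "fs.subspace ?W" by (simp add: stable_def)
  have inj: "inj_on ?\<Psi> ?W"
  proof (rule inj_onI)
    fix \<phi> \<phi>' assume p: "\<phi> \<in> ?W" and q: "\<phi>' \<in> ?W" and "?\<Psi> \<phi> = ?\<Psi> \<phi>'"
    then have eq: "P1.\<Psi> \<phi> = P1.\<Psi> \<phi>'" "P2.\<Psi> \<phi> = P2.\<Psi> \<phi>'" by auto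
    show "\<phi> = \<phi>'"
    proof (rule ext)
      fix f
      show "\<phi> f = \<phi>' f"
      proof (cases "f \<in> onto r k")
        case True
        then obtain y h where yh: "y \<in> Sym k" "h \<in> Sym r" "f = y \<circ> f1 \<circ> h \<or> f = y \<circ> f2 \<circ> h" using cover by blast
        show ?thesis using yh(3) P1.\<Psi>_inj[OF p q eq(1) yh(1,2)] P2.\<Psi>_inj[OF p q eq(2) yh(1,2)] by blast
      next
        case False
        then show ?thesis using p q by (simp add: avg_space_def funs_def)
      qed
    qed
  qed
  have surj: "\<exists>\<phi>\<in>?W. ?\<Psi> \<phi> = (F1, F2)" if F: "F1 \<in> carrier P1.Ind" "F2 \<in> carrier P2.Ind" for F1 F2
  proof -
    obtain \<psi>1 where 1: "\<And>p h. p \<in> Sym k \<Longrightarrow> h \<in> Sym r \<Longrightarrow> \<psi>1 (p \<circ> f1 \<circ> h) = P1.\<theta>i (F1 h) (inv' p)"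
      using P1.\<Psi>_lift[OF F(1)] by metis
    obtain \<psi>2 where 2: "\<And>p h. p \<in> Sym k \<Longrightarrow> h \<in> Sym r \<Longrightarrow> \<psi>2 (p \<circ> f2 \<circ> h) = P2.\<theta>i (F2 h) (inv' p)"
      using P2.\<Psi>_lift[OF F(2)] by metis
    define \<phi> where "\<phi> f = (if \<exists>p\<in>Sym k. \<exists>h\<in>Sym r. f = p \<circ> f1 \<circ> h then \<psi>1 f else if f \<in> onto r k then \<psi>2 f else 0)" for f
    have on: "p \<circ> f \<circ> h \<in> onto r k" if "f \<in> onto r k" "p \<in> Sym k" "h \<in> Sym r" for p f h
      using onto_comp_perm[OF onto_perm_comp[OF that(1), of p], of h] that(2,3) by simp
    have p1: "\<phi> (p \<circ> f1 \<circ> h) = P1.\<theta>i (F1 h) (inv' p)" if "p \<in> Sym k" "h \<in> Sym r" for p h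
      using 1[OF that] that unfolding \<phi>_def by metis
    have p2: "\<phi> (p \<circ> f2 \<circ> h) = P2.\<theta>i (F2 h) (inv' p)" if ph: "p \<in> Sym k" "h \<in> Sym r" for p h
    proof -
      have "\<not> (\<exists>p'\<in>Sym k. \<exists>h'\<in>Sym r. p \<circ> f2 \<circ> h = p' \<circ> f1 \<circ> h')" using disjoint ph by metis
      then show ?thesis using 2[OF ph] on[OF P2.f0 ph] unfolding \<phi>_def by (simp only: if_False if_True)
    qed
    have "avg r k e \<phi> = \<phi>"
    proof (rule ext)
      fix f
      show "avg r k e \<phi> f = \<phi> f"
      proof (cases "f \<in> onto r k")
        case True
        then obtain p h where ph: "p \<in> Sym k" "h \<in> Sym r" "f = p \<circ> f1 \<circ> h \<or> f = p \<circ> f2 \<circ> h" using cover by blast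
        have "(\<Sum>y\<in>Sym k. e y * \<phi> (y \<circ> f)) = \<phi> f"
          using ph(3) P1.slice_lift(2)[OF F(1) ph(2) p1[OF _ ph(2)] ph(1)] P2.slice_lift(2)[OF F(2) ph(2) p2[OF _ ph(2)] ph(1)]
          by blast
        then show ?thesis using True by (simp add: avg_def)
      next
        case False
        then have "\<not> (\<exists>p\<in>Sym k. \<exists>h\<in>Sym r. f = p \<circ> f1 \<circ> h)" using on[OF P1.f0] by blast
        then show ?thesis using False by (simp only: avg_def \<phi>_def if_False)
      qed
    qed
    then have \<phi>W: "\<phi> \<in> ?W" unfolding avg_space_def using avg_funs[of r k e \<phi>] by simp
    have "P1.\<Psi> \<phi> = F1"
    proof (rule ext)
      fix h show "P1.\<Psi> \<phi> h = F1 h"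
        using P1.slice_lift(1)[OF F(1) _ p1] F(1)
        by (cases "h \<in> Sym r") (auto simp: P1.\<Psi>_def carrier_sym induced_def PiE_def extensional_def)
    qed
    moreover have "P2.\<Psi> \<phi> = F2"
    proof (rule ext)
      fix h show "P2.\<Psi> \<phi> h = F2 h"
        using P2.slice_lift(1)[OF F(2) _ p2] F(2)
        by (cases "h \<in> Sym r") (auto simp: P2.\<Psi>_def carrier_sym induced_def PiE_def extensional_def)
    qed
    ultimately show ?thesis using \<phi>W by (intro bexI[of _ \<phi>]) simp_all
  qed
  have cD: "carrier ?D = carrier P1.Ind \<times> carrier P2.Ind" by (simp add: direct_sum_def)
  have im: "?\<Psi> ` ?W = carrier ?D"
  proof (intro equalityI subsetI)
    fix x assume "x \<in> ?\<Psi> ` ?W"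
    then show "x \<in> carrier ?D" unfolding cD using P1.\<Psi>_in P2.\<Psi>_in by blast
  next
    fix x assume "x \<in> carrier ?D"
    then obtain F1 F2 where x: "x = (F1, F2)" "F1 \<in> carrier P1.Ind" "F2 \<in> carrier P2.Ind" unfolding cD by blast
    from surj[OF x(2,3)] show "x \<in> ?\<Psi> ` ?W"
    proof
      fix \<phi> assume w: "\<phi> \<in> ?W" and e: "?\<Psi> \<phi> = (F1, F2)"
      show ?thesis unfolding x(1) e[symmetric] by (rule imageI[OF w])
    qed
  qed
  have D_ops: "(a, b) \<oplus>\<^bsub>?D\<^esub> (a', b') = (a \<oplus>\<^bsub>P1.Ind\<^esub> a', b \<oplus>\<^bsub>P2.Ind\<^esub> b')"
    "c \<odot>\<^bsub>?D\<^esub> (a, b) = (c \<odot>\<^bsub>P1.Ind\<^esub> a, c \<odot>\<^bsub>P2.Ind\<^esub> b)"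
    "act ?D g (a, b) = (act P1.Ind g a, act P2.Ind g b)" for a b a' b' c g
    by (simp_all add: direct_sum_def)
  have via: "iso_via (carrier (sym_group r)) ?\<Psi> (fun_module ?W precomp) ?D"
    unfolding iso_via_def fun_module_simps D_ops
  proof (intro conjI ballI allI)
    show "bij_betw ?\<Psi> ?W (carrier ?D)" using inj im by (simp add: bij_betw_def)
  qed (simp_all only: P1.\<Psi>_hom P2.\<Psi>_hom)
  have modW: "module complex_ring (fun_module ?W precomp)" by (rule module_fun_module[OF subW])
  have z: "P1.slice 0 f = 0" "P2.slice 0 f = 0" for f
    by (simp_all add: P1.slice_def P2.slice_def zero_fun_def)
  have "module complex_ring ?D"
  proof (rule module_surjective_image[OF modW, of ?\<Psi>])
    show "?\<Psi> ` carrier (fun_module ?W precomp) = carrier ?D" using im by simp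
    show "?\<Psi> \<zero>\<^bsub>fun_module ?W precomp\<^esub> = \<zero>\<^bsub>?D\<^esub>"
      by (simp add: direct_sum_def induced_def P1.\<Psi>_def P2.\<Psi>_def P1.\<theta>_zero P2.\<theta>_zero z)
  qed (use iso_viaD(2,3)[OF via] in auto)
  moreover have "act ?D g x \<in> carrier ?D" if g: "g \<in> carrier (sym_group r)" and x: "x \<in> carrier ?D" for g x
  proof -
    have "x \<in> ?\<Psi> ` ?W" using x im by simp
    then obtain \<phi> where p: "\<phi> \<in> ?W" "x = ?\<Psi> \<phi>" by (rule imageE)
    have ag: "act ?D g x = ?\<Psi> (precomp g \<phi>)"
      unfolding p(2) using iso_viaD(4)[OF via g, of \<phi>] p(1) by simp
    have pw: "precomp g \<phi> \<in> ?W" using stW g p(1) by (simp add: stable_def)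
    have "act ?D g x \<in> ?\<Psi> ` ?W" unfolding ag by (rule imageI[OF pw])
    then show ?thesis unfolding im .
  qed
  ultimately have D: "act_closed (carrier (sym_group r)) ?D" by (simp add: act_closed_def)
  have W: "act_closed (carrier (sym_group r)) (fun_module ?W precomp)"
    using modW stW by (simp add: act_closed_def stable_def)
  show ?thesis by (rule constituent_multiplicity_iso[OF W D via, symmetric])
qed



section \<open>The two orbits and their stabilisers\<close>

lemma permutes_of_inverse:
  assumes "\<And>x. g (f x) = x" "\<And>x. f (g x) = x" "\<And>x. x \<notin> A \<Longrightarrow> f x = x"
  shows "f permutes A"
  unfolding permutes_def
proof (intro conjI allI impI)
  show "f x = x" if "x \<notin> A" for x by (rule assms(3)[OF that])
  fix y
  show "\<exists>!x. f x = y" by (rule ex1I[of _ "g y"]) (use assms(1,2) in auto)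
qed

lemma Sym_le: "\<sigma> \<in> Sym p \<Longrightarrow> x \<le> p \<Longrightarrow> \<sigma> x \<le> p"
  using permutes_in_image[of \<sigma> "{1..p}" x] permutes_not_in[of \<sigma> "{1..p}" x] by fastforce

lemma Sym_out: "\<sigma> \<in> Sym p \<Longrightarrow> x > p \<or> x = 0 \<Longrightarrow> \<sigma> x = x"
  by (auto intro: permutes_not_in)

lemma Sym_inj: "\<sigma> \<in> Sym p \<Longrightarrow> \<sigma> x = \<sigma> y \<Longrightarrow> x = y"
  using permutes_inj[of \<sigma>] by (auto simp: inj_def)

lemma Sym_range: "\<sigma> \<in> Sym p \<Longrightarrow> 1 \<le> x \<Longrightarrow> x \<le> p \<Longrightarrow> 1 \<le> \<sigma> x \<and> \<sigma> x \<le> p"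
  using permutes_in_image[of \<sigma> "{1..p}" x] by simp

lemma Sym_pos: "\<sigma> \<in> Sym p \<Longrightarrow> 1 \<le> x \<Longrightarrow> 1 \<le> \<sigma> x"
  using Sym_range[of \<sigma> p x] Sym_out[of \<sigma> p x] by (cases "x \<le> p") auto

lemma young_embed_simps:
  "x \<le> p \<Longrightarrow> young_embed p (\<sigma>, \<tau>) x = \<sigma> x"
  "young_embed p (\<sigma>, \<tau>) (p + Suc i) = \<tau> (Suc i) + p"
  "x > p \<Longrightarrow> young_embed p (\<sigma>, \<tau>) x = \<tau> (x - p) + p"
  by (simp_all add: young_embed_def)

lemma young_embed_in:
  assumes s: "\<sigma> \<in> Sym p" and t: "\<tau> \<in> Sym q"
  shows "young_embed p (\<sigma>, \<tau>) \<in> Sym (p + q)"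
proof -
  have inv: "young_embed p (\<sigma>', \<tau>') (young_embed p (\<sigma>, \<tau>) x) = x"
    if "\<sigma> \<in> Sym p" "\<tau> \<in> Sym q" "\<And>x. \<sigma>' (\<sigma> x) = x" "\<And>x. \<tau>' (\<tau> x) = x" for \<sigma> \<tau> \<sigma>' \<tau>' x
  proof (cases "x \<le> p")
    case True
    then show ?thesis using Sym_le[OF that(1) True] that(3) by (simp add: young_embed_simps)
  next
    case False
    then have "1 \<le> \<tau> (x - p)" by (intro Sym_pos[OF that(2)]) simp
    then show ?thesis using False that(4) by (simp add: young_embed_simps)
  qed
  have si: "inv' \<sigma> \<in> Sym p" "inv' \<tau> \<in> Sym q" using s t by (auto intro: permutes_inv)
  have pi: "\<sigma> (inv' \<sigma> x) = x" "inv' \<sigma> (\<sigma> x) = x" "\<tau> (inv' \<tau> x) = x" "inv' \<tau> (\<tau> x) = x" for x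
    using permutes_inverses[of \<sigma> "{1..p}"] permutes_inverses[of \<tau> "{1..q}"] s t by simp_all
  have "young_embed p (\<sigma>, \<tau>) permutes {1..p + q}"
  proof (rule permutes_of_inverse[where g = "young_embed p (inv' \<sigma>, inv' \<tau>)"])
    show "young_embed p (inv' \<sigma>, inv' \<tau>) (young_embed p (\<sigma>, \<tau>) x) = x" for x by (rule inv[OF s t pi(2,4)])
    show "young_embed p (\<sigma>, \<tau>) (young_embed p (inv' \<sigma>, inv' \<tau>) x) = x" for x by (rule inv[OF si pi(1,3)])
    fix x assume "x \<notin> {1..p + q}"
    then consider "x = 0" | "x > p + q" by fastforce
    then show "young_embed p (\<sigma>, \<tau>) x = x"
      using Sym_out[OF s, of 0] Sym_out[OF t, of "x - p"] by cases (simp_all add: young_embed_simps)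
  qed
  then show ?thesis by simp
qed

text \<open>
  A permutation that keeps the last \<open>q\<close> points above \<open>m\<close> permutes them, hence also the first \<open>m\<close> points.
\<close>

lemma young_embed_split:
  assumes x: "x \<in> Sym (m + q)" and up: "\<And>i. 1 \<le> i \<Longrightarrow> i \<le> q \<Longrightarrow> x (m + i) > m"
  obtains \<sigma> \<tau> where "\<sigma> \<in> Sym m" "\<tau> \<in> Sym q" "x = young_embed m (\<sigma>, \<tau>)"
proof -
  have in1: "x ` {m + 1..m + q} \<subseteq> {m + 1..m + q}"
  proof
    fix y assume "y \<in> x ` {m + 1..m + q}"
    then obtain j where j: "m + 1 \<le> j" "j \<le> m + q" "y = x j" by auto
    have "x (m + (j - m)) > m" using j by (intro up) auto
    then show "y \<in> {m + 1..m + q}" using j Sym_le[OF x j(2)] by simp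
  qed
  have inj: "inj_on x A" for A using Sym_inj[OF x] by (auto simp: inj_on_def)
  have im1: "x ` {m + 1..m + q} = {m + 1..m + q}" by (rule endo_inj_surj[OF _ in1 inj]) simp
  have in2: "x ` {1..m} \<subseteq> {1..m}"
  proof
    fix y assume "y \<in> x ` {1..m}"
    then obtain j where j: "1 \<le> j" "j \<le> m" "y = x j" by auto
    have r: "1 \<le> x j" "x j \<le> m + q" using Sym_range[OF x, of j] j by auto
    have "\<not> x j > m"
    proof
      assume "x j > m"
      then have "x j \<in> x ` {m + 1..m + q}" unfolding im1 using r by simp
      then obtain i where "i \<ge> m + 1" "x j = x i" by auto
      then show False using Sym_inj[OF x, of j i] j by simp
    qed
    then show "y \<in> {1..m}" using r j by simp
  qed
  have im2: "x ` {1..m} = {1..m}" by (rule endo_inj_surj[OF _ in2 inj]) simp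
  define \<sigma> where "\<sigma> j = (if j \<le> m then x j else j)" for j
  define \<tau> where "\<tau> i = (if 1 \<le> i \<and> i \<le> q then x (m + i) - m else i)" for i
  have x0: "x 0 = 0" by (rule Sym_out[OF x]) simp
  have "\<sigma> ` {1..m} = x ` {1..m}" by (intro image_cong) (auto simp: \<sigma>_def)
  moreover have "\<sigma> j = j" if "j \<notin> {1..m}" for j
    by (cases "j = 0") (use that x0 in \<open>auto simp: \<sigma>_def\<close>)
  ultimately have "\<sigma> \<in> onto m m" unfolding onto_def using im2 by blast
  then have s: "\<sigma> \<in> Sym m" by (simp add: onto_self_iff)
  have "\<tau> ` {1..q} = {1..q}"
  proof (rule endo_inj_surj)
    have r: "m < x (m + i) \<and> x (m + i) \<le> m + q" if "1 \<le> i" "i \<le> q" for i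
      using up[OF that] Sym_le[OF x, of "m + i"] that by simp
    then show "\<tau> ` {1..q} \<subseteq> {1..q}" by (fastforce simp: \<tau>_def)
    show "inj_on \<tau> {1..q}"
    proof (rule inj_onI)
      fix i j assume ij: "i \<in> {1..q}" "j \<in> {1..q}" "\<tau> i = \<tau> j"
      then have "x (m + i) = x (m + j)" using r[of i] r[of j] by (simp add: \<tau>_def, arith)
      then show "i = j" using Sym_inj[OF x] by fastforce
    qed
  qed simp
  then have "\<tau> \<in> onto q q" unfolding onto_def by (auto simp: \<tau>_def)
  then have t: "\<tau> \<in> Sym q" by (simp add: onto_self_iff)
  have "x j = young_embed m (\<sigma>, \<tau>) j" for j
  proof -
    consider "j \<le> m" | "m < j" "j \<le> m + q" | "m + q < j" by linarith
    then show ?thesis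
    proof cases
      case 2
      then have "x (m + (j - m)) > m" by (intro up) auto
      moreover have "1 \<le> j - m \<and> j - m \<le> q" using 2 by arith
      ultimately show ?thesis using 2 by (simp add: young_embed_simps \<tau>_def)
    next
      case 3
      then have "\<not> (1 \<le> j - m \<and> j - m \<le> q)" by arith
      then show ?thesis using 3 Sym_out[OF x, of j] by (simp add: young_embed_simps \<tau>_def)
    qed (simp add: young_embed_simps \<sigma>_def)
  qed
  then show ?thesis using that[OF s t] by blast
qed

text \<open>
  Representatives of the two orbits, written with \<open>k = m + 2\<close>: the first has the single large fibre \<open>{m+2, m+3, m+4}\<close>,
  the second the fibres \<open>{m+1, m+2}\<close> and \<open>{m+3, m+4}\<close>.
\<close>

definition fold3 :: "nat \<Rightarrow> nat \<Rightarrow> nat"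
  where "fold3 m j = (if j \<le> m + 4 then min j (m + 2) else j)"

definition fold22 :: "nat \<Rightarrow> nat \<Rightarrow> nat"
  where "fold22 m j = (if j \<le> m then j else if j \<le> m + 2 then m + 1 else if j \<le> m + 4 then m + 2 else j)"

lemma fold3_onto: "fold3 m \<in> onto (m + 4) (m + 2)"
proof -
  have "fold3 m ` {1..m + 4} = {1..m + 2}"
  proof (intro equalityI subsetI)
    fix y assume "y \<in> {1..m + 2}"
    then show "y \<in> fold3 m ` {1..m + 4}" by (intro image_eqI[of _ _ y]) (auto simp: fold3_def)
  qed (auto simp: fold3_def)
  then show ?thesis by (auto simp: onto_def fold3_def)
qed

lemma fold22_onto: "fold22 m \<in> onto (m + 4) (m + 2)"
proof -
  have "fold22 m ` {1..m + 4} = {1..m + 2}"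
  proof (intro equalityI subsetI)
    fix y assume "y \<in> {1..m + 2}"
    then show "y \<in> fold22 m ` {1..m + 4}"
      by (intro image_eqI[of _ _ "if y \<le> m + 1 then y else m + 3"]) (auto simp: fold22_def)
  qed (auto simp: fold22_def split: if_splits)
  then show ?thesis by (auto simp: onto_def fold22_def)
qed

text \<open>
  Only the value \<open>m + 2\<close> is taken more than once, so \<open>p\<close> fixes it and \<open>x\<close> preserves its fibre; elsewhere \<open>fold3\<close> is the
  identity and \<open>x\<close> agrees with \<open>p\<close>.
\<close>

lemma stabilizer_fold3:
  assumes x: "x \<in> Sym (m + 4)" and p: "p \<in> Sym (m + 2)"
  shows "fold3 m \<circ> x = p \<circ> fold3 m \<longleftrightarrow>
    (\<exists>\<kappa>\<in>carrier (sym_group (m + 1) \<times>\<times> sym_group 3). x = young_embed (m + 1) \<kappa> \<and> p = fst \<kappa>)"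
proof
  assume eq: "fold3 m \<circ> x = p \<circ> fold3 m"
  have E: "fold3 m (x j) = p (fold3 m j)" for j using fun_cong[OF eq, of j] by simp
  have pl: "p (m + 2) \<le> m + 2" by (rule Sym_le[OF p]) simp
  have d: "x (m + 2) \<noteq> x (m + 3)" using Sym_inj[OF x, of "m + 2" "m + 3"] by auto
  have e: "fold3 m (x (m + 2)) = p (m + 2)" "fold3 m (x (m + 3)) = p (m + 2)"
    using E[of "m + 2"] E[of "m + 3"] by (simp_all add: fold3_def)
  have p2: "p (m + 2) = m + 2" using d e pl unfolding fold3_def by (auto split: if_splits simp: min_def)
  have up: "x (m + 1 + i) > m + 1" if i: "1 \<le> i" "i \<le> 3" for i
  proof -
    have "fold3 m (m + 1 + i) = m + 2" using i by (auto simp: fold3_def min_def)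
    then have "fold3 m (x (m + 1 + i)) = m + 2" using E[of "m + 1 + i"] p2 by metis
    then show ?thesis by (auto simp: fold3_def split: if_splits)
  qed
  have x': "x \<in> Sym (m + 1 + 3)" using x by (simp add: add.assoc)
  obtain \<sigma> \<tau> where st: "\<sigma> \<in> Sym (m + 1)" "\<tau> \<in> Sym 3" "x = young_embed (m + 1) (\<sigma>, \<tau>)"
    using young_embed_split[OF x' up] by blast
  have "p j = \<sigma> j" for j
  proof (cases "j \<le> m + 1")
    case True
    then have "x j = \<sigma> j" unfolding st(3) by (simp add: young_embed_simps)
    moreover have "\<sigma> j \<le> m + 1" by (rule Sym_le[OF st(1) True])
    ultimately show ?thesis using E[of j] True by (simp add: fold3_def min_def)
  next
    case False
    then show ?thesis using p2 Sym_out[OF st(1), of j] Sym_out[OF p, of j] by (cases "j = m + 2") auto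
  qed
  then have "p = \<sigma>" by blast
  then show "\<exists>\<kappa>\<in>carrier (sym_group (m + 1) \<times>\<times> sym_group 3). x = young_embed (m + 1) \<kappa> \<and> p = fst \<kappa>"
    using st by (intro bexI[of _ "(\<sigma>, \<tau>)"]) (auto simp: carrier_sym)
next
  assume "\<exists>\<kappa>\<in>carrier (sym_group (m + 1) \<times>\<times> sym_group 3). x = young_embed (m + 1) \<kappa> \<and> p = fst \<kappa>"
  then obtain \<tau> where st: "p \<in> Sym (m + 1)" "\<tau> \<in> Sym 3" "x = young_embed (m + 1) (p, \<tau>)"
    by (auto simp: carrier_sym)
  have "fold3 m (x j) = p (fold3 m j)" for j
  proof -
    consider "j \<le> m + 1" | "m + 1 < j" "j \<le> m + 4" | "m + 4 < j" by linarith
    then show ?thesis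
    proof cases
      case 1
      then show ?thesis using Sym_le[OF st(1) 1] unfolding st(3) by (simp add: young_embed_simps fold3_def)
    next
      case 2
      have "1 \<le> \<tau> (j - (m + 1)) \<and> \<tau> (j - (m + 1)) \<le> 3" using 2 by (intro Sym_range[OF st(2)]) auto
      then have "fold3 m (\<tau> (j - (m + 1)) + (m + 1)) = m + 2" by (auto simp: fold3_def min_def)
      moreover have "fold3 m j = m + 2" using 2 by (auto simp: fold3_def min_def)
      moreover have "p (m + 2) = m + 2" by (rule Sym_out[OF st(1)]) simp
      ultimately show ?thesis using young_embed_simps(3)[of "m + 1" j p \<tau>] 2 st(3) by simp
    next
      case 3
      then show ?thesis using Sym_out[OF x, of j] Sym_out[OF p, of j] by (simp add: fold3_def)
    qed
  qed
  then show "fold3 m \<circ> x = p \<circ> fold3 m" by auto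
qed

text \<open>
  The blocks \<open>{1, 2}\<close> and \<open>{3, 4}\<close>, numbered \<open>1\<close> and \<open>2\<close>, that are permuted by \<open>D\<^sub>4\<close> through \<open>\<nu>\<close>.
\<close>

definition block :: "nat \<Rightarrow> nat"
  where "block i = (if i \<le> 2 then 1 else 2)"

lemma D4_simps: "carrier D4 = generate (sym_group 4) {D4_a, D4_b}" "x \<otimes>\<^bsub>D4\<^esub> y = x \<circ> y"
  by (simp_all add: D4_def sym_group_mult)

lemma D4_values:
  "D4_a 1 = 2" "D4_a 2 = 1" "D4_a 3 = 3" "D4_a 4 = 4"
  "D4_b 1 = 3" "D4_b 2 = 4" "D4_b 3 = 1" "D4_b 4 = 2"
  by (simp_all add: D4_a_def D4_b_def transpose_def)

lemma D4_gens: "D4_a \<in> Sym 4" "D4_b \<in> Sym 4" "D4_a \<circ> D4_a = id" "D4_b \<circ> D4_b = id"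
proof -
  have t: "transpose i j permutes {1..4}" if "i \<in> {1..4}" "j \<in> {1..4}" for i j :: nat
    by (rule permutes_swap_id[OF that])
  show a: "D4_a \<in> Sym 4" unfolding D4_a_def using t[of 1 2] by simp
  show b: "D4_b \<in> Sym 4" unfolding D4_b_def using permutes_compose[OF t[of 2 4] t[of 1 3]] by simp
  show "D4_a \<circ> D4_a = id" by (auto simp: D4_a_def)
  show "D4_b \<circ> D4_b = id" by (auto simp: D4_b_def transpose_def fun_eq_iff)
qed

lemma involution_inv: "s \<circ> s = id \<Longrightarrow> inv' s = s"
  by (metis inv_unique_comp)

lemma cases4: "1 \<le> i \<Longrightarrow> i \<le> 4 \<Longrightarrow> i = 1 \<or> i = 2 \<or> i = 3 \<or> i = (4::nat)"
  by linarith

lemma Sym4_eqI: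
  assumes "d \<in> Sym 4" "d' \<in> Sym 4" "d 1 = d' 1" "d 2 = d' 2" "d 3 = d' 3" "d 4 = d' 4"
  shows "d = d'"
proof (rule ext)
  fix i
  show "d i = d' i"
    using cases4[of i] Sym_out[OF assms(1), of i] Sym_out[OF assms(2), of i] assms(3-6)
    by (cases "1 \<le> i \<and> i \<le> 4") auto
qed

lemma D4_stabilizes_blocks:
  assumes \<nu>: "\<nu> \<in> hom D4 (sym_group 2)" "\<nu> D4_a = id" "\<nu> D4_b = transpose 1 2" and d: "d \<in> carrier D4"
  shows "d \<in> Sym 4" "\<forall>i\<in>{1..4}. block (d i) = \<nu> d (block i)"
proof -
  interpret S: group "sym_group 4" by (rule sym_group_is_group)
  have mul: "\<nu> (x \<circ> y) = \<nu> x \<circ> \<nu> y" if "x \<in> carrier D4" "y \<in> carrier D4" for x y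
    using hom_mult[OF \<nu>(1) that] by (simp add: D4_simps sym_group_mult)
  have gin: "D4_a \<in> carrier D4" "D4_b \<in> carrier D4" unfolding D4_simps by (auto intro: generate.incl)
  have nid: "\<nu> id = id" using mul[OF gin(1) gin(1)] \<nu>(2) D4_gens(3) by simp
  have ab: "\<forall>i\<in>{1..4}. block (D4_a i) = \<nu> D4_a (block i)" "\<forall>i\<in>{1..4}. block (D4_b i) = \<nu> D4_b (block i)"
  proof -
    have "block (D4_a i) = \<nu> D4_a (block i) \<and> block (D4_b i) = \<nu> D4_b (block i)" if "i \<in> {1..4}" for i
    proof -
      have "i = 1 \<or> i = 2 \<or> i = 3 \<or> i = 4" using cases4 that by simp
      then show ?thesis by (elim disjE) (simp_all add: D4_values \<nu>(2,3) block_def)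
    qed
    then show "\<forall>i\<in>{1..4}. block (D4_a i) = \<nu> D4_a (block i)" "\<forall>i\<in>{1..4}. block (D4_b i) = \<nu> D4_b (block i)" by blast+
  qed
  have "d \<in> generate (sym_group 4) {D4_a, D4_b}" using d by (simp add: D4_simps)
  then have "d \<in> Sym 4 \<and> (\<forall>i\<in>{1..4}. block (d i) = \<nu> d (block i))"
  proof (induction rule: generate.induct)
    case one
    have "id \<in> Sym 4" by (rule CollectI, rule permutes_id)
    moreover have "\<forall>i\<in>{1..4}. block (id i) = id (block i)" by simp
    ultimately show ?case unfolding sym_group_one nid by (rule conjI)
  next
    case (incl h)
    then show ?case using D4_gens ab by auto
  next
    case (inv h)
    then have "m_inv (sym_group 4) h = h"
      using D4_gens involution_inv by (auto simp: inv_sym)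
    then show ?case using inv D4_gens ab by auto
  next
    case (eng h1 h2)
    have i2: "h2 i \<in> {1..4}" if "i \<in> {1..4}" for i using Sym_range[of h2 4 i] eng.IH(2) that by simp
    have hm: "\<nu> (h1 \<circ> h2) = \<nu> h1 \<circ> \<nu> h2" using eng.hyps by (intro mul) (simp_all add: D4_simps)
    have "h1 \<circ> h2 \<in> Sym 4" by (rule CollectI, rule permutes_compose) (use eng.IH in auto)
    moreover have "\<forall>i\<in>{1..4}. block ((h1 \<circ> h2) i) = \<nu> (h1 \<circ> h2) (block i)"
    proof
      fix i :: nat assume i: "i \<in> {1..4}"
      have "block (h1 (h2 i)) = \<nu> h1 (block (h2 i))" using eng.IH(1) i2[OF i] by blast
      also have "block (h2 i) = \<nu> h2 (block i)" using eng.IH(2) i by blast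
      finally show "block ((h1 \<circ> h2) i) = \<nu> (h1 \<circ> h2) (block i)" unfolding hm comp_apply .
    qed
    ultimately show ?case unfolding sym_group_mult by (rule conjI)
  qed
  then show "d \<in> Sym 4" "\<forall>i\<in>{1..4}. block (d i) = \<nu> d (block i)" by blast+
qed

text \<open>
  Up to \<open>D4_b\<close>, which exchanges the blocks, both blocks are preserved, and then the four
  possibilities are products of \<open>D4_a\<close> and its conjugate by \<open>D4_b\<close>.
\<close>

lemma block_stabilizer_in_D4:
  assumes d: "d \<in> Sym 4" and s: "s \<in> Sym 2" and b: "\<And>i. 1 \<le> i \<Longrightarrow> i \<le> 4 \<Longrightarrow> block (d i) = s (block i)"
  shows "d \<in> carrier D4"
proof -
  let ?g = "generate (sym_group 4) {D4_a, D4_b}"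
  have gen: "D4_a \<in> ?g" "D4_b \<in> ?g" "id \<in> ?g" using generate.one[of "sym_group 4"] by (auto intro: generate.incl simp: sym_group_one)
  have mul: "x \<circ> y \<in> ?g" if "x \<in> ?g" "y \<in> ?g" for x y
    using generate.eng[OF that] by (simp add: sym_group_mult)
  have fixing: "d \<in> ?g" if d: "d \<in> Sym 4" and b: "d 1 \<le> 2" "d 2 \<le> 2" "d 3 > 2" "d 4 > 2" for d
  proof -
    let ?c = "D4_b \<circ> D4_a \<circ> D4_b"
    have cg: "?c \<in> ?g" by (intro mul gen)
    have cS: "?c \<in> Sym 4" "D4_a \<circ> ?c \<in> Sym 4"
    proof -
      have pa: "D4_a permutes {1..4}" and pb: "D4_b permutes {1..4}" using D4_gens by simp_all
      note c = permutes_compose[OF pb permutes_compose[OF pa pb]]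
      show "?c \<in> Sym 4" by (rule CollectI, rule c)
      show "D4_a \<circ> ?c \<in> Sym 4" by (rule CollectI, rule permutes_compose[OF c pa])
    qed
    have r: "1 \<le> d i \<and> d i \<le> 4" if "1 \<le> i" "i \<le> 4" for i using Sym_range[OF d that] .
    have ne: "d 1 \<noteq> d 2" "d 3 \<noteq> d 4" using Sym_inj[OF d, of 1 2] Sym_inj[OF d, of 3 4] by auto
    have "d 1 = 1 \<or> d 1 = 2" "d 2 = 1 \<or> d 2 = 2" "d 3 = 3 \<or> d 3 = 4" "d 4 = 3 \<or> d 4 = 4"
      using b r[of 1] r[of 2] r[of 3] r[of 4] by linarith+
    then have "d 1 = 1 \<and> d 2 = 2 \<or> d 1 = 2 \<and> d 2 = 1" "d 3 = 3 \<and> d 4 = 4 \<or> d 3 = 4 \<and> d 4 = 3"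
      using ne by (elim disjE; simp)+
    then consider "d 1 = 1" "d 2 = 2" "d 3 = 3" "d 4 = 4" | "d 1 = 2" "d 2 = 1" "d 3 = 3" "d 4 = 4"
      | "d 1 = 1" "d 2 = 2" "d 3 = 4" "d 4 = 3" | "d 1 = 2" "d 2 = 1" "d 3 = 4" "d 4 = 3"
      by blast
    then show ?thesis
    proof cases
      case 1
      then have "d = id" by (intro Sym4_eqI[OF d]) (simp_all add: permutes_id)
      then show ?thesis using gen by simp
    next
      case 2
      then have "d = D4_a" by (intro Sym4_eqI[OF d D4_gens(1)]) (simp_all add: D4_values)
      then show ?thesis using gen by simp
    next
      case 3
      then have "d = ?c" by (intro Sym4_eqI[OF d cS(1)]) (simp_all add: D4_values)
      then show ?thesis using cg by simp
    next
      case 4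
      then have "d = D4_a \<circ> ?c" by (intro Sym4_eqI[OF d cS(2)]) (simp_all add: D4_values)
      then show ?thesis using mul[OF gen(1) cg] by simp
    qed
  qed
  have r: "1 \<le> d i \<and> d i \<le> 4" if "1 \<le> i" "i \<le> 4" for i using Sym_range[OF d that] .
  have sr: "1 \<le> s 1 \<and> s 1 \<le> 2" "1 \<le> s 2 \<and> s 2 \<le> 2" "s 1 \<noteq> s 2"
    using Sym_range[OF s, of 1] Sym_range[OF s, of 2] Sym_inj[OF s, of 1 2] by auto
  have v: "block (d 1) = s 1" "block (d 2) = s 1" "block (d 3) = s 2" "block (d 4) = s 2"
    using b[of 1] b[of 2] b[of 3] b[of 4] by (simp_all add: block_def)
  have "s 1 = 1 \<or> s 1 = 2" "s 2 = 1 \<or> s 2 = 2" using sr by linarith+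
  then have "s 1 = 1 \<and> s 2 = 2 \<or> s 1 = 2 \<and> s 2 = 1" using sr(3) by (elim disjE; simp)
  then consider "s 1 = 1" "s 2 = 2" | "s 1 = 2" "s 2 = 1" by blast
  then have "d \<in> ?g"
  proof cases
    case 1
    then show ?thesis using v by (intro fixing[OF d]) (auto simp: block_def split: if_splits)
  next
    case 2
    have bv: "D4_b i \<le> 2" if "i > 2" "i \<le> 4" for i
      using cases4[of i] that by (auto simp: D4_values)
    have bv': "D4_b i > 2" if "i \<le> 2" "1 \<le> i" for i
      using cases4[of i] that by (auto simp: D4_values)
    have "D4_b \<circ> d \<in> ?g"
    proof (rule fixing)
      show "D4_b \<circ> d \<in> Sym 4" by (rule CollectI, rule permutes_compose) (use d D4_gens(2) in auto)
      show "(D4_b \<circ> d) 1 \<le> 2" "(D4_b \<circ> d) 2 \<le> 2" "(D4_b \<circ> d) 3 > 2" "(D4_b \<circ> d) 4 > 2"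
        using v 2 r[of 1] r[of 2] r[of 3] r[of 4] bv bv' by (auto simp: block_def split: if_splits)
    qed
    then have "D4_b \<circ> (D4_b \<circ> d) \<in> ?g" by (rule mul[OF gen(2)])
    then show ?thesis by (simp add: o_assoc D4_gens(4))
  qed
  then show ?thesis by (simp add: D4_simps)
qed

text \<open>
  Here \<open>p\<close> preserves the set of the two values taken twice, and \<open>x\<close> the union of their fibres; on the fibres
  \<open>x\<close> permutes the two blocks as \<open>p\<close> permutes the two values.
\<close>

lemma stabilizer_fold22:
  assumes \<nu>: "\<nu> \<in> hom D4 (sym_group 2)" "\<nu> D4_a = id" "\<nu> D4_b = transpose 1 2"
    and x: "x \<in> Sym (m + 4)" and p: "p \<in> Sym (m + 2)"
  shows "fold22 m \<circ> x = p \<circ> fold22 m \<longleftrightarrow>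
    (\<exists>\<kappa>\<in>carrier (sym_group m \<times>\<times> D4). x = young_embed m \<kappa> \<and> p = young_embed m (map_prod id \<nu> \<kappa>))"
proof
  assume eq: "fold22 m \<circ> x = p \<circ> fold22 m"
  have E: "fold22 m (x j) = p (fold22 m j)" for j using fun_cong[OF eq, of j] by simp
  have d: "x (m + 1) \<noteq> x (m + 2)" "x (m + 3) \<noteq> x (m + 4)"
    using Sym_inj[OF x, of "m + 1" "m + 2"] Sym_inj[OF x, of "m + 3" "m + 4"] by auto
  have e: "fold22 m (x (m + 1)) = p (m + 1)" "fold22 m (x (m + 2)) = p (m + 1)"
    "fold22 m (x (m + 3)) = p (m + 2)" "fold22 m (x (m + 4)) = p (m + 2)"
    using E[of "m + 1"] E[of "m + 2"] E[of "m + 3"] E[of "m + 4"] by (simp_all add: fold22_def)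
  have up1: "p (m + 1) > m" "p (m + 2) > m" using d e unfolding fold22_def by (auto split: if_splits)
  have upp: "p (m + i) > m" if "1 \<le> i" "i \<le> 2" for i
  proof -
    have "i = 1 \<or> i = 2" using that by linarith
    then show ?thesis using up1 by auto
  qed
  have upx: "x (m + i) > m" if i: "1 \<le> i" "i \<le> 4" for i
  proof -
    have "fold22 m (x (m + i)) > m" using E[of "m + i"] i up1 by (auto simp: fold22_def)
    then show ?thesis by (auto simp: fold22_def split: if_splits)
  qed
  obtain \<sigma> t where x': "\<sigma> \<in> Sym m" "t \<in> Sym 4" "x = young_embed m (\<sigma>, t)" using young_embed_split[OF x upx] by blast
  obtain \<sigma>' s where p': "\<sigma>' \<in> Sym m" "s \<in> Sym 2" "p = young_embed m (\<sigma>', s)" using young_embed_split[OF p upp] by blast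
  have "\<sigma> j = \<sigma>' j" for j
  proof (cases "j \<le> m")
    case True
    then show ?thesis using E[of j] Sym_le[OF x'(1) True] unfolding x'(3) p'(3) by (simp add: young_embed_simps fold22_def)
  qed (simp add: Sym_out[OF x'(1)] Sym_out[OF p'(1)])
  then have ss: "\<sigma>' = \<sigma>" by auto
  have bl: "block (t i) = s (block i)" if i: "1 \<le> i" "i \<le> 4" for i
  proof -
    have ti: "1 \<le> t i \<and> t i \<le> 4" by (rule Sym_range[OF x'(2) i])
    have "x (m + i) = t i + m" "p (fold22 m (m + i)) = s (block i) + m"
      unfolding x'(3) p'(3) using i by (auto simp: young_embed_simps fold22_def block_def)
    moreover have "fold22 m (t i + m) = block (t i) + m" using ti by (auto simp: fold22_def block_def)
    ultimately show ?thesis using E[of "m + i"] by simp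
  qed
  have tD: "t \<in> carrier D4" by (rule block_stabilizer_in_D4[OF x'(2) p'(2) bl])
  note tb = D4_stabilizes_blocks[OF \<nu> tD]
  have \<nu>t: "\<nu> t \<in> Sym 2" using hom_in_carrier[OF \<nu>(1) tD] by (simp add: carrier_sym)
  have "s i = \<nu> t i" for i
  proof -
    consider "i = 1" | "i = 2" | "i = 0 \<or> i > 2" by linarith
    then show ?thesis
    proof cases
      case 1
      then show ?thesis using bl[of 1] tb(2)[rule_format, of 1] by (simp add: block_def)
    next
      case 2
      then show ?thesis using bl[of 3] tb(2)[rule_format, of 3] by (simp add: block_def)
    next
      case 3
      then show ?thesis using Sym_out[OF p'(2), of i] Sym_out[OF \<nu>t, of i] by auto
    qed
  qed
  then have "s = \<nu> t" by auto
  then show "\<exists>\<kappa>\<in>carrier (sym_group m \<times>\<times> D4). x = young_embed m \<kappa> \<and> p = young_embed m (map_prod id \<nu> \<kappa>)"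
    using x' p' ss tD by (intro bexI[of _ "(\<sigma>, t)"]) (auto simp: carrier_sym)
next
  assume "\<exists>\<kappa>\<in>carrier (sym_group m \<times>\<times> D4). x = young_embed m \<kappa> \<and> p = young_embed m (map_prod id \<nu> \<kappa>)"
  then obtain \<sigma> t where st: "\<sigma> \<in> Sym m" "t \<in> carrier D4" "x = young_embed m (\<sigma>, t)" "p = young_embed m (\<sigma>, \<nu> t)"
    by (auto simp: carrier_sym)
  note tb = D4_stabilizes_blocks[OF \<nu> st(2)]
  have "fold22 m (x j) = p (fold22 m j)" for j
  proof -
    consider "j \<le> m" | "m < j" "j \<le> m + 4" | "m + 4 < j" by linarith
    then show ?thesis
    proof cases
      case 1
      then show ?thesis using Sym_le[OF st(1) 1] unfolding st(3,4) by (simp add: young_embed_simps fold22_def)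
    next
      case 2
      define i where "i = j - m"
      have i: "1 \<le> i" "i \<le> 4" "j = m + i" using 2 by (auto simp: i_def)
      have ti: "1 \<le> t i \<and> t i \<le> 4" by (rule Sym_range[OF tb(1) i(1,2)])
      have "x j = t i + m" "p (fold22 m j) = \<nu> t (block i) + m"
        unfolding st(3,4) i(3) using i by (auto simp: young_embed_simps fold22_def block_def)
      moreover have "fold22 m (t i + m) = block (t i) + m" using ti by (auto simp: fold22_def block_def)
      ultimately show ?thesis using tb(2) i by simp
    next
      case 3
      then show ?thesis using Sym_out[OF x, of j] Sym_out[OF p, of j] by (simp add: fold22_def)
    qed
  qed
  then show "fold22 m \<circ> x = p \<circ> fold22 m" by auto
qed

text \<open>
  A section of \<open>f\<close> leaves out two points \<open>u\<close>, \<open>v\<close> of the source. If \<open>f u = f v\<close> the fibre over that value has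
  size three, otherwise there are two fibres of size two. In both cases extend the section, permuted by \<open>g\<close> so that
  the repeated values come last, to a bijection \<open>y\<close> by \<open>m + 3 \<mapsto> u\<close> and \<open>m + 4 \<mapsto> v\<close>.
\<close>

lemma onto_cover:
  assumes f: "f \<in> onto (m + 4) (m + 2)"
  shows "\<exists>p\<in>Sym (m + 2). \<exists>h\<in>Sym (m + 4). f = p \<circ> fold3 m \<circ> h \<or> f = p \<circ> fold22 m \<circ> h"
proof -
  have im: "f ` {1..m + 4} = {1..m + 2}" and out: "\<And>j. j \<notin> {1..m + 4} \<Longrightarrow> f j = j" using f by (auto simp: onto_def)
  define s where "s = inv_into {1..m + 4} f"
  have s: "s j \<in> {1..m + 4}" "f (s j) = j" if "j \<in> {1..m + 2}" for j
    unfolding s_def using inv_into_into[of j f "{1..m + 4}"] f_inv_into_f[of j f "{1..m + 4}"] im that by auto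
  have inj: "inj_on s {1..m + 2}" by (rule inj_on_inverseI[of _ f]) (rule s(2))
  let ?S = "s ` {1..m + 2}"
  have "card ({1..m + 4} - ?S) = 2"
    using s(1) card_image[OF inj] by (subst card_Diff_subset) auto
  then obtain u v where uv: "{1..m + 4} - ?S = {u, v}" "u \<noteq> v" by (auto simp: card_2_iff)
  have fuv: "f u \<in> {1..m + 2}" "f v \<in> {1..m + 2}" using uv(1) im by blast+
  have key: "\<exists>y\<in>Sym (m + 4). (\<forall>j\<in>{1..m + 2}. f (y j) = g j) \<and> f (y (m + 3)) = f u \<and> f (y (m + 4)) = f v"
    if g: "g \<in> Sym (m + 2)" for g
  proof -
    define y where "y j = (if j \<in> {1..m + 2} then s (g j) else if j = m + 3 then u else if j = m + 4 then v else j)" for j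
    have gi: "g ` {1..m + 2} = {1..m + 2}" using permutes_image[of g "{1..m + 2}"] g by simp
    have "{1..m + 4} = {1..m + 2} \<union> {m + 3, m + 4}" by auto
    then have "y ` {1..m + 4} = y ` {1..m + 2} \<union> {y (m + 3), y (m + 4)}" by (simp add: image_Un)
    also have "y ` {1..m + 2} = s ` (g ` {1..m + 2})" unfolding image_image by (intro image_cong) (auto simp: y_def)
    also have "\<dots> \<union> {y (m + 3), y (m + 4)} = ?S \<union> {u, v}" unfolding gi by (simp add: y_def)
    also have "\<dots> = {1..m + 4}" using uv(1) s(1) by blast
    finally have "y \<in> onto (m + 4) (m + 4)" unfolding onto_def by (auto simp: y_def)
    then have "y \<in> Sym (m + 4)" by (simp add: onto_self_iff)
    moreover have "f (y j) = g j" if j: "j \<in> {1..m + 2}" for j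
    proof -
      have "g j \<in> {1..m + 2}" using gi j by blast
      then show ?thesis using s(2) j by (simp add: y_def)
    qed
    ultimately show ?thesis by (intro bexI[of _ y]) (simp_all add: y_def)
  qed
  have fin: "f = p \<circ> w \<circ> inv' y" if "y \<in> Sym (m + 4)" "f \<circ> y = p \<circ> w" for p w y
  proof -
    have "y \<circ> inv' y = id" using permutes_inv_o(1)[of y "{1..m + 4}"] that(1) by simp
    then have "f = f \<circ> y \<circ> inv' y" by (simp add: o_assoc[symmetric])
    then show ?thesis unfolding that(2) .
  qed
  have tr: "transpose i j \<in> Sym (m + 2)" if "i \<in> {1..m + 2}" "j \<in> {1..m + 2}" for i j
    using permutes_swap_id[OF that] by simp
  show ?thesis
  proof (cases "f u = f v")
    case True
    define g where "g = transpose (f u) (m + 2)"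
    have g: "g \<in> Sym (m + 2)" unfolding g_def by (rule tr[OF fuv(1)]) simp
    obtain y where y: "y \<in> Sym (m + 4)" "\<forall>j\<in>{1..m + 2}. f (y j) = g j" "f (y (m + 3)) = f u" "f (y (m + 4)) = f v"
      using key[OF g] by blast
    have "f (y j) = g (fold3 m j)" for j
    proof -
      consider "j \<in> {1..m + 2}" | "j = m + 3" | "j = m + 4" | "j \<notin> {1..m + 4}" by fastforce
      then show ?thesis
      proof cases
        case 4
        then have "y j = j" "g j = j" using Sym_out[OF y(1), of j] Sym_out[OF g, of j] by auto
        then show ?thesis using out[OF 4] 4 by (auto simp: fold3_def)
      qed (use y True in \<open>auto simp: fold3_def g_def\<close>)
    qed
    then have "f \<circ> y = g \<circ> fold3 m" by auto
    then have "f = g \<circ> fold3 m \<circ> inv' y" by (rule fin[OF y(1)])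
    moreover have "inv' y \<in> Sym (m + 4)" using y(1) by (auto intro: permutes_inv)
    ultimately show ?thesis using g by blast
  next
    case False
    define c where "c = transpose (f u) (m + 1) (f v)"
    define g where "g = transpose (f u) (m + 1) \<circ> transpose c (m + 2)"
    have cin: "c \<in> {1..m + 2}" using fuv unfolding c_def transpose_def by auto
    have cne: "c \<noteq> m + 1" using False unfolding c_def transpose_def by auto
    have g: "g \<in> Sym (m + 2)" unfolding g_def
      by (rule CollectI, rule permutes_compose) (use tr[OF cin, of "m + 2"] tr[OF fuv(1), of "m + 1"] in auto)
    have g1: "g (m + 1) = f u" using cne by (simp add: g_def)
    have g2: "g (m + 2) = f v" by (simp add: g_def c_def)
    obtain y where y: "y \<in> Sym (m + 4)" "\<forall>j\<in>{1..m + 2}. f (y j) = g j" "f (y (m + 3)) = f u" "f (y (m + 4)) = f v"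
      using key[OF g] by blast
    let ?t = "transpose (m + 2) (m + 3)"
    have t: "?t permutes {1..m + 4}" by (rule permutes_swap_id) simp_all
    have yt: "y \<circ> ?t \<in> Sym (m + 4)" by (rule CollectI, rule permutes_compose[OF t]) (use y(1) in auto)
    have "f ((y \<circ> ?t) j) = g (fold22 m j)" for j
    proof -
      consider "j \<in> {1..m}" | "j = m + 1" | "j = m + 2" | "j = m + 3" | "j = m + 4" | "j \<notin> {1..m + 4}" by fastforce
      then show ?thesis
      proof cases
        case 1
        then have "?t j = j" "j \<in> {1..m + 2}" by (simp_all add: transpose_def)
        then show ?thesis using y(2) 1 by (simp add: fold22_def)
      next
        case 2
        then have "?t j = j" by (simp add: transpose_def)
        then show ?thesis using y(2) 2 by (simp add: fold22_def)
      next
        case 3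
        then show ?thesis using y(3) g1 by (simp add: fold22_def)
      next
        case 4
        then show ?thesis using y(2) g2 by (simp add: fold22_def)
      next
        case 5
        then have "?t j = j" by (simp add: transpose_def)
        then show ?thesis using y(4) g2 5 by (simp add: fold22_def)
      next
        case 6
        then have "?t j = j" "y j = j" "g j = j"
          using Sym_out[OF y(1), of j] Sym_out[OF g, of j] by (auto simp: transpose_def)
        then show ?thesis using out[OF 6] 6 by (auto simp: fold22_def)
      qed
    qed
    then have "f \<circ> (y \<circ> ?t) = g \<circ> fold22 m" by auto
    then have "f = g \<circ> fold22 m \<circ> inv' (y \<circ> ?t)" by (rule fin[OF yt])
    moreover have "inv' (y \<circ> ?t) \<in> Sym (m + 4)" by (rule CollectI, rule permutes_inv) (rule yt[unfolded mem_Collect_eq])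
    ultimately show ?thesis using g by blast
  qed
qed

text \<open>
  The first map has a fibre of size three, the second has none.
\<close>

lemma orbits_disjoint:
  assumes p: "p \<in> Sym (m + 2)" "p' \<in> Sym (m + 2)" and h: "h \<in> Sym (m + 4)" "h' \<in> Sym (m + 4)"
  shows "p \<circ> fold3 m \<circ> h \<noteq> p' \<circ> fold22 m \<circ> h'"
proof
  assume eq: "p \<circ> fold3 m \<circ> h = p' \<circ> fold22 m \<circ> h'"
  define w where "w i = h' (inv' h i)" for i
  have hi: "h (inv' h i) = i" for i using permutes_inverses(1)[of h "{1..m + 4}"] h(1) by simp
  have "inv' h \<in> Sym (m + 4)" using h(1) by (auto intro: permutes_inv)
  then have wi: "w i = w j \<Longrightarrow> i = j" for i j unfolding w_def using Sym_inj h(2) by blast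
  have e: "p (fold3 m i) = p' (fold22 m (w i))" for i
    using fun_cong[OF eq, of "inv' h i"] by (simp add: w_def hi)
  have "p' (fold22 m (w (m + 2))) = p' (fold22 m (w (m + 3)))" "p' (fold22 m (w (m + 2))) = p' (fold22 m (w (m + 4)))"
    using e[of "m + 2"] e[of "m + 3"] e[of "m + 4"] by (simp_all add: fold3_def)
  then have "fold22 m (w (m + 2)) = fold22 m (w (m + 3))" "fold22 m (w (m + 2)) = fold22 m (w (m + 4))"
    using Sym_inj[OF p(2)] by blast+
  moreover have "w (m + 2) \<noteq> w (m + 3)" "w (m + 2) \<noteq> w (m + 4)" "w (m + 3) \<noteq> w (m + 4)"
    using wi[of "m + 2" "m + 3"] wi[of "m + 2" "m + 4"] wi[of "m + 3" "m + 4"] by auto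
  ultimately show False unfolding fold22_def by (simp split: if_splits)
qed

lemma pullback_fun_module: "pullback \<phi> (fun_module V \<rho>) = fun_module V (\<lambda>h. \<rho> (\<phi> h))"
  by (simp add: pullback_def fun_module_def)

lemma tensor_trivial_bij:
  assumes V: "fs.subspace V"
  shows "bij_betw (\<lambda>v. tensor v (\<lambda>_::unit. 1)) V (tensor_space V UNIV)"
proof -
  let ?t = "\<lambda>v. tensor v (\<lambda>_::unit. 1)"
  have lin: "flinear ?t"
    by (rule flinearI) (auto simp: tensor_def plus_fun_def cscale_def fun_eq_iff algebra_simps)
  have tw: "tensor v w = ?t (cscale (w ()) v)" for v and w :: "unit \<Rightarrow> complex"
    by (auto simp: tensor_def cscale_def fun_eq_iff)
  have "{tensor v w | v w. v \<in> V \<and> w \<in> (UNIV :: (unit \<Rightarrow> complex) set)} = ?t ` V"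
  proof (intro equalityI subsetI)
    fix z assume "z \<in> {tensor v w | v w. v \<in> V \<and> w \<in> (UNIV :: (unit \<Rightarrow> complex) set)}"
    then obtain v w where vw: "z = tensor v w" "v \<in> V" by blast
    show "z \<in> ?t ` V" unfolding vw(1) tw[of v w] by (rule imageI[OF fs.subspace_scale[OF V vw(2)]])
  qed blast
  moreover have "fs.subspace (?t ` V)"
    unfolding fs.subspace_def
  proof (intro conjI ballI allI)
    have "?t 0 \<in> ?t ` V" by (rule imageI[OF fs.subspace_0[OF V]])
    then show "0 \<in> ?t ` V" unfolding flinear_zero[OF lin] .
  next
    fix x y assume "x \<in> ?t ` V" "y \<in> ?t ` V"
    then obtain u v where uv: "u \<in> V" "v \<in> V" "x = ?t u" "y = ?t v" by blast
    show "x + y \<in> ?t ` V"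
      unfolding uv(3,4) flinear_add[OF lin, symmetric] by (rule imageI[OF fs.subspace_add[OF V uv(1,2)]])
  next
    fix c x assume "x \<in> ?t ` V"
    then obtain u where u: "u \<in> V" "x = ?t u" by blast
    show "cscale c x \<in> ?t ` V"
      unfolding u(2) flinear_scale[OF lin, symmetric] by (rule imageI[OF fs.subspace_scale[OF V u(1)]])
  qed
  ultimately have "tensor_space V (UNIV :: (unit \<Rightarrow> complex) set) = ?t ` V"
    unfolding tensor_space_def by (simp only: fs.span_eq_iff)
  moreover have "inj_on ?t V"
  proof (rule inj_onI)
    fix u v assume eq: "?t u = ?t v"
    show "u = v" by (rule ext) (use fun_cong[OF eq, of "(x, ())" for x] in \<open>simp add: tensor_apply\<close>)
  qed
  ultimately show ?thesis by (simp add: bij_betw_def)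
qed

section \<open>The multiplicity formula\<close>

lemma constituent_multiplicity_induced:
  assumes \<alpha>: "sum_list \<alpha> = m + 4" and \<beta>: "sum_list \<beta> = m + 2"
    and ea: "SE_idempotent_for \<alpha> a" and eb: "SE_idempotent_for \<beta> b"
    and \<nu>: "\<nu> \<in> hom D4 (sym_group 2)" "\<nu> D4_a = id" "\<nu> D4_b = transpose 1 2"
  shows "of_nat (constituent_multiplicity (carrier (sym_group (m + 4)))
      (direct_sum
        (induced (sym_group (m + 1) \<times>\<times> sym_group 3) (sym_group (m + 4)) (young_embed (m + 1))
          (outer_tensor (pullback id (Specht \<beta>)) trivial_rep))
        (induced (sym_group m \<times>\<times> D4) (sym_group (m + 4)) (young_embed m)
          (pullback (map_prod id \<nu>) (pullback (young_embed m) (Specht \<beta>)))))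
      (Specht \<alpha>)) = fixed_point_sum (m + 4) (m + 2) b a"
proof -
  let ?L = "lideal (sym_group (m + 2)) b"
  show ?thesis
  proof (rule Specht_of_idempotent[OF \<beta> eb])
  fix \<phi> assume B: "primitive_idem (sym_group (m + 2)) b"
    "frep (sym_group (m + 2)) (Specht_act \<beta>) (Specht_space \<beta>)"
    "op_simple (carrier (sym_group (m + 2))) (fun_module (Specht_space \<beta>) (Specht_act \<beta>))"
    and bij: "bij_betw \<phi> ?L (Specht_space \<beta>)"
    and add: "\<And>u v. u \<in> ?L \<Longrightarrow> v \<in> ?L \<Longrightarrow> \<phi> (u + v) = \<phi> u + \<phi> v"
    and scale: "\<And>c v. v \<in> ?L \<Longrightarrow> \<phi> (cscale c v) = cscale c (\<phi> v)"
    and act: "\<And>g v. g \<in> carrier (sym_group (m + 2)) \<Longrightarrow> v \<in> ?L \<Longrightarrow>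
      \<phi> (reg (sym_group (m + 2)) g v) = Specht_act \<beta> g (\<phi> v)"
    and "\<phi> b \<in> Specht_space \<beta>" "\<phi> b \<noteq> 0" "galg (sym_group (m + 2)) (Specht_act \<beta>) b (\<phi> b) = \<phi> b"
  interpret P: primitive_idem "sym_group (m + 2)" b by (rule B(1))
  interpret S: frep "sym_group (m + 2)" "Specht_act \<beta>" "Specht_space \<beta>" by (rule B(2))
  have zero: "\<phi> 0 = 0" using scale[OF fs.subspace_0[OF P.lideal_subspace], of 0] by simp
  let ?one = "\<lambda>_::unit. 1 :: complex"
  let ?\<theta> = "\<lambda>v. tensor (\<phi> v) ?one"
  have lin: "flinear (\<lambda>v. tensor v ?one)"
    by (rule flinearI) (auto simp: tensor_def plus_fun_def cscale_def fun_eq_iff algebra_simps)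
  have W1: "outer_tensor (pullback id (Specht \<beta>)) trivial_rep =
    fun_module (tensor_space (Specht_space \<beta>) (UNIV :: (unit \<Rightarrow> complex) set))
      (tensor_act (\<lambda>h. Specht_act \<beta> (id h)) (\<lambda>g v. v))"
    unfolding Specht_eq pullback_fun_module trivial_rep_def outer_tensor_eq ..
  have W2: "pullback (map_prod id \<nu>) (pullback (young_embed m) (Specht \<beta>)) =
    fun_module (Specht_space \<beta>) (\<lambda>h. Specht_act \<beta> (young_embed m (map_prod id \<nu> h)))"
    unfolding Specht_eq pullback_fun_module ..
  have sub12: "\<sigma> \<in> Sym (m + 2)" if "\<sigma> \<in> Sym (m + 1)" for \<sigma>
    using permutes_subset[of \<sigma> "{1..m + 1}" "{1..m + 2}"] that by auto
  have in1: "young_embed (m + 1) \<kappa> \<in> Sym (m + 4)" "fst \<kappa> \<in> Sym (m + 2)"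
    if \<kappa>: "\<kappa> \<in> carrier (sym_group (m + 1) \<times>\<times> sym_group 3)" for \<kappa>
  proof -
    obtain \<sigma> \<tau> where k: "\<kappa> = (\<sigma>, \<tau>)" "\<sigma> \<in> Sym (m + 1)" "\<tau> \<in> Sym 3" using \<kappa> by (auto simp: carrier_sym)
    show "young_embed (m + 1) \<kappa> \<in> Sym (m + 4)" unfolding k(1) using young_embed_in[OF k(2,3)] by (simp add: add.assoc)
    show "fst \<kappa> \<in> Sym (m + 2)" unfolding k(1) using sub12[OF k(2)] by simp
  qed
  have in2: "young_embed m \<kappa> \<in> Sym (m + 4)" "young_embed m (map_prod id \<nu> \<kappa>) \<in> Sym (m + 2)"
    if \<kappa>: "\<kappa> \<in> carrier (sym_group m \<times>\<times> D4)" for \<kappa>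
  proof -
    obtain \<sigma> d where k: "\<kappa> = (\<sigma>, d)" "\<sigma> \<in> Sym m" "d \<in> carrier D4" using \<kappa> by (auto simp: carrier_sym)
    have nd: "\<nu> d \<in> Sym 2" using hom_in_carrier[OF \<nu>(1) k(3)] by (simp add: carrier_sym)
    show "young_embed m (map_prod id \<nu> \<kappa>) \<in> Sym (m + 2)"
      unfolding k(1) map_prod_simp id_apply by (rule young_embed_in[OF k(2) nd])
    show "young_embed m \<kappa> \<in> Sym (m + 4)"
      unfolding k(1) by (rule young_embed_in[OF k(2) D4_stabilizes_blocks(1)[OF \<nu> k(3)]])
  qed
  have O1: "orbit_piece (m + 2) b (m + 4) (fold3 m) (sym_group (m + 1) \<times>\<times> sym_group 3) (young_embed (m + 1)) fst
    (outer_tensor (pullback id (Specht \<beta>)) trivial_rep) ?\<theta>"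
    unfolding W1
  proof (intro orbit_piece.intro orbit_piece_axioms.intro B(1) fold3_onto)
    show "bij_betw ?\<theta> ?L (carrier (fun_module (tensor_space (Specht_space \<beta>) UNIV)
        (tensor_act (\<lambda>h. Specht_act \<beta> (id h)) (\<lambda>g v. v))))"
      using bij_betw_trans[OF bij tensor_trivial_bij[OF S.subV]] by (simp add: comp_def)
    fix \<kappa> v assume \<kappa>: "\<kappa> \<in> carrier (sym_group (m + 1) \<times>\<times> sym_group 3)" and v: "v \<in> ?L"
    obtain \<sigma> \<tau> where k: "\<kappa> = (\<sigma>, \<tau>)" by (cases \<kappa>)
    have sc: "\<sigma> \<in> carrier (sym_group (m + 2))" using in1(2)[OF \<kappa>] by (simp add: k carrier_sym)
    have "tensor_act (\<lambda>h. Specht_act \<beta> (id h)) (\<lambda>g v. v) (\<sigma>, \<tau>) (tensor (\<phi> v) ?one) =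
      tensor (Specht_act \<beta> (id \<sigma>) (\<phi> v)) ?one"
      by (rule tensor_act_tensor[where \<rho> = "\<lambda>h. Specht_act \<beta> (id h)" and \<sigma> = "\<lambda>g v. v", OF Specht_act_linear flinear_ident])
    then show "?\<theta> (reg (sym_group (m + 2)) (fst \<kappa>) v) =
      act (fun_module (tensor_space (Specht_space \<beta>) UNIV) (tensor_act (\<lambda>h. Specht_act \<beta> (id h)) (\<lambda>g v. v))) \<kappa> (?\<theta> v)"
      unfolding k fst_conv act[OF sc v] fun_module_simps by simp
  next
    show "\<And>u v. u \<in> ?L \<Longrightarrow> v \<in> ?L \<Longrightarrow> ?\<theta> (u + v) = ?\<theta> u \<oplus>\<^bsub>fun_module (tensor_space (Specht_space \<beta>) UNIV)
        (tensor_act (\<lambda>h. Specht_act \<beta> (id h)) (\<lambda>g v. v))\<^esub> ?\<theta> v"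
      by (simp add: add flinear_add[OF lin])
    show "\<And>c v. v \<in> ?L \<Longrightarrow> ?\<theta> (cscale c v) = c \<odot>\<^bsub>fun_module (tensor_space (Specht_space \<beta>) UNIV)
        (tensor_act (\<lambda>h. Specht_act \<beta> (id h)) (\<lambda>g v. v))\<^esub> ?\<theta> v"
      by (simp add: scale flinear_scale[OF lin])
    show "?\<theta> 0 = \<zero>\<^bsub>fun_module (tensor_space (Specht_space \<beta>) UNIV)
        (tensor_act (\<lambda>h. Specht_act \<beta> (id h)) (\<lambda>g v. v))\<^esub>"
      by (simp add: zero flinear_zero[OF lin])
  qed (fact stabilizer_fold3 in1)+
  have O2: "orbit_piece (m + 2) b (m + 4) (fold22 m) (sym_group m \<times>\<times> D4) (young_embed m)
    (\<lambda>\<kappa>. young_embed m (map_prod id \<nu> \<kappa>))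
    (pullback (map_prod id \<nu>) (pullback (young_embed m) (Specht \<beta>))) \<phi>"
    unfolding W2
  proof (intro orbit_piece.intro orbit_piece_axioms.intro B(1) fold22_onto)
    fix \<kappa> v assume \<kappa>: "\<kappa> \<in> carrier (sym_group m \<times>\<times> D4)" and v: "v \<in> ?L"
    have sc: "young_embed m (map_prod id \<nu> \<kappa>) \<in> carrier (sym_group (m + 2))" using in2(2)[OF \<kappa>] by (simp add: carrier_sym)
    show "\<phi> (reg (sym_group (m + 2)) (young_embed m (map_prod id \<nu> \<kappa>)) v) =
      act (fun_module (Specht_space \<beta>) (\<lambda>h. Specht_act \<beta> (young_embed m (map_prod id \<nu> h)))) \<kappa> (\<phi> v)"
      unfolding act[OF sc v] fun_module_simps ..
  qed (simp_all only: fun_module_simps bij add scale zero, (fact stabilizer_fold22[OF \<nu>] in2)+)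
  have "constituent_multiplicity (carrier (sym_group (m + 4)))
      (direct_sum
        (induced (sym_group (m + 1) \<times>\<times> sym_group 3) (sym_group (m + 4)) (young_embed (m + 1))
          (outer_tensor (pullback id (Specht \<beta>)) trivial_rep))
        (induced (sym_group m \<times>\<times> D4) (sym_group (m + 4)) (young_embed m)
          (pullback (map_prod id \<nu>) (pullback (young_embed m) (Specht \<beta>)))))
      (Specht \<alpha>) =
    constituent_multiplicity (carrier (sym_group (m + 4))) (fun_module (avg_space (m + 4) (m + 2) b) precomp) (Specht \<alpha>)"
    by (rule two_orbits_iso[OF O1 O2]) (rule onto_cover orbits_disjoint; assumption)+
  then show ?thesis using constituent_multiplicity_avg_space[OF \<alpha> ea B(1)] by simp
  qed
qed

theorem corollary5p10:
  fixes n k :: nat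
    and \<alpha> \<beta> :: "nat list"
    and e\<^sub>\<alpha> e\<^sub>\<beta> :: "(nat \<Rightarrow> nat) \<Rightarrow> complex"
    and \<nu> :: "(nat \<Rightarrow> nat) \<Rightarrow> (nat \<Rightarrow> nat)"
  assumes "2 \<le> k" and "k + 2 \<le> n"
    and "partition_of \<alpha> (k + 2)" and "partition_of \<beta> k"
    and "SE_idempotent_for \<alpha> e\<^sub>\<alpha>" and "SE_idempotent_for \<beta> e\<^sub>\<beta>"
    and "\<nu> \<in> hom D4 (sym_group 2)" and "\<nu> D4_a = id" and "\<nu> D4_b = transpose 1 2"
  shows "JH_multiplicity (carrier (SE_algebra n)) (SE_proj n (k + 2) e\<^sub>\<alpha>) (SE_simple n k e\<^sub>\<beta>)
           = constituent_multiplicity (carrier (sym_group k \<times>\<times> sym_group (k + 2)))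
               (SE_hom_module n (k + 2) k) (outer_tensor (Specht \<beta>) (Specht \<alpha>))
       \<and> JH_multiplicity (carrier (SE_algebra n)) (SE_proj n (k + 2) e\<^sub>\<alpha>) (SE_simple n k e\<^sub>\<beta>)
           = constituent_multiplicity (carrier (sym_group (k + 2)))
               (direct_sum
                 (induced (sym_group (k - 1) \<times>\<times> sym_group 3) (sym_group (k + 2)) (young_embed (k - 1))
                   (outer_tensor (pullback id (Specht \<beta>)) trivial_rep))
                 (induced (sym_group (k - 2) \<times>\<times> D4) (sym_group (k + 2)) (young_embed (k - 2))
                   (pullback (map_prod id \<nu>) (pullback (young_embed (k - 2)) (Specht \<beta>)))))
               (Specht \<alpha>)"
proof -
  obtain m where m: "k = m + 2" using \<open>2 \<le> k\<close> by (metis add.commute le_Suc_ex)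
  have k2: "k + 2 = m + 4" "k - 1 = m + 1" "k - 2 = m" by (simp_all add: m)
  have sa: "sum_list \<alpha> = k + 2" and sb: "sum_list \<beta> = k" using assms(3,4) by (simp_all add: partition_of_def)
  have kn: "k \<le> n" using assms(2) by simp
  have pa: "primitive_idem (sym_group (k + 2)) e\<^sub>\<alpha>" by (rule Specht_of_idempotent[OF sa assms(5)])
  have pb: "primitive_idem (sym_group k) e\<^sub>\<beta>" by (rule Specht_of_idempotent[OF sb assms(6)])
  have ea: "e\<^sub>\<alpha> \<in> funs (Sym (k + 2))" "gmult (sym_group (k + 2)) e\<^sub>\<alpha> e\<^sub>\<alpha> = e\<^sub>\<alpha>"
    using primitive_idem.e_funs[OF pa] primitive_idem.e_idem[OF pa] by (simp_all add: carrier_sym)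
  have A: "of_nat (JH_multiplicity (carrier (SE_algebra n)) (SE_proj n (k + 2) e\<^sub>\<alpha>) (SE_simple n k e\<^sub>\<beta>)) =
      fixed_point_sum (k + 2) k e\<^sub>\<beta> e\<^sub>\<alpha>"
    by (rule JH_multiplicity_SE[OF pb kn ea assms(2)])
  have B: "of_nat (constituent_multiplicity (carrier (sym_group k \<times>\<times> sym_group (k + 2)))
               (SE_hom_module n (k + 2) k) (outer_tensor (Specht \<beta>) (Specht \<alpha>))) = fixed_point_sum (k + 2) k e\<^sub>\<beta> e\<^sub>\<alpha>"
    by (rule constituent_multiplicity_SE_hom[OF sa assms(2) sb kn assms(5,6)])
  have sm: "sum_list \<alpha> = m + 4" "sum_list \<beta> = m + 2" using sa sb by (simp_all add: m)
  note C = constituent_multiplicity_induced[OF sm assms(5-9)]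
  have inj: "x = y" if "of_nat x = t" "of_nat y = t" for x y :: nat and t :: complex
    using that by (metis of_nat_eq_iff)
  show ?thesis
  proof (rule conjI)
    show "JH_multiplicity (carrier (SE_algebra n)) (SE_proj n (k + 2) e\<^sub>\<alpha>) (SE_simple n k e\<^sub>\<beta>)
           = constituent_multiplicity (carrier (sym_group k \<times>\<times> sym_group (k + 2)))
               (SE_hom_module n (k + 2) k) (outer_tensor (Specht \<beta>) (Specht \<alpha>))"
      by (rule inj[OF A B])
    note A' = A[unfolded k2(1)]
    show "JH_multiplicity (carrier (SE_algebra n)) (SE_proj n (k + 2) e\<^sub>\<alpha>) (SE_simple n k e\<^sub>\<beta>)
           = constituent_multiplicity (carrier (sym_group (k + 2)))
               (direct_sum
                 (induced (sym_group (k - 1) \<times>\<times> sym_group 3) (sym_group (k + 2)) (young_embed (k - 1))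
                   (outer_tensor (pullback id (Specht \<beta>)) trivial_rep))
                 (induced (sym_group (k - 2) \<times>\<times> D4) (sym_group (k + 2)) (young_embed (k - 2))
                   (pullback (map_prod id \<nu>) (pullback (young_embed (k - 2)) (Specht \<beta>)))))
               (Specht \<alpha>)"
      unfolding k2 by (rule inj[OF A' C[folded m]])
  qed
qed


end
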